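(* Let $M>0$, $T>0$, and let $X=[0,M]$ with periodic boundary conditions. Fix $n\in\mathbf{N}$ with $n\ge 4$. Consider the linear equation $$u_t = a(x,t)u_{xxx}+b(x,t)u_{xx}+c(x,t)u_x+d(x,t)u+e(x,t),\qquad x\in X,\ t\in[0,T],\tag{$*$}$$ where the coefficient functions are periodic in $x$ and satisfy: (A1) $a\in C([0,T];C^{n+3})$, $a_t\in C([0,T];C^{n})$, $b\in C([0,T];C^{n+2})$, $b_t\in C([0,T];C^{n})$, $c\in C([0,T];C^{n})$, $d\in C([0,T];C^{n})$, $e\in L^\infty([0,T];H^n)$; (A2) there is a constant $a_0$ with $0<a_0\le |a(x,t)|$ for all $x\in X$, $t\in[0,T]$; (A3) $\bar\delta(t):=\frac1M\int_0^M \frac{b(y,t)}{|a(y,t)|}\,dy\ge 0$ for all $t\in[0,T]$. Then there is a continuous map $\Psi:H^n\to L^\infty([0,T];H^n)$ such that for all $u_0\in H^n$, $$\|\Psi(u_0)\|_{L^\infty([0,T];H^n)}\le K(\|u_0\|_{H^n}+1),$$ and such that, with $u=\Psi(u_0)$: (1) for all $0\le n'<n$, $u\in C([0,T];H^{n'})$ and $\|u(t)\|_{H^{n'}}\le K(\|u_0\|_{H^n}+1)$; (2) $u(x,0)=u_0$; (3) $u$ solves $( * )$ for $t\in[0,T]$; (4) $u$ is the only function for which (2) and (3) hold simultaneously.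
   Context: $C^k$, $W^{k,p}=W^{k,p}(X)$ and $H^n=W^{n,2}$ denote spaces of $M$-periodic functions on $X$. For a Banach space $B$ of functions on $X$, $B_T:=L^\infty([0,T];B)$. Set $\tilde K:=M+T+n+\|a\|_{W^{n+3,\infty}_T}+\|a_t\|_{W^{1,\infty}_T}+\|a^{-1}\|_{L^\infty_T}+\|b\|_{W^{n,\infty}_T}+\|b_t\|_{L^\infty_T}+\|c\|_{W^{n,\infty}_T}+\|d\|_{W^{n,\infty}_T}+\|e\|_{H^n_T}$. Throughout, $K$ denotes a positive constant depending only on $\tilde K$. *)

theory Defs
  imports "HOL-Analysis.Analysis"
begin

definition periodic :: "real \<Rightarrow> (real \<Rightarrow> real) \<Rightarrow> bool" where
  "periodic M f \<longleftrightarrow> (\<forall>x. f (x + M) = f x)"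

definition Ck :: "real \<Rightarrow> nat \<Rightarrow> (real \<Rightarrow> real) \<Rightarrow> bool" where
  "Ck M k f \<longleftrightarrow> periodic M f \<and>
     (\<forall>j<k. \<forall>x. (deriv ^^ j) f differentiable (at x)) \<and>
     continuous_on UNIV ((deriv ^^ k) f)"

definition Ck_norm :: "real \<Rightarrow> nat \<Rightarrow> (real \<Rightarrow> real) \<Rightarrow> real" where
  "Ck_norm M k f = Max ((\<lambda>j. Sup ((\<lambda>x. \<bar>(deriv ^^ j) f x\<bar>) ` {0..M})) ` {..k})"

definition test_fn :: "real \<Rightarrow> (real \<Rightarrow> real) \<Rightarrow> bool" where
  "test_fn M \<phi> \<longleftrightarrow> periodic M \<phi> \<and> (\<forall>k x. (deriv ^^ k) \<phi> differentiable (at x))"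

definition L2 :: "real \<Rightarrow> (real \<Rightarrow> real) \<Rightarrow> bool" where
  "L2 M f \<longleftrightarrow> periodic M f \<and> set_borel_measurable lborel {0..M} f \<and>
     set_integrable lborel {0..M} (\<lambda>x. (f x)\<^sup>2)"

definition L2_norm :: "real \<Rightarrow> (real \<Rightarrow> real) \<Rightarrow> real" where
  "L2_norm M f = sqrt (LINT x:{0..M}|lborel. (f x)\<^sup>2)"

definition weak_deriv :: "real \<Rightarrow> (real \<Rightarrow> real) \<Rightarrow> (real \<Rightarrow> real) \<Rightarrow> bool" where
  "weak_deriv M f g \<longleftrightarrow> L2 M f \<and> L2 M g \<and>
     (\<forall>\<phi>. test_fn M \<phi> \<longrightarrow>
        (LINT x:{0..M}|lborel. f x * deriv \<phi> x) = - (LINT x:{0..M}|lborel. g x * \<phi> x))"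

definition Hn_derivs :: "real \<Rightarrow> nat \<Rightarrow> (real \<Rightarrow> real) \<Rightarrow> (nat \<Rightarrow> real \<Rightarrow> real) \<Rightarrow> bool" where
  "Hn_derivs M n f D \<longleftrightarrow> D 0 = f \<and> L2 M f \<and> (\<forall>k<n. weak_deriv M (D k) (D (Suc k)))"

definition in_Hn :: "real \<Rightarrow> nat \<Rightarrow> (real \<Rightarrow> real) \<Rightarrow> bool" where
  "in_Hn M n f \<longleftrightarrow> (\<exists>D. Hn_derivs M n f D)"

definition Hn_norm :: "real \<Rightarrow> nat \<Rightarrow> (real \<Rightarrow> real) \<Rightarrow> real" where
  "Hn_norm M n f = (let D = (SOME D. Hn_derivs M n f D) in
     sqrt (\<Sum>k\<le>n. (L2_norm M (D k))\<^sup>2))"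

definition cont_into :: "((real \<Rightarrow> real) \<Rightarrow> real) \<Rightarrow> real \<Rightarrow> (real \<Rightarrow> real \<Rightarrow> real) \<Rightarrow> bool" where
  "cont_into N T u \<longleftrightarrow> (\<forall>t\<in>{0..T}. \<forall>\<epsilon>>0. \<exists>\<delta>>0. \<forall>s\<in>{0..T}.
      \<bar>s - t\<bar> < \<delta> \<longrightarrow> N (\<lambda>x. u x s - u x t) < \<epsilon>)"

definition C_Ck :: "real \<Rightarrow> real \<Rightarrow> nat \<Rightarrow> (real \<Rightarrow> real \<Rightarrow> real) \<Rightarrow> bool" where
  "C_Ck M T k u \<longleftrightarrow> (\<forall>t\<in>{0..T}. Ck M k (\<lambda>x. u x t)) \<and> cont_into (Ck_norm M k) T u"

definition C_Hn :: "real \<Rightarrow> real \<Rightarrow> nat \<Rightarrow> (real \<Rightarrow> real \<Rightarrow> real) \<Rightarrow> bool" where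
  "C_Hn M T k u \<longleftrightarrow> (\<forall>t\<in>{0..T}. in_Hn M k (\<lambda>x. u x t)) \<and> cont_into (Hn_norm M k) T u"

definition LinfT :: "((real \<Rightarrow> real) \<Rightarrow> real) \<Rightarrow> real \<Rightarrow> (real \<Rightarrow> real \<Rightarrow> real) \<Rightarrow> real" where
  "LinfT N T u = Inf {C. AE t in lborel. t \<in> {0..T} \<longrightarrow> N (\<lambda>x. u x t) \<le> C}"

definition in_Linf_Hn :: "real \<Rightarrow> nat \<Rightarrow> real \<Rightarrow> (real \<Rightarrow> real \<Rightarrow> real) \<Rightarrow> bool" where
  "in_Linf_Hn M n T u \<longleftrightarrow>
     set_borel_measurable lborel ({0..M} \<times> {0..T}) (\<lambda>p. u (fst p) (snd p)) \<and>
     (AE t in lborel. t \<in> {0..T} \<longrightarrow> in_Hn M n (\<lambda>x. u x t)) \<and>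
     (\<exists>C. AE t in lborel. t \<in> {0..T} \<longrightarrow> Hn_norm M n (\<lambda>x. u x t) \<le> C)"

definition solves :: "real \<Rightarrow> real \<Rightarrow> (real \<Rightarrow> real \<Rightarrow> real) \<Rightarrow> (real \<Rightarrow> real \<Rightarrow> real) \<Rightarrow>
    (real \<Rightarrow> real \<Rightarrow> real) \<Rightarrow> (real \<Rightarrow> real \<Rightarrow> real) \<Rightarrow> (real \<Rightarrow> real \<Rightarrow> real) \<Rightarrow>
    (real \<Rightarrow> real \<Rightarrow> real) \<Rightarrow> bool" where
  "solves M T a b c d e u \<longleftrightarrow> (\<exists>U1 U2 U3.
     (\<forall>t\<in>{0..T}. weak_deriv M (\<lambda>x. u x t) (\<lambda>x. U1 x t) \<and>
                  weak_deriv M (\<lambda>x. U1 x t) (\<lambda>x. U2 x t) \<and>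
                  weak_deriv M (\<lambda>x. U2 x t) (\<lambda>x. U3 x t)) \<and>
     (\<forall>V\<in>{u, U1, U2, U3}.
        set_borel_measurable lborel ({0..M} \<times> {0..T}) (\<lambda>p. V (fst p) (snd p))) \<and>
     (\<forall>t\<in>{0..T}. AE x in lborel. x \<in> {0..M} \<longrightarrow>
        (let F = (\<lambda>s. a x s * U3 x s + b x s * U2 x s + c x s * U1 x s + d x s * u x s + e x s)
         in set_integrable lborel {0..t} F \<and> u x t = u x 0 + (LINT s:{0..t}|lborel. F s))))"

text \<open>The quantity K~ of the paper (a_t = da, b_t = db).\<close>
definition Ktilde :: "real \<Rightarrow> real \<Rightarrow> nat \<Rightarrow> (real \<Rightarrow> real \<Rightarrow> real) \<Rightarrow> (real \<Rightarrow> real \<Rightarrow> real) \<Rightarrow>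
    (real \<Rightarrow> real \<Rightarrow> real) \<Rightarrow> (real \<Rightarrow> real \<Rightarrow> real) \<Rightarrow> (real \<Rightarrow> real \<Rightarrow> real) \<Rightarrow>
    (real \<Rightarrow> real \<Rightarrow> real) \<Rightarrow> (real \<Rightarrow> real \<Rightarrow> real) \<Rightarrow> real" where
  "Ktilde M T n a da b db c d e =
     M + T + real n + LinfT (Ck_norm M (n + 3)) T a + LinfT (Ck_norm M 1) T da
     + LinfT (\<lambda>f. Ck_norm M 0 (\<lambda>x. 1 / f x)) T a
     + LinfT (Ck_norm M n) T b + LinfT (Ck_norm M 0) T db
     + LinfT (Ck_norm M n) T c + LinfT (Ck_norm M n) T d + LinfT (Hn_norm M n) T e"

end

theory Submission
  imports Defs "HOL-Complex_Analysis.Great_Picard"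
begin

text \<open>
  With \<open>\<mu>(t)\<close> the mean of \<open>b / a\<close>, (A3) says \<open>a \<mu> \<ge> 0\<close>. The \<open>j\<close>th derivative of a solution
  satisfies \<open>v\<^sub>t = a v\<^sub>x\<^sub>x\<^sub>x + (b + j a\<^sub>x) v\<^sub>x\<^sub>x + \<dots>\<close>, and multiplying by \<open>w\<^sub>j v\<close> with a suitable periodic weight
  \<open>w\<^sub>j > 0\<close> built from \<open>a\<close> and the primitive of \<open>b / a - \<mu>\<close> leaves, up to terms bounded by \<open>v\<^sup>2\<close>, only
  \<open>- a \<mu> w\<^sub>j v\<^sub>x\<^sup>2 \<le> 0\<close>. Summing over \<open>j \<le> n\<close> gives an energy equivalent to the \<open>H\<^sup>n\<close> norm that grows at most
  exponentially.

  Existence follows by implicit Euler steps in time. Each step is a third order linear periodic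
  boundary value problem, solvable because the energy inequality excludes nontrivial homogeneous
  solutions, and the discrete Gronwall inequality bounds the iterates in \<open>H\<^sup>n\<close> uniformly in the step
  size. They are equicontinuous in time, so by interpolation and Arzela-Ascoli a subsequence converges
  uniformly with all derivatives of order below \<open>n\<close>; as \<open>n \<ge> 4\<close>, this includes every term of the
  equation. The energy inequality for \<open>j = 0\<close> gives uniqueness, and uniqueness turns the a priori bound
  into continuity of the solution map.
\<close>

section \<open>Classical derivatives and test functions\<close>

text \<open>The weight is |a|^(2j/3 - 1) times the exponential of 2/3 of the primitive of b/a -
  \<mu>. Its exponent depends on j because every derivative of a v_xxx produces another a_x v_xx, as
  strong as b v_xx and of no definite sign; comparing the weights of different orders costs only a
  constant factor. Taking the logarithm of a^2 covers both signs of a.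

  As \<mu> may vanish, the energy need not smooth, while the operator loses three derivatives. Hence
  the implicit step: the operator acts on the new iterate, and testing with that iterate closes the
  estimate at the same order.

  One number R bounds M, T, n and the coefficient norms, and every constant is a function of R,
  finally \<open>Ktilde\<close>; the number of time steps never enters.

  Data and source are only of class H^n, the source only measurable in time. Both are replaced by
  smooth periodic functions; their density, and the membership in H^n of limits and of time
  integrals, rest on Riesz duality against test functions.

  Solutions satisfy the equation in integrated form only, so in the uniqueness proof the energy is
  not differentiated but estimated over ever shorter steps.\<close>

definition Cd :: "nat \<Rightarrow> (real \<Rightarrow> real) \<Rightarrow> bool" where
  "Cd k f \<longleftrightarrow> (\<forall>j<k. \<forall>x. (deriv ^^ j) f differentiable (at x)) \<and> continuous_on UNIV ((deriv ^^ k) f)"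

lemma Ck_iff: "Ck M k f \<longleftrightarrow> periodic M f \<and> Cd k f"
  by (simp add: Ck_def Cd_def)

lemma Cd_0: "Cd 0 f \<longleftrightarrow> continuous_on UNIV f"
  by (simp add: Cd_def)

lemma funpow_deriv_Suc: "(deriv ^^ Suc j) f = (deriv ^^ j) (deriv f)"
  by (simp add: funpow_Suc_right del: funpow.simps)

text \<open>Peels off the innermost derivative, so closure under sums, products and reciprocals
  follows by induction on k; peeling off the outermost one would already require the Leibniz rule
  for products.\<close>

lemma Cd_Suc: "Cd (Suc k) f \<longleftrightarrow> (\<forall>x. f differentiable (at x)) \<and> Cd k (deriv f)"
proof -
  have "(\<forall>j<Suc k. P j) \<longleftrightarrow> P 0 \<and> (\<forall>j<k. P (Suc j))" for P :: "nat \<Rightarrow> bool"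
    using less_Suc_eq_0_disj by auto
  then show ?thesis
    unfolding Cd_def by (simp add: funpow_deriv_Suc del: funpow.simps(2))
qed

lemma differentiable_imp_DERIV_deriv:
  "(f::real\<Rightarrow>real) differentiable (at x) \<Longrightarrow> (f has_real_derivative deriv f x) (at x)"
  using DERIV_deriv_iff_real_differentiable by blast

lemma Cd_DERIV:
  assumes "Cd k f" "j < k"
  shows "((deriv ^^ j) f has_real_derivative (deriv ^^ Suc j) f x) (at x)"
  using assms differentiable_imp_DERIV_deriv[of "(deriv ^^ j) f" x] by (auto simp: Cd_def)

lemma Cd_continuous_on:
  assumes "Cd k f" "j \<le> k"
  shows "continuous_on A ((deriv ^^ j) f)"
proof (cases "j = k")
  case True then show ?thesis using assms by (auto simp: Cd_def intro: continuous_on_subset)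
next
  case False
  then have "j < k" using assms by simp
  then show ?thesis using Cd_DERIV[OF assms(1)] 
    by (meson DERIV_isCont continuous_at_imp_continuous_on)
qed

lemma Cd_mono: "Cd k f \<Longrightarrow> j \<le> k \<Longrightarrow> Cd j f"
  using Cd_continuous_on[of k f j UNIV] by (auto simp: Cd_def)

lemma Cd_SucI:
  assumes "\<And>x. (f has_real_derivative g x) (at x)" "Cd k g"
  shows "Cd (Suc k) f"
proof -
  have "deriv f = g" using assms(1) by (auto intro: DERIV_imp_deriv)
  then show ?thesis using assms by (auto simp: Cd_Suc real_differentiable_def)
qed

lemma Cd_SucE:
  assumes "Cd (Suc k) f"
  shows "(f has_real_derivative deriv f x) (at x)" "Cd k (deriv f)"
  using assms by (auto simp: Cd_Suc differentiable_imp_DERIV_deriv)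

lemma Cd_deriv: "Cd (k + j) f \<Longrightarrow> Cd k ((deriv ^^ j) f)"
  by (induction j arbitrary: f) (simp_all add: funpow_deriv_Suc Cd_Suc del: funpow.simps(2))

lemma Cd_const: "Cd k (\<lambda>x. c)"
proof (induction k arbitrary: c)
  case 0 then show ?case by (simp add: Cd_0)
next
  case (Suc k) show ?case by (rule Cd_SucI[of _ "\<lambda>x. 0"]) (auto intro: Suc.IH)
qed

lemma Cd_add: "Cd k f \<Longrightarrow> Cd k g \<Longrightarrow> Cd k (\<lambda>x. f x + g x)"
proof (induction k arbitrary: f g)
  case 0 then show ?case by (auto simp: Cd_0 intro: continuous_intros)
next
  case (Suc k)
  note f = Cd_SucE[OF Suc.prems(1)] and g = Cd_SucE[OF Suc.prems(2)]
  show ?case 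
    by (rule Cd_SucI[of _ "\<lambda>x. deriv f x + deriv g x"]) (auto intro!: f g Suc.IH DERIV_add)
qed

lemma Cd_mult: "Cd k f \<Longrightarrow> Cd k g \<Longrightarrow> Cd k (\<lambda>x. f x * g x)"
proof (induction k arbitrary: f g)
  case 0 then show ?case by (auto simp: Cd_0 intro: continuous_intros)
next
  case (Suc k)
  note f = Cd_SucE[OF Suc.prems(1)] and g = Cd_SucE[OF Suc.prems(2)]
  have fk: "Cd k f" "Cd k g" using Suc.prems by (auto intro: Cd_mono)
  show ?case 
  proof (rule Cd_SucI)
    show "((\<lambda>x. f x * g x) has_real_derivative deriv f x * g x + f x * deriv g x) (at x)" for x
      using DERIV_mult[OF f(1) g(1)] by (simp add: algebra_simps)
    show "Cd k (\<lambda>x. deriv f x * g x + f x * deriv g x)"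
      by (intro Cd_add Suc.IH f g fk)
  qed
qed

lemma Cd_cmult: "Cd k f \<Longrightarrow> Cd k (\<lambda>x. c * f x)"
  by (intro Cd_mult Cd_const)

lemma Cd_diff: "Cd k f \<Longrightarrow> Cd k g \<Longrightarrow> Cd k (\<lambda>x. f x - g x)"
  using Cd_add[of k f "\<lambda>x. (-1) * g x"] Cd_cmult[of k g "-1"] by simp

lemma Cd_inverse: "Cd k f \<Longrightarrow> (\<And>x. f x \<noteq> 0) \<Longrightarrow> Cd k (\<lambda>x. 1 / f x)"
proof (induction k)
  case 0 then show ?case by (auto simp: Cd_0 intro!: continuous_intros)
next
  case (Suc k)
  note f = Cd_SucE[OF Suc.prems(1)]
  have IH: "Cd k (\<lambda>x. 1 / f x)" using Suc.IH Suc.prems Cd_mono[OF Suc.prems(1), of k] by auto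
  show ?case
  proof (rule Cd_SucI)
    show "((\<lambda>x. 1 / f x) has_real_derivative (-1) * (deriv f x * ((1 / f x) * (1 / f x)))) (at x)" for x
      by (rule derivative_eq_intros f(1) refl | use Suc.prems(2) in \<open>simp add: field_simps\<close>)+
    show "Cd k (\<lambda>x. (-1) * (deriv f x * ((1 / f x) * (1 / f x))))"
      by (intro Cd_cmult Cd_mult IH f)
  qed
qed

lemma funpow_deriv_add:
  assumes "Cd k f" "Cd k g" "j \<le> k"
  shows "(deriv ^^ j) (\<lambda>x. f x + g x) = (\<lambda>x. (deriv ^^ j) f x + (deriv ^^ j) g x)"
  using assms
proof (induction j)
  case 0 then show ?case by simp
next
  case (Suc j)
  then have "(deriv ^^ j) (\<lambda>x. f x + g x) = (\<lambda>x. (deriv ^^ j) f x + (deriv ^^ j) g x)" by simp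
  moreover have "((\<lambda>x. (deriv ^^ j) f x + (deriv ^^ j) g x) has_real_derivative 
       (deriv ^^ Suc j) f x + (deriv ^^ Suc j) g x) (at x)" for x
    using Suc.prems by (intro DERIV_add Cd_DERIV) auto
  ultimately show ?case by (simp only: funpow.simps(2) o_def) (auto intro: DERIV_imp_deriv)
qed

lemma funpow_deriv_cmult:
  assumes "Cd k f" "j \<le> k"
  shows "(deriv ^^ j) (\<lambda>x. c * f x) = (\<lambda>x. c * (deriv ^^ j) f x)"
  using assms
proof (induction j)
  case 0 then show ?case by simp
next
  case (Suc j)
  then have "(deriv ^^ j) (\<lambda>x. c * f x) = (\<lambda>x. c * (deriv ^^ j) f x)" by simp
  moreover have "((\<lambda>x. c * (deriv ^^ j) f x) has_real_derivative c * (deriv ^^ Suc j) f x) (at x)" for x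
    using Suc.prems by (intro DERIV_cmult Cd_DERIV) auto
  ultimately show ?case by (simp only: funpow.simps(2) o_def) (auto intro: DERIV_imp_deriv)
qed

lemma funpow_deriv_diff:
  assumes "Cd k f" "Cd k g" "j \<le> k"
  shows "(deriv ^^ j) (\<lambda>x. f x - g x) = (\<lambda>x. (deriv ^^ j) f x - (deriv ^^ j) g x)"
  using funpow_deriv_add[OF assms(1) Cd_cmult[OF assms(2), of "-1"] assms(3)]
    funpow_deriv_cmult[OF assms(2,3), of "-1"] by simp

lemma funpow_deriv_Leibniz:
  assumes "Cd k f" "Cd k g" "j \<le> k"
  shows "(deriv ^^ j) (\<lambda>x. f x * g x) =
    (\<lambda>x. \<Sum>i\<le>j. real (j choose i) * (deriv ^^ i) f x * (deriv ^^ (j - i)) g x)"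
  using assms
proof (induction j)
  case 0 then show ?case by simp
next
  case (Suc j)
  let ?f = "\<lambda>i. (deriv ^^ i) f" and ?g = "\<lambda>i. (deriv ^^ i) g"
  have IH: "(deriv ^^ j) (\<lambda>x. f x * g x) = (\<lambda>x. \<Sum>i\<le>j. real (j choose i) * ?f i x * ?g (j - i) x)"
    using Suc by simp
  have D: "((\<lambda>x. \<Sum>i\<le>j. real (j choose i) * ?f i x * ?g (j - i) x) has_real_derivative
      (\<Sum>i\<le>j. real (j choose i) * (?f (Suc i) x * ?g (j - i) x + ?f i x * ?g (Suc (j - i)) x))) (at x)" for x
  proof (intro DERIV_sum)
    fix i assume "i \<in> {..j}"
    then have "(?f i has_real_derivative ?f (Suc i) x) (at x)" 
        "(?g (j - i) has_real_derivative ?g (Suc (j - i)) x) (at x)"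
      using Suc.prems by (auto intro!: Cd_DERIV simp del: funpow.simps(2))
    from DERIV_cmult[OF DERIV_mult[OF this], of "real (j choose i)"]
    show "((\<lambda>x. real (j choose i) * ?f i x * ?g (j - i) x) has_real_derivative
      real (j choose i) * (?f (Suc i) x * ?g (j - i) x + ?f i x * ?g (Suc (j - i)) x)) (at x)"
      by (simp add: mult.assoc add.commute mult.commute mult.left_commute del: funpow.simps(2))
  qed
  have "(\<Sum>i\<le>j. real (j choose i) * (?f (Suc i) x * ?g (j - i) x + ?f i x * ?g (Suc (j - i)) x))
      = (\<Sum>i\<le>Suc j. real (Suc j choose i) * ?f i x * ?g (Suc j - i) x)" for x
  proof -
    \<comment> \<open>The index range may be enlarged by \<open>Suc j\<close>, whose binomial
      coefficient vanishes; after the shift the two halves combine by Pascal's rule.\<close>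
    have 1: "(\<Sum>i\<le>j. real (j choose i) * (?f i x * ?g (Suc (j - i)) x))
       = ?f 0 x * ?g (Suc j) x + (\<Sum>i\<le>j. real (j choose Suc i) * (?f (Suc i) x * ?g (j - i) x))"
    proof -
      have "(\<Sum>i\<le>j. real (j choose i) * (?f i x * ?g (Suc (j - i)) x))
          = (\<Sum>i\<le>Suc j. real (j choose i) * (?f i x * ?g (Suc j - i) x))"
        by (simp add: Suc_diff_le del: funpow.simps(2))
      also have "\<dots> = ?f 0 x * ?g (Suc j) x + (\<Sum>i\<le>j. real (j choose Suc i) * (?f (Suc i) x * ?g (j - i) x))"
        by (subst sum.atMost_Suc_shift) (simp del: funpow.simps(2))
      finally show ?thesis .
    qed
    have 2: "(\<Sum>i\<le>Suc j. real (Suc j choose i) * ?f i x * ?g (Suc j - i) x)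
       = ?f 0 x * ?g (Suc j) x + (\<Sum>i\<le>j. real (Suc j choose Suc i) * ?f (Suc i) x * ?g (j - i) x)"
      by (subst sum.atMost_Suc_shift) (simp del: funpow.simps(2))
    show ?thesis
      unfolding 2 distrib_left sum.distrib 1
      by (simp add: sum.distrib algebra_simps del: funpow.simps(2))
  qed
  with D have "((\<lambda>x. \<Sum>i\<le>j. real (j choose i) * ?f i x * ?g (j - i) x) has_real_derivative
      (\<Sum>i\<le>Suc j. real (Suc j choose i) * ?f i x * ?g (Suc j - i) x)) (at x)" for x
    by (simp del: funpow.simps(2) sum.atMost_Suc)
  from DERIV_imp_deriv[OF this] show ?case
    by (simp only: funpow.simps(2) o_def IH) 
qed

text \<open>Holds even where f is not differentiable: \<open>deriv\<close> chooses from the set of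
  derivatives at a point, and this set is the same at x and at x + M.\<close>

lemma periodic_deriv:
  assumes "periodic M f" shows "periodic M (deriv f)"
proof -
  have "(\<lambda>x. f (x + M)) = f" using assms by (auto simp: periodic_def)
  then have "(f has_field_derivative D) (at (x + M)) \<longleftrightarrow> (f has_field_derivative D) (at x)" for D x
    using DERIV_shift[of f D x M] by simp
  then show ?thesis unfolding periodic_def deriv_def by simp
qed

lemma periodic_funpow_deriv: "periodic M f \<Longrightarrow> periodic M ((deriv ^^ j) f)"
  by (induction j) (auto intro: periodic_deriv)

section \<open>Algebra of periodic smooth functions\<close>

lemma test_fn_iff: "test_fn M \<phi> \<longleftrightarrow> (\<forall>k. Ck M k \<phi>)"
proof -
  have "Cd k \<phi>" if "\<forall>k x. (deriv ^^ k) \<phi> differentiable (at x)" for k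
    using that by (auto simp: Cd_def intro!: differentiable_imp_continuous_on 
       differentiable_at_imp_differentiable_on)
  moreover have "(deriv ^^ k) \<phi> differentiable (at x)" if "\<forall>k. Cd k \<phi>" for k x
    using that[rule_format, of "Suc k"] by (auto simp: Cd_def)
  ultimately show ?thesis by (auto simp: test_fn_def Ck_iff)
qed

lemma test_fn_Cd: "test_fn M \<phi> \<Longrightarrow> Cd k \<phi>"
  by (auto simp: test_fn_iff Ck_iff)

lemma test_fn_periodic: "test_fn M \<phi> \<Longrightarrow> periodic M \<phi>"
  by (auto simp: test_fn_def)

lemma test_fn_deriv: "test_fn M \<phi> \<Longrightarrow> test_fn M ((deriv ^^ j) \<phi>)"
  by (auto simp: test_fn_iff Ck_iff periodic_funpow_deriv intro!: Cd_deriv)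

lemma test_fn_add: "test_fn M \<phi> \<Longrightarrow> test_fn M \<psi> \<Longrightarrow> test_fn M (\<lambda>x. \<phi> x + \<psi> x)"
  by (auto simp: test_fn_iff Ck_iff Cd_add periodic_def)

lemma test_fn_mult: "test_fn M \<phi> \<Longrightarrow> test_fn M \<psi> \<Longrightarrow> test_fn M (\<lambda>x. \<phi> x * \<psi> x)"
  by (auto simp: test_fn_iff Ck_iff Cd_mult periodic_def)

lemma test_fn_const: "test_fn M (\<lambda>x. c)"
  by (auto simp: test_fn_iff Ck_iff Cd_const periodic_def)

lemma test_fn_power: "test_fn M \<phi> \<Longrightarrow> test_fn M (\<lambda>x. \<phi> x ^ m)"
  by (induction m) (auto intro: test_fn_const test_fn_mult)

section \<open>Square integrable functions on an interval\<close>

abbreviation I :: "real \<Rightarrow> (real \<Rightarrow> real) \<Rightarrow> real" where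
  "I M f \<equiv> (LINT x:{0..M}|lborel. f x)"

text \<open>\<open>L2\<close> without periodicity: indicators, primitives and slices in the time
  variable are not periodic, and the Hilbert space arguments on an interval do not see the
  difference.\<close>

definition sq :: "real \<Rightarrow> (real \<Rightarrow> real) \<Rightarrow> bool" where
  "sq M f \<longleftrightarrow> set_borel_measurable lborel {0..M} f \<and> set_integrable lborel {0..M} (\<lambda>x. (f x)\<^sup>2)"

lemma L2_iff: "L2 M f \<longleftrightarrow> periodic M f \<and> sq M f"
  by (auto simp: L2_def sq_def)

lemma set_measurable_mult:
  fixes f g :: "'a::euclidean_space \<Rightarrow> real"
  assumes "set_borel_measurable lborel A f" "set_borel_measurable lborel A g"
  shows "set_borel_measurable lborel A (\<lambda>x. f x * g x)"
proof -
  have "(\<lambda>x. indicator A x *\<^sub>R (f x * g x)) = (\<lambda>x. (indicator A x *\<^sub>R f x) * (indicator A x *\<^sub>R g x))"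
    by (auto simp: indicator_def)
  then show ?thesis using assms unfolding set_borel_measurable_def
    by simp 
qed

lemma set_measurable_add:
  fixes f g :: "'a::euclidean_space \<Rightarrow> real"
  assumes "set_borel_measurable lborel A f" "set_borel_measurable lborel A g"
  shows "set_borel_measurable lborel A (\<lambda>x. f x + g x)"
proof -
  have "(\<lambda>x. indicator A x *\<^sub>R (f x + g x)) = (\<lambda>x. (indicator A x *\<^sub>R f x) + (indicator A x *\<^sub>R g x))"
    by (auto simp: indicator_def)
  then show ?thesis using assms unfolding set_borel_measurable_def
    by simp 
qed

lemma set_integrable_boundedI:
  fixes f g :: "real \<Rightarrow> real"
  assumes "set_integrable lborel A f" "set_borel_measurable lborel A g"
    and "\<And>x. x \<in> A \<Longrightarrow> \<bar>g x\<bar> \<le> f x"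
  shows "set_integrable lborel A g"
  using assms(1) assms(2)
  by (rule set_integrable_bound) (use assms(3) in force)

lemma sq_mult_integrable:
  assumes "sq M f" "sq M g"
  shows "set_integrable lborel {0..M} (\<lambda>x. f x * g x)"
proof (rule set_integrable_boundedI)
  show "set_integrable lborel {0..M} (\<lambda>x. (f x)\<^sup>2 + (g x)\<^sup>2)"
    using assms by (auto simp: sq_def)
  show "set_borel_measurable lborel {0..M} (\<lambda>x. f x * g x)"
    using assms by (auto simp: sq_def intro: set_measurable_mult)
  show "\<bar>f x * g x\<bar> \<le> (f x)\<^sup>2 + (g x)\<^sup>2" for x
    using sum_squares_bound[of "f x" "g x"] sum_squares_bound[of "- f x" "g x"]
      zero_le_power2[of "f x"] zero_le_power2[of "g x"] unfolding abs_le_iff by auto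
qed

lemma sq_add: assumes "sq M f" "sq M g" shows "sq M (\<lambda>x. f x + g x)"
proof -
  have "set_integrable lborel {0..M} (\<lambda>x. (f x)\<^sup>2 + 2 * (f x * g x) + (g x)\<^sup>2)"
    using assms sq_mult_integrable[OF assms] by (auto simp: sq_def intro!: set_integral_add)
  moreover have "(\<lambda>x. (f x)\<^sup>2 + 2 * (f x * g x) + (g x)\<^sup>2) = (\<lambda>x. (f x + g x)\<^sup>2)"
    by (auto simp: power2_eq_square algebra_simps)
  ultimately show ?thesis using assms by (auto simp: sq_def intro: set_measurable_add)
qed

lemma sq_continuous: assumes "continuous_on {0..M} f" shows "sq M f"
proof -
  have "continuous_on {0..M} (\<lambda>x. (f x)\<^sup>2)" using assms by (intro continuous_intros)
  with assms have i: "set_integrable lborel {0..M} f" "set_integrable lborel {0..M} (\<lambda>x. (f x)\<^sup>2)"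
    by (auto intro: borel_integrable_atLeastAtMost')
  then show ?thesis unfolding sq_def set_borel_measurable_def set_integrable_def by auto
qed

lemma sq_const: "sq M (\<lambda>x. c)"
  by (rule sq_continuous) simp

lemma sq_cmult: assumes "sq M f" shows "sq M (\<lambda>x. c * f x)"
proof -
  have "set_borel_measurable lborel {0..M} (\<lambda>x. c * f x)"
    using assms sq_const[of M c] by (auto simp: sq_def intro: set_measurable_mult)
  then show ?thesis using assms by (auto simp: sq_def power_mult_distrib)
qed

lemma sq_diff: assumes "sq M f" "sq M g" shows "sq M (\<lambda>x. f x - g x)"
  using sq_add[OF assms(1) sq_cmult[OF assms(2), of "-1"]] by simp

lemma sq_integrable: assumes "sq M f" shows "set_integrable lborel {0..M} f"
  using sq_mult_integrable[OF assms sq_const[of M 1]] by simp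

lemma sq_cmult_cont: 
  assumes "continuous_on {0..M} g" "sq M f" shows "sq M (\<lambda>x. g x * f x)"
proof -
  obtain B where B: "\<And>x. x \<in> {0..M} \<Longrightarrow> \<bar>g x\<bar> \<le> B"
    using compact_imp_bounded[OF compact_continuous_image[OF assms(1) compact_Icc]]
    unfolding bounded_iff by (metis real_norm_def image_eqI)
  have m: "set_borel_measurable lborel {0..M} (\<lambda>x. g x * f x)"
    using assms sq_continuous[OF assms(1)] by (auto simp: sq_def intro: set_measurable_mult)
  have "set_integrable lborel {0..M} (\<lambda>x. (g x * f x)\<^sup>2)"
  proof (rule set_integrable_boundedI)
    show "set_integrable lborel {0..M} (\<lambda>x. B\<^sup>2 * (f x)\<^sup>2)"
      using assms by (auto simp: sq_def)
    show "set_borel_measurable lborel {0..M} (\<lambda>x. (g x * f x)\<^sup>2)"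
      unfolding power2_eq_square by (intro set_measurable_mult m)
    show "\<bar>(g x * f x)\<^sup>2\<bar> \<le> B\<^sup>2 * (f x)\<^sup>2" if "x \<in> {0..M}" for x
      using power_mono[OF B[OF that] abs_ge_zero, of 2] 
      by (simp add: power_mult_distrib mult_right_mono)
  qed
  with m show ?thesis by (simp add: sq_def)
qed

lemma sq_sum: "finite A \<Longrightarrow> (\<And>i. i \<in> A \<Longrightarrow> sq M (f i)) \<Longrightarrow> sq M (\<lambda>x. \<Sum>i\<in>A. f i x)"
  by (induction A rule: finite_induct) (auto intro: sq_const sq_add)

text \<open>Periodisation can change the value at M. Borel measurability does not survive arbitrary
  changes on null sets, so the change at this one point is written as a case distinction.\<close>

lemma set_measurable_cong_interval:
  fixes f g :: "real \<Rightarrow> real"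
  assumes "\<And>x. x \<in> {0..<M} \<Longrightarrow> f x = g x" "set_borel_measurable lborel {0..M} f" 
  shows "set_borel_measurable lborel {0..M} g"
proof -
  have "(\<lambda>x. indicator {0..M} x *\<^sub>R g x) = 
     (\<lambda>x. if x = M then indicator {0..M} M *\<^sub>R g M else indicator {0..M} x *\<^sub>R f x)"
    using assms(1) by (auto simp: indicator_def)
  also have "\<dots> \<in> borel_measurable lborel"
    using assms(2) unfolding set_borel_measurable_def by measurable
  finally show ?thesis unfolding set_borel_measurable_def .
qed

lemma AE_lborel_neq: "AE x in lborel. x \<noteq> (c::real)"
  by (rule AE_lborel_singleton)

lemma set_integrable_cong_interval:
  fixes f g :: "real \<Rightarrow> real"
  assumes "\<And>x. x \<in> {0..<M} \<Longrightarrow> f x = g x" "set_integrable lborel {0..M} f" 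
  shows "set_integrable lborel {0..M} g"
proof -
  have m: "set_borel_measurable lborel {0..M} g" 
    by (rule set_measurable_cong_interval[OF assms(1)])
      (use assms(2) in \<open>auto simp: set_integrable_def set_borel_measurable_def\<close>)
  have "AE x in lborel. indicator {0..M} x *\<^sub>R f x = indicator {0..M} x *\<^sub>R g x"
    using AE_lborel_neq[of M] by eventually_elim (use assms(1) in \<open>auto simp: indicator_def\<close>)
  then show ?thesis 
    using assms(2) m integrable_cong_AE_imp[of lborel "\<lambda>x. indicator {0..M} x *\<^sub>R f x" "\<lambda>x. indicator {0..M} x *\<^sub>R g x"]
    unfolding set_integrable_def set_borel_measurable_def by simp
qed

lemma sq_cong_interval:
  assumes "\<And>x. x \<in> {0..<M} \<Longrightarrow> f x = g x" "sq M f" shows "sq M g"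
  using assms set_measurable_cong_interval[of M f g] set_integrable_cong_interval[of M "\<lambda>x. (f x)\<^sup>2" "\<lambda>x. (g x)\<^sup>2"]
  by (auto simp: sq_def)

lemma I_cong_AE:
  assumes "set_borel_measurable lborel {0..M} f" "set_borel_measurable lborel {0..M} g"
    "AE x in lborel. x \<in> {0..M} \<longrightarrow> f x = g x"
  shows "I M f = I M g"
  unfolding set_lebesgue_integral_def
proof (rule integral_cong_AE)
  show "AE x in lborel. indicator {0..M} x *\<^sub>R f x = indicator {0..M} x *\<^sub>R g x"
    using assms(3) by eventually_elim (simp add: indicator_def)
qed (use assms in \<open>simp_all add: set_borel_measurable_def\<close>)

section \<open>The L2 norm and its inequalities\<close>

lemma I_mono: 
  fixes f g :: "real \<Rightarrow> real"
  assumes "set_integrable lborel {0..M} f" "set_integrable lborel {0..M} g"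
   "\<And>x. x \<in> {0..M} \<Longrightarrow> f x \<le> g x"
  shows "I M f \<le> I M g"
  using assms by (intro set_integral_mono) auto

lemma L2_norm_nonneg: "L2_norm M f \<ge> 0"
  unfolding L2_norm_def by (simp add: set_lebesgue_integral_def)

lemma L2_norm_sq: "(L2_norm M f)\<^sup>2 = I M (\<lambda>x. (f x)\<^sup>2)"
  unfolding L2_norm_def by (simp add: set_lebesgue_integral_def)

lemma I_sq_nonneg: "I M (\<lambda>x. (f x)\<^sup>2) \<ge> 0"
  by (simp add: set_lebesgue_integral_def)

lemma L2_norm_le: "I M (\<lambda>x. (f x)\<^sup>2) \<le> C\<^sup>2 \<Longrightarrow> C \<ge> 0 \<Longrightarrow> L2_norm M f \<le> C"
  unfolding L2_norm_def by (simp add: real_le_lsqrt)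

lemma I_square_lin:
  assumes "sq M f" "sq M g"
  shows "I M (\<lambda>x. (f x + s * g x)\<^sup>2) = I M (\<lambda>x. (f x)\<^sup>2) + 2 * s * I M (\<lambda>x. f x * g x) + s\<^sup>2 * I M (\<lambda>x. (g x)\<^sup>2)"
proof -
  have i: "set_integrable lborel {0..M} (\<lambda>x. (f x)\<^sup>2)" "set_integrable lborel {0..M} (\<lambda>x. (g x)\<^sup>2)"
     "set_integrable lborel {0..M} (\<lambda>x. f x * g x)"
    using assms sq_mult_integrable by (auto simp: sq_def)
  have "(\<lambda>x. (f x + s * g x)\<^sup>2) = (\<lambda>x. (f x)\<^sup>2 + (2 * s) * (f x * g x) + s\<^sup>2 * (g x)\<^sup>2)"
    by (auto simp: power2_eq_square algebra_simps)
  then show ?thesis using i by simp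
qed

lemma Cauchy_Schwarz_I:
  assumes "sq M f" "sq M g"
  shows "\<bar>I M (\<lambda>x. f x * g x)\<bar> \<le> L2_norm M f * L2_norm M g"
proof -
  define A where "A = I M (\<lambda>x. (f x)\<^sup>2)"
  define B where "B = I M (\<lambda>x. f x * g x)"
  define C where "C = I M (\<lambda>x. (g x)\<^sup>2)"
  have A: "A \<ge> 0" and C: "C \<ge> 0" unfolding A_def C_def by (auto intro: I_sq_nonneg)
  have q: "0 \<le> A + 2 * s * B + s\<^sup>2 * C" for s
    using I_square_lin[OF assms, of s] I_sq_nonneg[of M "\<lambda>x. f x + s * g x"] by (simp add: A_def B_def C_def)
  have "B\<^sup>2 \<le> A * C"
  proof (cases "C = 0")
    case True
    have "B = 0"
    proof (rule ccontr)
      assume "B \<noteq> 0"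
      \<comment> \<open>With C = 0 the polynomial is linear, and at this s it takes the value
        -1.\<close>
      then show False using q[of "-(A+1)/(2*B)"] True A by (simp add: field_simps)
    qed
    then show ?thesis using A C by simp
  next
    case False
    then have "C > 0" using C by simp
    \<comment> \<open>s = -B/C is the minimiser of the quadratic.\<close>
    then have "0 \<le> A - B\<^sup>2 / C" using q[of "-B/C"] by (simp add: field_simps power2_eq_square)
    with \<open>C > 0\<close> show ?thesis by (simp add: field_simps)
  qed
  also have "A * C = (L2_norm M f * L2_norm M g)\<^sup>2"
    by (simp add: A_def C_def L2_norm_sq power_mult_distrib)
  finally show ?thesis unfolding B_def
    by (simp add: L2_norm_nonneg abs_le_square_iff[symmetric])
qed

lemma L2_norm_triangle:
  assumes "sq M f" "sq M g"
  shows "L2_norm M (\<lambda>x. f x + g x) \<le> L2_norm M f + L2_norm M g"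
proof (rule L2_norm_le)
  have "I M (\<lambda>x. (f x + g x)\<^sup>2) = (L2_norm M f)\<^sup>2 + 2 * I M (\<lambda>x. f x * g x) + (L2_norm M g)\<^sup>2"
    using I_square_lin[OF assms, of 1] by (simp add: L2_norm_sq)
  also have "\<dots> \<le> (L2_norm M f + L2_norm M g)\<^sup>2"
    using Cauchy_Schwarz_I[OF assms] by (simp add: power2_eq_square algebra_simps)
  finally show "I M (\<lambda>x. (f x + g x)\<^sup>2) \<le> (L2_norm M f + L2_norm M g)\<^sup>2" .
qed (simp add: L2_norm_nonneg)

lemma L2_norm_cmult: "L2_norm M (\<lambda>x. c * f x) = \<bar>c\<bar> * L2_norm M f"
  unfolding L2_norm_def by (simp add: power_mult_distrib real_sqrt_mult)

lemma L2_norm_triangle_diff: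
  assumes "sq M f" "sq M g"
  shows "L2_norm M (\<lambda>x. f x - g x) \<le> L2_norm M f + L2_norm M g"
  using L2_norm_triangle[OF assms(1) sq_cmult[OF assms(2), of "-1"]] L2_norm_cmult[of M "-1" g] by simp

lemma L2_norm_diff_commute: "L2_norm M (\<lambda>x. f x - g x) = L2_norm M (\<lambda>x. g x - f x)"
  unfolding L2_norm_def by (simp add: power2_commute)

lemma L2_norm_diff_le:
  assumes "sq M f" "sq M g"
  shows "L2_norm M f - L2_norm M g \<le> L2_norm M (\<lambda>x. f x - g x)"
  using L2_norm_triangle[OF sq_diff[OF assms] assms(2)] by simp

lemma L2_norm_triangle_sub:
  assumes "sq M f" "sq M g" "sq M h"
  shows "L2_norm M (\<lambda>x. f x - h x) \<le> L2_norm M (\<lambda>x. f x - g x) + L2_norm M (\<lambda>x. g x - h x)"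
  using L2_norm_triangle[OF sq_diff[OF assms(1,2)] sq_diff[OF assms(2,3)]] by simp

lemma L2_norm_cong_AE:
  assumes "sq M f" "sq M g" "AE x in lborel. x \<in> {0..M} \<longrightarrow> f x = g x"
  shows "L2_norm M f = L2_norm M g"
proof -
  have "I M (\<lambda>x. (f x)\<^sup>2) = I M (\<lambda>x. (g x)\<^sup>2)"
    using assms unfolding power2_eq_square by (intro I_cong_AE set_measurable_mult) (auto simp: sq_def)
  then show ?thesis by (simp add: L2_norm_def)
qed

lemma L2_norm_zero_AE:
  assumes "sq M f" "L2_norm M f = 0"
  shows "AE x in lborel. x \<in> {0..M} \<longrightarrow> f x = 0"
proof -
  have "I M (\<lambda>x. (f x)\<^sup>2) = 0" using assms(2) L2_norm_sq[of M f] by simp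
  then have "(\<integral>x. indicator {0..M} x *\<^sub>R (f x)\<^sup>2 \<partial>lborel) = 0" by (simp add: set_lebesgue_integral_def)
  moreover have "integrable lborel (\<lambda>x. indicator {0..M} x *\<^sub>R (f x)\<^sup>2)"
    using assms(1) by (simp add: sq_def set_integrable_def)
  ultimately have "AE x in lborel. indicator {0..M} x *\<^sub>R (f x)\<^sup>2 = 0"
    by (subst (asm) integral_nonneg_eq_0_iff_AE) auto
  then show ?thesis by eventually_elim (auto simp: indicator_def)
qed

lemma L2_norm_const: "M \<ge> 0 \<Longrightarrow> L2_norm M (\<lambda>x. c) = sqrt M * \<bar>c\<bar>"
  by (simp add: L2_norm_def set_lebesgue_integral_def real_sqrt_mult mult.commute)

lemma L2_norm_sup:
  assumes "M \<ge> 0" "sq M f" "\<And>x. x \<in> {0..M} \<Longrightarrow> \<bar>f x\<bar> \<le> c"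
  shows "L2_norm M f \<le> sqrt M * c"
proof -
  have c: "c \<ge> 0" using assms(3)[of 0] assms(1) by simp
  have "I M (\<lambda>x. (f x)\<^sup>2) \<le> I M (\<lambda>x. c\<^sup>2)"
    using assms sq_const[of M c] power_mono[OF assms(3) abs_ge_zero, of _ 2] by (intro I_mono) (auto simp: sq_def)
  then show ?thesis using L2_norm_const[OF assms(1), of c] c
    by (auto simp: L2_norm_def) (metis real_sqrt_le_iff)
qed

lemma I_abs_le_L2:
  assumes "M \<ge> 0" "sq M f" shows "I M (\<lambda>x. \<bar>f x\<bar>) \<le> sqrt M * L2_norm M f"
proof -
  have "(\<lambda>x. indicator {0..M} x *\<^sub>R \<bar>f x\<bar>) = (\<lambda>x. \<bar>indicator {0..M} x *\<^sub>R f x\<bar>)"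
    by (auto simp: indicator_def)
  then have "sq M (\<lambda>x. \<bar>f x\<bar>)"
    using assms(2) unfolding sq_def set_borel_measurable_def by auto
  from Cauchy_Schwarz_I[OF this sq_const[of M 1]] show ?thesis
    using L2_norm_const[OF assms(1), of 1] by (simp add: L2_norm_def mult.commute)
qed

text \<open>Reads f on [0, M) only, so the value at M becomes f 0; it agrees with f on the closed
  interval exactly when the two end values coincide (\<open>per_eq'\<close>).\<close>

definition per :: "real \<Rightarrow> (real \<Rightarrow> real) \<Rightarrow> real \<Rightarrow> real" where
  "per M f x = f (x - M * of_int \<lfloor>x / M\<rfloor>)"

lemma periodic_per: "M > 0 \<Longrightarrow> periodic M (per M f)"
  by (simp add: periodic_def per_def add_divide_distrib algebra_simps)

lemma per_eq: "M > 0 \<Longrightarrow> x \<in> {0..<M} \<Longrightarrow> per M f x = f x"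
proof -
  assume "M > 0" "x \<in> {0..<M}"
  then have "\<lfloor>x / M\<rfloor> = 0" by (simp add: floor_eq_iff)
  then show ?thesis by (simp add: per_def)
qed

lemma per_eq': "M > 0 \<Longrightarrow> f M = f 0 \<Longrightarrow> x \<in> {0..M} \<Longrightarrow> per M f x = f x"
  using per_eq[of M x f] by (cases "x = M") (auto simp: per_def)

lemma AE_per: "M > 0 \<Longrightarrow> AE x in lborel. x \<in> {0..M} \<longrightarrow> per M f x = f x"
  using AE_lborel_neq[of M] by eventually_elim (simp add: per_eq)

lemma L2_per: "M > 0 \<Longrightarrow> sq M f \<Longrightarrow> L2 M (per M f)"
  using sq_cong_interval[of M f "per M f"] by (auto simp: L2_iff periodic_per per_eq)

text \<open>On a bounded interval an L2 Cauchy sequence is L1 Cauchy, so a subsequence converges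
  almost everywhere; Fatou's lemma in the second index carries the Cauchy estimate over to the
  limit.\<close>

lemma L2_complete:
  assumes M: "M > 0" and f: "\<And>m. sq M (f m)"
    and Cauchy: "\<And>e. e > 0 \<Longrightarrow> \<exists>N. \<forall>i\<ge>N. \<forall>j\<ge>N. L2_norm M (\<lambda>x. f i x - f j x) < e"
  shows "\<exists>g. sq M g \<and> (\<lambda>m. L2_norm M (\<lambda>x. f m x - g x)) \<longlonglongrightarrow> 0"
proof -
  define F where "F = (\<lambda>i x. indicator {0..M} x *\<^sub>R f i x)"
  have Fm [measurable]: "F i \<in> borel_measurable lborel" for i
    using f[of i] by (simp add: F_def sq_def set_borel_measurable_def)
  have Fi: "integrable lborel (F i)" for i
    using sq_integrable[OF f[of i]] by (simp add: F_def set_integrable_def)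
  have FL1: "(LINT x|lborel. norm (F i x - F j x)) \<le> sqrt M * L2_norm M (\<lambda>x. f i x - f j x)" for i j
  proof -
    have "(LINT x|lborel. norm (F i x - F j x)) = I M (\<lambda>x. \<bar>f i x - f j x\<bar>)"
      unfolding set_lebesgue_integral_def F_def
      by (intro Bochner_Integration.integral_cong) (auto simp: indicator_def)
    also have "\<dots> \<le> sqrt M * L2_norm M (\<lambda>x. f i x - f j x)"
      using M f by (intro I_abs_le_L2 sq_diff) auto
    finally show ?thesis .
  qed
  obtain r where r: "strict_mono r" "AE x in lborel. Cauchy (\<lambda>i. F (r i) x)"
  proof (rule cauchy_L1_AE_cauchy_subseq[of lborel F])
    fix e :: real assume "e > 0"
    then obtain N where "\<forall>i\<ge>N. \<forall>j\<ge>N. L2_norm M (\<lambda>x. f i x - f j x) < e / sqrt M"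
      using Cauchy[of "e / sqrt M"] M by auto
    then show "\<exists>N. \<forall>i\<ge>N. \<forall>j\<ge>N. (LINT x|lborel. norm (F i x - F j x)) < e"
      using FL1 M by (intro exI[of _ N]) (smt (verit) mult.commute pos_less_divide_eq real_sqrt_gt_zero)
  qed (use Fi in auto)
  \<comment> \<open>\<open>lim\<close> has a value also where the sequence diverges, so g is
    measurable without removing a null set.\<close>
  define g where "g = (\<lambda>x. lim (\<lambda>i. F (r i) x))"
  have gm [measurable]: "g \<in> borel_measurable lborel"
    unfolding g_def by measurable
  have lim: "AE x in lborel. (\<lambda>i. F (r i) x) \<longlonglongrightarrow> g x"
    using r(2) by eventually_elim (simp add: g_def Cauchy_convergent convergent_LIMSEQ_iff[symmetric])
  have g0: "g x = 0" if "x \<notin> {0..M}" for x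
    using that by (simp add: g_def F_def)
  have key: "(\<integral>\<^sup>+x. ennreal ((F m x - g x)\<^sup>2) \<partial>lborel) \<le> ennreal (e\<^sup>2)"
    if N: "\<forall>i\<ge>N. \<forall>j\<ge>N. L2_norm M (\<lambda>x. f i x - f j x) < e" and m: "m \<ge> N" for N m e
  proof -
    have "(\<integral>\<^sup>+x. ennreal ((F m x - g x)\<^sup>2) \<partial>lborel) = 
      (\<integral>\<^sup>+x. liminf (\<lambda>i. ennreal ((F m x - F (r i) x)\<^sup>2)) \<partial>lborel)"
    proof (rule nn_integral_cong_AE)
      show "AE x in lborel. ennreal ((F m x - g x)\<^sup>2) = liminf (\<lambda>i. ennreal ((F m x - F (r i) x)\<^sup>2))"
        using lim
      proof eventually_elim
        case (elim x)
        have "(\<lambda>i. ennreal ((F m x - F (r i) x)\<^sup>2)) \<longlonglongrightarrow> ennreal ((F m x - g x)\<^sup>2)"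
          by (intro tendsto_ennrealI tendsto_intros elim)
        from lim_imp_Liminf[OF _ this] show ?case by simp
      qed
    qed
    also have "\<dots> \<le> liminf (\<lambda>i. \<integral>\<^sup>+x. ennreal ((F m x - F (r i) x)\<^sup>2) \<partial>lborel)"
      by (rule nn_integral_liminf) auto
    also have "\<dots> \<le> ennreal (e\<^sup>2)"
    proof -
      have "(\<integral>\<^sup>+x. ennreal ((F m x - F (r i) x)\<^sup>2) \<partial>lborel) \<le> ennreal (e\<^sup>2)" if "i \<ge> N" for i
      proof -
        have eq: "(F m x - F (r i) x)\<^sup>2 = indicator {0..M} x *\<^sub>R (f m x - f (r i) x)\<^sup>2" for x
          by (auto simp: F_def indicator_def)
        have "integrable lborel (\<lambda>x. indicator {0..M} x *\<^sub>R (f m x - f (r i) x)\<^sup>2)"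
          using sq_diff[OF f[of m] f[of "r i"]] by (simp add: sq_def set_integrable_def)
        from nn_integral_eq_integral[OF this]
        have "(\<integral>\<^sup>+x. ennreal ((F m x - F (r i) x)\<^sup>2) \<partial>lborel) = ennreal ((L2_norm M (\<lambda>x. f m x - f (r i) x))\<^sup>2)"
          unfolding eq L2_norm_sq set_lebesgue_integral_def by simp
        moreover have "L2_norm M (\<lambda>x. f m x - f (r i) x) < e"
          using N m that seq_suble[OF r(1), of i] by simp
        ultimately show ?thesis
          using power_mono[of "L2_norm M (\<lambda>x. f m x - f (r i) x)" e 2] L2_norm_nonneg[of M]
          by (simp add: ennreal_leI)
      qed
      then have "eventually (\<lambda>i. (\<integral>\<^sup>+x. ennreal ((F m x - F (r i) x)\<^sup>2) \<partial>lborel) \<le> ennreal (e\<^sup>2)) sequentially"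
        by (auto simp: eventually_sequentially)
      then show ?thesis
        by (intro Liminf_le) auto
    qed
    finally show ?thesis .
  qed
  have gs: "set_borel_measurable lborel {0..M} g" by (simp add: set_borel_measurable_def)
  have gF: "sq M (\<lambda>x. f m x - g x) \<and> L2_norm M (\<lambda>x. f m x - g x) \<le> e"
    if N: "\<forall>i\<ge>N. \<forall>j\<ge>N. L2_norm M (\<lambda>x. f i x - f j x) < e" and m: "m \<ge> N" and e: "e > 0" for N m e
  proof -
    have eq: "(F m x - g x)\<^sup>2 = indicator {0..M} x *\<^sub>R (f m x - g x)\<^sup>2" for x
      using g0[of x] by (auto simp: F_def indicator_def)
    have i: "integrable lborel (\<lambda>x. (F m x - g x)\<^sup>2)"
      using key[OF N m] by (intro integrableI_nonneg) (auto intro: le_less_trans)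
    have "set_borel_measurable lborel {0..M} (\<lambda>x. f m x + (-1) * g x)"
      using f[of m] gs by (intro set_measurable_add set_measurable_mult) (auto simp: sq_def set_borel_measurable_def)
    then have s: "sq M (\<lambda>x. f m x - g x)"
      using i by (simp add: sq_def set_integrable_def eq)
    have "ennreal (I M (\<lambda>x. (f m x - g x)\<^sup>2)) \<le> ennreal (e\<^sup>2)"
      using key[OF N m] nn_integral_eq_integral[OF i] by (simp add: eq set_lebesgue_integral_def)
    then have "I M (\<lambda>x. (f m x - g x)\<^sup>2) \<le> e\<^sup>2" by (subst (asm) ennreal_le_iff) auto
    with s e show ?thesis by (auto intro: L2_norm_le)
  qed
  obtain N where "\<forall>i\<ge>N. \<forall>j\<ge>N. L2_norm M (\<lambda>x. f i x - f j x) < 1" using Cauchy[of 1] by auto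
  from gF[OF this order.refl] have "sq M (\<lambda>x. f N x - g x)" by auto
  from sq_diff[OF f[of N] this] have "sq M g" by simp
  moreover have "(\<lambda>m. L2_norm M (\<lambda>x. f m x - g x)) \<longlonglongrightarrow> 0"
  proof (rule LIMSEQ_I)
    fix e :: real assume e: "e > 0"
    obtain N where "\<forall>i\<ge>N. \<forall>j\<ge>N. L2_norm M (\<lambda>x. f i x - f j x) < e/2" using Cauchy[of "e/2"] e by auto
    from gF[OF this] e have le: "\<forall>m\<ge>N. L2_norm M (\<lambda>x. f m x - g x) \<le> e / 2" by auto
    then show "\<exists>N. \<forall>m\<ge>N. norm (L2_norm M (\<lambda>x. f m x - g x) - 0) < e"
    proof (intro exI[of _ N] allI impI)
      fix m assume "m \<ge> N"
      then have "L2_norm M (\<lambda>x. f m x - g x) \<le> e / 2" using le by blast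
      then show "norm (L2_norm M (\<lambda>x. f m x - g x) - 0) < e"
        using e L2_norm_nonneg[of M "\<lambda>x. f m x - g x"] by simp
    qed
  qed
  ultimately show ?thesis by blast
qed

lemma I_tendsto:
  assumes "\<And>m. sq M (f m)" "sq M g" "sq M h" "(\<lambda>m. L2_norm M (\<lambda>x. f m x - g x)) \<longlonglongrightarrow> 0"
  shows "(\<lambda>m. I M (\<lambda>x. f m x * h x)) \<longlonglongrightarrow> I M (\<lambda>x. g x * h x)"
proof -
  have "\<bar>I M (\<lambda>x. f m x * h x) - I M (\<lambda>x. g x * h x)\<bar> \<le> L2_norm M (\<lambda>x. f m x - g x) * L2_norm M h" for m
  proof -
    have "I M (\<lambda>x. f m x * h x) - I M (\<lambda>x. g x * h x) = I M (\<lambda>x. (f m x - g x) * h x)"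
      using sq_mult_integrable[OF assms(1)[of m] assms(3)] sq_mult_integrable[OF assms(2,3)]
      by (simp add: left_diff_distrib)
    then show ?thesis using Cauchy_Schwarz_I[OF sq_diff[OF assms(1)[of m] assms(2)] assms(3)] by simp
  qed
  moreover have "(\<lambda>m. L2_norm M (\<lambda>x. f m x - g x) * L2_norm M h) \<longlonglongrightarrow> 0"
    using tendsto_mult_right[OF assms(4), of "L2_norm M h"] by simp
  ultimately have "(\<lambda>m. I M (\<lambda>x. f m x * h x) - I M (\<lambda>x. g x * h x)) \<longlonglongrightarrow> 0"
    unfolding real_norm_def[symmetric] by (rule Lim_null_comparison[OF always_eventually[OF allI]])
  then show ?thesis by (simp add: LIM_zero_iff)
qed

lemma L2_norm_tendsto:
  assumes "\<And>m. sq M (f m)" "sq M g" "(\<lambda>m. L2_norm M (\<lambda>x. f m x - g x)) \<longlonglongrightarrow> 0"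
  shows "(\<lambda>m. L2_norm M (f m)) \<longlonglongrightarrow> L2_norm M g"
proof -
  have "\<bar>L2_norm M (f m) - L2_norm M g\<bar> \<le> L2_norm M (\<lambda>x. f m x - g x)" for m
    using L2_norm_diff_le[OF assms(1)[of m] assms(2)] L2_norm_diff_le[OF assms(2) assms(1)[of m]]
    by (simp add: L2_norm_diff_commute[of M g "f m"])
  then have "(\<lambda>m. L2_norm M (f m) - L2_norm M g) \<longlonglongrightarrow> 0"
    by (intro Lim_null_comparison[OF _ assms(3)]) auto
  then show ?thesis by (simp add: LIM_zero_iff)
qed

text \<open>Riesz representation on a subspace \<open>V\<close>, by minimising \<open>\<parallel>\<phi>\<parallel>\<^sup>2 - 2 l(\<phi>)\<close>: by the parallelogram
  identity every minimising sequence is Cauchy.\<close>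

lemma Riesz_subspace:
  fixes V :: "(real \<Rightarrow> real) set" and l :: "(real \<Rightarrow> real) \<Rightarrow> real"
  assumes M: "M > 0" and V: "\<And>\<phi>. \<phi> \<in> V \<Longrightarrow> sq M \<phi>" "(\<lambda>x. 0) \<in> V"
    and Vlin: "\<And>\<phi> \<psi> s. \<phi> \<in> V \<Longrightarrow> \<psi> \<in> V \<Longrightarrow> (\<lambda>x. \<phi> x + s * \<psi> x) \<in> V"
    and llin: "\<And>\<phi> \<psi> s. \<phi> \<in> V \<Longrightarrow> \<psi> \<in> V \<Longrightarrow> l (\<lambda>x. \<phi> x + s * \<psi> x) = l \<phi> + s * l \<psi>"
    and bound: "\<And>\<phi>. \<phi> \<in> V \<Longrightarrow> \<bar>l \<phi>\<bar> \<le> C * L2_norm M \<phi>" and C: "C \<ge> 0"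
  shows "\<exists>g \<phi>. sq M g \<and> L2_norm M g \<le> C \<and> (\<forall>\<psi>\<in>V. l \<psi> = I M (\<lambda>x. g x * \<psi> x)) \<and>
     (\<forall>m::nat. \<phi> m \<in> V) \<and> (\<lambda>m. L2_norm M (\<lambda>x. \<phi> m x - g x)) \<longlonglongrightarrow> 0"
proof -
  \<comment> \<open>By Young's inequality this functional is at least -C^2 on V.\<close>
  define J where "J = (\<lambda>\<phi>. I M (\<lambda>x. (\<phi> x)\<^sup>2) - 2 * l \<phi>)"
  have Jlow: "J \<phi> \<ge> - (C\<^sup>2)" if "\<phi> \<in> V" for \<phi>
  proof -
    have "2 * l \<phi> \<le> 2 * C * L2_norm M \<phi>" using bound[OF that] by simp
    also have "\<dots> \<le> C\<^sup>2 + (L2_norm M \<phi>)\<^sup>2" using sum_squares_bound[of C "L2_norm M \<phi>"] by simp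
    finally show ?thesis by (simp add: J_def L2_norm_sq)
  qed
  define j where "j = Inf (J ` V)"
  have bdd: "bdd_below (J ` V)" using Jlow by (intro bdd_belowI[of _ "- (C\<^sup>2)"]) auto
  have jle: "j \<le> J \<phi>" if "\<phi> \<in> V" for \<phi>
    unfolding j_def using bdd that by (intro cInf_lower) auto
  have "\<exists>\<phi>\<in>V. J \<phi> < j + 1 / real (Suc m)" for m
    using cInf_lessD[of "J ` V" "j + 1 / real (Suc m)"] V(2) unfolding j_def by auto
  then obtain \<phi> where \<phi>: "\<And>m. \<phi> m \<in> V" "\<And>m. J (\<phi> m) < j + 1 / real (Suc m)" by metis
  have Jexp: "J (\<lambda>x. \<phi> x + s * \<psi> x) = J \<phi> + 2 * s * (I M (\<lambda>x. \<phi> x * \<psi> x) - l \<psi>) + s\<^sup>2 * I M (\<lambda>x. (\<psi> x)\<^sup>2)"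
    if "\<phi> \<in> V" "\<psi> \<in> V" for \<phi> \<psi> s
    using I_square_lin[OF V(1)[OF that(1)] V(1)[OF that(2)], of s] llin[OF that, of s]
    by (simp add: J_def algebra_simps)
  \<comment> \<open>J is quadratic along the segment from \<phi> k to \<phi> i, and at the midpoint
    it is still at least j. Eliminating the linear term bounds the squared distance by 2 (J (\<phi>
    i) - j) + 2 (J (\<phi> k) - j).\<close>
  have diff: "(L2_norm M (\<lambda>x. \<phi> i x - \<phi> k x))\<^sup>2 \<le> 2 / real (Suc i) + 2 / real (Suc k)" for i k
  proof -
    let ?d = "\<lambda>x. \<phi> i x + (-1) * \<phi> k x"
    have dV: "?d \<in> V" using Vlin[OF \<phi>(1)[of i] \<phi>(1)[of k], of "-1"] .
    have "J (\<lambda>x. \<phi> k x + 1 * ?d x) = J (\<phi> i)" "j \<le> J (\<lambda>x. \<phi> k x + 1/2 * ?d x)"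
      using jle[OF Vlin[OF \<phi>(1)[of k] dV, of "1/2"]] by auto
    then have "J (\<phi> i) = J (\<phi> k) + 2 * (I M (\<lambda>x. \<phi> k x * ?d x) - l ?d) + I M (\<lambda>x. (?d x)\<^sup>2)"
      "j \<le> J (\<phi> k) + (I M (\<lambda>x. \<phi> k x * ?d x) - l ?d) + 1/4 * I M (\<lambda>x. (?d x)\<^sup>2)"
      unfolding Jexp[OF \<phi>(1)[of k] dV] by (auto simp: power2_eq_square)
    moreover have "B \<le> 2 * (a - c) + 2 * (b - c)" if "a = b + 2 * A + B" "c \<le> b + A + 1/4 * B" for a b c A B :: real
      using that by argo
    ultimately have 1: "I M (\<lambda>x. (?d x)\<^sup>2) \<le> 2 * (J (\<phi> i) - j) + 2 * (J (\<phi> k) - j)"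
      by blast
    have "J (\<phi> m) - j \<le> 1 / real (Suc m)" for m using \<phi>(2)[of m] by linarith
    then have "2 * (J (\<phi> m) - j) \<le> 2 * (1 / real (Suc m))" for m by (intro mult_left_mono) auto
    from order_trans[OF 1 add_mono[OF this this]]
    have "I M (\<lambda>x. (?d x)\<^sup>2) \<le> 2 / real (Suc i) + 2 / real (Suc k)" by simp
    then show ?thesis by (simp add: L2_norm_sq)
  qed
  have "\<exists>g. sq M g \<and> (\<lambda>m. L2_norm M (\<lambda>x. \<phi> m x - g x)) \<longlonglongrightarrow> 0"
  proof (rule L2_complete[OF M])
    show "sq M (\<phi> m)" for m by (rule V(1)[OF \<phi>(1)])
    fix e :: real assume e: "e > 0"
    obtain N where N: "4 / real (Suc N) < e\<^sup>2"
      using reals_Archimedean[of "e\<^sup>2 / 4"] e by (auto simp: field_simps)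
    show "\<exists>N. \<forall>i\<ge>N. \<forall>k\<ge>N. L2_norm M (\<lambda>x. \<phi> i x - \<phi> k x) < e"
    proof (intro exI[of _ N] allI impI)
      fix i k assume ik: "i \<ge> N" "k \<ge> N"
      have "2 / real (Suc i) \<le> 2 / real (Suc N)" "2 / real (Suc k) \<le> 2 / real (Suc N)"
        using ik by (auto intro!: divide_left_mono)
      then have "(L2_norm M (\<lambda>x. \<phi> i x - \<phi> k x))\<^sup>2 < e\<^sup>2" using diff[of i k] N by linarith
      then show "L2_norm M (\<lambda>x. \<phi> i x - \<phi> k x) < e" using e by (auto intro: power2_less_imp_less)
    qed
  qed
  then obtain g where g: "sq M g" "(\<lambda>m. L2_norm M (\<lambda>x. \<phi> m x - g x)) \<longlonglongrightarrow> 0" by blast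
  have s\<phi>: "sq M (\<phi> m)" for m by (rule V(1)[OF \<phi>(1)])
  have rep: "l \<psi> = I M (\<lambda>x. g x * \<psi> x)" if \<psi>: "\<psi> \<in> V" for \<psi>
  proof -
    have t: "(\<lambda>m. I M (\<lambda>x. \<phi> m x * \<psi> x)) \<longlonglongrightarrow> I M (\<lambda>x. g x * \<psi> x)"
      by (rule I_tendsto[OF s\<phi> g(1) V(1)[OF \<psi>] g(2)])
    define D where "D = I M (\<lambda>x. g x * \<psi> x) - l \<psi>"
    define P where "P = I M (\<lambda>x. (\<psi> x)\<^sup>2)"
    \<comment> \<open>Each \<phi> m is minimal up to 1/(m+1); in the limit this is nonnegativity of
      a quadratic in s without constant term, which forces the linear coefficient D to
      vanish.\<close>
    have "0 \<le> 2 * s * D + s\<^sup>2 * P" for s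
    proof -
      have "(\<lambda>m. 1 / real (Suc m) + 2 * s * (I M (\<lambda>x. \<phi> m x * \<psi> x) - l \<psi>) + s\<^sup>2 * P) \<longlonglongrightarrow> 0 + 2 * s * D + s\<^sup>2 * P"
        unfolding D_def by (intro tendsto_intros t LIMSEQ_inverse_real_of_nat[unfolded inverse_eq_divide])
      moreover have "0 \<le> 1 / real (Suc m) + 2 * s * (I M (\<lambda>x. \<phi> m x * \<psi> x) - l \<psi>) + s\<^sup>2 * P" for m
        using jle[OF Vlin[OF \<phi>(1)[of m] \<psi>, of s]] \<phi>(2)[of m] Jexp[OF \<phi>(1)[of m] \<psi>, of s]
        unfolding P_def by linarith
      ultimately show ?thesis by (intro LIMSEQ_le_const[where X = "\<lambda>m. 1 / real (Suc m) + 2 * s * (I M (\<lambda>x. \<phi> m x * \<psi> x) - l \<psi>) + s\<^sup>2 * P"]) auto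
    qed
    note q = this
    have "P \<ge> 0" unfolding P_def by (rule I_sq_nonneg)
    have "D = 0"
    proof (rule ccontr)
      assume D: "D \<noteq> 0"
      \<comment> \<open>The step -D r is short enough (r P < 2) for the linear term to dominate the
        quadratic one.\<close>
      define r where "r = 1 / (P + 1)"
      have r: "r > 0" "r * P - 2 < 0" using \<open>P \<ge> 0\<close> by (auto simp: r_def field_simps)
      have "2 * (- D * r) * D + (- D * r)\<^sup>2 * P = (D\<^sup>2 * r) * (r * P - 2)"
        by (simp add: power2_eq_square algebra_simps)
      moreover have "(D\<^sup>2 * r) * (r * P - 2) < 0" using D r by (intro mult_pos_neg) auto
      ultimately show False using q[of "- D * r"] by simp
    qed
    then show ?thesis by (simp add: D_def)
  qed
  \<comment> \<open>Testing the representation with \<phi> m and letting it tend to g bounds the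
    square of the norm of g by C times that norm.\<close>
  have "L2_norm M g \<le> C"
  proof -
    have "(\<lambda>m. I M (\<lambda>x. \<phi> m x * g x)) \<longlonglongrightarrow> I M (\<lambda>x. g x * g x)"
      by (rule I_tendsto[OF s\<phi> g(1) g(1) g(2)])
    moreover have "(\<lambda>m. C * L2_norm M (\<phi> m)) \<longlonglongrightarrow> C * L2_norm M g"
      by (intro tendsto_intros L2_norm_tendsto[OF s\<phi> g(1) g(2)])
    moreover have "I M (\<lambda>x. \<phi> m x * g x) \<le> C * L2_norm M (\<phi> m)" for m
      using rep[OF \<phi>(1)[of m]] bound[OF \<phi>(1)[of m]] by (simp add: mult.commute)
    ultimately have "I M (\<lambda>x. g x * g x) \<le> C * L2_norm M g" by (intro LIMSEQ_le) auto
    moreover have "(L2_norm M g)\<^sup>2 = I M (\<lambda>x. g x * g x)" unfolding L2_norm_sq by (simp only: power2_eq_square)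
    ultimately have "(L2_norm M g)\<^sup>2 \<le> C * L2_norm M g" by simp
    then show ?thesis using L2_norm_nonneg[of M g] C 
      by (cases "L2_norm M g = 0") (auto simp: power2_eq_square)
  qed
  with g rep \<phi>(1) show ?thesis by blast
qed

section \<open>Weak derivatives by duality\<close>

lemma test_fn_sq: "test_fn M \<phi> \<Longrightarrow> sq M \<phi>"
  using Cd_continuous_on[OF test_fn_Cd[of M \<phi> 0], of 0] by (intro sq_continuous) auto

lemma test_fn_deriv_lin:
  assumes "test_fn M \<phi>" "test_fn M \<psi>"
  shows "(deriv ^^ j) (\<lambda>x. \<phi> x + s * \<psi> x) = (\<lambda>x. (deriv ^^ j) \<phi> x + s * (deriv ^^ j) \<psi> x)"
  using funpow_deriv_add[OF test_fn_Cd[OF assms(1), of j] Cd_cmult[OF test_fn_Cd[OF assms(2), of j], of s]]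
   funpow_deriv_cmult[OF test_fn_Cd[OF assms(2), of j], of j s] by simp

lemma test_fn_lin: "test_fn M \<phi> \<Longrightarrow> test_fn M \<psi> \<Longrightarrow> test_fn M (\<lambda>x. \<phi> x + s * \<psi> x)"
  by (intro test_fn_add test_fn_mult test_fn_const)

text \<open>Riesz represents the functional that sends \<phi> to (-1)^j times the integral of f
  times the jth derivative of \<phi>; the representer is the jth weak derivative. Bounds against
  test functions pass to limits and to integrals over time, and this is how the limit of the scheme
  and the time integrals of the source are placed in H^n.\<close>

lemma Hn_derivs_dual:
  assumes M: "M > 0" and f: "L2 M f" "L2_norm M f \<le> C"
    and bound: "\<And>j \<phi>. j \<le> n \<Longrightarrow> test_fn M \<phi> \<Longrightarrow> \<bar>I M (\<lambda>x. f x * (deriv ^^ j) \<phi> x)\<bar> \<le> C * L2_norm M \<phi>"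
  shows "\<exists>D. Hn_derivs M n f D \<and> (\<forall>j\<le>n. L2_norm M (D j) \<le> C)"
proof -
  have sf: "sq M f" using f by (simp add: L2_iff)
  have C: "C \<ge> 0" using f(2) L2_norm_nonneg[of M f] by simp
  have tsq: "test_fn M \<phi> \<Longrightarrow> sq M ((deriv ^^ j) \<phi>)" for \<phi> j by (intro test_fn_sq test_fn_deriv)
  have ex: "\<exists>g. sq M g \<and> L2_norm M g \<le> C \<and> (\<forall>\<phi>. test_fn M \<phi> \<longrightarrow> (-1)^j * I M (\<lambda>x. f x * (deriv ^^ j) \<phi> x) = I M (\<lambda>x. g x * \<phi> x))"
    if j: "j \<le> n" for j
  proof -
    have "\<exists>g \<phi>. sq M g \<and> L2_norm M g \<le> C \<and> (\<forall>\<psi>\<in>{\<phi>. test_fn M \<phi>}. (-1)^j * I M (\<lambda>x. f x * (deriv ^^ j) \<psi> x) = I M (\<lambda>x. g x * \<psi> x)) \<and>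
     (\<forall>m::nat. \<phi> m \<in> {\<phi>. test_fn M \<phi>}) \<and> (\<lambda>m. L2_norm M (\<lambda>x. \<phi> m x - g x)) \<longlonglongrightarrow> 0"
    proof (rule Riesz_subspace[OF M])
      fix \<phi> \<psi> :: "real \<Rightarrow> real" and s :: real
      assume "\<phi> \<in> {\<phi>. test_fn M \<phi>}" "\<psi> \<in> {\<phi>. test_fn M \<phi>}"
      then have t: "test_fn M \<phi>" "test_fn M \<psi>" by auto
      show "(\<lambda>x. \<phi> x + s * \<psi> x) \<in> {\<phi>. test_fn M \<phi>}" using t by (auto intro: test_fn_lin)
      have i: "set_integrable lborel {0..M} (\<lambda>x. f x * (deriv ^^ j) \<phi> x)" "set_integrable lborel {0..M} (\<lambda>x. f x * (deriv ^^ j) \<psi> x)"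
        using t by (auto intro!: sq_mult_integrable sf tsq)
      have "(\<lambda>x. f x * (deriv ^^ j) (\<lambda>x. \<phi> x + s * \<psi> x) x) = (\<lambda>x. f x * (deriv ^^ j) \<phi> x + s * (f x * (deriv ^^ j) \<psi> x))"
        by (simp add: test_fn_deriv_lin[OF t] algebra_simps)
      then show "(-1)^j * I M (\<lambda>x. f x * (deriv ^^ j) (\<lambda>x. \<phi> x + s * \<psi> x) x) = 
         (-1)^j * I M (\<lambda>x. f x * (deriv ^^ j) \<phi> x) + s * ((-1)^j * I M (\<lambda>x. f x * (deriv ^^ j) \<psi> x))"
        using i by (simp add: algebra_simps)
    qed (use C bound[OF j] in \<open>auto simp: test_fn_sq test_fn_const abs_mult power_abs\<close>)
    then show ?thesis by blast
  qed
  \<comment> \<open>\<open>Hn_derivs\<close> asks for \<open>D 0 = f\<close> literally, so order 0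
    is f itself and not a representative; the other orders are periodised in order to lie in
    \<open>L2\<close>.\<close>
  define G where "G = (\<lambda>j. if j = 0 then f else per M (SOME g. sq M g \<and> L2_norm M g \<le> C \<and> (\<forall>\<phi>. test_fn M \<phi> \<longrightarrow> (-1)^j * I M (\<lambda>x. f x * (deriv ^^ j) \<phi> x) = I M (\<lambda>x. g x * \<phi> x))))"
  have G: "L2 M (G j) \<and> L2_norm M (G j) \<le> C \<and> (\<forall>\<phi>. test_fn M \<phi> \<longrightarrow> (-1)^j * I M (\<lambda>x. f x * (deriv ^^ j) \<phi> x) = I M (\<lambda>x. G j x * \<phi> x))"
    if j: "j \<le> n" for j
  proof (cases "j = 0")
    case True
    then show ?thesis using f by (simp add: G_def)
  next
    case False
    define g where "g = (SOME g. sq M g \<and> L2_norm M g \<le> C \<and> (\<forall>\<phi>. test_fn M \<phi> \<longrightarrow> (-1)^j * I M (\<lambda>x. f x * (deriv ^^ j) \<phi> x) = I M (\<lambda>x. g x * \<phi> x)))"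
    have "sq M g \<and> L2_norm M g \<le> C \<and> (\<forall>\<phi>. test_fn M \<phi> \<longrightarrow> (-1)^j * I M (\<lambda>x. f x * (deriv ^^ j) \<phi> x) = I M (\<lambda>x. g x * \<phi> x))"
      unfolding g_def by (rule someI_ex[OF ex[OF j]])
    then have g: "sq M g" "L2_norm M g \<le> C" "\<And>\<phi>. test_fn M \<phi> \<Longrightarrow> (-1)^j * I M (\<lambda>x. f x * (deriv ^^ j) \<phi> x) = I M (\<lambda>x. g x * \<phi> x)"
      by blast+
    have p: "L2 M (per M g)" using L2_per[OF M g(1)] .
    have "L2_norm M (per M g) = L2_norm M g"
      using p g(1) M by (intro L2_norm_cong_AE AE_per) (auto simp: L2_iff)
    moreover have "I M (\<lambda>x. per M g x * \<phi> x) = I M (\<lambda>x. g x * \<phi> x)" if "test_fn M \<phi>" for \<phi>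
    proof (rule I_cong_AE)
      show "AE x in lborel. x \<in> {0..M} \<longrightarrow> per M g x * \<phi> x = g x * \<phi> x"
        using AE_per[OF M, of g] by eventually_elim auto
    qed (use p g test_fn_sq[OF that] in \<open>auto simp: L2_iff sq_def intro: set_measurable_mult\<close>)
    moreover have "G j = per M g" using False by (simp add: G_def g_def)
    ultimately show ?thesis using g p by simp
  qed
  have "Hn_derivs M n f G"
    unfolding Hn_derivs_def
  proof (intro conjI allI impI)
    show "G 0 = f" by (simp add: G_def)
    fix k assume k: "k < n"
    show "weak_deriv M (G k) (G (Suc k))"
      unfolding weak_deriv_def
    proof (intro conjI allI impI)
      fix \<phi> assume t: "test_fn M \<phi>"
      have "I M (\<lambda>x. G k x * deriv \<phi> x) = (-1)^k * I M (\<lambda>x. f x * (deriv ^^ Suc k) \<phi> x)"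
        using G[of k] k test_fn_deriv[OF t, of 1] by (simp add: funpow_deriv_Suc del: funpow.simps(2))
      also have "\<dots> = - I M (\<lambda>x. G (Suc k) x * \<phi> x)"
      proof -
        have "(-1) ^ Suc k * I M (\<lambda>x. f x * (deriv ^^ Suc k) \<phi> x) = I M (\<lambda>x. G (Suc k) x * \<phi> x)"
          using G[OF Suc_leI[OF k]] t by blast
        moreover have "(-1) ^ Suc k * z = - ((-1) ^ k * z)" for z :: real by simp
        ultimately show ?thesis by (metis minus_minus)
      qed
      finally show "I M (\<lambda>x. G k x * deriv \<phi> x) = - I M (\<lambda>x. G (Suc k) x * \<phi> x)" .
    qed (use G k in auto)
  qed (use f in simp)
  with G show ?thesis by blast
qed

section \<open>Weak derivatives\<close>

abbreviation prim :: "(real \<Rightarrow> real) \<Rightarrow> real \<Rightarrow> real" where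
  "prim g x \<equiv> (LINT y:{0..x}|lborel. g y)"

lemma continuous_on_Icc_bounded:
  fixes f :: "real \<Rightarrow> real"
  assumes "continuous_on {a..b} f"
  obtains B where "\<And>x. x \<in> {a..b} \<Longrightarrow> \<bar>f x\<bar> \<le> B"
  using compact_imp_bounded[OF compact_continuous_image[OF assms compact_Icc]]
  unfolding bounded_iff by (metis real_norm_def image_eqI)

lemma integral_eq_FTC:
  fixes F :: "real \<Rightarrow> real"
  assumes "a \<le> b" "\<And>x. x \<in> {a..b} \<Longrightarrow> (F has_real_derivative f x) (at x within {a..b})" 
    "continuous_on {a..b} f"
  shows "(LINT x:{a..b}|lborel. f x) = F b - F a"
  using integral_FTC_atLeastAtMost[of a b F f] assms
  by (simp add: set_lebesgue_integral_def has_real_derivative_iff_has_vector_derivative)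

lemma prim_diff:
  assumes "set_integrable lborel {0..M} g" "0 \<le> x" "x \<le> y" "y \<le> M"
  shows "prim g y - prim g x = (LINT z:{x..y}|lborel. g z)" "set_integrable lborel {x..y} g"
proof -
  have i: "set_integrable lborel {0..x} g" "set_integrable lborel {x..y} g"
    using assms by (auto intro: set_integrable_subset)
  have e: "{0..y} = {0..x} \<union> {x..y}" using assms by auto
  have "AE z in lborel. \<not> (z \<in> {0..x} \<and> z \<in> {x..y})"
    using AE_lborel_neq[of x] by eventually_elim auto
  then show "prim g y - prim g x = (LINT z:{x..y}|lborel. g z)"
    unfolding e by (subst set_integral_Un_AE) (use i in auto)
  show "set_integrable lborel {x..y} g" by (rule i)
qed

text \<open>g is merely integrable, so its primitive need not obey the product rule pointwise.
  Instead one double integral over the triangle y \<le> x is evaluated in both orders.\<close>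

lemma primitive_by_parts:
  assumes M: "M > 0" and g: "set_integrable lborel {0..M} g"
    and d: "\<And>x. (\<phi> has_real_derivative \<phi>' x) (at x)" and c: "continuous_on UNIV \<phi>'"
  shows "I M (\<lambda>x. prim g x * \<phi>' x) = prim g M * \<phi> M - I M (\<lambda>x. g x * \<phi> x)"
proof -
  define gg where "gg = (\<lambda>y. indicator {0..M} y * g y)"
  define pp where "pp = (\<lambda>x. indicator {0..M} x * \<phi>' x)"
  have gi: "integrable lborel gg" using g by (simp add: gg_def set_integrable_def)
  have gm [measurable]: "gg \<in> borel_measurable borel" using borel_measurable_integrable[OF gi] by simp
  have pi: "integrable lborel pp" using borel_integrable_atLeastAtMost'[of 0 M \<phi>'] c 
    by (simp add: pp_def set_integrable_def continuous_on_subset)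
  have pm [measurable]: "pp \<in> borel_measurable borel" using borel_measurable_integrable[OF pi] by simp
  have P: "integrable (lborel \<Otimes>\<^sub>M lborel) (\<lambda>(x, y). pp x * gg y)"
  proof (rule lborel_pair.Fubini_integrable)
    show "(\<lambda>(x, y). pp x * gg y) \<in> borel_measurable (lborel \<Otimes>\<^sub>M lborel)" by measurable
    show "integrable lborel (\<lambda>x. LINT y|lborel. norm (case (x, y) of (x, y) \<Rightarrow> pp x * gg y))"
      using pi by (simp add: abs_mult)
    show "AE x in lborel. integrable lborel (\<lambda>y. case (x, y) of (x, y) \<Rightarrow> pp x * gg y)"
      using gi by simp
  qed
  have H: "integrable (lborel \<Otimes>\<^sub>M lborel) (\<lambda>(x, y). pp x * gg y * (if y \<le> x then 1 else 0))"
  proof (rule Bochner_Integration.integrable_bound[OF P])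
    show "(\<lambda>(x, y). pp x * gg y * (if y \<le> x then 1 else 0)) \<in> borel_measurable (lborel \<Otimes>\<^sub>M lborel)"
      by measurable
  qed auto
  have "(LINT x|lborel. LINT y|lborel. pp x * gg y * (if y \<le> x then 1 else 0)) = I M (\<lambda>x. prim g x * \<phi>' x)"
    unfolding set_lebesgue_integral_def
  proof (intro Bochner_Integration.integral_cong refl)
    fix x
    have "(LINT y|lborel. pp x * gg y * (if y \<le> x then 1 else 0)) = pp x * (LINT y|lborel. gg y * (if y \<le> x then 1 else 0))"
      by (simp add: mult.assoc)
    also have "\<dots> = indicator {0..M} x *\<^sub>R ((LINT y|lborel. indicator {0..x} y *\<^sub>R g y) * \<phi>' x)"
    proof (cases "x \<in> {0..M}")
      case True
      have "(LINT y|lborel. gg y * (if y \<le> x then 1 else 0)) = (LINT y|lborel. indicator {0..x} y *\<^sub>R g y)"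
        using True by (intro Bochner_Integration.integral_cong) (auto simp: gg_def indicator_def)
      then show ?thesis using True by (simp add: pp_def)
    qed (simp add: pp_def)
    finally show "(LINT y|lborel. pp x * gg y * (if y \<le> x then 1 else 0)) =
      indicator {0..M} x *\<^sub>R ((LINT y|lborel. indicator {0..x} y *\<^sub>R g y) * \<phi>' x)" .
  qed
  moreover have "(LINT y|lborel. LINT x|lborel. pp x * gg y * (if y \<le> x then 1 else 0)) = I M (\<lambda>y. g y * (\<phi> M - \<phi> y))"
    unfolding set_lebesgue_integral_def
  proof (intro Bochner_Integration.integral_cong refl)
    fix y
    show "(LINT x|lborel. pp x * gg y * (if y \<le> x then 1 else 0)) = indicator {0..M} y *\<^sub>R (g y * (\<phi> M - \<phi> y))"
    proof (cases "y \<in> {0..M}")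
      case True
      have "(LINT x|lborel. pp x * gg y * (if y \<le> x then 1 else 0)) = (LINT x|lborel. g y * (indicator {y..M} x * \<phi>' x))"
        using True by (intro Bochner_Integration.integral_cong) (auto simp: pp_def gg_def indicator_def)
      also have "\<dots> = g y * (LINT x:{y..M}|lborel. \<phi>' x)"
        by (simp add: set_lebesgue_integral_def)
      also have "(LINT x:{y..M}|lborel. \<phi>' x) = \<phi> M - \<phi> y"
        using True d c by (intro integral_eq_FTC) (auto intro: has_field_derivative_at_within continuous_on_subset)
      finally show ?thesis using True by simp
    qed (simp add: gg_def)
  qed
  moreover have "(LINT y|lborel. LINT x|lborel. pp x * gg y * (if y \<le> x then 1 else 0)) =
       (LINT x|lborel. LINT y|lborel. pp x * gg y * (if y \<le> x then 1 else 0))"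
    using lborel_pair.Fubini_integral[OF H] by simp
  moreover have "I M (\<lambda>y. g y * (\<phi> M - \<phi> y)) = prim g M * \<phi> M - I M (\<lambda>x. g x * \<phi> x)"
  proof -
    have "continuous_on {0..M} \<phi>" by (rule DERIV_continuous_on[OF has_field_derivative_at_within[OF d]])
    then obtain B where B: "\<And>x. x \<in> {0..M} \<Longrightarrow> \<bar>\<phi> x\<bar> \<le> B"
      using continuous_on_Icc_bounded by blast
    have "set_integrable lborel {0..M} (\<lambda>x. g x * \<phi> x)"
    proof (rule set_integrable_boundedI)
      show "set_integrable lborel {0..M} (\<lambda>x. B * \<bar>g x\<bar>)" using g by (intro set_integrable_mult_right set_integrable_abs) auto
      show "set_borel_measurable lborel {0..M} (\<lambda>x. g x * \<phi> x)"
        using g sq_continuous[OF \<open>continuous_on {0..M} \<phi>\<close>]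
        by (intro set_measurable_mult) (auto simp: sq_def set_integrable_def set_borel_measurable_def)
      show "\<bar>g x * \<phi> x\<bar> \<le> B * \<bar>g x\<bar>" if "x \<in> {0..M}" for x
        using B[OF that] by (simp add: abs_mult mult.commute mult_right_mono)
    qed
    then show ?thesis using g by (simp add: right_diff_distrib)
  qed
  ultimately show ?thesis by simp
qed

lemma antiderivative_exists:
  fixes f :: "real \<Rightarrow> 'a::euclidean_space"
  assumes "continuous_on UNIV f"
  shows "\<exists>F. F 0 = 0 \<and> (\<forall>x. (F has_vector_derivative f x) (at x))"
proof -
  have "\<exists>F. \<forall>x. - \<infinity> < ereal x \<longrightarrow> ereal x < \<infinity> \<longrightarrow> (F has_vector_derivative f x) (at x)"
    using assms by (intro einterval_antiderivative) (auto simp: continuous_on_eq_continuous_at)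
  then obtain F where F: "\<And>x. (F has_vector_derivative f x) (at x)" by auto
  have "((\<lambda>x. F x - F 0) has_vector_derivative f x) (at x)" for x
    using has_vector_derivative_diff[OF F has_vector_derivative_const[of "F 0"], of x] by simp
  then show ?thesis by (intro exI[of _ "\<lambda>x. F x - F 0"]) auto
qed

text \<open>The vanishing mean is what makes the primitive periodic: F (x + M) - F x has zero
  derivative, and its value at x = 0 is \<open>I M \<psi>\<close>.\<close>

lemma test_fn_primitive:
  assumes M: "M > 0" and \<psi>: "test_fn M \<psi>" and 0: "I M \<psi> = 0"
  obtains F where "test_fn M F" "F 0 = 0" "deriv F = \<psi>" "\<And>x. (F has_real_derivative \<psi> x) (at x)"
    "\<And>x. x \<ge> 0 \<Longrightarrow> F x = prim \<psi> x"
proof -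
  have c: "continuous_on UNIV \<psi>" using test_fn_Cd[OF \<psi>, of 0] by (simp add: Cd_0)
  obtain F where F: "F 0 = 0" "\<And>x. (F has_real_derivative \<psi> x) (at x)"
    using antiderivative_exists[OF c] by (auto simp: has_real_derivative_iff_has_vector_derivative)
  have FM: "F x = prim \<psi> x" if "x \<ge> 0" for x
    using integral_eq_FTC[of 0 x F \<psi>, OF that has_field_derivative_at_within[OF F(2)] continuous_on_subset[OF c]] F(1) by simp
  have "periodic M F"
    unfolding periodic_def
  proof
    fix x
    have "((\<lambda>x. F (x + M) - F x) has_real_derivative 0) (at x)" for x
    proof -
      have "((\<lambda>x. F (x + M)) has_real_derivative \<psi> (x + M)) (at x)"
        using F(2)[of "x + M"] DERIV_shift[of F "\<psi> (x + M)" x M] by simp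
      moreover have "\<psi> (x + M) = \<psi> x" using test_fn_periodic[OF \<psi>] by (simp add: periodic_def)
      ultimately show ?thesis using DERIV_diff[of "\<lambda>x. F (x + M)" "\<psi> x" x UNIV F "\<psi> x"] F(2) by simp
    qed
    from DERIV_isconst_all[OF allI, OF this, of x 0] show "F (x + M) = F x"
      using FM[of M] M 0 F(1) by simp
  qed
  moreover have "Cd k F" for k
    using Cd_SucI[OF F(2) test_fn_Cd[OF \<psi>, of k]] Cd_mono by fastforce
  moreover have "deriv F = \<psi>" using F(2) by (auto intro: DERIV_imp_deriv)
  ultimately show ?thesis using F FM that[of F] by (auto simp: test_fn_iff Ck_iff)
qed

text \<open>Differentiation scales and shifts the phase by pi/2, so the induction over k closes when
  it runs over all phases.\<close>

lemma test_fn_cos: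
  assumes "M > 0" shows "test_fn M (\<lambda>x. cos (2 * pi / M * x + \<theta>))"
proof -
  have "Cd k (\<lambda>x. cos (w * x + \<theta>))" for k w \<theta>
  proof (induction k arbitrary: \<theta>)
    case 0 then show ?case by (auto simp: Cd_0 intro!: continuous_intros)
  next
    case (Suc k)
    have "((\<lambda>x. cos (w * x + \<theta>)) has_real_derivative w * cos (w * x + (\<theta> + pi/2))) (at x)" for x
      by (rule derivative_eq_intros refl)+ (simp add: cos_add[of "w * x + \<theta>" "pi/2", unfolded add.assoc])
    then show ?case by (rule Cd_SucI) (intro Cd_cmult Suc.IH)
  qed
  moreover have "periodic M (\<lambda>x. cos (2 * pi / M * x + \<theta>))"
    unfolding periodic_def
  proof
    fix x
    have "2 * pi / M * (x + M) + \<theta> = (2 * pi / M * x + \<theta>) + 2 * pi" using assms by (simp add: field_simps)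
    then show "cos (2 * pi / M * (x + M) + \<theta>) = cos (2 * pi / M * x + \<theta>)" by (simp only: cos_periodic)
  qed
  ultimately show ?thesis unfolding test_fn_iff Ck_iff by blast
qed

text \<open>The powers of \<open>1 + cos (2\<pi>(x - y)/M) - cos (2\<pi>\<delta>/M)\<close> concentrate at \<open>y\<close>.\<close>

lemma orthogonal_tests_pos:
  assumes M: "M > 0" and c: "continuous_on {0..M} G" and y: "0 < y" "y < M"
    and 0: "\<And>\<psi>. test_fn M \<psi> \<Longrightarrow> I M (\<lambda>x. G x * \<psi> x) = 0"
  shows "G y \<le> 0"
proof (rule ccontr)
  assume "\<not> G y \<le> 0"
  then have Gy: "G y > 0" by simp
  have "isCont G y" using continuous_on_interior[OF c, of y] y by auto
  then obtain d where d: "d > 0" "\<And>x. \<bar>x - y\<bar> < d \<Longrightarrow> \<bar>G x - G y\<bar> < G y / 2"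
    using Gy unfolding continuous_at_eps_delta dist_real_def by (meson half_gt_zero)
  \<comment> \<open>Keeps the bump inside (0, M) and inside the neighbourhood where G exceeds half
    of G y; M/4 keeps the angle w \<delta> below pi, where cos decreases.\<close>
  define \<delta> where "\<delta> = Min {d / 2, y, M - y, M / 4}"
  have \<delta>: "\<delta> > 0" "\<delta> < d" "\<delta> \<le> y" "\<delta> \<le> M - y" "\<delta> \<le> M / 4"
    using d(1) y M by (auto simp: \<delta>_def min_def)
  obtain B where B: "\<And>x. x \<in> {0..M} \<Longrightarrow> \<bar>G x\<bar> \<le> B"
    using continuous_on_Icc_bounded[OF c] by blast
  define w where "w = 2 * pi / M"
  have w: "w > 0" using M by (simp add: w_def)
  have w\<delta>: "w * \<delta> > 0" "w * \<delta> < pi"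
  proof -
    show "w * \<delta> > 0" using w \<delta> by simp
    have "w * \<delta> \<le> w * (M / 4)" using w \<delta> by (intro mult_left_mono) auto
    also have "\<dots> < pi" using M by (simp add: w_def)
    finally show "w * \<delta> < pi" .
  qed
  define p where "p = (\<lambda>x. cos (w * x + (- w * y)) + (1 - cos (w * \<delta>)))"
  define \<eta> where "\<eta> = cos (w * (\<delta> / 2)) - cos (w * \<delta>)"
  have \<eta>: "\<eta> > 0" using cos_monotone_0_pi[of "w * (\<delta> / 2)" "w * \<delta>"] w\<delta> w \<delta>(1) 
    unfolding \<eta>_def by (simp add: mult.commute)
  have pt: "test_fn M p" unfolding p_def w_def by (intro test_fn_add test_fn_cos test_fn_const M)
  have p_abs: "p x = cos (w * \<bar>x - y\<bar>) + 1 - cos (w * \<delta>)" for x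
  proof -
    have "cos (w * x + (- w * y)) = cos (w * (x - y))" by (simp add: algebra_simps)
    also have "\<dots> = cos (w * \<bar>x - y\<bar>)" by (metis abs_if cos_minus mult_minus_right)
    finally show ?thesis by (simp add: p_def)
  qed
  have in_small: "p x \<ge> 1 + \<eta>" if "\<bar>x - y\<bar> \<le> \<delta> / 2" for x
  proof -
    have "cos (w * (\<delta> / 2)) \<le> cos (w * \<bar>x - y\<bar>)"
      using that w w\<delta> by (intro cos_monotone_0_pi_le) (auto intro!: mult_left_mono)
    then show ?thesis by (simp add: p_abs \<eta>_def)
  qed
  have in_mid: "p x \<ge> 1" if "\<bar>x - y\<bar> \<le> \<delta>" for x
  proof -
    have "cos (w * \<delta>) \<le> cos (w * \<bar>x - y\<bar>)"
      using that w w\<delta> by (intro cos_monotone_0_pi_le) (auto intro!: mult_left_mono)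
    then show ?thesis by (simp add: p_abs)
  qed
  \<comment> \<open>Past half a period the cosine is reflected, cos t = cos (2 pi - t). As the
    distance is at most M - \<delta>, the reflected angle stays above w \<delta>.\<close>
  have out: "\<bar>p x\<bar> \<le> 1" if "\<bar>x - y\<bar> \<ge> \<delta>" "x \<in> {0..M}" for x
  proof -
    have le: "\<bar>x - y\<bar> \<le> M - \<delta>" using that \<delta> by auto
    have "cos (w * \<bar>x - y\<bar>) \<le> cos (w * \<delta>)"
    proof (cases "w * \<bar>x - y\<bar> \<le> pi")
      case True then show ?thesis using that w w\<delta> by (intro cos_monotone_0_pi_le) (auto intro!: mult_left_mono)
    next
      case False
      have e: "cos (w * \<bar>x - y\<bar>) = cos (2 * pi - w * \<bar>x - y\<bar>)" by (simp add: cos_diff)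
      have "w * \<delta> \<le> w * (M - \<bar>x - y\<bar>)" using le w by (intro mult_left_mono) auto
      also have "\<dots> = 2 * pi - w * \<bar>x - y\<bar>" using M by (simp add: w_def field_simps)
      finally show ?thesis unfolding e using False w\<delta> by (intro cos_monotone_0_pi_le) auto
    qed
    then show ?thesis using cos_ge_minus_one[of "w * \<bar>x - y\<bar>"] cos_le_one[of "w * \<delta>"] 
      unfolding p_abs abs_le_iff by linarith
  qed
  \<comment> \<open>On the core p is at least 1 + \<eta>, on the rest of the \<delta>-neighbourhood
    the product is nonnegative, and outside |p| is at most 1: the gain grows geometrically in m
    while the loss stays below B.\<close>
  have low: "(1 + \<eta>) ^ m * (G y / 2) * indicator {y - \<delta>/2..y + \<delta>/2} x - B \<le> G x * p x ^ m" if x: "x \<in> {0..M}" for m x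
  proof (cases "\<bar>x - y\<bar> < \<delta>")
    case True
    then have "\<bar>G x - G y\<bar> < G y / 2" using d(2)[of x] \<delta>(2) by auto
    then have Gx: "G x \<ge> G y / 2" unfolding abs_diff_less_iff by auto
    have B0: "B \<ge> 0" using B[OF x] by simp
    have p1: "p x ^ m \<ge> 0" using in_mid[of x] True by simp
    show ?thesis
    proof (cases "\<bar>x - y\<bar> \<le> \<delta> / 2")
      case True
      have "(1 + \<eta>) ^ m \<le> p x ^ m" using in_small[OF True] \<eta> by (intro power_mono) auto
      then have "(1 + \<eta>) ^ m * (G y / 2) \<le> p x ^ m * G x" using Gx Gy p1 by (intro mult_mono) auto
      moreover have "x \<in> {y - \<delta>/2..y + \<delta>/2}" using True unfolding abs_diff_le_iff by auto
      ultimately show ?thesis using B0 by (simp add: mult.commute)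
    next
      case False
      then have "indicator {y - \<delta>/2..y + \<delta>/2} x = (0::real)" unfolding abs_diff_le_iff by (auto simp: indicator_def)
      moreover have "0 \<le> G x * p x ^ m" using Gx Gy p1 by simp
      ultimately show ?thesis using B0 by simp
    qed
  next
    case False
    then have "\<bar>p x ^ m\<bar> \<le> 1" using out[OF _ x] by (simp add: power_abs power_le_one)
    then have "\<bar>G x * p x ^ m\<bar> \<le> B * 1" using B[OF x] unfolding abs_mult by (intro mult_mono) auto
    moreover have "indicator {y - \<delta>/2..y + \<delta>/2} x = (0::real)" using False \<delta>(1) unfolding abs_diff_less_iff by (auto simp: indicator_def)
    ultimately show ?thesis by simp
  qed
  have "(1 + \<eta>) ^ m * (G y / 2 * \<delta>) \<le> B * M" for m
  proof -
    have ind: "set_integrable lborel {0..M} (\<lambda>x. indicator {y - \<delta>/2..y + \<delta>/2} x :: real)"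
    proof -
      have "(\<lambda>x. indicator {0..M} x *\<^sub>R indicator {y - \<delta>/2..y + \<delta>/2} x :: real) = indicator ({0..M} \<inter> {y - \<delta>/2..y + \<delta>/2})"
        by (auto simp: indicator_def)
      moreover have "integrable lborel (indicator ({0..M} \<inter> {y - \<delta>/2..y + \<delta>/2}) :: real \<Rightarrow> real)"
        unfolding Int_atLeastAtMost by (rule integrable_real_indicator) (auto simp: emeasure_lborel_Icc_eq)
      ultimately show ?thesis unfolding set_integrable_def by simp
    qed
    have Iind: "I M (\<lambda>x. indicator {y - \<delta>/2..y + \<delta>/2} x) = \<delta>"
    proof -
      have "(\<lambda>x. indicator {0..M} x *\<^sub>R indicator {y - \<delta>/2..y + \<delta>/2} x :: real) = indicator {y - \<delta>/2..y + \<delta>/2}"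
        using \<delta> y by (auto simp: indicator_def)
      then show ?thesis using \<delta>(1) by (simp add: set_lebesgue_integral_def)
    qed
    have cM: "set_integrable lborel {0..M} (\<lambda>x. B)" "I M (\<lambda>x. B) = B * M"
      using M by (auto simp: set_lebesgue_integral_def set_integrable_def)
    have "I M (\<lambda>x. (1 + \<eta>) ^ m * (G y / 2) * indicator {y - \<delta>/2..y + \<delta>/2} x - B) \<le> I M (\<lambda>x. G x * p x ^ m)"
      using low ind cM(1) sq_mult_integrable[OF sq_continuous[OF c] test_fn_sq[OF test_fn_power[OF pt, of m]]]
      by (intro I_mono) auto
    also have "\<dots> = 0" by (intro 0 test_fn_power pt)
    finally show ?thesis using ind cM Iind by (simp add: mult.assoc)
  qed
  moreover obtain m where "B * M / (G y / 2 * \<delta>) < (1 + \<eta>) ^ m"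
    using real_arch_pow[of "1 + \<eta>"] \<eta> by auto
  ultimately show False using Gy \<delta>(1) by (simp add: field_simps) (smt (verit))
qed

text \<open>The concentration argument, for G and for -G, works at interior points; continuity
  reaches the two ends.\<close>

lemma orthogonal_tests_continuous:
  assumes M: "M > 0" and c: "continuous_on {0..M} G" 
    and 0: "\<And>\<psi>. test_fn M \<psi> \<Longrightarrow> I M (\<lambda>x. G x * \<psi> x) = 0"
    and x: "x \<in> {0..M}"
  shows "G x = 0"
proof -
  have z: "G y = 0" if "y \<in> {0<..<M}" for y
  proof -
    have "G y \<le> 0" using orthogonal_tests_pos[OF M c _ _ 0] that by auto
    moreover have "- G y \<le> 0"
      using orthogonal_tests_pos[of M "\<lambda>x. - G x" y] M c that 0 continuous_on_minus[OF c] 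
      by (auto simp: set_lebesgue_integral_def)
    ultimately show ?thesis by simp
  qed
  have "closure {0<..<M} = {0..M}" using M by (simp add: closure_greaterThanLessThan)
  then show ?thesis
    using continuous_constant_on_closure[of "{0<..<M}" G 0 x] c z x by simp
qed

section \<open>Primitives and the fundamental lemma of the calculus of variations\<close>

lemma prim_0: "prim g 0 = 0"
proof -
  have "AE x in lborel. indicator {0..0} x *\<^sub>R g x = 0"
    using AE_lborel_neq[of 0] by eventually_elim (simp add: indicator_def)
  then show ?thesis unfolding set_lebesgue_integral_def by (rule integral_eq_zero_AE)
qed

lemma integrable_indicator_Icc: "integrable lborel (indicator {a..b} :: real \<Rightarrow> real)"
  by (rule integrable_real_indicator) (auto simp: emeasure_lborel_Icc_eq)

lemma prim_L2_bound:
  assumes M: "M > 0" and g: "sq M g" and x: "0 \<le> x" "x \<le> y" "y \<le> M"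
  shows "\<bar>prim g y - prim g x\<bar> \<le> sqrt (y - x) * L2_norm M g"
proof -
  let ?i = "\<lambda>z. indicator {x..y} z :: real"
  have e: "indicator {0..M} z *\<^sub>R ?i z = ?i z" "indicator {0..M} z *\<^sub>R (?i z)\<^sup>2 = ?i z" for z
    using x by (auto simp: indicator_def)
  have s: "sq M ?i" unfolding sq_def set_borel_measurable_def set_integrable_def e
    by (simp add: integrable_indicator_Icc)
  have n: "L2_norm M ?i = sqrt (y - x)" unfolding L2_norm_def set_lebesgue_integral_def e using x by simp
  have "(LINT z:{x..y}|lborel. g z) = I M (\<lambda>z. ?i z * g z)"
    unfolding set_lebesgue_integral_def
    using x by (intro Bochner_Integration.integral_cong) (auto simp: indicator_def)
  then have "prim g y - prim g x = I M (\<lambda>z. ?i z * g z)"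
    using prim_diff(1)[OF sq_integrable[OF g] x] by simp
  then show ?thesis using Cauchy_Schwarz_I[OF s g] n by simp
qed

lemma prim_continuous:
  assumes M: "M > 0" and g: "sq M g"
  shows "continuous_on {0..M} (prim g)"
proof (cases "L2_norm M g = 0")
  case True
  have "prim g y = prim g 0" if "y \<in> {0..M}" for y
    using prim_L2_bound[OF M g, of 0 y] that True by simp
  then show ?thesis using continuous_on_cong[of "{0..M}" "{0..M}" "prim g" "\<lambda>x. prim g 0"] by simp
next
  case False
  then have L: "L2_norm M g > 0" using L2_norm_nonneg[of M g] by simp
  show ?thesis
    unfolding continuous_on_iff
  proof (intro ballI allI impI)
    fix x e :: real assume x: "x \<in> {0..M}" and e: "e > 0"
    have "dist (prim g y) (prim g x) < e" if y: "y \<in> {0..M}" "dist y x < (e / L2_norm M g)\<^sup>2" for y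
    proof -
      have "\<bar>prim g y - prim g x\<bar> \<le> sqrt \<bar>y - x\<bar> * L2_norm M g"
        using prim_L2_bound[OF M g, of x y] prim_L2_bound[OF M g, of y x] x y(1)
        by (cases "x \<le> y") (auto simp: abs_minus_commute)
      also have "sqrt \<bar>y - x\<bar> < e / L2_norm M g"
        using y(2) e L by (intro real_less_lsqrt) (auto simp: dist_real_def)
      then have "sqrt \<bar>y - x\<bar> * L2_norm M g < e" using L by (simp add: field_simps)
      finally show ?thesis by (simp add: dist_real_def)
    qed
    then show "\<exists>d>0. \<forall>y\<in>{0..M}. dist y x < d \<longrightarrow> dist (prim g y) (prim g x) < e"
      using e L by (intro exI[of _ "(e / L2_norm M g)\<^sup>2"]) auto
  qed
qed

text \<open>A vanishing primitive gives the positive and the negative part the same integral over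
  every half line. These generate the Borel sets, so the two measures with these densities agree,
  and so do the densities almost everywhere.\<close>

lemma zero_prim_imp_AE_zero:
  assumes M: "M > 0" and g: "sq M g" and 0: "\<And>x. x \<in> {0..M} \<Longrightarrow> prim g x = 0"
  shows "AE x in lborel. x \<in> {0..M} \<longrightarrow> g x = 0"
proof -
  define h where "h = (\<lambda>x. indicator {0..M} x * g x)"
  have hi: "integrable lborel h" using sq_integrable[OF g] by (simp add: h_def set_integrable_def)
  have [measurable]: "h \<in> borel_measurable borel" using borel_measurable_integrable[OF hi] by simp
  let ?p = "\<lambda>x. max 0 (h x)" and ?n = "\<lambda>x. max 0 (- h x)"
  have pi: "integrable lborel ?p" "integrable lborel ?n" using hi by auto
  have tail: "(LINT x|lborel. h x * indicator {a<..} x) = 0" for a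
  proof -
    have t: "(LINT x|lborel. h x * indicator {a<..} x) = I M g - prim g a" if "a \<in> {0..M}"
    proof -
      have "(LINT x|lborel. h x * indicator {a<..} x) = (LINT x:{a..M}|lborel. g x)"
        unfolding set_lebesgue_integral_def
      proof (rule integral_cong_AE)
        show "AE x in lborel. h x * indicator {a<..} x = indicator {a..M} x *\<^sub>R g x"
          using AE_lborel_neq[of a] by eventually_elim (use that in \<open>auto simp: h_def indicator_def\<close>)
        show "(\<lambda>x. indicator {a..M} x *\<^sub>R g x) \<in> borel_measurable lborel"
          using set_integrable_subset[OF sq_integrable[OF g], of "{a..M}"] that
          by (auto simp: set_integrable_def)
      qed measurable
      then show ?thesis using prim_diff(1)[OF sq_integrable[OF g], of a M] that by simp
    qed
    consider "a < 0" | "a \<in> {0..M}" | "a > M" by fastforce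
    then show ?thesis
    proof cases
      case 1
      then have "h x * indicator {a<..} x = indicator {0..M} x *\<^sub>R g x" for x by (auto simp: h_def indicator_def)
      then show ?thesis using 0[of M] M by (simp add: set_lebesgue_integral_def)
    next
      case 2 then show ?thesis using t 0[of a] 0[of M] M by simp
    next
      case 3
      then have "(\<lambda>x. h x * indicator {a<..} x) = (\<lambda>x. 0)" by (auto simp: h_def indicator_def)
      then show ?thesis by simp
    qed
  qed
  have ed: "emeasure (density lborel (\<lambda>x. ennreal (k x))) {a<..} = ennreal (LINT x|lborel. k x * indicator {a<..} x)"
    if "integrable lborel k" "\<And>x. k x \<ge> 0" for k :: "real \<Rightarrow> real" and a
  proof -
    have [measurable]: "k \<in> borel_measurable borel" using borel_measurable_integrable[OF that(1)] by simp
    have i: "integrable lborel (\<lambda>x. k x * indicator {a<..} x)" using that(1) by (intro integrable_real_mult_indicator) auto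
    have "emeasure (density lborel (\<lambda>x. ennreal (k x))) {a<..} = (\<integral>\<^sup>+x. ennreal (k x * indicator {a<..} x) \<partial>lborel)"
      by (subst emeasure_density) (auto intro!: nn_integral_cong simp: indicator_def)
    also have "\<dots> = ennreal (LINT x|lborel. k x * indicator {a<..} x)"
      using that by (intro nn_integral_eq_integral i) auto
    finally show ?thesis .
  qed
  have "density lborel (\<lambda>x. ennreal (?p x)) = density lborel (\<lambda>x. ennreal (?n x))"
  proof (rule measure_eqI_lessThan)
    fix a
    show "emeasure (density lborel (\<lambda>x. ennreal (?p x))) {a<..} < \<infinity>" using ed[OF pi(1)] by simp
    have i: "integrable lborel (\<lambda>x. ?p x * indicator {a<..} x)" "integrable lborel (\<lambda>x. ?n x * indicator {a<..} x)"
      using pi by (auto intro: integrable_real_mult_indicator)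
    have "(LINT x|lborel. ?p x * indicator {a<..} x) - (LINT x|lborel. ?n x * indicator {a<..} x) = (LINT x|lborel. h x * indicator {a<..} x)"
      by (subst Bochner_Integration.integral_diff[OF i, symmetric]) (auto intro!: Bochner_Integration.integral_cong simp: indicator_def)
    then show "emeasure (density lborel (\<lambda>x. ennreal (?p x))) {a<..} = emeasure (density lborel (\<lambda>x. ennreal (?n x))) {a<..}"
      using tail[of a] ed[OF pi(1)] ed[OF pi(2)] by simp
  qed auto
  then have "AE x in lborel. ennreal (?p x) = ennreal (?n x)"
    by (rule sigma_finite_measure.density_unique[OF sigma_finite_lborel, rotated 2]) auto
  then show ?thesis
  proof eventually_elim
    case (elim x)
    then have "?p x = ?n x" by (subst (asm) ennreal_inj) auto
    then show ?case by (auto simp: h_def max_def split: if_splits)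
  qed
qed

lemma I_const: "M \<ge> 0 \<Longrightarrow> I M (\<lambda>x. c) = M * c"
  by (simp add: set_lebesgue_integral_def)

text \<open>Subtracting its mean makes any test function admissible in the hypothesis; the resulting
  pairing with a constant is compensated by the mean of h.\<close>

lemma mean_zero_tests:
  assumes M: "M > 0" and h: "sq M h" and 0: "\<And>\<psi>. test_fn M \<psi> \<Longrightarrow> I M \<psi> = 0 \<Longrightarrow> I M (\<lambda>x. h x * \<psi> x) = 0"
    and \<psi>: "test_fn M \<psi>"
  shows "I M (\<lambda>x. (h x - I M h / M) * \<psi> x) = 0"
proof -
  let ?m = "I M \<psi> / M"
  have s: "sq M \<psi>" by (rule test_fn_sq[OF \<psi>])
  have i: "set_integrable lborel {0..M} (\<lambda>x. h x * \<psi> x)" "set_integrable lborel {0..M} h" "set_integrable lborel {0..M} \<psi>"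
     "set_integrable lborel {0..M} (\<lambda>x. c)" for c :: real
    using h s sq_mult_integrable sq_integrable sq_const by auto
  have "test_fn M (\<lambda>x. \<psi> x + (-?m))" by (intro test_fn_add \<psi> test_fn_const)
  moreover have "I M (\<lambda>x. \<psi> x + (-?m)) = 0" using i(3,4) I_const[of M ?m] M by simp
  ultimately have "I M (\<lambda>x. h x * (\<psi> x + (-?m))) = 0" by (rule 0)
  moreover have "I M (\<lambda>x. h x * (\<psi> x + (-?m))) = I M (\<lambda>x. h x * \<psi> x) - ?m * I M h"
  proof -
    have "(\<lambda>x. h x * (\<psi> x + (-?m))) = (\<lambda>x. h x * \<psi> x - ?m * h x)" by (auto simp: algebra_simps)
    then show ?thesis using i(1,2) by simp
  qed
  ultimately show ?thesis using i by (simp add: left_diff_distrib field_simps)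
qed

text \<open>Integration by parts moves the orthogonality to the continuous function
  \<open>prim g\<close>, tested with functions of mean zero. It is therefore constant, and it
  vanishes at 0.\<close>

lemma orthogonal_tests_AE:
  assumes M: "M > 0" and g: "sq M g" and 0: "\<And>\<phi>. test_fn M \<phi> \<Longrightarrow> I M (\<lambda>x. g x * \<phi> x) = 0"
  shows "AE x in lborel. x \<in> {0..M} \<longrightarrow> g x = 0"
proof (rule zero_prim_imp_AE_zero[OF M g])
  have c: "continuous_on {0..M} (prim g)" by (rule prim_continuous[OF M g])
  have gM: "prim g M = 0" using 0[OF test_fn_const[of M 1]] by simp
  have "I M (\<lambda>x. prim g x * \<psi> x) = 0" if \<psi>: "test_fn M \<psi>" "I M \<psi> = 0" for \<psi>
  proof -
    obtain F where F: "test_fn M F" "\<And>x. (F has_real_derivative \<psi> x) (at x)"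
      using test_fn_primitive[OF M \<psi>] by metis
    have "I M (\<lambda>x. prim g x * \<psi> x) = prim g M * F M - I M (\<lambda>x. g x * F x)"
      using test_fn_Cd[OF \<psi>(1), of 0] by (intro primitive_by_parts M sq_integrable g F) (simp add: Cd_0)
    then show ?thesis using gM 0[OF F(1)] by simp
  qed
  then have "I M (\<lambda>x. (prim g x - I M (prim g) / M) * \<psi> x) = 0" if "test_fn M \<psi>" for \<psi>
    using mean_zero_tests[OF M sq_continuous[OF c] _ that] by blast
  then have "prim g x - I M (prim g) / M = 0" if "x \<in> {0..M}" for x
    using that by (intro orthogonal_tests_continuous[OF M, of "\<lambda>x. prim g x - I M (prim g) / M"] continuous_intros c) auto
  from this[of 0] this show "prim g x = 0" if "x \<in> {0..M}" for x
    using that M prim_0[of g] by simp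
qed

text \<open>Du Bois-Reymond: f minus the primitive of g is orthogonal to derivatives of test
  functions, that is to all test functions of mean zero, hence constant. Testing with 1 gives the
  zero mean of g, which is what makes the primitive periodic.\<close>

lemma weak_deriv_primitive:
  assumes M: "M > 0" and w: "weak_deriv M f g"
  obtains c where "AE x in lborel. x \<in> {0..M} \<longrightarrow> f x = c + prim g x" "I M g = 0"
proof -
  have f: "sq M f" and g: "sq M g" and t: "\<And>\<phi>. test_fn M \<phi> \<Longrightarrow> I M (\<lambda>x. f x * deriv \<phi> x) = - I M (\<lambda>x. g x * \<phi> x)"
    using w by (auto simp: weak_deriv_def L2_iff)
  have g0: "I M g = 0" using t[OF test_fn_const[of M 1]] by simp
  have ps: "sq M (prim g)" by (rule sq_continuous[OF prim_continuous[OF M g]])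
  let ?h = "\<lambda>x. f x - prim g x"
  have hs: "sq M ?h" by (rule sq_diff[OF f ps])
  have h0: "I M (\<lambda>x. ?h x * \<psi> x) = 0" if \<psi>: "test_fn M \<psi>" "I M \<psi> = 0" for \<psi>
  proof -
    obtain F where F: "test_fn M F" "\<And>x. (F has_real_derivative \<psi> x) (at x)" "deriv F = \<psi>"
      using test_fn_primitive[OF M \<psi>] by metis
    have "I M (\<lambda>x. prim g x * \<psi> x) = prim g M * F M - I M (\<lambda>x. g x * F x)"
      using test_fn_Cd[OF \<psi>(1), of 0] by (intro primitive_by_parts M sq_integrable g F) (simp add: Cd_0)
    moreover have "I M (\<lambda>x. f x * \<psi> x) = - I M (\<lambda>x. g x * F x)" using t[OF F(1)] F(3) by simp
    moreover have "I M (\<lambda>x. ?h x * \<psi> x) = I M (\<lambda>x. f x * \<psi> x) - I M (\<lambda>x. prim g x * \<psi> x)"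
      using sq_mult_integrable[OF f test_fn_sq[OF \<psi>(1)]] sq_mult_integrable[OF ps test_fn_sq[OF \<psi>(1)]]
      by (simp add: left_diff_distrib)
    ultimately show ?thesis using g0 by simp
  qed
  have "AE x in lborel. x \<in> {0..M} \<longrightarrow> ?h x - I M ?h / M = 0"
    using mean_zero_tests[OF M hs h0] by (intro orthogonal_tests_AE[OF M] sq_diff[OF hs sq_const]) blast
  then have "AE x in lborel. x \<in> {0..M} \<longrightarrow> f x = I M ?h / M + prim g x"
    by eventually_elim auto
  with g0 that show ?thesis by blast
qed

section \<open>Uniqueness of weak derivatives and the norm of H^n\<close>

lemma weak_deriv_unique:
  assumes M: "M > 0" and "weak_deriv M f g" "weak_deriv M f' g'" 
    and eq: "AE x in lborel. x \<in> {0..M} \<longrightarrow> f x = f' x"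
  shows "AE x in lborel. x \<in> {0..M} \<longrightarrow> g x = g' x"
proof -
  have s: "sq M f" "sq M g" "sq M f'" "sq M g'" using assms by (auto simp: weak_deriv_def L2_iff)
  have "I M (\<lambda>x. (g x - g' x) * \<phi> x) = 0" if t: "test_fn M \<phi>" for \<phi>
  proof -
    note t' = test_fn_sq[OF t] test_fn_sq[OF test_fn_deriv[OF t, of 1]]
    have "I M (\<lambda>x. f x * deriv \<phi> x) = I M (\<lambda>x. f' x * deriv \<phi> x)"
    proof (rule I_cong_AE)
      show "AE x in lborel. x \<in> {0..M} \<longrightarrow> f x * deriv \<phi> x = f' x * deriv \<phi> x" using eq by eventually_elim auto
    qed (use s t' in \<open>auto simp: sq_def intro!: set_measurable_mult\<close>)
    then have "I M (\<lambda>x. g x * \<phi> x) = I M (\<lambda>x. g' x * \<phi> x)" using assms t by (auto simp: weak_deriv_def)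
    then show ?thesis
      using sq_mult_integrable[OF s(2) t'(1)] sq_mult_integrable[OF s(4) t'(1)] by (simp add: left_diff_distrib)
  qed
  then have "AE x in lborel. x \<in> {0..M} \<longrightarrow> g x - g' x = 0"
    by (rule orthogonal_tests_AE[OF M sq_diff[OF s(2,4)]])
  then show ?thesis by eventually_elim auto
qed

lemma Hn_derivs_unique:
  assumes M: "M > 0" and D: "Hn_derivs M n f D" "Hn_derivs M n f' D'" 
    and eq: "AE x in lborel. x \<in> {0..M} \<longrightarrow> f x = f' x" and k: "k \<le> n"
  shows "AE x in lborel. x \<in> {0..M} \<longrightarrow> D k x = D' k x"
  using k
proof (induction k)
  case 0 then show ?case using D eq by (simp add: Hn_derivs_def)
next
  case (Suc k)
  then have 1: "AE x in lborel. x \<in> {0..M} \<longrightarrow> D k x = D' k x" 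
     and 2: "weak_deriv M (D k) (D (Suc k))" "weak_deriv M (D' k) (D' (Suc k))" 
    using D unfolding Hn_derivs_def by simp_all
  show ?case by (rule weak_deriv_unique[OF M 2 1])
qed

lemma Hn_derivs_L2: "Hn_derivs M n f D \<Longrightarrow> k \<le> n \<Longrightarrow> L2 M (D k)"
  by (cases k) (auto simp: Hn_derivs_def weak_deriv_def)

lemma Hn_derivs_sq: "Hn_derivs M n f D \<Longrightarrow> k \<le> n \<Longrightarrow> sq M (D k)"
  using Hn_derivs_L2 L2_iff by blast

text \<open>\<open>Hn_norm\<close> picks a family of derivatives by choice; uniqueness almost
  everywhere makes the value independent of this choice and of the representative of f.\<close>

lemma Hn_norm_eq_AE:
  assumes M: "M > 0" and D: "Hn_derivs M n f D" and f': "in_Hn M n f'" 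
    and eq: "AE x in lborel. x \<in> {0..M} \<longrightarrow> f x = f' x"
  shows "Hn_norm M n f' = sqrt (\<Sum>k\<le>n. (L2_norm M (D k))\<^sup>2)"
proof -
  define D' where "D' = (SOME D. Hn_derivs M n f' D)"
  have D': "Hn_derivs M n f' D'" using f' unfolding D'_def in_Hn_def by (rule someI_ex)
  have "(\<Sum>k\<le>n. (L2_norm M (D' k))\<^sup>2) = (\<Sum>k\<le>n. (L2_norm M (D k))\<^sup>2)"
  proof (rule sum.cong[OF refl])
    fix k assume "k \<in> {..n}"
    then have "L2_norm M (D k) = L2_norm M (D' k)"
      by (intro L2_norm_cong_AE Hn_derivs_unique[OF M D D' eq] Hn_derivs_sq[OF D] Hn_derivs_sq[OF D']) auto
    then show "(L2_norm M (D' k))\<^sup>2 = (L2_norm M (D k))\<^sup>2" by simp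
  qed
  then show ?thesis by (simp add: Hn_norm_def D'_def Let_def)
qed

lemma Hn_norm_eq:
  assumes M: "M > 0" and D: "Hn_derivs M n f D"
  shows "Hn_norm M n f = sqrt (\<Sum>k\<le>n. (L2_norm M (D k))\<^sup>2)"
  using Hn_norm_eq_AE[OF M D] D by (auto simp: in_Hn_def)

lemma Hn_norm_nonneg: "Hn_norm M n f \<ge> 0"
  by (simp add: Hn_norm_def Let_def sum_nonneg)

lemma L2_norm_le_Hn_norm:
  assumes M: "M > 0" and D: "Hn_derivs M n f D" and k: "k \<le> n"
  shows "L2_norm M (D k) \<le> Hn_norm M n f"
  unfolding Hn_norm_eq[OF M D]
  using member_le_sum[of k "{..n}" "\<lambda>k. (L2_norm M (D k))\<^sup>2"] k by (intro real_le_rsqrt) auto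

lemma Hn_norm_le:
  assumes M: "M > 0" and D: "Hn_derivs M n f D" and k: "\<And>k. k \<le> n \<Longrightarrow> L2_norm M (D k) \<le> C"
  shows "Hn_norm M n f \<le> sqrt (real n + 1) * C"
proof -
  have C: "C \<ge> 0" using k[of 0] L2_norm_nonneg[of M "D 0"] by simp
  have "(\<Sum>k\<le>n. (L2_norm M (D k))\<^sup>2) \<le> (\<Sum>k\<le>n. C\<^sup>2)"
    using k by (intro sum_mono power_mono) (auto simp: L2_norm_nonneg)
  then have "Hn_norm M n f \<le> sqrt ((real n + 1) * C\<^sup>2)"
    unfolding Hn_norm_eq[OF M D] by (simp add: add.commute)
  also have "\<dots> = sqrt (real n + 1) * C" using C by (simp add: real_sqrt_mult)
  finally show ?thesis .
qed

lemma Hn_derivs_mono: "Hn_derivs M n f D \<Longrightarrow> m \<le> n \<Longrightarrow> Hn_derivs M m f D"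
  by (auto simp: Hn_derivs_def)

lemma Hn_norm_mono:
  assumes M: "M > 0" and "in_Hn M n f" "m \<le> n"
  shows "Hn_norm M m f \<le> Hn_norm M n f"
proof -
  obtain D where D: "Hn_derivs M n f D" using assms by (auto simp: in_Hn_def)
  have "(\<Sum>k\<le>m. (L2_norm M (D k))\<^sup>2) \<le> (\<Sum>k\<le>n. (L2_norm M (D k))\<^sup>2)"
    using assms by (intro sum_mono2) auto
  then show ?thesis using Hn_norm_eq[OF M D] Hn_norm_eq[OF M Hn_derivs_mono[OF D assms(3)]] by simp
qed

section \<open>Linear combinations and classical derivatives\<close>

lemma periodic_lin: "periodic M f \<Longrightarrow> periodic M g \<Longrightarrow> periodic M (\<lambda>x. f x + s * g x)"
  by (simp add: periodic_def)

lemma L2_lin: "L2 M f \<Longrightarrow> L2 M g \<Longrightarrow> L2 M (\<lambda>x. f x + s * g x)"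
  by (auto simp: L2_iff periodic_lin intro: sq_add sq_cmult)

lemma weak_deriv_lin:
  assumes "weak_deriv M f f'" "weak_deriv M g g'"
  shows "weak_deriv M (\<lambda>x. f x + s * g x) (\<lambda>x. f' x + s * g' x)"
proof -
  have s: "sq M f" "sq M g" "sq M f'" "sq M g'" using assms by (auto simp: weak_deriv_def L2_iff)
  have "I M (\<lambda>x. (f x + s * g x) * deriv \<phi> x) = - I M (\<lambda>x. (f' x + s * g' x) * \<phi> x)" if t: "test_fn M \<phi>" for \<phi>
  proof -
    note t' = test_fn_sq[OF t] test_fn_sq[OF test_fn_deriv[OF t, of 1]]
    have lin: "I M (\<lambda>x. (f x + s * g x) * h x) = I M (\<lambda>x. f x * h x) + s * I M (\<lambda>x. g x * h x)"
      if "sq M f" "sq M g" "sq M h" for f g h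
      using sq_mult_integrable[OF that(1,3)] sq_mult_integrable[OF that(2,3)] 
      by (simp add: distrib_right mult.assoc)
    show ?thesis using assms t lin[OF s(1,2)] lin[OF s(3,4)] t' by (auto simp: weak_deriv_def)
  qed
  then show ?thesis using assms by (auto simp: weak_deriv_def L2_lin)
qed

lemma Hn_derivs_lin:
  assumes "Hn_derivs M n f D" "Hn_derivs M n g E"
  shows "Hn_derivs M n (\<lambda>x. f x + s * g x) (\<lambda>k x. D k x + s * E k x)"
  using assms by (auto simp: Hn_derivs_def L2_lin weak_deriv_lin)

lemma Hn_derivs_diff:
  assumes "Hn_derivs M n f D" "Hn_derivs M n g E"
  shows "Hn_derivs M n (\<lambda>x. f x - g x) (\<lambda>k x. D k x - E k x)"
  using Hn_derivs_lin[OF assms, of "-1"] by simp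

lemma weak_deriv_classical:
  assumes M: "M > 0" and u: "periodic M u" "Cd 1 u"
  shows "weak_deriv M u (deriv u)"
proof -
  note d = Cd_SucE[of 0 u] u(2)
  have c: "continuous_on UNIV u" "continuous_on UNIV (deriv u)"
    using Cd_continuous_on[OF u(2), of 0] Cd_continuous_on[OF u(2), of 1] by auto
  have "I M (\<lambda>x. u x * deriv \<phi> x) = - I M (\<lambda>x. deriv u x * \<phi> x)" if t: "test_fn M \<phi>" for \<phi>
  proof -
    have p: "((\<lambda>x. u x * \<phi> x) has_real_derivative deriv u x * \<phi> x + u x * deriv \<phi> x) (at x)" for x
      using DERIV_mult[of u "deriv u x" x UNIV \<phi> "deriv \<phi> x"] d Cd_SucE(1)[OF test_fn_Cd[OF t, of "Suc 0"]] 
      by (auto simp: algebra_simps)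
    have tc: "continuous_on UNIV \<phi>" "continuous_on UNIV (deriv \<phi>)"
      using Cd_continuous_on[OF test_fn_Cd[OF t, of 1], of 0] Cd_continuous_on[OF test_fn_Cd[OF t, of 1], of 1] by auto
    have cc: "continuous_on {0..M} (\<lambda>x. deriv u x * \<phi> x)" "continuous_on {0..M} (\<lambda>x. u x * deriv \<phi> x)"
      using c tc by (auto intro!: continuous_intros continuous_on_subset[of UNIV _ "{0..M}"])
    have "I M (\<lambda>x. deriv u x * \<phi> x + u x * deriv \<phi> x) = u M * \<phi> M - u 0 * \<phi> 0"
      using M cc by (intro integral_eq_FTC has_field_derivative_at_within[OF p] continuous_on_add) auto
    also have "\<dots> = 0" using u(1) test_fn_periodic[OF t] unfolding periodic_def by (metis add_0 diff_self)
    finally show ?thesis using sq_integrable[OF sq_continuous[OF cc(1)]] sq_integrable[OF sq_continuous[OF cc(2)]] by simp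
  qed
  then show ?thesis
    using u c by (auto simp: weak_deriv_def L2_iff periodic_deriv intro!: sq_continuous continuous_on_subset[of UNIV _ "{0..M}"])
qed

lemma Hn_derivs_classical:
  assumes M: "M > 0" and u: "Ck M n u"
  shows "Hn_derivs M n u (\<lambda>j. (deriv ^^ j) u)"
  unfolding Hn_derivs_def
proof (intro conjI allI impI)
  have p: "periodic M u" and c: "Cd n u" using u by (auto simp: Ck_iff)
  show "L2 M u" using p Cd_continuous_on[OF c, of 0 "{0..M}"] by (auto simp: L2_iff intro: sq_continuous)
  show "weak_deriv M ((deriv ^^ k) u) ((deriv ^^ Suc k) u)" if "k < n" for k
    using weak_deriv_classical[OF M periodic_funpow_deriv[OF p, of k]] Cd_deriv[of 1 k u] Cd_mono[OF c, of "Suc k"] that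
    by auto
qed simp

section \<open>Continuous representatives, interpolation and density\<close>

lemma prim_sing: "set_lebesgue_integral lborel {0} (g :: real \<Rightarrow> real) = 0"
  using prim_0[of g] by simp

lemma prim_abs_le:
  assumes "M > 0" "sq M g" "0 \<le> x" "x \<le> M"
  shows "\<bar>prim g x\<bar> \<le> sqrt x * L2_norm M g"
  using prim_L2_bound[OF assms(1,2), of 0 x] assms(3,4) by (simp add: prim_sing)

lemma prim_cong_AE:
  assumes "set_borel_measurable lborel {0..M} f" "set_borel_measurable lborel {0..M} g"
    and eq: "AE x in lborel. x \<in> {0..M} \<longrightarrow> f x = g x" and x: "x \<le> M"
  shows "prim f x = prim g x"
proof (rule I_cong_AE)
  have "set_borel_measurable lborel {0..x} h" if "set_borel_measurable lborel {0..M} h" for h :: "real \<Rightarrow> real"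
    by (rule set_borel_measurable_subset[OF that]) (use x in auto)
  then show "set_borel_measurable lborel {0..x} f" "set_borel_measurable lborel {0..x} g" using assms by auto
  show "AE y in lborel. y \<in> {0..x} \<longrightarrow> f y = g y" using eq by eventually_elim (use x in auto)
qed

lemma weak_deriv_cong_AE:
  assumes w: "weak_deriv M f g" and L: "L2 M f'" "L2 M g'"
    and eq: "AE x in lborel. x \<in> {0..M} \<longrightarrow> f x = f' x" "AE x in lborel. x \<in> {0..M} \<longrightarrow> g x = g' x"
  shows "weak_deriv M f' g'"
proof -
  have s: "sq M f" "sq M g" "sq M f'" "sq M g'" using assms by (auto simp: weak_deriv_def L2_iff)
  have e: "I M (\<lambda>x. f x * h x) = I M (\<lambda>x. f' x * h x)" 
    if "sq M f" "sq M f'" "sq M h" "AE x in lborel. x \<in> {0..M} \<longrightarrow> f x = f' x" for f f' h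
  proof (rule I_cong_AE)
    show "AE x in lborel. x \<in> {0..M} \<longrightarrow> f x * h x = f' x * h x" using that(4) by eventually_elim auto
  qed (use that in \<open>auto simp: sq_def intro!: set_measurable_mult\<close>)
  have "I M (\<lambda>x. f' x * deriv \<phi> x) = - I M (\<lambda>x. g' x * \<phi> x)" if t: "test_fn M \<phi>" for \<phi>
    using w t e[OF s(1,3) test_fn_sq[OF test_fn_deriv[OF t, of 1]] eq(1)] e[OF s(2,4) test_fn_sq[OF t] eq(2)]
    by (auto simp: weak_deriv_def)
  then show ?thesis using L by (simp add: weak_deriv_def)
qed

text \<open>What an H^n bound B yields in one dimension by Cauchy-Schwarz: the orders below n are
  Hoelder continuous of exponent 1/2 with constant B, each the classical derivative of the one
  before. Stated for families, so that iterates, limits and their differences are treated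
  alike.\<close>

definition Hc :: "real \<Rightarrow> nat \<Rightarrow> real \<Rightarrow> (nat \<Rightarrow> real \<Rightarrow> real) \<Rightarrow> bool" where
  "Hc M n B V \<longleftrightarrow>
    (\<forall>j. Suc j < n \<longrightarrow> (\<forall>x\<in>{0..M}. (V j has_real_derivative V (Suc j) x) (at x within {0..M}))) \<and>
    (\<forall>j<n. \<forall>x\<in>{0..M}. \<forall>y\<in>{0..M}. \<bar>V j x - V j y\<bar> \<le> B * sqrt \<bar>x - y\<bar>)"

lemma Hc_diff:
  assumes "Hc M n B V" "Hc M n C W" shows "Hc M n (B + C) (\<lambda>j x. V j x - W j x)"
proof -
  have "\<bar>V j x - W j x - (V j y - W j y)\<bar> \<le> (B + C) * sqrt \<bar>x - y\<bar>" if "j < n" "x \<in> {0..M}" "y \<in> {0..M}" for j x y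
  proof -
    have "\<bar>V j x - V j y\<bar> \<le> B * sqrt \<bar>x - y\<bar>" "\<bar>W j x - W j y\<bar> \<le> C * sqrt \<bar>x - y\<bar>"
      using assms that unfolding Hc_def by blast+
    moreover have "\<bar>V j x - W j x - (V j y - W j y)\<bar> \<le> \<bar>V j x - V j y\<bar> + \<bar>W j x - W j y\<bar>" by arith
    ultimately show ?thesis by (simp add: distrib_right)
  qed
  then show ?thesis using assms unfolding Hc_def by (auto intro!: DERIV_diff)
qed

lemma Hc_continuous:
  assumes "Hc M n B V" "j < n" "M > 0" shows "continuous_on {0..M} (V j)"
  unfolding continuous_on_def
proof
  fix x assume x: "x \<in> {0..M}"
  have "((\<lambda>y. B * sqrt \<bar>y - x\<bar>) \<longlongrightarrow> B * sqrt \<bar>x - x\<bar>) (at x within {0..M})"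
    by (intro tendsto_intros)
  then have "((\<lambda>y. B * sqrt \<bar>y - x\<bar>) \<longlongrightarrow> 0) (at x within {0..M})" by simp
  moreover have "\<forall>\<^sub>F y in at x within {0..M}. norm (V j y - V j x) \<le> B * sqrt \<bar>y - x\<bar>"
    using assms x unfolding Hc_def eventually_at_filter by (intro always_eventually) auto
  ultimately have "((\<lambda>y. V j y - V j x) \<longlongrightarrow> 0) (at x within {0..M})"
    by (rule Lim_null_comparison[rotated])
  then show "(V j \<longlongrightarrow> V j x) (at x within {0..M})" by (simp add: LIM_zero_iff)
qed

text \<open>On an interval of length \<eta> containing x there is a mean value point z with |W z| at
  most 2 s / \<eta>; the Hoelder bound carries this to x. As \<eta> is at most M / 2, such an
  interval fits on one side of x.\<close>

lemma interp_step:
  fixes V W :: "real \<Rightarrow> real"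
  assumes d: "\<And>x. x \<in> {0..M} \<Longrightarrow> (V has_real_derivative W x) (at x within {0..M})"
    and h: "\<And>x y. x \<in> {0..M} \<Longrightarrow> y \<in> {0..M} \<Longrightarrow> \<bar>W x - W y\<bar> \<le> B * sqrt \<bar>x - y\<bar>"
    and s: "\<And>x. x \<in> {0..M} \<Longrightarrow> \<bar>V x\<bar> \<le> s" and \<eta>: "0 < \<eta>" "\<eta> \<le> M / 2" and B: "B \<ge> 0" and x: "x \<in> {0..M}"
  shows "\<bar>W x\<bar> \<le> 2 * s / \<eta> + B * sqrt \<eta>"
proof -
  obtain a where a: "0 \<le> a" "a + \<eta> \<le> M" "a \<le> x" "x \<le> a + \<eta>"
  proof (cases "x \<le> M / 2")
    case True then show ?thesis using that[of x] \<eta> x by auto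
  next
    case False then show ?thesis using that[of "x - \<eta>"] \<eta> x by auto
  qed
  have "\<exists>z\<in>{a..a+\<eta>}. V (a + \<eta>) - V a = (\<lambda>h. W z * h) (a + \<eta> - a)"
  proof (rule mvt_very_simple)
    fix z assume "a \<le> z" "z \<le> a + \<eta>"
    then have "(V has_real_derivative W z) (at z within {a..a+\<eta>})"
      using a by (intro DERIV_subset[OF d]) auto
    then show "(V has_derivative (\<lambda>h. W z * h)) (at z within {a..a + \<eta>})"
      by (simp add: has_field_derivative_def)
  qed (use \<eta> in auto)
  then obtain z where z: "z \<in> {a..a+\<eta>}" "V (a + \<eta>) - V a = W z * \<eta>" by auto
  have "\<bar>W z * \<eta>\<bar> \<le> 2 * s" using s[of a] s[of "a + \<eta>"] z(2) a \<eta> by auto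
  then have Wz: "\<bar>W z\<bar> \<le> 2 * s / \<eta>" using \<eta> by (simp add: abs_mult field_simps)
  have "\<bar>x - z\<bar> \<le> \<eta>" using z a by auto
  then have "B * sqrt \<bar>x - z\<bar> \<le> B * sqrt \<eta>" using B by (intro mult_left_mono) auto
  moreover have "\<bar>W x - W z\<bar> \<le> B * sqrt \<bar>x - z\<bar>" using h[of x z] x z a by auto
  ultimately show ?thesis using Wz by linarith
qed

text \<open>Qualitative interpolation between the sup norm and H^n. The point is that \<delta> is
  uniform over all families with the same B, so uniform convergence of functions carries over to
  every derivative below n.\<close>

lemma interpolation:
  assumes M: "M > 0" and B: "B \<ge> 0" and j: "j < n" and \<epsilon>: "\<epsilon> > 0"
  shows "\<exists>\<delta>>0. \<forall>V. Hc M n B V \<longrightarrow> (\<forall>x\<in>{0..M}. \<bar>V 0 x\<bar> \<le> \<delta>) \<longrightarrow> (\<forall>x\<in>{0..M}. \<bar>V j x\<bar> \<le> \<epsilon>)"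
  using j \<epsilon>
proof (induction j arbitrary: \<epsilon>)
  case 0 then show ?case by auto
next
  case (Suc j)
  \<comment> \<open>Half of \<epsilon> is spent on the Hoelder error, the other half on 2 s / \<eta>
    with s = \<epsilon> \<eta> / 4 from the induction hypothesis.\<close>
  define \<eta> where "\<eta> = min (M / 2) ((\<epsilon> / (2 * (B + 1)))\<^sup>2)"
  have \<eta>: "\<eta> > 0" "\<eta> \<le> M / 2" using M B Suc.prems by (auto simp: \<eta>_def)
  have "sqrt \<eta> \<le> \<epsilon> / (2 * (B + 1))"
    using B Suc.prems by (intro real_le_lsqrt) (auto simp: \<eta>_def)
  then have "B * sqrt \<eta> \<le> B * (\<epsilon> / (2 * (B + 1)))" using B by (intro mult_left_mono) auto
  also have "\<dots> \<le> \<epsilon> / 2" using B Suc.prems by (simp add: field_simps)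
  finally have 1: "B * sqrt \<eta> \<le> \<epsilon> / 2" .
  obtain \<delta> where \<delta>: "\<delta> > 0" "\<And>V. Hc M n B V \<Longrightarrow> (\<forall>x\<in>{0..M}. \<bar>V 0 x\<bar> \<le> \<delta>) \<Longrightarrow> (\<forall>x\<in>{0..M}. \<bar>V j x\<bar> \<le> \<epsilon> * \<eta> / 4)"
    using Suc.IH[of "\<epsilon> * \<eta> / 4"] Suc.prems \<eta> by auto
  have "\<bar>V (Suc j) x\<bar> \<le> \<epsilon>" if V: "Hc M n B V" "\<forall>x\<in>{0..M}. \<bar>V 0 x\<bar> \<le> \<delta>" and x: "x \<in> {0..M}" for V x
  proof -
    have "\<bar>V (Suc j) x\<bar> \<le> 2 * (\<epsilon> * \<eta> / 4) / \<eta> + B * sqrt \<eta>"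
      using \<delta>(2)[OF V] V(1) Suc.prems \<eta> B x unfolding Hc_def
      by (intro interp_step[of M "V j"]) auto
    then show ?thesis using 1 \<eta> by simp
  qed
  with \<delta>(1) show ?case by blast
qed

lemma interpolation_all:
  assumes M: "M > 0" and B: "B \<ge> 0" and \<epsilon>: "\<epsilon> > 0"
  shows "\<exists>\<delta>>0. \<forall>V. Hc M n B V \<longrightarrow> (\<forall>x\<in>{0..M}. \<bar>V 0 x\<bar> \<le> \<delta>) \<longrightarrow> (\<forall>j<n. \<forall>x\<in>{0..M}. \<bar>V j x\<bar> \<le> \<epsilon>)"
proof -
  have "\<forall>j. \<exists>\<delta>. j < n \<longrightarrow> \<delta> > 0 \<and> (\<forall>V. Hc M n B V \<longrightarrow> (\<forall>x\<in>{0..M}. \<bar>V 0 x\<bar> \<le> \<delta>) \<longrightarrow> (\<forall>x\<in>{0..M}. \<bar>V j x\<bar> \<le> \<epsilon>))"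
    using interpolation[OF M B _ \<epsilon>, of _ n] by meson
  then obtain \<delta> where \<delta>: "\<And>j. j < n \<Longrightarrow> \<delta> j > 0" 
    "\<And>j V. j < n \<Longrightarrow> Hc M n B V \<Longrightarrow> (\<forall>x\<in>{0..M}. \<bar>V 0 x\<bar> \<le> \<delta> j) \<Longrightarrow> (\<forall>x\<in>{0..M}. \<bar>V j x\<bar> \<le> \<epsilon>)"
    by metis
  define d where "d = Min (insert 1 (\<delta> ` {..<n}))"
  have d: "d > 0" "\<And>j. j < n \<Longrightarrow> d \<le> \<delta> j" using \<delta>(1) by (auto simp: d_def)
  have "\<bar>V j x\<bar> \<le> \<epsilon>" if "Hc M n B V" "\<forall>x\<in>{0..M}. \<bar>V 0 x\<bar> \<le> d" "j < n" "x \<in> {0..M}" for V j x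
    using \<delta>(2)[OF that(3,1)] that d(2)[OF that(3)] by (meson order_trans)
  with d(1) show ?thesis by blast
qed

text \<open>Sobolev embedding by averaging over y: |V j x| exceeds |V j y| by at most B sqrt M, and
  the L1 norm is at most sqrt M times the L2 norm.\<close>

lemma sup_bound_Hc:
  assumes M: "M > 0" and V: "Hc M n B V" "j < n" and x: "x \<in> {0..M}" and L: "L2_norm M (V j) \<le> B"
  shows "\<bar>V j x\<bar> \<le> B / sqrt M + B * sqrt M"
proof -
  have B: "B \<ge> 0" using L L2_norm_nonneg[of M "V j"] by simp
  have c: "continuous_on {0..M} (V j)" by (rule Hc_continuous[OF V M])
  have "I M (\<lambda>y. \<bar>V j x\<bar>) \<le> I M (\<lambda>y. \<bar>V j y\<bar> + B * sqrt M)"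
  proof (rule I_mono)
    show "set_integrable lborel {0..M} (\<lambda>y. \<bar>V j x\<bar>)" by (rule sq_integrable[OF sq_const])
    show "set_integrable lborel {0..M} (\<lambda>y. \<bar>V j y\<bar> + B * sqrt M)"
      by (intro sq_integrable sq_continuous continuous_intros c)
    show "\<bar>V j x\<bar> \<le> \<bar>V j y\<bar> + B * sqrt M" if "y \<in> {0..M}" for y
    proof -
      have "\<bar>V j x - V j y\<bar> \<le> B * sqrt \<bar>x - y\<bar>" using V x that unfolding Hc_def by blast
      also have "\<dots> \<le> B * sqrt M" using B x that by (intro mult_left_mono) auto
      finally show ?thesis by linarith
    qed
  qed
  also have "\<dots> = I M (\<lambda>y. \<bar>V j y\<bar>) + M * (B * sqrt M)"
    using set_integrable_abs[OF sq_integrable[OF sq_continuous[OF c]]] sq_integrable[OF sq_const[of M "B * sqrt M"]] M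
    by (simp add: I_const)
  also have "I M (\<lambda>y. \<bar>V j y\<bar>) \<le> sqrt M * B"
    using order_trans[OF I_abs_le_L2[OF _ sq_continuous[OF c]] mult_left_mono[OF L, of "sqrt M"]] M by simp
  finally have "M * \<bar>V j x\<bar> \<le> sqrt M * B + M * (B * sqrt M)" using M by (simp add: I_const)
  then have "\<bar>V j x\<bar> \<le> (sqrt M * B + M * (B * sqrt M)) / M" using M by (simp add: field_simps)
  also have "\<dots> = B / sqrt M + B * sqrt M" using M by (simp add: field_simps)
  finally show ?thesis .
qed

lemma Hc_primitive:
  assumes M: "M > 0"
    and V: "\<And>j x. j < n \<Longrightarrow> x \<in> {0..M} \<Longrightarrow> V j x = V j 0 + prim (V (Suc j)) x"
    and s: "\<And>j. j \<le> n \<Longrightarrow> sq M (V j)" and c: "\<And>j. j < n \<Longrightarrow> continuous_on {0..M} (V j)"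
    and B: "\<And>j. j \<le> n \<Longrightarrow> L2_norm M (V j) \<le> B"
  shows "Hc M n B V"
  unfolding Hc_def
proof (intro conjI allI impI ballI)
  fix j x assume j: "Suc j < n" and x: "x \<in> {0..M}"
  have "((\<lambda>u. integral {0..u} (V (Suc j))) has_real_derivative V (Suc j) x) (at x within {0..M})"
    by (rule integral_has_real_derivative[OF c[OF j] x])
  then have d: "((\<lambda>u. V j 0 + integral {0..u} (V (Suc j))) has_real_derivative V (Suc j) x) (at x within {0..M})"
    using DERIV_add[OF DERIV_const] by fastforce
  have e: "V j 0 + integral {0..u} (V (Suc j)) = V j u" if "u \<in> {0..M}" for u
    using V[of j u] j that set_borel_integral_eq_integral(2)[OF borel_integrable_atLeastAtMost'[OF continuous_on_subset[OF c[OF j], of "{0..u}"]]]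
    by auto
  show "(V j has_real_derivative V (Suc j) x) (at x within {0..M})"
    by (rule has_field_derivative_transform_within[OF d zero_less_one x]) (rule e)
next
  fix j x y assume j: "j < n" and x: "x \<in> {0..M}" and y: "y \<in> {0..M}"
  have *: "\<bar>V j y - V j x\<bar> \<le> B * sqrt (y - x)" if "x \<in> {0..M}" "y \<in> {0..M}" "x \<le> y" for x y
  proof -
    have "\<bar>V j y - V j x\<bar> \<le> sqrt (y - x) * L2_norm M (V (Suc j))"
    proof -
      have "V j y - V j x = prim (V (Suc j)) y - prim (V (Suc j)) x"
        using V[OF j that(1)] V[OF j that(2)] by (metis add_diff_cancel_left)
      then show ?thesis using prim_L2_bound[OF M s[of "Suc j"], of x y] j that by simp
    qed
    also have "\<dots> \<le> sqrt (y - x) * B" using j that by (intro mult_left_mono B) auto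
    finally show ?thesis by (simp add: mult.commute)
  qed
  show "\<bar>V j x - V j y\<bar> \<le> B * sqrt \<bar>x - y\<bar>"
    using *[of x y] *[of y x] x y by (cases "x \<le> y") (auto simp: abs_minus_commute)
qed

lemma Hc_classical:
  assumes M: "M > 0" and u: "Ck M n u" and B: "\<And>j. j \<le> n \<Longrightarrow> L2_norm M ((deriv ^^ j) u) \<le> B"
  shows "Hc M n B (\<lambda>j. (deriv ^^ j) u)"
proof (rule Hc_primitive[OF M _ _ _ B])
  have c: "Cd n u" using u by (simp add: Ck_iff)
  note cc = Cd_continuous_on[OF c]
  show "continuous_on {0..M} ((deriv ^^ j) u)" if "j < n" for j using cc that by simp
  show "sq M ((deriv ^^ j) u)" if "j \<le> n" for j using cc that by (intro sq_continuous) simp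
  show "(deriv ^^ j) u x = (deriv ^^ j) u 0 + prim ((deriv ^^ Suc j) u) x" if "j < n" "x \<in> {0..M}" for j x
    using integral_eq_FTC[of 0 x "(deriv ^^ j) u" "(deriv ^^ Suc j) u"] that
      has_field_derivative_at_within[OF Cd_DERIV[OF c, of j]] cc[of "Suc j" "{0..x}"] by simp
qed

text \<open>Every order below n is replaced by a constant plus the primitive of the next order,
  which is continuous; order n keeps its L2 version.\<close>

lemma Hn_representative:
  assumes M: "M > 0" and D: "Hn_derivs M n f D"
  obtains V where "Hn_derivs M n (V 0) V" "\<And>j. j \<le> n \<Longrightarrow> AE x in lborel. x \<in> {0..M} \<longrightarrow> D j x = V j x"
    "\<And>j. j \<le> n \<Longrightarrow> L2_norm M (V j) = L2_norm M (D j)"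
    "\<And>B. (\<And>j. j \<le> n \<Longrightarrow> L2_norm M (D j) \<le> B) \<Longrightarrow> Hc M n B V"
    "\<And>j. j < n \<Longrightarrow> continuous_on {0..M} (V j)"
    "\<And>j. j \<le> n \<Longrightarrow> periodic M (V j)"
proof -
  have s: "sq M (D j)" if "j \<le> n" for j using Hn_derivs_sq[OF D that] .
  have w: "weak_deriv M (D j) (D (Suc j))" if "j < n" for j using D that by (simp add: Hn_derivs_def)
  have "\<exists>c. (AE x in lborel. x \<in> {0..M} \<longrightarrow> D j x = c + prim (D (Suc j)) x) \<and> I M (D (Suc j)) = 0" if "j < n" for j
    by (rule weak_deriv_primitive[OF M w[OF that]]) blast
  then have "\<forall>j. \<exists>c. j < n \<longrightarrow> (AE x in lborel. x \<in> {0..M} \<longrightarrow> D j x = c + prim (D (Suc j)) x) \<and> I M (D (Suc j)) = 0"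
    by blast
  from choice[OF this] obtain c where c: "\<And>j. j < n \<Longrightarrow> AE x in lborel. x \<in> {0..M} \<longrightarrow> D j x = c j + prim (D (Suc j)) x" 
      "\<And>j. j < n \<Longrightarrow> I M (D (Suc j)) = 0" by blast
  \<comment> \<open>Weak derivatives have mean zero, so the primitives have equal end values and
    \<open>per\<close> leaves them unchanged on [0, M].\<close>
  define V where "V = (\<lambda>j. if j < n then per M (\<lambda>x. c j + prim (D (Suc j)) x) else D j)"
  have Vx: "V j x = c j + prim (D (Suc j)) x" if "j < n" "x \<in> {0..M}" for j x
    using per_eq'[OF M, of "\<lambda>x. c j + prim (D (Suc j)) x" x] that c(2)[OF that(1)] prim_0[of "D (Suc j)"]
    unfolding V_def by (simp only: if_True)
  have ae: "AE x in lborel. x \<in> {0..M} \<longrightarrow> D j x = V j x" if "j \<le> n" for j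
  proof (cases "j < n")
    case True then show ?thesis using c(1)[OF True] by eventually_elim (use Vx[OF True] in auto)
  qed (simp add: V_def)
  have cont: "continuous_on {0..M} (V j)" if "j < n" for j
  proof -
    have "continuous_on {0..M} (\<lambda>x. c j + prim (D (Suc j)) x)"
      using that by (intro continuous_intros prim_continuous[OF M] s) auto
    then show ?thesis using Vx[OF that] by (metis (no_types, lifting) continuous_on_cong)
  qed
  have VL: "L2 M (V j)" if "j \<le> n" for j
  proof (cases "j < n")
    case True then show ?thesis using cont[OF True] M by (auto simp: L2_iff V_def periodic_per intro: sq_continuous)
  next
    case False then show ?thesis using Hn_derivs_L2[OF D that] by (simp add: V_def)
  qed
  have nrm: "L2_norm M (V j) = L2_norm M (D j)" if "j \<le> n" for j
    using L2_norm_cong_AE[OF s[OF that] _ ae[OF that]] VL[OF that] by (simp add: L2_iff)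
  have "Hn_derivs M n (V 0) V"
    using VL[of 0] unfolding Hn_derivs_def
    by (auto intro!: weak_deriv_cong_AE[OF w] ae VL)
  moreover have "Hc M n B V" if "\<And>j. j \<le> n \<Longrightarrow> L2_norm M (D j) \<le> B" for B
  proof (rule Hc_primitive[OF M])
    show "V j x = V j 0 + prim (V (Suc j)) x" if "j < n" "x \<in> {0..M}" for j x
    proof -
      have "prim (D (Suc j)) x = prim (V (Suc j)) x"
        using s[of "Suc j"] VL[of "Suc j"] ae[of "Suc j"] that 
        by (intro prim_cong_AE[of M]) (auto simp: L2_iff sq_def)
      then show ?thesis using Vx[OF that] Vx[OF that(1), of 0] M by (simp add: prim_sing)
    qed
  qed (use VL cont that nrm in \<open>auto simp: L2_iff\<close>)
  ultimately show ?thesis using that[of V] ae nrm cont VL by (auto simp: L2_iff)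
qed

text \<open>Riesz on the space of test functions, applied to integration against f: the representer
  is a limit of test functions by construction, and it differs from f by something orthogonal to all
  of them, hence by zero.\<close>

lemma tests_dense_L2:
  assumes M: "M > 0" and f: "sq M f" and e: "e > 0"
  shows "\<exists>\<phi>. test_fn M \<phi> \<and> L2_norm M (\<lambda>x. \<phi> x - f x) < e"
proof -
  have "\<exists>g \<phi>. sq M g \<and> L2_norm M g \<le> L2_norm M f \<and> (\<forall>\<psi>\<in>{\<phi>. test_fn M \<phi>}. I M (\<lambda>x. f x * \<psi> x) = I M (\<lambda>x. g x * \<psi> x)) \<and>
     (\<forall>m::nat. \<phi> m \<in> {\<phi>. test_fn M \<phi>}) \<and> (\<lambda>m. L2_norm M (\<lambda>x. \<phi> m x - g x)) \<longlonglongrightarrow> 0"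
  proof (rule Riesz_subspace[OF M])
    fix \<phi> \<psi> :: "real \<Rightarrow> real" and s :: real
    assume "\<phi> \<in> {\<phi>. test_fn M \<phi>}" "\<psi> \<in> {\<phi>. test_fn M \<phi>}"
    then have t: "test_fn M \<phi>" "test_fn M \<psi>" by auto
    show "(\<lambda>x. \<phi> x + s * \<psi> x) \<in> {\<phi>. test_fn M \<phi>}" using t by (auto intro: test_fn_lin)
    have "(\<lambda>x. f x * (\<phi> x + s * \<psi> x)) = (\<lambda>x. f x * \<phi> x + s * (f x * \<psi> x))" by (simp add: algebra_simps)
    then show "I M (\<lambda>x. f x * (\<phi> x + s * \<psi> x)) = I M (\<lambda>x. f x * \<phi> x) + s * I M (\<lambda>x. f x * \<psi> x)"
      using sq_mult_integrable[OF f test_fn_sq[OF t(1)]] sq_mult_integrable[OF f test_fn_sq[OF t(2)]] by simp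
  next
    fix \<phi> assume "\<phi> \<in> {\<phi>. test_fn M \<phi>}"
    then show "\<bar>I M (\<lambda>x. f x * \<phi> x)\<bar> \<le> L2_norm M f * L2_norm M \<phi>"
      using Cauchy_Schwarz_I[OF f test_fn_sq] by auto
  qed (auto simp: test_fn_sq test_fn_const L2_norm_nonneg)
  then obtain g \<phi> where g: "sq M g" "\<And>\<psi>. test_fn M \<psi> \<Longrightarrow> I M (\<lambda>x. f x * \<psi> x) = I M (\<lambda>x. g x * \<psi> x)"
     and \<phi>: "\<And>m::nat. test_fn M (\<phi> m)" "(\<lambda>m. L2_norm M (\<lambda>x. \<phi> m x - g x)) \<longlonglongrightarrow> 0" by auto
  have z: "I M (\<lambda>x. (g x - f x) * \<psi> x) = 0" if "test_fn M \<psi>" for \<psi>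
    using g(2)[OF that] sq_mult_integrable[OF f test_fn_sq[OF that]] sq_mult_integrable[OF g(1) test_fn_sq[OF that]]
    by (simp add: left_diff_distrib)
  have gf: "AE x in lborel. x \<in> {0..M} \<longrightarrow> g x - f x = 0"
    by (rule orthogonal_tests_AE[OF M sq_diff[OF g(1) f] z])
  obtain m where m: "L2_norm M (\<lambda>x. \<phi> m x - g x) < e"
    using LIMSEQ_D[OF \<phi>(2) e] by (metis abs_ge_self diff_zero le_less_trans order_refl real_norm_def)
  have "L2_norm M (\<lambda>x. \<phi> m x - f x) = L2_norm M (\<lambda>x. \<phi> m x - g x)"
  proof (rule L2_norm_cong_AE)
    show "AE x in lborel. x \<in> {0..M} \<longrightarrow> \<phi> m x - f x = \<phi> m x - g x" using gf by eventually_elim auto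
  qed (intro sq_diff f g(1) test_fn_sq \<phi>(1))+
  with m have "L2_norm M (\<lambda>x. \<phi> m x - f x) < e" by simp
  with \<phi>(1)[of m] show ?thesis by (intro exI[of _ "\<phi> m"]) simp
qed

text \<open>Induction on the order: approximate the derivative of f, correct the mean, integrate.
  Errors in the positive orders are inherited from the derivative, and the error of f itself is the
  primitive of the error of its derivative.\<close>

lemma tests_dense:
  assumes M: "M > 0"
  shows "Hn_derivs M n f D \<Longrightarrow> e > 0 \<Longrightarrow>
    \<exists>\<phi>. test_fn M \<phi> \<and> (\<forall>j\<le>n. L2_norm M (\<lambda>x. (deriv ^^ j) \<phi> x - D j x) < e)"
proof (induction n arbitrary: f D e)
  case 0
  then show ?case using tests_dense_L2[OF M Hn_derivs_sq[OF 0(1)], of 0 e] by auto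
next
  case (Suc n)
  have D1: "Hn_derivs M n (D 1) (\<lambda>k. D (Suc k))"
    using Suc.prems(1) Hn_derivs_L2[OF Suc.prems(1), of 1] by (auto simp: Hn_derivs_def)
  \<comment> \<open>Order 0 will cost 2 M e', order 1 will cost 2 e' and higher orders e'; dividing
    by 2 M + 3 keeps each of them below e.\<close>
  define e' where "e' = e / (2 * M + 3)"
  have e': "e' > 0" using Suc.prems M by (simp add: e'_def)
  have "e' * (2 * M + 3) = e" using M unfolding e'_def by simp
  then have ee: "e = 2 * (M * e') + 3 * e'" by (simp add: algebra_simps)
  have Me: "M * e' > 0" using M e' by simp
  obtain \<psi> where \<psi>: "test_fn M \<psi>" "\<And>j. j \<le> n \<Longrightarrow> L2_norm M (\<lambda>x. (deriv ^^ j) \<psi> x - D (Suc j) x) < e'"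
    using Suc.IH[OF D1 e'] by blast
  have f0: "D 0 = f" "weak_deriv M f (D 1)" using Suc.prems(1) by (auto simp: Hn_derivs_def)
  obtain c where c: "AE x in lborel. x \<in> {0..M} \<longrightarrow> f x = c + prim (D 1) x" "I M (D 1) = 0"
    using weak_deriv_primitive[OF M f0(2)] .
  have sf: "sq M f" "sq M (D 1)" using f0(2) by (auto simp: weak_deriv_def L2_iff)
  have s\<psi>: "sq M \<psi>" by (rule test_fn_sq[OF \<psi>(1)])
  \<comment> \<open>\<psi> is close to \<open>D 1\<close>, whose mean is zero, so m is small and may
    be subtracted; only then is the primitive periodic.\<close>
  define m where "m = I M \<psi> / M"
  have "\<bar>I M \<psi>\<bar> \<le> sqrt M * e'"
  proof -
    have "I M \<psi> = I M (\<lambda>x. (\<psi> x - D 1 x) * 1)" using c(2) sq_integrable[OF s\<psi>] sq_integrable[OF sf(2)] by simp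
    also have "\<bar>\<dots>\<bar> \<le> L2_norm M (\<lambda>x. \<psi> x - D 1 x) * L2_norm M (\<lambda>x. 1)"
      by (intro Cauchy_Schwarz_I sq_diff s\<psi> sf sq_const)
    also have "\<dots> \<le> e' * sqrt M" using \<psi>(2)[of 0] M by (auto simp: L2_norm_const intro!: mult_right_mono)
    finally show ?thesis by (simp add: mult.commute)
  qed
  moreover have "sqrt M * (sqrt M * \<bar>m\<bar>) = \<bar>I M \<psi>\<bar>" using M by (simp add: m_def mult.assoc[symmetric] abs_divide)
  ultimately have "sqrt M * (sqrt M * \<bar>m\<bar>) \<le> sqrt M * e'" by simp
  then have m: "sqrt M * \<bar>m\<bar> \<le> e'" by (rule mult_left_le_imp_le) (use M in simp)
  let ?\<psi> = "\<lambda>x. \<psi> x + (-m) * 1"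
  have t: "test_fn M ?\<psi>" by (intro test_fn_lin \<psi> test_fn_const)
  have st: "sq M ?\<psi>" by (rule test_fn_sq[OF t])
  have I0: "I M ?\<psi> = 0" using sq_integrable[OF s\<psi>] sq_integrable[OF sq_const[of M m]] M I_const[of M m] by (simp add: m_def)
  obtain F where F: "test_fn M F" "F 0 = 0" "deriv F = ?\<psi>" "\<And>x. (F has_real_derivative ?\<psi> x) (at x)"
      "\<And>x. x \<ge> 0 \<Longrightarrow> F x = prim ?\<psi> x"
    by (rule test_fn_primitive[OF M t I0]) blast
  have d1: "L2_norm M (\<lambda>x. ?\<psi> x - D 1 x) < 2 * e'"
  proof -
    have "L2_norm M (\<lambda>x. (\<psi> x - D 1 x) + (-m)) \<le> L2_norm M (\<lambda>x. \<psi> x - D 1 x) + L2_norm M (\<lambda>x. -m)"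
      by (intro L2_norm_triangle sq_diff s\<psi> sf sq_const)
    also have "\<dots> < e' + e'" using \<psi>(2)[of 0] m M L2_norm_const[of M "-m"] by auto
    finally show ?thesis by (simp add: algebra_simps)
  qed
  let ?\<phi> = "\<lambda>x. c + 1 * F x"
  have t\<phi>: "test_fn M ?\<phi>" by (intro test_fn_lin F test_fn_const)
  have d\<phi>: "(deriv ^^ Suc j) ?\<phi> = (deriv ^^ j) ?\<psi>" for j
  proof -
    have "deriv ?\<phi> = ?\<psi>"
      using test_fn_deriv_lin[OF test_fn_const[of M c] F(1), of 1 1] F(3) by simp
    then show ?thesis by (simp only: funpow_deriv_Suc)
  qed
  have "L2_norm M (\<lambda>x. (deriv ^^ j) ?\<phi> x - D j x) < e" if j: "j \<le> Suc n" for j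
  proof (cases j)
    case 0
    have "L2_norm M (\<lambda>x. ?\<phi> x - f x) = L2_norm M (\<lambda>x. prim (\<lambda>x. ?\<psi> x - D 1 x) x)"
    proof (rule L2_norm_cong_AE)
      show "sq M (\<lambda>x. ?\<phi> x - f x)" by (intro sq_diff test_fn_sq t\<phi> sf)
      show "sq M (prim (\<lambda>x. ?\<psi> x - D 1 x))" by (intro sq_continuous prim_continuous M sq_diff st sf)
      show "AE x in lborel. x \<in> {0..M} \<longrightarrow> ?\<phi> x - f x = prim (\<lambda>x. ?\<psi> x - D 1 x) x"
        using c(1)
      proof eventually_elim
        case (elim x)
        show ?case
        proof
          assume x: "x \<in> {0..M}"
          have "set_integrable lborel {0..x} ?\<psi>" "set_integrable lborel {0..x} (D 1)"
            using sq_integrable[OF st] sq_integrable[OF sf(2)] x by (auto elim!: set_integrable_subset)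
          then have "prim (\<lambda>x. ?\<psi> x - D 1 x) x = prim ?\<psi> x - prim (D 1) x"
            by (rule set_integral_diff(2))
          then show "?\<phi> x - f x = prim (\<lambda>x. ?\<psi> x - D 1 x) x"
            using elim x F(5)[of x] by simp
        qed
      qed
    qed
    \<comment> \<open>One factor sqrt M comes from Cauchy-Schwarz in the primitive, the other from
      bounding the L2 norm by the sup norm.\<close>
    also have "\<dots> \<le> sqrt M * (sqrt M * (2 * e'))"
    proof (rule L2_norm_sup)
      show "sq M (prim (\<lambda>x. ?\<psi> x - D 1 x))" by (intro sq_continuous prim_continuous M sq_diff st sf)
      fix x assume x: "x \<in> {0..M}"
      have "\<bar>prim (\<lambda>x. ?\<psi> x - D 1 x) x\<bar> \<le> sqrt x * L2_norm M (\<lambda>x. ?\<psi> x - D 1 x)"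
        using x by (intro prim_abs_le M sq_diff[OF st sf(2)]) auto
      also have "\<dots> \<le> sqrt M * (2 * e')" using d1 x by (intro mult_mono) (auto simp: L2_norm_nonneg)
      finally show "\<bar>prim (\<lambda>x. ?\<psi> x - D 1 x) x\<bar> \<le> sqrt M * (2 * e')" .
    qed (use M in simp)
    also have "\<dots> = M * (2 * e')" using M by (simp add: mult.assoc[symmetric])
    also have "\<dots> < e" unfolding ee using Me e' by simp
    finally show ?thesis using 0 f0(1) by simp
  next
    case (Suc i)
    show ?thesis
    proof (cases i)
      case 0
      have "2 * e' < e" unfolding ee using Me e' by simp
      moreover have "(\<lambda>x. (deriv ^^ j) ?\<phi> x - D j x) = (\<lambda>x. ?\<psi> x - D 1 x)"
        unfolding Suc d\<phi> 0 by simp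
      ultimately show ?thesis using d1 by simp
    next
      case (Suc k)
      have "(deriv ^^ i) ?\<psi> = (\<lambda>x. (deriv ^^ i) \<psi> x + (-m) * (deriv ^^ i) (\<lambda>x. 1) x)"
        by (rule test_fn_deriv_lin[OF \<psi>(1) test_fn_const])
      moreover have "(deriv ^^ i) (\<lambda>x. 1::real) = (\<lambda>x. 0)"
      proof -
        have d0: "deriv (\<lambda>x. c) = (\<lambda>x. 0)" for c :: real by (rule ext) simp
        have "(deriv ^^ k) (\<lambda>x. 0::real) = (\<lambda>x. 0)" by (induction k) (simp_all add: d0)
        then show ?thesis unfolding Suc funpow_deriv_Suc d0 .
      qed
      ultimately have "(deriv ^^ i) ?\<psi> = (deriv ^^ i) \<psi>" by (simp only: mult_zero_right add_0_right)
      then have "(deriv ^^ j) ?\<phi> = (deriv ^^ i) \<psi>" unfolding \<open>j = Suc i\<close> d\<phi> .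
      moreover have "e' < e" unfolding ee using Me e' by simp
      ultimately show ?thesis using \<psi>(2)[of i] j \<open>j = Suc i\<close> by simp
    qed
  qed
  with t\<phi> show ?case by blast
qed

section \<open>The weighted energy inequality\<close>

lemma I_abs_le:
  assumes "set_integrable lborel {0..x} f" "\<And>y. y \<in> {0..x} \<Longrightarrow> \<bar>f y\<bar> \<le> (C::real)" "x \<ge> 0"
  shows "\<bar>I x f\<bar> \<le> x * C"
proof -
  have "\<bar>I x f\<bar> \<le> I x (\<lambda>y. \<bar>f y\<bar>)"
    using set_integral_norm_bound[OF assms(1)] by simp
  also have "\<dots> \<le> I x (\<lambda>y. C)"
    using assms(2) by (intro I_mono set_integrable_abs assms(1) sq_integrable sq_const)
  finally show ?thesis using assms(3) by (simp add: I_const)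
qed

lemma abs_add_bound: "\<bar>x\<bar> \<le> A \<Longrightarrow> \<bar>y\<bar> \<le> B \<Longrightarrow> \<bar>x + y :: real\<bar> \<le> A + B"
  by (rule order_trans[OF abs_triangle_ineq add_mono])

lemma abs_diff_bound: "\<bar>x\<bar> \<le> A \<Longrightarrow> \<bar>y\<bar> \<le> B \<Longrightarrow> \<bar>x - y :: real\<bar> \<le> A + B"
  by (rule order_trans[OF abs_triangle_ineq4 add_mono])

lemma abs_mult_bound: "\<bar>x\<bar> \<le> A \<Longrightarrow> \<bar>y\<bar> \<le> B \<Longrightarrow> \<bar>x * y :: real\<bar> \<le> A * B"
  unfolding abs_mult by (rule mult_mono) auto

text \<open>For \<open>w' = \<rho> w\<close> and \<open>(w a)' = w S\<close> the zeroth order term left over by integrating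
  \<open>w v (a v''' + \<beta> v'' + \<gamma> v')\<close> by parts is \<open>- w Y v\<^sup>2 / 2\<close>.\<close>

definition Yterm :: "real \<Rightarrow> real \<Rightarrow> real \<Rightarrow> real \<Rightarrow> real \<Rightarrow> real \<Rightarrow> real \<Rightarrow> real \<Rightarrow> real \<Rightarrow> real \<Rightarrow> real" where
  "Yterm \<rho> \<rho>1 S S1 S2 \<beta> \<beta>1 \<beta>2 \<gamma> \<gamma>1 =
    (S2 + \<rho>1 * S + \<rho> * S1) - (\<beta>2 + \<rho>1 * \<beta> + \<rho> * \<beta>1) + \<gamma>1 + \<rho> * ((S1 + \<rho> * S) - (\<beta>1 + \<rho> * \<beta>) + \<gamma>)"

text \<open>The left side is (w P)' / w for the flux P of \<open>energy_core\<close>. Besides the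
  operator paired with v0 only squares remain, and the coefficient of v1^2 is \<beta> - (3/2) S,
  which the second assumption turns into a m.\<close>

lemma energy_identity:
  fixes a :: real
  assumes S: "a * \<rho> + a1 = S" and \<beta>: "\<beta> = 3 / 2 * S + a * m"
  shows "\<rho> * (a * (v0 * v2) - 1/2 * (a * (v1 * v1)) + (\<beta> - S) * (v0 * v1) + 1/2 * (((S1 + \<rho> * S) - (\<beta>1 + \<rho> * \<beta>) + \<gamma>) * (v0 * v0)))
    + (a1 * (v0 * v2) + a * (v1 * v2 + v0 * v3) - 1/2 * (a1 * (v1 * v1) + a * (2 * (v1 * v2)))
      + (\<beta>1 - S1) * (v0 * v1) + (\<beta> - S) * (v1 * v1 + v0 * v2)
      + 1/2 * (((S2 + \<rho>1 * S + \<rho> * S1) - (\<beta>2 + \<rho>1 * \<beta> + \<rho> * \<beta>1) + \<gamma>1) * (v0 * v0)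
         + ((S1 + \<rho> * S) - (\<beta>1 + \<rho> * \<beta>) + \<gamma>) * (2 * (v0 * v1))))
   = v0 * (a * v3 + \<beta> * v2 + \<gamma> * v1) + a * m * (v1 * v1) + 1/2 * (Yterm \<rho> \<rho>1 S S1 S2 \<beta> \<beta>1 \<beta>2 \<gamma> \<gamma>1 * (v0 * v0))"
proof -
  have a1: "a1 = S - a * \<rho>" using S by simp
  show ?thesis unfolding a1 \<beta> Yterm_def by (simp add: field_simps)
qed

text \<open>The bound is left open and filled in by the rules for sums, differences and products
  while \<open>Yterm\<close> is taken apart, so the polynomial in R is never written out. The
  variables stand for \<open>k\<close> = 2/3, \<open>p\<close> = 2j/3 - 1, \<open>c2\<close> = j
  choose 2, \<open>ia\<close> = 1/a and \<open>m\<close> = \<open>mu\<close>.\<close>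

lemma Yterm_bounded_ex:
  "\<exists>C. \<forall>k p j c2 m ia a0 a1 a2 a3 b0 b1 b2 c0 c1 :: real.
    \<bar>k\<bar> \<le> 1 \<longrightarrow> \<bar>p\<bar> \<le> R \<longrightarrow> \<bar>j\<bar> \<le> R \<longrightarrow> \<bar>c2\<bar> \<le> R * R \<longrightarrow> \<bar>m\<bar> \<le> R * R \<longrightarrow> \<bar>ia\<bar> \<le> R \<longrightarrow> \<bar>a0\<bar> \<le> R \<longrightarrow> \<bar>a1\<bar> \<le> R \<longrightarrow> \<bar>a2\<bar> \<le> R \<longrightarrow>
    \<bar>a3\<bar> \<le> R \<longrightarrow> \<bar>b0\<bar> \<le> R \<longrightarrow> \<bar>b1\<bar> \<le> R \<longrightarrow> \<bar>b2\<bar> \<le> R \<longrightarrow> \<bar>c0\<bar> \<le> R \<longrightarrow> \<bar>c1\<bar> \<le> R \<longrightarrow>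
    \<bar>Yterm (p * (a1 * ia) + k * (b0 * ia - m)) (p * (a2 * ia - a1 * a1 * (ia * ia)) + k * (b1 * ia - b0 * a1 * (ia * ia)))
      (k * (b0 + j * a1 - a0 * m)) (k * (b1 + j * a2 - a1 * m)) (k * (b2 + j * a3 - a2 * m))
      (b0 + j * a1) (b1 + j * a2) (b2 + j * a3) (c0 + j * b1 + c2 * a2) (c1 + j * b2 + c2 * a3)\<bar> \<le> C"
  unfolding Yterm_def
  by (rule exI, intro allI impI)
    ((assumption | rule abs_add_bound abs_diff_bound abs_mult_bound)+)

text \<open>Every bound depending on \<open>R\<close> alone will do; choosing one avoids expanding \<open>Yterm\<close>.\<close>

definition Ybound :: "real \<Rightarrow> real" where
  "Ybound R = \<bar>SOME C. \<forall>k p j c2 m ia a0 a1 a2 a3 b0 b1 b2 c0 c1 :: real.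
    \<bar>k\<bar> \<le> 1 \<longrightarrow> \<bar>p\<bar> \<le> R \<longrightarrow> \<bar>j\<bar> \<le> R \<longrightarrow> \<bar>c2\<bar> \<le> R * R \<longrightarrow> \<bar>m\<bar> \<le> R * R \<longrightarrow> \<bar>ia\<bar> \<le> R \<longrightarrow> \<bar>a0\<bar> \<le> R \<longrightarrow> \<bar>a1\<bar> \<le> R \<longrightarrow> \<bar>a2\<bar> \<le> R \<longrightarrow>
    \<bar>a3\<bar> \<le> R \<longrightarrow> \<bar>b0\<bar> \<le> R \<longrightarrow> \<bar>b1\<bar> \<le> R \<longrightarrow> \<bar>b2\<bar> \<le> R \<longrightarrow> \<bar>c0\<bar> \<le> R \<longrightarrow> \<bar>c1\<bar> \<le> R \<longrightarrow>
    \<bar>Yterm (p * (a1 * ia) + k * (b0 * ia - m)) (p * (a2 * ia - a1 * a1 * (ia * ia)) + k * (b1 * ia - b0 * a1 * (ia * ia)))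
      (k * (b0 + j * a1 - a0 * m)) (k * (b1 + j * a2 - a1 * m)) (k * (b2 + j * a3 - a2 * m))
      (b0 + j * a1) (b1 + j * a2) (b2 + j * a3) (c0 + j * b1 + c2 * a2) (c1 + j * b2 + c2 * a3)\<bar> \<le> C\<bar>"

lemma Yterm_le_Ybound:
  fixes k :: real
  assumes "\<bar>k\<bar> \<le> 1" "\<bar>p\<bar> \<le> R" "\<bar>j\<bar> \<le> R" "\<bar>c2\<bar> \<le> R * R" "\<bar>m\<bar> \<le> R * R" "\<bar>ia\<bar> \<le> R" "\<bar>a0\<bar> \<le> R" "\<bar>a1\<bar> \<le> R" "\<bar>a2\<bar> \<le> R"
    "\<bar>a3\<bar> \<le> R" "\<bar>b0\<bar> \<le> R" "\<bar>b1\<bar> \<le> R" "\<bar>b2\<bar> \<le> R" "\<bar>c0\<bar> \<le> R" "\<bar>c1\<bar> \<le> R"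
  shows "\<bar>Yterm (p * (a1 * ia) + k * (b0 * ia - m)) (p * (a2 * ia - a1 * a1 * (ia * ia)) + k * (b1 * ia - b0 * a1 * (ia * ia)))
      (k * (b0 + j * a1 - a0 * m)) (k * (b1 + j * a2 - a1 * m)) (k * (b2 + j * a3 - a2 * m))
      (b0 + j * a1) (b1 + j * a2) (b2 + j * a3) (c0 + j * b1 + c2 * a2) (c1 + j * b2 + c2 * a3)\<bar> \<le> Ybound R"
  unfolding Ybound_def
  by (rule order_trans[OF _ abs_ge_self], rule someI_ex[OF Yterm_bounded_ex, rule_format]) (rule assms)+

text \<open>The exponent solves \<open>2 b + 2 j a' = 3 (a \<eta>' + a') + 2 a \<mu>\<close>. After integration by parts the
  weight \<open>exp \<eta>\<close> therefore leaves of the second order term only \<open>a \<mu> \<ge> 0\<close>, which dissipates;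
  subtracting the mean \<open>\<mu>\<close> of \<open>b / a\<close> is what makes \<open>\<eta>\<close> periodic.\<close>

definition mu :: "real \<Rightarrow> (real \<Rightarrow> real) \<Rightarrow> (real \<Rightarrow> real) \<Rightarrow> real" where
  "mu M a b = I M (\<lambda>y. b y / a y) / M"

definition eta :: "real \<Rightarrow> nat \<Rightarrow> (real \<Rightarrow> real) \<Rightarrow> (real \<Rightarrow> real) \<Rightarrow> real \<Rightarrow> real" where
  "eta M j a b x = (real j / 3 - 1 / 2) * ln ((a x)\<^sup>2) + 2 / 3 * (prim (\<lambda>y. b y / a y) x - x * mu M a b)"

abbreviation wt :: "real \<Rightarrow> nat \<Rightarrow> (real \<Rightarrow> real) \<Rightarrow> (real \<Rightarrow> real) \<Rightarrow> real \<Rightarrow> real" where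
  "wt M j a b x \<equiv> exp (eta M j a b x)"

text \<open>The logarithm contributes a factor at most R times 2 R; the primitive and the mean
  contribute 2/3 of at most R^3 each.\<close>

definition Hbound :: "real \<Rightarrow> real" where "Hbound R = 2 * R\<^sup>2 + 2 * R ^ 3"

text \<open>The coefficients frozen at one time. A single R dominates the period, n, 1/a and all
  derivatives that enter constants; of b only n derivatives are bounded, which includes the two that
  \<open>Yterm\<close> involves. The last assumption is the form that (A3) takes for either sign of
  a.\<close>

locale coef =
  fixes R M :: real and n :: nat and a b c d :: "real \<Rightarrow> real"
  assumes M: "M > 0" "M \<le> R" and n: "n \<ge> 4" "real n \<le> R"
    and a: "Ck M (n + 3) a" and b: "Ck M (n + 2) b" and c: "Ck M n c" and d: "Ck M n d"
    and a0: "\<And>x. a x \<noteq> 0" "\<And>x. \<bar>1 / a x\<bar> \<le> R"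
    and bd: "\<And>i x. i \<le> n + 3 \<Longrightarrow> \<bar>(deriv ^^ i) a x\<bar> \<le> R"  "\<And>i x. i \<le> n \<Longrightarrow> \<bar>(deriv ^^ i) b x\<bar> \<le> R"
      "\<And>i x. i \<le> n \<Longrightarrow> \<bar>(deriv ^^ i) c x\<bar> \<le> R" "\<And>i x. i \<le> n \<Longrightarrow> \<bar>(deriv ^^ i) d x\<bar> \<le> R"
    and amu: "\<And>x. a x * mu M a b \<ge> 0"
begin

lemma R4: "R \<ge> 4" using n by linarith

abbreviation "A i \<equiv> (deriv ^^ i) a"
abbreviation "B i \<equiv> (deriv ^^ i) b"
abbreviation "C i \<equiv> (deriv ^^ i) c"

lemma per0: "periodic M f \<Longrightarrow> f M = f 0"
  unfolding periodic_def by (metis add_0)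

lemma a_cont: "continuous_on S a" "continuous_on S b"
  using Cd_continuous_on[of "n + 3" a 0] Cd_continuous_on[of "n + 2" b 0] a b by (auto simp: Ck_iff)

lemma quot_cont: "continuous_on S (\<lambda>y. b y / a y)"
  using a0 by (intro continuous_intros a_cont) auto

lemma quot_le: "\<bar>b y / a y\<bar> \<le> R * R"
  using abs_mult_bound[OF bd(2)[of 0 y] a0(2)[of y]] by simp

lemma prim_quot_le: "x \<in> {0..M} \<Longrightarrow> \<bar>prim (\<lambda>y. b y / a y) x\<bar> \<le> R * R * R"
proof -
  assume x: "x \<in> {0..M}"
  have "\<bar>prim (\<lambda>y. b y / a y) x\<bar> \<le> x * (R * R)"
    using x by (intro I_abs_le borel_integrable_atLeastAtMost' quot_cont quot_le) auto
  also have "\<dots> \<le> R * (R * R)" using x M R4 by (intro mult_right_mono) auto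
  finally show ?thesis by (simp add: mult.assoc)
qed

lemma mu_le: "\<bar>mu M a b\<bar> \<le> R * R"
proof -
  have "\<bar>I M (\<lambda>y. b y / a y)\<bar> \<le> M * (R * R)"
    using M by (intro I_abs_le borel_integrable_atLeastAtMost' quot_cont quot_le) auto
  then show ?thesis using M by (simp add: mu_def abs_divide field_simps)
qed

text \<open>Both |a| and 1/|a| are at most R, and ln y is at most y - 1.\<close>

lemma ln_a2_le: "\<bar>ln ((a x)\<^sup>2)\<bar> \<le> 2 * R"
proof -
  have R: "R > 0" using R4 by simp
  have up: "\<bar>a x\<bar> \<le> R" using bd(1)[of 0 x] by simp
  have lo: "1 \<le> \<bar>a x\<bar> * R" using a0[of x] by (simp add: field_simps abs_divide)
  have "ln ((a x)\<^sup>2) = 2 * ln \<bar>a x\<bar>"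
    using a0(1)[of x] ln_realpow[of "\<bar>a x\<bar>" 2] by simp
  moreover have "ln \<bar>a x\<bar> \<le> R"
    using ln_le_minus_one[of "\<bar>a x\<bar>"] a0(1)[of x] up by simp
  moreover have "- R \<le> ln \<bar>a x\<bar>"
  proof -
    have "0 \<le> ln (\<bar>a x\<bar> * R)" using lo by simp
    also have "\<dots> = ln \<bar>a x\<bar> + ln R" using a0(1)[of x] R by (simp add: ln_mult)
    also have "ln R \<le> R" using ln_le_minus_one[OF R] by simp
    finally show ?thesis by simp
  qed
  ultimately show ?thesis by simp
qed

lemma eta_le: "j \<le> n \<Longrightarrow> x \<in> {0..M} \<Longrightarrow> \<bar>eta M j a b x\<bar> \<le> Hbound R"
proof -
  assume j: "j \<le> n" and x: "x \<in> {0..M}"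
  have 1: "\<bar>real j / 3 - 1 / 2\<bar> \<le> R"
  proof -
    have "real j \<le> R" using j n(2) by (meson of_nat_mono order_trans)
    then show ?thesis using R4 by (simp add: abs_le_iff)
  qed
  have 2: "\<bar>x * mu M a b\<bar> \<le> R * (R * R)"
    using x M mu_le by (intro abs_mult_bound) auto
  have "\<bar>eta M j a b x\<bar> \<le> R * (2 * R) + 2 / 3 * (R * R * R + R * (R * R))"
    unfolding eta_def by (intro abs_add_bound abs_mult_bound abs_diff_bound 1 2 ln_a2_le prim_quot_le x) simp
  also have "\<dots> \<le> Hbound R" using R4 by (simp add: Hbound_def power2_eq_square power3_eq_cube)
  finally show ?thesis .
qed

lemma wt_bounds: "j \<le> n \<Longrightarrow> x \<in> {0..M} \<Longrightarrow> wt M j a b x \<le> exp (Hbound R)"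
   "j \<le> n \<Longrightarrow> x \<in> {0..M} \<Longrightarrow> exp (- Hbound R) \<le> wt M j a b x"
  using eta_le[of j x] by auto

lemma aD: "i < n + 3 \<Longrightarrow> (A i has_real_derivative A (Suc i) x) (at x within S)"
  using Cd_DERIV[of "n + 3" a i x] a by (auto simp: Ck_iff intro: has_field_derivative_at_within)

lemma bD: "i < n + 2 \<Longrightarrow> (B i has_real_derivative B (Suc i) x) (at x within S)"
  using Cd_DERIV[of "n + 2" b i x] b by (auto simp: Ck_iff intro: has_field_derivative_at_within)

lemma cD: "i < n \<Longrightarrow> (C i has_real_derivative C (Suc i) x) (at x within S)"
  using Cd_DERIV[of "n" c i x] c by (auto simp: Ck_iff intro: has_field_derivative_at_within)

text \<open>The logarithmic derivative of the weight. Quotients are written as products with 1 / a,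
  so that the terms match the pattern in \<open>Yterm_le_Ybound\<close>.\<close>

abbreviation "rho j x \<equiv> (2 * real j / 3 - 1) * (A 1 x * (1 / a x)) + 2/3 * (B 0 x * (1 / a x) - mu M a b)"
abbreviation "rho1 j x \<equiv> (2 * real j / 3 - 1) * (A 2 x * (1 / a x) - A 1 x * A 1 x * ((1 / a x) * (1 / a x)))
   + 2/3 * (B 1 x * (1 / a x) - B 0 x * A 1 x * ((1 / a x) * (1 / a x)))"

lemma iaD: "((\<lambda>x. 1 / a x) has_real_derivative - (A 1 x * ((1 / a x) * (1 / a x)))) (at x within S)"
proof -
  have "(a has_real_derivative A 1 x) (at x within S)" using aD[of 0 x S] by simp
  then show ?thesis
    using a0(1)[of x] by (auto intro!: derivative_eq_intros simp: field_simps power2_eq_square)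
qed

lemma eta_deriv: "x \<in> {0..M} \<Longrightarrow> (eta M j a b has_real_derivative rho j x) (at x within {0..M})"
proof -
  assume x: "x \<in> {0..M}"
  have D: "(a has_real_derivative A 1 x) (at x within {0..M})" using aD[of 0 x "{0..M}"] by simp
  have P: "(prim (\<lambda>y. b y / a y) has_real_derivative b x / a x) (at x within {0..M})"
  proof (rule has_field_derivative_transform_within[OF integral_has_real_derivative[OF quot_cont x] zero_less_one x])
    fix u show "integral {0..u} (\<lambda>y. b y / a y) = prim (\<lambda>y. b y / a y) u"
      using set_borel_integral_eq_integral(2)[OF borel_integrable_atLeastAtMost'[OF quot_cont]] by simp
  qed
  have pos: "(a x)\<^sup>2 > 0" using a0(1)[of x] by simp
  have "((\<lambda>x. (a x)\<^sup>2) has_real_derivative 2 * a x * A 1 x) (at x within {0..M})"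
    by (rule D derivative_eq_intros refl)+ simp
  from DERIV_chain2[OF DERIV_ln[OF pos] this]
  have L: "((\<lambda>x. ln ((a x)\<^sup>2)) has_real_derivative 2 * (A 1 x * (1 / a x))) (at x within {0..M})"
    by (rule DERIV_cong) (use a0(1)[of x] in \<open>simp add: field_simps power2_eq_square\<close>)
  have "((\<lambda>x. (real j / 3 - 1 / 2) * ln ((a x)\<^sup>2) + 2 / 3 * (prim (\<lambda>y. b y / a y) x - x * mu M a b)) has_real_derivative rho j x) (at x within {0..M})"
    by (rule L P derivative_eq_intros refl)+ (use a0(1)[of x] in \<open>simp add: field_simps\<close>)
  then show ?thesis unfolding eta_def[abs_def] .
qed

lemma wt_deriv: "x \<in> {0..M} \<Longrightarrow> (wt M j a b has_real_derivative wt M j a b x * rho j x) (at x within {0..M})"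
  by (rule DERIV_chain2[OF DERIV_exp eta_deriv])

lemma wt_cont: "continuous_on {0..M} (wt M j a b)"
  by (rule DERIV_continuous_on[OF wt_deriv])

lemma wt_periodic: "wt M j a b M = wt M j a b 0"
proof -
  have "a M = a 0" using a by (intro per0) (simp add: Ck_iff)
  moreover have "prim (\<lambda>y. b y / a y) M - M * mu M a b = 0" using M by (simp add: mu_def)
  ultimately show ?thesis by (simp add: eta_def prim_sing)
qed

lemma rhoD: "(rho j has_real_derivative rho1 j x) (at x within S)"
proof -
  have D: "(A 1 has_real_derivative A 2 x) (at x within S)" "(B 0 has_real_derivative B 1 x) (at x within S)"
    using aD[of 1 x S] bD[of 0 x S] n by (auto simp: numeral_2_eq_2)
  show ?thesis
    by (rule D iaD derivative_eq_intros refl)+ (simp add: algebra_simps)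
qed

text \<open>The derivative of w P integrates to zero over a period, the term with a
  \<open>mu\<close> has a sign and is dropped, and the rest is of order zero. Asking only for
  derivatives within [0, M] and equal end values lets the lemma serve smooth iterates, solutions of
  the resolvent system and continuous representatives of H^n functions alike.\<close>

lemma energy_core:
  assumes j: "j \<le> n"
    and v: "\<And>x. x \<in> {0..M} \<Longrightarrow> (v0 has_real_derivative v1 x) (at x within {0..M})"
      "\<And>x. x \<in> {0..M} \<Longrightarrow> (v1 has_real_derivative v2 x) (at x within {0..M})"
      "\<And>x. x \<in> {0..M} \<Longrightarrow> (v2 has_real_derivative v3 x) (at x within {0..M})"
      "continuous_on {0..M} v3"
    and per: "v0 M = v0 0" "v1 M = v1 0" "v2 M = v2 0"
  shows "I M (\<lambda>x. wt M j a b x * (v0 x * (a x * v3 x + (b x + real j * A 1 x) * v2 x + (c x + real j * B 1 x + real (j choose 2) * A 2 x) * v1 x)))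
     \<le> Ybound R * I M (\<lambda>x. wt M j a b x * (v0 x)\<^sup>2)"
proof -
  let ?W = "wt M j a b" and ?m = "mu M a b"
  define \<rho> where "\<rho> = rho j"
  define \<rho>1 where "\<rho>1 = rho1 j"
  define \<beta> where "\<beta> = (\<lambda>x. B 0 x + real j * A 1 x)"
  define \<beta>1 where "\<beta>1 = (\<lambda>x. B 1 x + real j * A 2 x)"
  define \<beta>2 where "\<beta>2 = (\<lambda>x. B 2 x + real j * A 3 x)"
  define \<gamma> where "\<gamma> = (\<lambda>x. C 0 x + real j * B 1 x + real (j choose 2) * A 2 x)"
  define \<gamma>1 where "\<gamma>1 = (\<lambda>x. C 1 x + real j * B 2 x + real (j choose 2) * A 3 x)"
  define S where "S = (\<lambda>x. 2/3 * (B 0 x + real j * A 1 x - A 0 x * ?m))"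
  define S1 where "S1 = (\<lambda>x. 2/3 * (B 1 x + real j * A 2 x - A 1 x * ?m))"
  define S2 where "S2 = (\<lambda>x. 2/3 * (B 2 x + real j * A 3 x - A 2 x * ?m))"
  define Y where "Y = (\<lambda>x. Yterm (\<rho> x) (\<rho>1 x) (S x) (S1 x) (S2 x) (\<beta> x) (\<beta>1 x) (\<beta>2 x) (\<gamma> x) (\<gamma>1 x))"
  have aD': "(A 0 has_real_derivative A 1 x) (at x within {0..M})" "(A 1 has_real_derivative A 2 x) (at x within {0..M})"
     "(A 2 has_real_derivative A 3 x) (at x within {0..M})" for x
    using aD[of 0 x "{0..M}"] aD[of 1 x "{0..M}"] aD[of 2 x "{0..M}"] n by (auto simp: eval_nat_numeral)
  have bD': "(B 0 has_real_derivative B 1 x) (at x within {0..M})" "(B 1 has_real_derivative B 2 x) (at x within {0..M})" for x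
    using bD[of 0 x "{0..M}"] bD[of 1 x "{0..M}"] n by (auto simp: eval_nat_numeral)
  have cD': "(C 0 has_real_derivative C 1 x) (at x within {0..M})" for x
    using cD[of 0 x "{0..M}"] n by auto
  have \<rho>D: "(\<rho> has_real_derivative \<rho>1 x) (at x within {0..M})" for x
    unfolding \<rho>_def \<rho>1_def by (rule rhoD)
  have \<beta>D: "(\<beta> has_real_derivative \<beta>1 x) (at x within {0..M})" "(\<beta>1 has_real_derivative \<beta>2 x) (at x within {0..M})" for x
    unfolding \<beta>_def \<beta>1_def \<beta>2_def by (intro DERIV_add DERIV_cmult aD' bD')+
  have \<gamma>D: "(\<gamma> has_real_derivative \<gamma>1 x) (at x within {0..M})" for x
    unfolding \<gamma>_def \<gamma>1_def by (intro DERIV_add DERIV_cmult aD' bD' cD')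
  have SD: "(S has_real_derivative S1 x) (at x within {0..M})" "(S1 has_real_derivative S2 x) (at x within {0..M})" for x
    unfolding S_def S1_def S2_def by (intro DERIV_add DERIV_diff DERIV_cmult DERIV_cmult_right aD' bD')+
  \<comment> \<open>The flux: (w P)' contains w v0 times the operator, and every product of two
    different derivatives beyond that cancels by \<open>energy_identity\<close>.\<close>
  define P where "P = (\<lambda>x. A 0 x * (v0 x * v2 x) - 1/2 * (A 0 x * (v1 x * v1 x)) + (\<beta> x - S x) * (v0 x * v1 x)
     + 1/2 * (((S1 x + \<rho> x * S x) - (\<beta>1 x + \<rho> x * \<beta> x) + \<gamma> x) * (v0 x * v0 x)))"
  define F where "F = (\<lambda>x. v0 x * (A 0 x * v3 x + \<beta> x * v2 x + \<gamma> x * v1 x))"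
  have QD: "((\<lambda>x. ?W x * P x) has_real_derivative ?W x * F x + ?W x * (a x * ?m * (v1 x * v1 x)) + ?W x * (1/2 * (Y x * (v0 x * v0 x)))) (at x within {0..M})"
    if x: "x \<in> {0..M}" for x
  proof -
    have PD: "(P has_real_derivative (A 1 x * (v0 x * v2 x) + A 0 x * (v1 x * v2 x + v0 x * v3 x) - 1/2 * (A 1 x * (v1 x * v1 x) + A 0 x * (2 * (v1 x * v2 x)))
      + (\<beta>1 x - S1 x) * (v0 x * v1 x) + (\<beta> x - S x) * (v1 x * v1 x + v0 x * v2 x)
      + 1/2 * (((S2 x + \<rho>1 x * S x + \<rho> x * S1 x) - (\<beta>2 x + \<rho>1 x * \<beta> x + \<rho> x * \<beta>1 x) + \<gamma>1 x) * (v0 x * v0 x)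
         + ((S1 x + \<rho> x * S x) - (\<beta>1 x + \<rho> x * \<beta> x) + \<gamma> x) * (2 * (v0 x * v1 x))))) (at x within {0..M})"
      unfolding P_def
      by (rule derivative_eq_intros aD' \<beta>D \<gamma>D SD \<rho>D v(1-3)[OF x] refl)+ (simp add: algebra_simps)
    have 1: "A 0 x * \<rho> x + A 1 x = S x"
      using a0(1)[of x] by (simp add: \<rho>_def S_def field_simps)
    have 2: "\<beta> x = 3 / 2 * S x + A 0 x * ?m" by (simp add: \<beta>_def S_def field_simps)
    have "((\<lambda>x. ?W x * P x) has_real_derivative ?W x * (\<rho> x * P x + (A 1 x * (v0 x * v2 x) + A 0 x * (v1 x * v2 x + v0 x * v3 x) - 1/2 * (A 1 x * (v1 x * v1 x) + A 0 x * (2 * (v1 x * v2 x)))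
      + (\<beta>1 x - S1 x) * (v0 x * v1 x) + (\<beta> x - S x) * (v1 x * v1 x + v0 x * v2 x)
      + 1/2 * (((S2 x + \<rho>1 x * S x + \<rho> x * S1 x) - (\<beta>2 x + \<rho>1 x * \<beta> x + \<rho> x * \<beta>1 x) + \<gamma>1 x) * (v0 x * v0 x)
         + ((S1 x + \<rho> x * S x) - (\<beta>1 x + \<rho> x * \<beta> x) + \<gamma> x) * (2 * (v0 x * v1 x)))))) (at x within {0..M})"
    proof (rule DERIV_cong[OF DERIV_mult[OF _ PD]])
      show "(?W has_real_derivative ?W x * \<rho> x) (at x within {0..M})" unfolding \<rho>_def by (rule wt_deriv[OF x])
      have "w * r * p + q * w = w * (r * p + q)" for w r p q :: real by algebra
      then show "?W x * \<rho> x * P x + z * ?W x = ?W x * (\<rho> x * P x + z)" for z .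
    qed
    then show ?thesis
      unfolding P_def energy_identity[OF 1 2] by (simp add: F_def Y_def distrib_left)
  qed
  have cts: "continuous_on {0..M} v0" "continuous_on {0..M} v1" "continuous_on {0..M} v2"
    by (auto intro: DERIV_continuous_on[OF v(1)] DERIV_continuous_on[OF v(2)] DERIV_continuous_on[OF v(3)])
  have Ac: "continuous_on {0..M} (A i)" if "i \<le> n + 3" for i using a Cd_continuous_on that by (auto simp: Ck_iff)
  have Bc: "continuous_on {0..M} (B i)" if "i \<le> n + 2" for i using b Cd_continuous_on that by (auto simp: Ck_iff)
  have Cc: "continuous_on {0..M} (C i)" if "i \<le> n" for i using c Cd_continuous_on that by (auto simp: Ck_iff)
  have \<rho>1c: "continuous_on {0..M} \<rho>1" unfolding \<rho>1_def using n by (intro continuous_intros Ac Bc a_cont) (auto simp: a0)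
  have cc: "continuous_on {0..M} \<beta>" "continuous_on {0..M} \<beta>1" "continuous_on {0..M} \<beta>2" "continuous_on {0..M} \<gamma>" "continuous_on {0..M} \<gamma>1"
     "continuous_on {0..M} S" "continuous_on {0..M} S1" "continuous_on {0..M} S2" 
    unfolding \<beta>_def \<beta>1_def \<beta>2_def \<gamma>_def \<gamma>1_def S_def S1_def S2_def using n by (intro continuous_intros Ac Bc Cc; simp)+
  have \<rho>c: "continuous_on {0..M} \<rho>" by (rule DERIV_continuous_on[OF \<rho>D])
  have Yc: "continuous_on {0..M} Y" unfolding Y_def Yterm_def by (intro continuous_intros cc \<rho>c \<rho>1c)
  have i1: "set_integrable lborel {0..M} (\<lambda>x. ?W x * F x)" unfolding F_def
    by (intro borel_integrable_atLeastAtMost' continuous_intros wt_cont cts cc v(4) Ac) simp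
  have c2: "continuous_on {0..M} (\<lambda>x. ?W x * (a x * ?m * (v1 x * v1 x)))"
    by (intro continuous_intros wt_cont cts a_cont)
  have i2: "set_integrable lborel {0..M} (\<lambda>x. ?W x * (a x * ?m * (v1 x * v1 x)))"
    by (rule borel_integrable_atLeastAtMost'[OF c2])
  have c3: "continuous_on {0..M} (\<lambda>x. ?W x * (1/2 * (Y x * (v0 x * v0 x))))"
    by (intro continuous_intros wt_cont cts Yc)
  have i3: "set_integrable lborel {0..M} (\<lambda>x. ?W x * (1/2 * (Y x * (v0 x * v0 x))))"
    by (rule borel_integrable_atLeastAtMost'[OF c3])
  have i4: "set_integrable lborel {0..M} (\<lambda>x. ?W x * (v0 x)\<^sup>2)"
    by (intro borel_integrable_atLeastAtMost' continuous_intros wt_cont cts)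
  have "I M (\<lambda>x. ?W x * F x + ?W x * (a x * ?m * (v1 x * v1 x)) + ?W x * (1/2 * (Y x * (v0 x * v0 x)))) = ?W M * P M - ?W 0 * P 0"
  proof (rule integral_eq_FTC)
    show "continuous_on {0..M} (\<lambda>x. ?W x * F x + ?W x * (a x * ?m * (v1 x * v1 x)) + ?W x * (1/2 * (Y x * (v0 x * v0 x))))"
      unfolding F_def by (intro continuous_intros wt_cont cts cc v(4) Ac Yc a_cont) simp
  qed (use QD M in auto)
  also have "\<dots> = 0"
  proof -
    have pA: "A i M = A i 0" and pB: "B i M = B i 0" and pC: "C i M = C i 0" for i
      using a b c by (auto simp: Ck_iff intro!: per0 periodic_funpow_deriv)
    have "P M = P 0"
      unfolding P_def \<beta>_def \<beta>1_def \<gamma>_def S_def S1_def \<rho>_def 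
      by (simp only: per pA pB pC pA[of 0, unfolded funpow_0])
    then show ?thesis using wt_periodic by simp
  qed
  finally have "I M (\<lambda>x. ?W x * F x) = - I M (\<lambda>x. ?W x * (a x * ?m * (v1 x * v1 x))) - I M (\<lambda>x. ?W x * (1/2 * (Y x * (v0 x * v0 x))))"
    using i1 i2 i3 by (simp add: set_integral_add(2)[OF set_integral_add(1)[OF i1 i2] i3] set_integral_add(2)[OF i1 i2])
  also have "\<dots> \<le> I M (\<lambda>x. Ybound R * (?W x * (v0 x)\<^sup>2))"
  proof -
    have "0 \<le> I M (\<lambda>x. ?W x * (a x * ?m * (v1 x * v1 x)))"
      using amu by (auto simp: set_lebesgue_integral_def intro!: integral_nonneg)
    moreover have "- I M (\<lambda>x. ?W x * (1/2 * (Y x * (v0 x * v0 x)))) \<le> I M (\<lambda>x. Ybound R * (?W x * (v0 x)\<^sup>2))"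
      unfolding set_integral_uminus[OF i3, symmetric]
    proof (rule I_mono)
      fix x assume x: "x \<in> {0..M}"
      have rj: "real j \<le> R" using j n(2) by (meson of_nat_mono order_trans)
      have "\<bar>Y x\<bar> \<le> Ybound R"
        unfolding Y_def \<rho>_def \<rho>1_def \<beta>_def \<beta>1_def \<beta>2_def \<gamma>_def \<gamma>1_def S_def S1_def S2_def
      proof (rule Yterm_le_Ybound)
        show "\<bar>2 * real j / 3 - 1\<bar> \<le> R" using rj R4 by (simp add: abs_le_iff)
        have "j choose 2 \<le> j * j" by (simp add: choose_two div_le_dividend le_trans[OF div_le_dividend] diff_mult_distrib2)
        then have "real (j choose 2) \<le> real j * real j" by (metis of_nat_le_iff of_nat_mult)
        also have "\<dots> \<le> R * R" using rj by (intro mult_mono) auto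
        finally show "\<bar>real (j choose 2)\<bar> \<le> R * R" by simp
      qed ((rule mu_le a0(2)) | (rule bd, use n in simp) | (use rj in simp))+
      then have "- (1/2 * Y x) \<le> Ybound R" by (simp add: abs_le_iff)
      then have "- (1/2 * Y x) * (?W x * (v0 x)\<^sup>2) \<le> Ybound R * (?W x * (v0 x)\<^sup>2)"
        by (intro mult_right_mono) auto
      then show "- (?W x * (1/2 * (Y x * (v0 x * v0 x)))) \<le> Ybound R * (?W x * (v0 x)\<^sup>2)"
        by (simp add: power2_eq_square mult.assoc mult.left_commute)
    next
      show "set_integrable lborel {0..M} (\<lambda>x. - (?W x * (1/2 * (Y x * (v0 x * v0 x)))))"
        by (rule borel_integrable_atLeastAtMost'[OF continuous_on_minus[OF c3]])
      show "set_integrable lborel {0..M} (\<lambda>x. Ybound R * (?W x * (v0 x)\<^sup>2))"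
        by (intro borel_integrable_atLeastAtMost' continuous_intros wt_cont cts)
    qed
    ultimately show ?thesis by simp
  qed
  finally show ?thesis using i4 by (simp add: F_def \<beta>_def \<gamma>_def)
qed

end

section \<open>Commutators and the energy of all orders\<close>

definition Aop :: "(real \<Rightarrow> real) \<Rightarrow> (real \<Rightarrow> real) \<Rightarrow> (real \<Rightarrow> real) \<Rightarrow> (real \<Rightarrow> real) \<Rightarrow> (real \<Rightarrow> real) \<Rightarrow> real \<Rightarrow> real" where
  "Aop a b c d u x = a x * (deriv ^^ 3) u x + b x * (deriv ^^ 2) u x + c x * deriv u x + d x * u x"

text \<open>Four coefficient terms, each with at most R + 1 Leibniz summands, binomials at most 2^R
  and derivatives of coefficients at most R.\<close>

definition Rembound :: "real \<Rightarrow> real" where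
  "Rembound R = 4 * ((R + 1) * (2 powr R * R))"

text \<open>Summands with i < k carry more than j derivatives of u and are kept exactly; in all
  others the order j + k - i is at most j, so they can be estimated by the energy.\<close>

lemma Leibniz_remainder:
  assumes f: "Cd j f" "\<And>i. i \<le> j \<Longrightarrow> \<bar>(deriv ^^ i) f x\<bar> \<le> R" and u: "Cd (j + k) u" and j: "real j \<le> R"
  shows "\<bar>(deriv ^^ j) (\<lambda>x. f x * (deriv ^^ k) u x) x - (\<Sum>i<k. real (j choose i) * (deriv ^^ i) f x * (deriv ^^ (j + k - i)) u x)\<bar>
    \<le> (R + 1) * (2 powr R * R) * (\<Sum>i\<le>j. \<bar>(deriv ^^ i) u x\<bar>)"
proof -
  let ?g = "\<lambda>i. real (j choose i) * (deriv ^^ i) f x * (deriv ^^ (j + k - i)) u x"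
  let ?\<Sigma> = "\<Sum>i\<le>j. \<bar>(deriv ^^ i) u x\<bar>"
  have R0: "R \<ge> 0" using j of_nat_0_le_iff[of j] by linarith
  have \<Sigma>: "?\<Sigma> \<ge> 0" by (rule sum_nonneg) simp
  have uk: "Cd j ((deriv ^^ k) u)" using Cd_deriv[OF u] .
  have "(deriv ^^ j) (\<lambda>x. f x * (deriv ^^ k) u x) x = (\<Sum>i\<le>j. ?g i)"
  proof -
    have "(deriv ^^ (j - i)) ((deriv ^^ k) u) = (deriv ^^ (j + k - i)) u" if "i \<le> j" for i
    proof -
      have "(deriv ^^ (j - i)) ((deriv ^^ k) u) = (deriv ^^ (j - i + k)) u" unfolding funpow_add by simp
      also have "j - i + k = j + k - i" using that by simp
      finally show ?thesis .
    qed
    then show ?thesis unfolding funpow_deriv_Leibniz[OF f(1) uk order.refl] by (intro sum.cong refl) simp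
  qed
  \<comment> \<open>For j < k - 1 the union reaches beyond j, but the binomial coefficients vanish
    there.\<close>
  also have "\<dots> = (\<Sum>i\<in>{..<k} \<union> {k..j}. ?g i)"
    by (rule sum.mono_neutral_left) (auto simp: binomial_eq_0)
  also have "\<dots> = (\<Sum>i<k. ?g i) + (\<Sum>i\<in>{k..j}. ?g i)"
    by (rule sum.union_disjoint) auto
  finally have eq: "(deriv ^^ j) (\<lambda>x. f x * (deriv ^^ k) u x) x - (\<Sum>i<k. ?g i) = (\<Sum>i\<in>{k..j}. ?g i)" by simp
  have "\<bar>?g i\<bar> \<le> 2 powr R * R * ?\<Sigma>" if i: "i \<in> {k..j}" for i
  proof (rule abs_mult_bound[OF abs_mult_bound])
    have "j choose i \<le> 2 ^ j" by (rule binomial_le_pow2)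
    then have "real (j choose i) \<le> real (2 ^ j)" by (rule of_nat_mono)
    also have "\<dots> = 2 powr real j" by (simp add: powr_realpow)
    also have "\<dots> \<le> 2 powr R" using j by simp
    finally show "\<bar>real (j choose i)\<bar> \<le> 2 powr R" by simp
    show "\<bar>(deriv ^^ i) f x\<bar> \<le> R" using f(2) i by simp
    show "\<bar>(deriv ^^ (j + k - i)) u x\<bar> \<le> ?\<Sigma>"
      using i by (intro member_le_sum[of "j + k - i" "{..j}" "\<lambda>i. \<bar>(deriv ^^ i) u x\<bar>"]) auto
  qed
  then have "\<bar>\<Sum>i\<in>{k..j}. ?g i\<bar> \<le> (\<Sum>i\<in>{k..j}. 2 powr R * R * ?\<Sigma>)"
    by (intro order_trans[OF sum_abs] sum_mono) auto
  also have "\<dots> = real (card {k..j}) * (2 powr R * R * ?\<Sigma>)" by simp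
  also have "\<dots> \<le> (R + 1) * (2 powr R * R * ?\<Sigma>)"
  proof (rule mult_right_mono)
    have "card {k..j} \<le> j + 1" by simp
    then have "real (card {k..j}) \<le> real j + 1" by (metis of_nat_1 of_nat_add of_nat_le_iff)
    then show "real (card {k..j}) \<le> R + 1" using j by linarith
  qed (use R0 \<Sigma> in auto)
  finally show ?thesis unfolding eq by (simp add: mult.assoc)
qed

lemma mult_le_half_squares: "w * (x * y) \<le> (w * x\<^sup>2 + w * y\<^sup>2) / (2::real)" if "w \<ge> 0"
proof -
  have "w * (2 * x * y) \<le> w * (x\<^sup>2 + y\<^sup>2)" using that by (intro mult_left_mono sum_squares_bound)
  then show ?thesis by (simp add: algebra_simps)
qed

definition En :: "real \<Rightarrow> nat \<Rightarrow> (real \<Rightarrow> real) \<Rightarrow> (real \<Rightarrow> real) \<Rightarrow> (nat \<Rightarrow> real \<Rightarrow> real) \<Rightarrow> real" where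
  "En M n a b v = (\<Sum>i\<le>n. I M (\<lambda>x. wt M i a b x * (v i x)\<^sup>2))"

text \<open>\<open>Ybound\<close> comes from the leading part. In the remainder the energy density
  appears once for each of at most R + 1 orders, and exp (2 \<open>Hbound\<close>) pays for
  replacing the weight of order j by the weight of order i.\<close>

definition CL :: "real \<Rightarrow> real" where
  "CL R = Ybound R + Rembound R * (R + 1 + exp (2 * Hbound R))"

text \<open>Twice \<open>CL\<close> for each of at most R + 1 orders, and 1 from Young's inequality
  for the source.\<close>

definition CS :: "real \<Rightarrow> real" where "CS R = 2 * (R + 1) * CL R + 1"

lemma Ybound_nonneg: "Ybound R \<ge> 0" unfolding Ybound_def by (rule abs_ge_zero)

context coef begin

lemma Cd_coefs: "Cd (n + 3) a" "Cd (n + 2) b" "Cd n c" "Cd n d"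
  using a b c d by (auto simp: Ck_iff)

lemma real_le_R: "j \<le> n \<Longrightarrow> real j \<le> R"
  using n(2) by (meson of_nat_mono order_trans)

lemma Aop_parts:
  assumes u: "Cd (n + 3) u" and j: "j \<le> n"
  shows "Cd n (\<lambda>x. a x * (deriv ^^ 3) u x)" "Cd n (\<lambda>x. b x * (deriv ^^ 2) u x)" "Cd n (\<lambda>x. c x * (deriv ^^ 1) u x)" "Cd n (\<lambda>x. d x * (deriv ^^ 0) u x)"
  using Cd_coefs Cd_mono[of "n + 3" a n] Cd_mono[of "n + 2" b n] Cd_deriv[of n 3 u] Cd_deriv[of n 2 u] Cd_deriv[of n 1 u] Cd_deriv[of n 0 u]
     Cd_mono[OF u, of "n + 2"] Cd_mono[OF u, of "n + 1"] Cd_mono[OF u, of n] u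
  by (auto intro!: Cd_mult)

lemma Aop_alt: "Aop a b c d u = (\<lambda>x. ((a x * (deriv ^^ 3) u x + b x * (deriv ^^ 2) u x) + c x * (deriv ^^ 1) u x) + d x * (deriv ^^ 0) u x)"
  by (simp add: Aop_def fun_eq_iff)

lemma Cd_Aop: "Cd (n + 3) u \<Longrightarrow> Cd n (Aop a b c d u)"
  unfolding Aop_alt by (intro Cd_add Aop_parts[of u 0]) auto

text \<open>The part of the jth derivative of the operator that contains more than j derivatives of
  v, in the shape treated by \<open>energy_core\<close>.\<close>

abbreviation "lead j v x \<equiv> a x * v (j + 3) x + (b x + real j * A 1 x) * v (j + 2) x + (c x + real j * B 1 x + real (j choose 2) * A 2 x) * v (j + 1) x"

lemma Aop_deriv_remainder:
  assumes u: "Cd (n + 3) u" and j: "j \<le> n"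
  shows "\<bar>(deriv ^^ j) (Aop a b c d u) x - lead j (\<lambda>i. (deriv ^^ i) u) x\<bar> \<le> Rembound R * (\<Sum>i\<le>j. \<bar>(deriv ^^ i) u x\<bar>)"
proof -
  let ?v = "\<lambda>i. (deriv ^^ i) u x"
  note P = Aop_parts[OF u j]
  let ?\<Sigma> = "\<Sum>i\<le>j. \<bar>?v i\<bar>"
  let ?K = "(R + 1) * (2 powr R * R) * ?\<Sigma>"
  have split: "(deriv ^^ j) (Aop a b c d u) x = (deriv ^^ j) (\<lambda>x. a x * (deriv ^^ 3) u x) x + (deriv ^^ j) (\<lambda>x. b x * (deriv ^^ 2) u x) x
    + (deriv ^^ j) (\<lambda>x. c x * (deriv ^^ 1) u x) x + (deriv ^^ j) (\<lambda>x. d x * (deriv ^^ 0) u x) x"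
    unfolding Aop_alt by (simp only: funpow_deriv_add[OF Cd_add[OF Cd_add[OF P(1,2)] P(3)] P(4) j] funpow_deriv_add[OF Cd_add[OF P(1,2)] P(3) j] funpow_deriv_add[OF P(1,2) j])
  have rj: "real j \<le> R" by (rule real_le_R[OF j])
  have cd: "Cd j a" "Cd j b" "Cd j c" "Cd j d" "Cd (j + 3) u" "Cd (j + 2) u" "Cd (j + 1) u" "Cd (j + 0) u"
    using Cd_coefs u j by (auto elim!: Cd_mono)
  have 1: "\<bar>(deriv ^^ j) (\<lambda>x. a x * (deriv ^^ 3) u x) x - (\<Sum>i<3. real (j choose i) * A i x * ?v (j + 3 - i))\<bar> \<le> ?K"
    by (rule Leibniz_remainder[OF cd(1) _ cd(5) rj]) (use bd j in auto)
  have 2: "\<bar>(deriv ^^ j) (\<lambda>x. b x * (deriv ^^ 2) u x) x - (\<Sum>i<2. real (j choose i) * B i x * ?v (j + 2 - i))\<bar> \<le> ?K"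
    by (rule Leibniz_remainder[OF cd(2) _ cd(6) rj]) (use bd j in auto)
  have 3: "\<bar>(deriv ^^ j) (\<lambda>x. c x * (deriv ^^ 1) u x) x - (\<Sum>i<1. real (j choose i) * C i x * ?v (j + 1 - i))\<bar> \<le> ?K"
    by (rule Leibniz_remainder[OF cd(3) _ cd(7) rj]) (use bd j in auto)
  \<comment> \<open>With k = 0 nothing is kept: the whole d term is of order at most j.\<close>
  have 4: "\<bar>(deriv ^^ j) (\<lambda>x. d x * (deriv ^^ 0) u x) x - (\<Sum>i<0. real (j choose i) * (deriv ^^ i) d x * ?v (j + 0 - i))\<bar> \<le> ?K"
    by (rule Leibniz_remainder[OF cd(4) _ cd(8) rj]) (use bd j in auto)
  have e1: "(\<Sum>i<3. real (j choose i) * A i x * ?v (j + 3 - i)) = a x * ?v (j + 3) + real j * A 1 x * ?v (j + 2) + real (j choose 2) * A 2 x * ?v (j + 1)"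
    by (simp add: eval_nat_numeral del: funpow.simps(2))
  have e2: "(\<Sum>i<2. real (j choose i) * B i x * ?v (j + 2 - i)) = b x * ?v (j + 2) + real j * B 1 x * ?v (j + 1)"
    by (simp add: eval_nat_numeral del: funpow.simps(2))
  have e3: "(\<Sum>i<1. real (j choose i) * C i x * ?v (j + 1 - i)) = c x * ?v (j + 1)" 
    by (simp del: funpow.simps(2))
  have t: "lead j (\<lambda>i. (deriv ^^ i) u) x = (a x * ?v (j + 3) + real j * A 1 x * ?v (j + 2) + real (j choose 2) * A 2 x * ?v (j + 1))
      + (b x * ?v (j + 2) + real j * B 1 x * ?v (j + 1)) + c x * ?v (j + 1)"
    by (simp add: algebra_simps del: funpow.simps(2))
  have ar: "\<bar>p + q + r + s - (p' + q' + r')\<bar> \<le> 4 * K" if "\<bar>p - p'\<bar> \<le> K" "\<bar>q - q'\<bar> \<le> K" "\<bar>r - r'\<bar> \<le> K" "\<bar>s - 0\<bar> \<le> K" for p q r s p' q' r' K :: real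
    using that by arith
  have E: "Rembound R * ?\<Sigma> = 4 * ?K" by (simp add: Rembound_def mult.assoc)
  show ?thesis unfolding split t E
    by (rule ar[OF 1[unfolded e1] 2[unfolded e2] 3[unfolded e3] 4[unfolded lessThan_0 sum.empty]])
qed

lemma wt_compare: "i \<le> n \<Longrightarrow> j \<le> n \<Longrightarrow> x \<in> {0..M} \<Longrightarrow> wt M j a b x \<le> exp (2 * Hbound R) * wt M i a b x"
  using eta_le[of i x] eta_le[of j x] by (simp add: exp_add[symmetric])

lemma Rembound_nonneg: "Rembound R \<ge> 0" using R4 by (simp add: Rembound_def)

lemma CL_nonneg: "CL R \<ge> 0" 
  using Ybound_nonneg[of R] Rembound_nonneg R4 by (simp add: CL_def)

lemma wt_sq_integrable:
  assumes "continuous_on {0..M} f" "continuous_on {0..M} g" 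
  shows "set_integrable lborel {0..M} (\<lambda>x. wt M j a b x * (f x * g x))" "set_integrable lborel {0..M} (\<lambda>x. wt M j a b x * (f x)\<^sup>2)"
  by (intro borel_integrable_atLeastAtMost' continuous_intros wt_cont assms)+

lemma wt_sq_nonneg: "0 \<le> I M (\<lambda>x. wt M j a b x * (f x)\<^sup>2)"
  by (auto simp: set_lebesgue_integral_def intro!: integral_nonneg)

lemma En_nonneg: "En M n a b v \<ge> 0"
  unfolding En_def by (intro sum_nonneg wt_sq_nonneg)

text \<open>\<open>energy_core\<close> takes care of the leading part. What remains are products of
  the jth derivative with derivatives of order at most j; Young's inequality and the comparison of
  weights bound them by the energy.\<close>

lemma level_energy:
  assumes u: "Ck M (n + 3) u" and j: "j \<le> n"
  shows "I M (\<lambda>x. wt M j a b x * ((deriv ^^ j) u x * (deriv ^^ j) (Aop a b c d u) x)) \<le> CL R * En M n a b (\<lambda>i. (deriv ^^ i) u)"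
proof -
  let ?v = "\<lambda>i. (deriv ^^ i) u" and ?W = "wt M j a b"
  have uC: "Cd (n + 3) u" and uP: "periodic M u" using u by (auto simp: Ck_iff)
  have vc: "continuous_on {0..M} (?v i)" if "i \<le> n + 3" for i by (rule Cd_continuous_on[OF uC that])
  have vD: "(?v i has_real_derivative ?v (Suc i) x) (at x within {0..M})" if "i < n + 3" for i x
    using Cd_DERIV[OF uC that] has_field_derivative_at_within by blast
  have vP: "?v i M = ?v i 0" for i by (rule per0[OF periodic_funpow_deriv[OF uP]])
  have Ac: "continuous_on {0..M} ((deriv ^^ j) (Aop a b c d u))"
    by (rule Cd_continuous_on[OF Cd_Aop[OF uC] j])
  have AAc: "continuous_on {0..M} (A i)" "continuous_on {0..M} (B i)" if "i \<le> 2" for i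
    using Cd_continuous_on[OF Cd_coefs(1), of i] Cd_continuous_on[OF Cd_coefs(2), of i] that by auto
  have cc: "continuous_on {0..M} c" using Cd_continuous_on[OF Cd_coefs(3), of 0] by simp
  have tc: "continuous_on {0..M} (lead j ?v)"
    using j by (intro continuous_intros AAc a_cont cc vc) auto
  let ?r = "\<lambda>x. (deriv ^^ j) (Aop a b c d u) x - lead j ?v x"
  have rc: "continuous_on {0..M} ?r" by (intro continuous_intros Ac tc)
  have vn: "set_integrable lborel {0..M} (\<lambda>x. wt M i a b x * (?v i x)\<^sup>2)" if "i \<le> n" for i
    using that by (intro wt_sq_integrable vc) auto
  have jn: "j \<le> n + 3" using j by simp
  have "I M (\<lambda>x. ?W x * (?v j x * (deriv ^^ j) (Aop a b c d u) x)) = I M (\<lambda>x. ?W x * (?v j x * lead j ?v x) + ?W x * (?v j x * ?r x))"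
    by (simp add: algebra_simps)
  also have eq: "\<dots> = I M (\<lambda>x. ?W x * (?v j x * lead j ?v x)) + I M (\<lambda>x. ?W x * (?v j x * ?r x))"
    by (rule set_integral_add(2)[OF wt_sq_integrable(1)[OF vc[OF jn] tc] wt_sq_integrable(1)[OF vc[OF jn] rc]])
  finally have eq: "I M (\<lambda>x. ?W x * (?v j x * (deriv ^^ j) (Aop a b c d u) x)) =
    I M (\<lambda>x. ?W x * (?v j x * lead j ?v x)) + I M (\<lambda>x. ?W x * (?v j x * ?r x))" .
  have "I M (\<lambda>x. ?W x * (?v j x * lead j ?v x)) \<le> Ybound R * I M (\<lambda>x. ?W x * (?v j x)\<^sup>2)"
  proof (rule energy_core[OF j])
    show "(?v j has_real_derivative ?v (j + 1) x) (at x within {0..M})" for x using vD[of j x] j by simp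
    show "(?v (j + 1) has_real_derivative ?v (j + 2) x) (at x within {0..M})" for x using vD[of "j + 1" x] j by simp
    show "(?v (j + 2) has_real_derivative ?v (j + 3) x) (at x within {0..M})" for x using vD[of "j + 2" x] j by (simp add: eval_nat_numeral)
    show "continuous_on {0..M} (?v (j + 3))" using j by (intro vc) simp
  qed (rule vP)+
  also have "\<dots> \<le> Ybound R * En M n a b ?v"
    unfolding En_def using j wt_sq_nonneg
    by (intro mult_left_mono member_le_sum[of j "{..n}" "\<lambda>j. I M (\<lambda>x. wt M j a b x * (?v j x)\<^sup>2)"] Ybound_nonneg) auto
  finally have t1: "I M (\<lambda>x. ?W x * (?v j x * lead j ?v x)) \<le> Ybound R * En M n a b ?v" .
  have "I M (\<lambda>x. ?W x * (?v j x * ?r x)) \<le> I M (\<lambda>x. (Rembound R * (R + 1 + exp (2 * Hbound R))) * (\<Sum>i\<le>n. wt M i a b x * (?v i x)\<^sup>2))"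
  proof (rule I_mono)
    show "set_integrable lborel {0..M} (\<lambda>x. ?W x * (?v j x * ?r x))" by (rule wt_sq_integrable(1)[OF vc[OF jn] rc])
    show "set_integrable lborel {0..M} (\<lambda>x. (Rembound R * (R + 1 + exp (2 * Hbound R))) * (\<Sum>i\<le>n. wt M i a b x * (?v i x)\<^sup>2))"
      by (intro borel_integrable_atLeastAtMost' continuous_intros wt_cont vc) auto
    fix x assume x: "x \<in> {0..M}"
    let ?E = "\<Sum>i\<le>n. wt M i a b x * (?v i x)\<^sup>2"
    have W: "?W x \<ge> 0" by simp
    have Ei: "wt M i a b x * (?v i x)\<^sup>2 \<le> ?E" if "i \<le> n" for i
      using that by (intro member_le_sum[of i "{..n}" "\<lambda>i. wt M i a b x * (?v i x)\<^sup>2"]) auto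
    have E0: "?E \<ge> 0" by (rule sum_nonneg) simp
    have "?W x * (?v j x * ?r x) \<le> ?W x * (\<bar>?v j x\<bar> * (Rembound R * (\<Sum>i\<le>j. \<bar>?v i x\<bar>)))"
    proof (rule mult_left_mono[OF _ W])
      have "?v j x * ?r x \<le> \<bar>?v j x\<bar> * \<bar>?r x\<bar>" unfolding abs_mult[symmetric] by (rule abs_ge_self)
      also have "\<dots> \<le> \<bar>?v j x\<bar> * (Rembound R * (\<Sum>i\<le>j. \<bar>?v i x\<bar>))"
        by (intro mult_left_mono Aop_deriv_remainder uC j) auto
      finally show "?v j x * ?r x \<le> \<bar>?v j x\<bar> * (Rembound R * (\<Sum>i\<le>j. \<bar>?v i x\<bar>))" .
    qed
    also have "\<dots> = Rembound R * (\<Sum>i\<le>j. ?W x * (\<bar>?v j x\<bar> * \<bar>?v i x\<bar>))"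
      by (simp add: sum_distrib_left algebra_simps)
    also have "\<dots> \<le> Rembound R * (\<Sum>i\<le>n. ?E + exp (2 * Hbound R) * (wt M i a b x * (?v i x)\<^sup>2))"
    proof (rule mult_left_mono[OF _ Rembound_nonneg])
      have "(\<Sum>i\<le>j. ?W x * (\<bar>?v j x\<bar> * \<bar>?v i x\<bar>)) \<le> (\<Sum>i\<le>n. ?W x * (\<bar>?v j x\<bar> * \<bar>?v i x\<bar>))"
        using j by (intro sum_mono2) auto
      also have "\<dots> \<le> (\<Sum>i\<le>n. ?E + exp (2 * Hbound R) * (wt M i a b x * (?v i x)\<^sup>2))"
      proof (rule sum_mono)
        fix i assume "i \<in> {..n}"
        then have i: "i \<le> n" by simp
        have "?W x * (\<bar>?v j x\<bar> * \<bar>?v i x\<bar>) \<le> (?W x * (?v j x)\<^sup>2 + ?W x * (?v i x)\<^sup>2) / 2"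
          using mult_le_half_squares[OF W, of "\<bar>?v j x\<bar>" "\<bar>?v i x\<bar>"] by simp
        also have "\<dots> \<le> ?W x * (?v j x)\<^sup>2 + ?W x * (?v i x)\<^sup>2" by simp
        also have "\<dots> \<le> ?E + exp (2 * Hbound R) * (wt M i a b x * (?v i x)\<^sup>2)"
          using mult_right_mono[OF wt_compare[OF i j x], of "(?v i x)\<^sup>2"] 
          by (intro add_mono Ei[OF j]) (simp add: mult.assoc)
        finally show "?W x * (\<bar>?v j x\<bar> * \<bar>?v i x\<bar>) \<le> ?E + exp (2 * Hbound R) * (wt M i a b x * (?v i x)\<^sup>2)" .
      qed
      finally show "(\<Sum>i\<le>j. ?W x * (\<bar>?v j x\<bar> * \<bar>?v i x\<bar>)) \<le> (\<Sum>i\<le>n. ?E + exp (2 * Hbound R) * (wt M i a b x * (?v i x)\<^sup>2))" .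
    qed
    also have "\<dots> = Rembound R * ((real n + 1) * ?E + exp (2 * Hbound R) * ?E)"
      by (simp add: sum.distrib sum_distrib_left add.commute)
    also have "\<dots> \<le> Rembound R * ((R + 1) * ?E + exp (2 * Hbound R) * ?E)"
      using n(2) E0 Rembound_nonneg by (intro mult_left_mono add_mono mult_right_mono) auto
    finally show "?W x * (?v j x * ?r x) \<le> (Rembound R * (R + 1 + exp (2 * Hbound R))) * ?E"
      by (simp add: algebra_simps)
  qed
  also have "\<dots> = Rembound R * (R + 1 + exp (2 * Hbound R)) * En M n a b ?v"
  proof -
    have "I M (\<lambda>x. \<Sum>i\<le>n. wt M i a b x * (?v i x)\<^sup>2) = En M n a b ?v"
      unfolding En_def set_lebesgue_integral_def scaleR_sum_right
      using vn by (intro Bochner_Integration.integral_sum) (auto simp: set_integrable_def)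
    then show ?thesis by simp
  qed
  finally show ?thesis using t1 unfolding eq CL_def distrib_right by (rule add_mono[rotated])
qed

text \<open>The differentiated equation is tested with the weighted new iterate. Since the operator
  acts on that same iterate, \<open>level_energy\<close> applies without loss of derivatives, and
  Young's inequality splits the products with p and g.\<close>

lemma step_energy:
  assumes u: "Ck M (n + 3) u" and p: "Ck M n p" and g: "Ck M n g" and \<tau>: "\<tau> \<ge> 0"
    and eq: "\<And>x. u x - \<tau> * Aop a b c d u x = p x + \<tau> * g x"
  shows "(1 - \<tau> * CS R) * En M n a b (\<lambda>i. (deriv ^^ i) u)
    \<le> En M n a b (\<lambda>i. (deriv ^^ i) p) + \<tau> * En M n a b (\<lambda>i. (deriv ^^ i) g)"
proof -
  let ?E = "\<lambda>u. En M n a b (\<lambda>i. (deriv ^^ i) u)"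
  have C: "Cd (n + 3) u" "Cd n p" "Cd n g" "Cd n u" "Cd n (Aop a b c d u)" 
    using u p g Cd_Aop[of u] Cd_mono[of "n + 3" u n] by (auto simp: Ck_iff)
  have feq: "(\<lambda>x. u x - \<tau> * Aop a b c d u x) = (\<lambda>x. p x + \<tau> * g x)" using eq by auto
  have lev: "2 * I M (\<lambda>x. wt M j a b x * ((deriv ^^ j) u x)\<^sup>2) \<le> 2 * (\<tau> * (CL R * ?E u)) +
      (I M (\<lambda>x. wt M j a b x * ((deriv ^^ j) u x)\<^sup>2) + I M (\<lambda>x. wt M j a b x * ((deriv ^^ j) p x)\<^sup>2)) + 
      \<tau> * (I M (\<lambda>x. wt M j a b x * ((deriv ^^ j) u x)\<^sup>2) + I M (\<lambda>x. wt M j a b x * ((deriv ^^ j) g x)\<^sup>2))" (is "?L \<le> _")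
    if j: "j \<le> n" for j
  proof -
    let ?W = "wt M j a b" and ?u = "(deriv ^^ j) u" and ?p = "(deriv ^^ j) p" and ?g = "(deriv ^^ j) g" and ?A = "(deriv ^^ j) (Aop a b c d u)"
    have cc: "continuous_on {0..M} ?u" "continuous_on {0..M} ?p" "continuous_on {0..M} ?g" "continuous_on {0..M} ?A"
      using C j Cd_continuous_on by auto
    have de: "?u x - \<tau> * ?A x = ?p x + \<tau> * ?g x" for x
    proof -
      have "(deriv ^^ j) (\<lambda>x. u x - \<tau> * Aop a b c d u x) = (\<lambda>x. ?u x - \<tau> * ?A x)"
        by (simp add: funpow_deriv_diff[OF C(4) Cd_cmult[OF C(5)] j] funpow_deriv_cmult[OF C(5) j])
      moreover have "(deriv ^^ j) (\<lambda>x. p x + \<tau> * g x) = (\<lambda>x. ?p x + \<tau> * ?g x)"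
        by (simp add: funpow_deriv_add[OF C(2) Cd_cmult[OF C(3)] j] funpow_deriv_cmult[OF C(3) j])
      ultimately show ?thesis unfolding feq by (metis (no_types, lifting))
    qed
    note i = wt_sq_integrable[OF cc(1) cc(4), of j] wt_sq_integrable[OF cc(1) cc(2), of j] wt_sq_integrable[OF cc(1) cc(3), of j]
      wt_sq_integrable(2)[OF cc(2) cc(2), of j] wt_sq_integrable(2)[OF cc(3) cc(3), of j]
    have "?W x * (?u x)\<^sup>2 = \<tau> * (?W x * (?u x * ?A x)) + ?W x * (?u x * ?p x) + \<tau> * (?W x * (?u x * ?g x))" for x
    proof -
      have "?u x = \<tau> * ?A x + ?p x + \<tau> * ?g x" using de[of x] by simp
      then have "?W x * (?u x * ?u x) = ?W x * (?u x * (\<tau> * ?A x + ?p x + \<tau> * ?g x))" by presburger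
      then show ?thesis by (simp add: power2_eq_square algebra_simps)
    qed
    then have "I M (\<lambda>x. ?W x * (?u x)\<^sup>2) = I M (\<lambda>x. \<tau> * (?W x * (?u x * ?A x)) + ?W x * (?u x * ?p x) + \<tau> * (?W x * (?u x * ?g x)))" by presburger
    also have "\<dots> = \<tau> * I M (\<lambda>x. ?W x * (?u x * ?A x)) + I M (\<lambda>x. ?W x * (?u x * ?p x)) + \<tau> * I M (\<lambda>x. ?W x * (?u x * ?g x))"
      using i by (subst set_integral_add(2) | simp)+
    finally have 1: "I M (\<lambda>x. ?W x * (?u x)\<^sup>2) = \<tau> * I M (\<lambda>x. ?W x * (?u x * ?A x)) + I M (\<lambda>x. ?W x * (?u x * ?p x)) + \<tau> * I M (\<lambda>x. ?W x * (?u x * ?g x))" .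
    have half: "2 * I M (\<lambda>x. ?W x * (f x * h x)) \<le> I M (\<lambda>x. ?W x * (f x)\<^sup>2) + I M (\<lambda>x. ?W x * (h x)\<^sup>2)"
      if "continuous_on {0..M} f" "continuous_on {0..M} h" for f h
    proof -
      have "I M (\<lambda>x. 2 * (?W x * (f x * h x))) \<le> I M (\<lambda>x. ?W x * (f x)\<^sup>2 + ?W x * (h x)\<^sup>2)"
        using wt_sq_integrable[OF that, of j] wt_sq_integrable[OF that(2,2), of j]
      proof (intro I_mono)
        show "2 * (?W x * (f x * h x)) \<le> ?W x * (f x)\<^sup>2 + ?W x * (h x)\<^sup>2" for x
          using mult_le_half_squares[of "?W x" "f x" "h x"] by simp
      qed auto
      then show ?thesis using wt_sq_integrable[OF that, of j] wt_sq_integrable[OF that(2,2), of j] by simp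
    qed
    have 2: "\<tau> * I M (\<lambda>x. ?W x * (?u x * ?A x)) \<le> \<tau> * (CL R * ?E u)"
      by (intro mult_left_mono level_energy u j \<tau>)
    have 3: "\<tau> * (2 * I M (\<lambda>x. ?W x * (?u x * ?g x))) \<le> \<tau> * (I M (\<lambda>x. ?W x * (?u x)\<^sup>2) + I M (\<lambda>x. ?W x * (?g x)\<^sup>2))"
      by (intro mult_left_mono half cc \<tau>)
    show ?thesis using 1 2 3 half[OF cc(1,2)] by argo
  qed
  have "(\<Sum>j\<le>n. 2 * I M (\<lambda>x. wt M j a b x * ((deriv ^^ j) u x)\<^sup>2)) \<le> (\<Sum>j\<le>n. 2 * (\<tau> * (CL R * ?E u)) +
      (I M (\<lambda>x. wt M j a b x * ((deriv ^^ j) u x)\<^sup>2) + I M (\<lambda>x. wt M j a b x * ((deriv ^^ j) p x)\<^sup>2)) + 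
      \<tau> * (I M (\<lambda>x. wt M j a b x * ((deriv ^^ j) u x)\<^sup>2) + I M (\<lambda>x. wt M j a b x * ((deriv ^^ j) g x)\<^sup>2)))"
    using lev by (intro sum_mono) auto
  then have main: "2 * ?E u \<le> (real n + 1) * (2 * (\<tau> * (CL R * ?E u))) + (?E u + ?E p) + \<tau> * (?E u + ?E g)"
    unfolding En_def by (simp add: sum.distrib sum_distrib_left[symmetric] add.commute)
  have "(real n + 1) * (2 * (\<tau> * (CL R * ?E u))) \<le> (R + 1) * (2 * (\<tau> * (CL R * ?E u)))"
    using n(2) \<tau> CL_nonneg En_nonneg by (intro mult_right_mono) auto
  with main show ?thesis unfolding CS_def by (simp add: algebra_simps)
qed

end

section \<open>The resolvent equation\<close>

text \<open>Integration gains the factor 1/K in the norm weighted by exp (-K |x|); this makes the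
  Picard map contract on the whole line at once.\<close>

lemma exp_weighted_primitive_bound:
  fixes G :: "real \<Rightarrow> 'a::euclidean_space"
  assumes K: "K > 0" and D: "D \<ge> 0" and G0: "G 0 = 0" and G: "\<And>x. (G has_vector_derivative f x) (at x)"
    and f: "\<And>x. norm (f x) \<le> D * exp (K * \<bar>x\<bar>)"
  shows "norm (G x) \<le> D / K * exp (K * \<bar>x\<bar>)"
proof -
  have *: "norm (H x) \<le> D / K * exp (K * x)" 
    if H0: "H 0 = 0" and H: "\<And>x. (H has_vector_derivative h x) (at x)" and h: "\<And>x. norm (h x) \<le> D * exp (K * \<bar>x\<bar>)" and x: "x > 0" 
    for H h :: "real \<Rightarrow> 'a" and x
  proof -
    have "norm (H x - H 0) \<le> D / K * exp (K * x) - D / K * exp (K * 0)"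
    proof (rule differentiable_bound_general[OF x])
      show "continuous_on {0..x} H" using H 
        by (intro continuous_at_imp_continuous_on ballI has_vector_derivative_continuous)
      show "continuous_on {0..x} (\<lambda>s. D / K * exp (K * s))" by (intro continuous_intros)
      show "((\<lambda>s. D / K * exp (K * s)) has_vector_derivative D * exp (K * s)) (at s)" for s
        unfolding has_real_derivative_iff_has_vector_derivative[symmetric]
        by (rule derivative_eq_intros refl)+ (use K in simp)
      show "(H has_vector_derivative h s) (at s)" for s by (rule H)
      show "norm (h s) \<le> D * exp (K * s)" if "0 < s" "s < x" for s using h[of s] that by simp
    qed
    also have "\<dots> \<le> D / K * exp (K * x)" using D K by simp
    finally show ?thesis using H0 by simp
  qed
  consider "x = 0" | "x > 0" | "x < 0" by linarith
  then show ?thesis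
  proof cases
    case 1 then show ?thesis using G0 D K by simp
  next
    case 2 then show ?thesis using *[OF G0 G f, of x] by simp
  next
    case 3
    have "((\<lambda>x. G (- x)) has_vector_derivative - f (- x)) (at x)" for x
    proof -
      have "((\<lambda>x::real. - x) has_real_derivative - 1) (at x)" by (rule derivative_eq_intros refl)+
      from vector_diff_chain_at[OF this[unfolded has_real_derivative_iff_has_vector_derivative] G]
      show ?thesis by (simp add: o_def)
    qed
    note D' = this
    have "norm (G (- (- x))) \<le> D / K * exp (K * (- x))"
    proof (rule *[where H = "\<lambda>x. G (- x)", OF _ D'])
      show "norm (- f (- s)) \<le> D * exp (K * \<bar>s\<bar>)" for s using f[of "- s"] by simp
    qed (use 3 G0 in auto)
    then show ?thesis using 3 by simp
  qed
qed

definition ant :: "(real \<Rightarrow> 'a::euclidean_space) \<Rightarrow> real \<Rightarrow> 'a" where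
  "ant f = (SOME F. F 0 = 0 \<and> (\<forall>x. (F has_vector_derivative f x) (at x)))"

lemma ant:
  assumes "continuous_on UNIV f"
  shows "ant f 0 = 0" "\<And>x. (ant f has_vector_derivative f x) (at x)"
  using someI_ex[OF antiderivative_exists[OF assms]] unfolding ant_def by auto

lemma ant_continuous: "continuous_on UNIV f \<Longrightarrow> continuous_on UNIV (ant f)"
  using ant(2)[of f] by (intro continuous_at_imp_continuous_on ballI has_vector_derivative_continuous)

lemma exp_cancel: "exp (- y) * (P * exp y) = (P::real)"
  by (simp add: exp_minus field_simps)

text \<open>Picard iteration in a Bielecki norm: the unknown is the damped function z = exp (-K |x|)
  y, which is bounded and continuous, and K = 2 L gives the contraction factor 1/2.\<close>

lemma linear_growth_ode_exists:
  fixes F :: "real \<Rightarrow> 'a::euclidean_space \<Rightarrow> 'a"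
  assumes L: "L > 0" "\<And>x y z. norm (F x y - F x z) \<le> L * norm (y - z)"
    and c: "continuous_on UNIV (\<lambda>p. F (fst p) (snd p))"
    and C: "\<And>x. norm (F x 0) \<le> C"
  shows "\<exists>y. y 0 = y0 \<and> (\<forall>x. (y has_vector_derivative F x (y x)) (at x))"
proof -
  define K where "K = 2 * L"
  have K: "K > 0" using L by (simp add: K_def)
  define \<Phi> where "\<Phi> = (\<lambda>z s. F s (exp (K * \<bar>s\<bar>) *\<^sub>R apply_bcontfun z s))"
  have \<Phi>c: "continuous_on UNIV (\<Phi> z)" for z
  proof -
    have "continuous_on UNIV (\<lambda>s. (s, exp (K * \<bar>s\<bar>) *\<^sub>R apply_bcontfun z s))" by (intro continuous_intros continuous_on_apply_bcontfun)
    from continuous_on_compose2[OF c this] show ?thesis by (simp add: \<Phi>_def)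
  qed
  have C0: "C \<ge> 0" using norm_ge_zero[of "F 0 0"] C[of 0] by linarith
  have \<Phi>b: "norm (\<Phi> z s) \<le> (L * norm z + C) * exp (K * \<bar>s\<bar>)" for z s
  proof -
    have "norm (\<Phi> z s) \<le> norm (\<Phi> z s - F s 0) + norm (F s 0)" by (metis diff_add_cancel norm_triangle_ineq)
    also have "\<dots> \<le> L * (exp (K * \<bar>s\<bar>) * norm (apply_bcontfun z s)) + C"
      using L(2)[of s "exp (K * \<bar>s\<bar>) *\<^sub>R apply_bcontfun z s" 0] C[of s] by (simp add: \<Phi>_def)
    also have "\<dots> \<le> L * (exp (K * \<bar>s\<bar>) * norm z) + C * exp (K * \<bar>s\<bar>)"
      using L(1) C0 K norm_bounded[of z s] by (intro add_mono mult_left_mono) (auto simp: mult_le_cancel_left1)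
    finally show ?thesis by (simp add: algebra_simps)
  qed
  define T where "T = (\<lambda>z x. exp (- (K * \<bar>x\<bar>)) *\<^sub>R (y0 + ant (\<Phi> z) x))"
  have Tb: "T z \<in> bcontfun" for z
  proof (rule bcontfun_normI)
    show "continuous_on UNIV (T z)" unfolding T_def by (intro continuous_intros ant_continuous \<Phi>c)
    show "norm (T z x) \<le> norm y0 + (L * norm z + C) / K" for x
    proof -
      have "norm (ant (\<Phi> z) x) \<le> (L * norm z + C) / K * exp (K * \<bar>x\<bar>)"
        using L C0 by (intro exp_weighted_primitive_bound[OF K _ ant[OF \<Phi>c] \<Phi>b]) auto
      then have "exp (- (K * \<bar>x\<bar>)) * norm (ant (\<Phi> z) x) \<le> exp (- (K * \<bar>x\<bar>)) * ((L * norm z + C) / K * exp (K * \<bar>x\<bar>))"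
        by (intro mult_left_mono) auto
      also have "\<dots> = (L * norm z + C) / K" by (rule exp_cancel)
      finally have 1: "exp (- (K * \<bar>x\<bar>)) * norm (ant (\<Phi> z) x) \<le> (L * norm z + C) / K" .
      have "norm (T z x) \<le> exp (- (K * \<bar>x\<bar>)) * (norm y0 + norm (ant (\<Phi> z) x))"
        unfolding T_def by (simp add: norm_triangle_ineq)
      also have "\<dots> \<le> norm y0 + (L * norm z + C) / K"
        using 1 K mult_right_mono[of "exp (- (K * \<bar>x\<bar>))" 1 "norm y0"] by (simp add: distrib_left)
      finally show ?thesis .
    qed
  qed
  have "\<exists>!z. Bcontfun (T z) = z"
  proof (rule banach_fix_type[of "1/2"])
    show "\<forall>z z'. dist (Bcontfun (T z)) (Bcontfun (T z')) \<le> 1 / 2 * dist z z'"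
    proof (intro allI dist_bound)
      fix z z' x
      have "norm (ant (\<Phi> z) x - ant (\<Phi> z') x) \<le> (L * dist z z') / K * exp (K * \<bar>x\<bar>)"
      proof (rule exp_weighted_primitive_bound[OF K, where f = "\<lambda>s. \<Phi> z s - \<Phi> z' s"])
        show "((\<lambda>x. ant (\<Phi> z) x - ant (\<Phi> z') x) has_vector_derivative \<Phi> z s - \<Phi> z' s) (at s)" for s
          by (intro has_vector_derivative_diff ant \<Phi>c)
        show "norm (\<Phi> z s - \<Phi> z' s) \<le> L * dist z z' * exp (K * \<bar>s\<bar>)" for s
        proof -
          have "norm (\<Phi> z s - \<Phi> z' s) \<le> L * (exp (K * \<bar>s\<bar>) * dist (apply_bcontfun z s) (apply_bcontfun z' s))"
            using L(2)[of s "exp (K * \<bar>s\<bar>) *\<^sub>R apply_bcontfun z s" "exp (K * \<bar>s\<bar>) *\<^sub>R apply_bcontfun z' s"]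
            by (simp add: \<Phi>_def dist_norm scaleR_diff_right[symmetric])
          also have "\<dots> \<le> L * (exp (K * \<bar>s\<bar>) * dist z z')"
            using L(1) by (intro mult_left_mono dist_bounded) auto
          finally show ?thesis by (simp add: algebra_simps)
        qed
      qed (use L ant[OF \<Phi>c] in auto)
      then have "exp (- (K * \<bar>x\<bar>)) * norm (ant (\<Phi> z) x - ant (\<Phi> z') x) \<le> exp (- (K * \<bar>x\<bar>)) * ((L * dist z z') / K * exp (K * \<bar>x\<bar>))"
        by (intro mult_left_mono) auto
      also have "\<dots> = 1/2 * dist z z'" unfolding exp_cancel using L by (simp add: K_def)
      finally show "dist (apply_bcontfun (Bcontfun (T z)) x) (apply_bcontfun (Bcontfun (T z')) x) \<le> 1/2 * dist z z'"
        by (simp add: Bcontfun_inverse[OF Tb] dist_norm) (simp add: T_def scaleR_diff_right[symmetric])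
    qed
  qed auto
  then obtain z where z: "Bcontfun (T z) = z" by blast
  then have zT: "apply_bcontfun z x = T z x" for x using Bcontfun_inverse[OF Tb, of z] by simp
  have e: "exp (K * \<bar>x\<bar>) *\<^sub>R apply_bcontfun z x = y0 + ant (\<Phi> z) x" for x
    unfolding zT T_def by (simp add: exp_minus)
  show ?thesis
  proof (intro exI[of _ "\<lambda>x. y0 + ant (\<Phi> z) x"] conjI allI)
    show "y0 + ant (\<Phi> z) 0 = y0" using ant(1)[OF \<Phi>c] by simp
    show "((\<lambda>x. y0 + ant (\<Phi> z) x) has_vector_derivative F x (y0 + ant (\<Phi> z) x)) (at x)" for x
    proof -
      have "\<Phi> z x = F x (y0 + ant (\<Phi> z) x)" unfolding e[symmetric] by (simp add: \<Phi>_def)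
      then show ?thesis
        using has_vector_derivative_add[OF has_vector_derivative_const[of y0] ant(2)[OF \<Phi>c], of z x] by simp
    qed
  qed
qed

text \<open>The square of |h| times exp (-2 L x) decreases to the right of 0, and times exp (2 L x)
  it increases to the left of 0; both vanish at 0.\<close>

lemma ode_unique_zero:
  fixes h :: "real \<Rightarrow> 'a::euclidean_space"
  assumes h0: "h 0 = 0" and h: "\<And>x. (h has_vector_derivative h' x) (at x)" and L: "\<And>x. norm (h' x) \<le> L * norm (h x)"
  shows "h x = 0"
proof -
  have ip: "\<bar>h s \<bullet> h' s\<bar> \<le> L * (h s \<bullet> h s)" for s
  proof -
    have "\<bar>h s \<bullet> h' s\<bar> \<le> norm (h s) * norm (h' s)" by (rule Cauchy_Schwarz_ineq2)
    also have "\<dots> \<le> norm (h s) * (L * norm (h s))" by (intro mult_left_mono L) auto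
    finally show ?thesis by (simp add: dot_square_norm power2_eq_square algebra_simps)
  qed
  have D: "((\<lambda>s. exp (k * s) * (h s \<bullet> h s)) has_real_derivative exp (k * s) * (k * (h s \<bullet> h s) + 2 * (h s \<bullet> h' s))) (at s)" for k s
  proof -
    have hh: "((\<lambda>s. h s \<bullet> h s) has_real_derivative h s \<bullet> h' s + h' s \<bullet> h s) (at s)"
      unfolding has_real_derivative_iff_has_vector_derivative
      by (rule bounded_bilinear.has_vector_derivative[OF bounded_bilinear_inner h h])
    show ?thesis
      by (rule hh derivative_eq_intros refl)+ (simp add: inner_commute algebra_simps)
  qed
  have "exp (- (2 * L) * x) * (h x \<bullet> h x) \<le> 0" if "x \<ge> 0"
  proof -
    have "exp (- (2 * L) * x) * (h x \<bullet> h x) \<le> exp (- (2 * L) * 0) * (h 0 \<bullet> h 0)"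
    proof (rule DERIV_nonpos_imp_nonincreasing[OF that])
      fix s
      have "exp (- (2 * L) * s) * (- (2 * L) * (h s \<bullet> h s) + 2 * (h s \<bullet> h' s)) \<le> 0"
        using ip[of s] by (intro mult_nonneg_nonpos) (auto simp: abs_le_iff)
      then show "\<exists>y. ((\<lambda>s. exp (- (2 * L) * s) * (h s \<bullet> h s)) has_real_derivative y) (at s) \<and> y \<le> 0"
        using D[of "- (2 * L)" s] by blast
    qed
    then show ?thesis by (simp add: h0)
  qed
  moreover have "exp (2 * L * x) * (h x \<bullet> h x) \<le> 0" if "x \<le> 0"
  proof -
    have "exp (2 * L * x) * (h x \<bullet> h x) \<le> exp (2 * L * 0) * (h 0 \<bullet> h 0)"
    proof (rule DERIV_nonneg_imp_nondecreasing[OF that])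
      fix s
      have "0 \<le> exp (2 * L * s) * (2 * L * (h s \<bullet> h s) + 2 * (h s \<bullet> h' s))"
        using ip[of s] by (intro mult_nonneg_nonneg) (auto simp: abs_le_iff)
      then show "\<exists>y. ((\<lambda>s. exp (2 * L * s) * (h s \<bullet> h s)) has_real_derivative y) (at s) \<and> 0 \<le> y"
        using D[of "2 * L" s] by blast
    qed
    then show ?thesis by (simp add: h0)
  qed
  ultimately have "h x \<bullet> h x \<le> 0"
    by (cases "x \<ge> 0") (auto simp: mult_le_0_iff)
  then show ?thesis by (metis inner_ge_zero inner_eq_zero_iff order_antisym)
qed

text \<open>Solvability of the periodic boundary value problem reduces to uniqueness, because the
  shooting map is affine on a finite-dimensional space.\<close>

lemma periodic_linear_ode:
  fixes A :: "real \<Rightarrow> 'a::euclidean_space \<Rightarrow> 'a"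
  assumes lin: "\<And>x. linear (A x)" and L: "L > 0" "\<And>x y. norm (A x y) \<le> L * norm y"
    and cA: "continuous_on UNIV (\<lambda>p. A (fst p) (snd p))"
    and g: "continuous_on UNIV g" "\<And>x. norm (g x) \<le> C"
    and per: "\<And>x. A (x + M) = A x" "\<And>x. g (x + M) = g x"
    and inj: "\<And>y. (\<And>x. (y has_vector_derivative A x (y x)) (at x)) \<Longrightarrow> y M = y 0 \<Longrightarrow> y 0 = 0"
  shows "\<exists>y. (\<forall>x. (y has_vector_derivative A x (y x) + g x) (at x)) \<and> (\<forall>x. y (x + M) = y x)"
proof -
  have ex: "\<exists>y. y 0 = y0 \<and> (\<forall>x. (y has_vector_derivative A x (y x) + k *\<^sub>R g x) (at x))" for y0 k
  proof (rule linear_growth_ode_exists[OF L(1)])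
    show "norm (A x y + k *\<^sub>R g x - (A x z + k *\<^sub>R g x)) \<le> L * norm (y - z)" for x y z
      using L(2)[of x "y - z"] linear_diff[OF lin, of x y z] by simp
    show "continuous_on UNIV (\<lambda>p. A (fst p) (snd p) + k *\<^sub>R g (fst p))"
      by (intro continuous_intros cA continuous_on_compose2[OF g(1)]) auto
    show "norm (A x 0 + k *\<^sub>R g x) \<le> \<bar>k\<bar> * C" for x
      using g(2)[of x] linear_0[OF lin, of x] by (simp add: mult_left_mono)
  qed
  have uniq: "y = z" if "y 0 = z 0" "\<And>x. (y has_vector_derivative A x (y x) + f x) (at x)" 
      "\<And>x. (z has_vector_derivative A x (z x) + f x) (at x)" for y z f
  proof
    fix x
    have "(\<lambda>x. y x - z x) x = 0"
    proof (rule ode_unique_zero)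
      show "((\<lambda>x. y x - z x) has_vector_derivative A x (y x - z x)) (at x)" for x
        using has_vector_derivative_diff[OF that(2,3), of x] linear_diff[OF lin, of x] by simp
      show "norm (A x (y x - z x)) \<le> L * norm (y x - z x)" for x by (rule L)
    qed (use that in simp)
    then show "y x = z x" by simp
  qed
  \<comment> \<open>The solution operator of the homogeneous system and one particular solution G;
    the boundary condition becomes a linear equation for the initial value.\<close>
  obtain S where S: "\<And>y0. S y0 0 = y0" "\<And>y0 x. (S y0 has_vector_derivative A x (S y0 x)) (at x)"
    using ex[of _ 0] by simp metis
  obtain G where G: "G 0 = 0" "\<And>x. (G has_vector_derivative A x (G x) + g x) (at x)"
    using ex[of 0 1] by auto
  have S0: "(S y0 has_vector_derivative A x (S y0 x) + 0) (at x)" for y0 x using S(2) by simp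
  have "linear (\<lambda>y0. S y0 M - y0)"
  proof (rule linearI)
    fix p q
    have "S (p + q) = (\<lambda>x. S p x + S q x)"
    proof (rule uniq[OF _ S0])
      show "((\<lambda>x. S p x + S q x) has_vector_derivative A x (S p x + S q x) + 0) (at x)" for x
        using has_vector_derivative_add[OF S(2) S(2), of p q x] linear_add[OF lin, of x] by simp
    qed (simp add: S)
    then show "S (p + q) M - (p + q) = (S p M - p) + (S q M - q)" by simp
  next
    fix r p
    have "S (r *\<^sub>R p) = (\<lambda>x. r *\<^sub>R S p x)"
    proof (rule uniq[OF _ S0])
      show "((\<lambda>x. r *\<^sub>R S p x) has_vector_derivative A x (r *\<^sub>R S p x) + 0) (at x)" for x
        using bounded_linear.has_vector_derivative[OF bounded_linear_scaleR_right S(2)[of p x], of r] linear_scale[OF lin, of x] by simp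
    qed (simp add: S)
    then show "S (r *\<^sub>R p) M - r *\<^sub>R p = r *\<^sub>R (S p M - p)" by (simp add: scaleR_diff_right)
  qed
  moreover have "inj (\<lambda>y0. S y0 M - y0)"
    unfolding linear_injective_0[OF \<open>linear (\<lambda>y0. S y0 M - y0)\<close>]
    using inj[OF S(2)] S(1) by auto
  ultimately have "surj (\<lambda>y0. S y0 M - y0)" by (rule linear_inj_imp_surj)
  then obtain y0 where y0: "- G M = S y0 M - y0" unfolding surj_def by blast
  define y where "y = (\<lambda>x. S y0 x + G x)"
  have yD: "(y has_vector_derivative A x (y x) + g x) (at x)" for x
    unfolding y_def using has_vector_derivative_add[OF S(2) G(2), of y0 x] linear_add[OF lin, of x] by (simp add: add.assoc)
  have "y M = S y0 M + G M" by (simp add: y_def)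
  also have "\<dots> = S y0 M - (S y0 M - y0)" unfolding y0[symmetric] by simp
  finally have yM: "y M = y 0" by (simp add: y_def S G)
  \<comment> \<open>The shifted solution solves the same system with the same value at 0, so equal
    end values already give periodicity on the whole line.\<close>
  have "(\<lambda>x. y (x + M)) = y"
  proof (rule uniq[OF _ _ yD])
    show "((\<lambda>x. y (x + M)) has_vector_derivative A x (y (x + M)) + g x) (at x)" for x
    proof -
      have "((\<lambda>x. x + M) has_real_derivative 1) (at x)" by (rule derivative_eq_intros refl)+ simp
      from vector_diff_chain_at[OF this[unfolded has_real_derivative_iff_has_vector_derivative] yD]
      show ?thesis using per by (simp add: o_def)
    qed
  qed (use yM in simp)
  then show ?thesis using yD by (metis (no_types))
qed

section \<open>The periodic third order problem\<close>

lemma Cd_raise: "Cd 3 u \<Longrightarrow> Cd k ((deriv ^^ 3) u) \<Longrightarrow> Cd (k + 3) u"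
  by (simp add: eval_nat_numeral Cd_Suc)

lemma has_vector_derivative_fst: "(y has_vector_derivative d) F \<Longrightarrow> ((\<lambda>x. fst (y x)) has_vector_derivative fst d) F"
  by (rule bounded_linear.has_vector_derivative[OF bounded_linear_fst])

lemma has_vector_derivative_snd: "(y has_vector_derivative d) F \<Longrightarrow> ((\<lambda>x. snd (y x)) has_vector_derivative snd d) F"
  by (rule bounded_linear.has_vector_derivative[OF bounded_linear_snd])

context coef begin

text \<open>The energy inequality of order zero bounds the weighted energy by \<tau>
  (\<open>Ybound\<close> R + R) times itself, so it vanishes; by continuity u vanishes
  pointwise.\<close>

lemma homogeneous_zero:
  assumes \<tau>: "\<tau> > 0" "\<tau> * (Ybound R + R) < 1"
    and u: "\<And>x. (u has_real_derivative v x) (at x)" "\<And>x. (v has_real_derivative w x) (at x)" "\<And>x. (w has_real_derivative z x) (at x)"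
    and cz: "continuous_on UNIV z" and per: "u M = u 0" "v M = v 0" "w M = w 0"
    and eq: "\<And>x. u x = \<tau> * (a x * z x + b x * w x + c x * v x + d x * u x)"
    and x: "x \<in> {0..M}"
  shows "u x = 0"
proof -
  let ?W = "wt M 0 a b"
  have cu: "continuous_on {0..M} u" "continuous_on {0..M} v" "continuous_on {0..M} w" "continuous_on {0..M} z"
    by (rule DERIV_continuous_on[OF has_field_derivative_at_within[OF u(1)]] DERIV_continuous_on[OF has_field_derivative_at_within[OF u(2)]]
        DERIV_continuous_on[OF has_field_derivative_at_within[OF u(3)]] continuous_on_subset[OF cz subset_UNIV])+
  have cd: "continuous_on {0..M} c" "continuous_on {0..M} d" using Cd_continuous_on[OF Cd_coefs(3), of 0] Cd_continuous_on[OF Cd_coefs(4), of 0] by auto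
  let ?T = "\<lambda>x. a x * z x + b x * w x + c x * v x"
  have Tc: "continuous_on {0..M} ?T" by (intro continuous_intros a_cont cu cd)
  have dc: "continuous_on {0..M} (\<lambda>x. d x * u x)" by (intro continuous_intros cu cd)
  have e1: "I M (\<lambda>x. ?W x * (u x * ?T x)) \<le> Ybound R * I M (\<lambda>x. ?W x * (u x)\<^sup>2)"
    using energy_core[of 0 u v w z] u per cu(4) by (simp add: has_field_derivative_at_within numeral_2_eq_2)
  have e2: "I M (\<lambda>x. ?W x * (u x * (d x * u x))) \<le> I M (\<lambda>x. R * (?W x * (u x)\<^sup>2))"
  proof (rule I_mono)
    show "set_integrable lborel {0..M} (\<lambda>x. ?W x * (u x * (d x * u x)))" by (rule wt_sq_integrable(1)[OF cu(1) dc])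
    show "set_integrable lborel {0..M} (\<lambda>x. R * (?W x * (u x)\<^sup>2))" using wt_sq_integrable(2)[OF cu(1) cu(1)] by simp
    show "?W x * (u x * (d x * u x)) \<le> R * (?W x * (u x)\<^sup>2)" for x
    proof -
      have "d x * (?W x * (u x)\<^sup>2) \<le> R * (?W x * (u x)\<^sup>2)"
        using bd(4)[of 0 x] by (intro mult_right_mono) (auto simp: abs_le_iff)
      then show ?thesis by (simp add: power2_eq_square algebra_simps)
    qed
  qed
  let ?E = "I M (\<lambda>x. ?W x * (u x)\<^sup>2)"
  have "?W x * (u x)\<^sup>2 = \<tau> * (?W x * (u x * ?T x) + ?W x * (u x * (d x * u x)))" for x
    by (subst power2_eq_square, subst (2) eq) (simp add: algebra_simps)
  then have "?E = I M (\<lambda>x. \<tau> * (?W x * (u x * ?T x) + ?W x * (u x * (d x * u x))))" by presburger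
  also have "\<dots> = \<tau> * (I M (\<lambda>x. ?W x * (u x * ?T x)) + I M (\<lambda>x. ?W x * (u x * (d x * u x))))"
    using set_integral_add(2)[OF wt_sq_integrable(1)[OF cu(1) Tc, of 0] wt_sq_integrable(1)[OF cu(1) dc, of 0]] by simp
  also have "\<dots> \<le> \<tau> * (Ybound R * ?E + R * ?E)"
    using e1 e2 \<tau> by (intro mult_left_mono add_mono) auto
  finally have "(1 - \<tau> * (Ybound R + R)) * ?E \<le> 0" by (simp add: algebra_simps)
  then have "?E \<le> 0" using \<tau> by (simp add: mult_le_0_iff)
  then have E0: "?E = 0" using wt_sq_nonneg[of 0 u] by simp
  have "sq M (\<lambda>x. exp (eta M 0 a b x / 2) * u x)"
  proof (intro sq_continuous continuous_intros cu)
    have "continuous_on {0..M} (eta M 0 a b)" by (rule DERIV_continuous_on[OF eta_deriv])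
    then show "continuous_on {0..M} (eta M 0 a b)" .
  qed simp
  show ?thesis
  proof (rule ccontr)
    assume "u x \<noteq> 0"
    have "continuous_on {0..M} (\<lambda>x. ?W x * (u x)\<^sup>2)" by (intro continuous_intros wt_cont cu)
    moreover have "?E = integral {0..M} (\<lambda>x. ?W x * (u x)\<^sup>2)"
      by (rule set_borel_integral_eq_integral(2)[OF wt_sq_integrable(2)[OF cu(1) cu(1)]])
    ultimately have "?W x * (u x)\<^sup>2 = 0"
      using integral_eq_0_iff[of 0 M "\<lambda>x. ?W x * (u x)\<^sup>2"] E0 M x by auto
    with \<open>u x \<noteq> 0\<close> show False by simp
  qed
qed

text \<open>As a has no zeros, the equation can be solved for the third derivative and becomes a
  periodic first order system in three unknowns. \<open>homogeneous_zero\<close> supplies the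
  uniqueness on which its solvability rests.\<close>

lemma resolvent:
  assumes \<tau>: "\<tau> > 0" "\<tau> * (Ybound R + R) < 1" and f: "Ck M n f"
  shows "\<exists>u. Ck M (n + 3) u \<and> (\<forall>x. u x - \<tau> * Aop a b c d u x = f x)"
proof -
  define Q where "Q = (\<lambda>x (y :: real \<times> real \<times> real). (1 / a x) * (fst y / \<tau> - b x * snd (snd y) - c x * fst (snd y) - d x * fst y))"
  define A where "A = (\<lambda>x (y :: real \<times> real \<times> real). (fst (snd y), snd (snd y), Q x y))"
  define g where "g = (\<lambda>x. (0::real, 0::real, - (1 / a x) * (f x / \<tau>)))"
  define L where "L = 2 + R * (1 / \<tau> + R + R + R)"
  have fC: "Cd n f" "periodic M f" using f by (auto simp: Ck_iff)
  have ctsU: "continuous_on UNIV f" "continuous_on UNIV a" "continuous_on UNIV b" "continuous_on UNIV c" "continuous_on UNIV d"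
    using Cd_continuous_on[OF fC(1), of 0] Cd_continuous_on[OF Cd_coefs(1), of 0] Cd_continuous_on[OF Cd_coefs(2), of 0]
      Cd_continuous_on[OF Cd_coefs(3), of 0] Cd_continuous_on[OF Cd_coefs(4), of 0] by auto
  have Pa: "a (x + M) = a x" "b (x + M) = b x" "c (x + M) = c x" "d (x + M) = d x" "f (x + M) = f x" for x
    using a b c d f by (auto simp: Ck_iff periodic_def)
  have nQ: "\<bar>Q x y\<bar> \<le> R * (1 / \<tau> + R + R + R) * norm y" for x y
  proof -
    have n1: "\<bar>fst y\<bar> \<le> norm y" "\<bar>fst (snd y)\<bar> \<le> norm y" "\<bar>snd (snd y)\<bar> \<le> norm y"
      using norm_fst_le[of "fst y" "snd y"] norm_snd_le[of "snd y" "fst y"] norm_fst_le[of "fst (snd y)" "snd (snd y)"] norm_snd_le[of "snd (snd y)" "fst (snd y)"]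
      by auto
    have "\<bar>Q x y\<bar> \<le> R * (1 / \<tau> * norm y + R * norm y + R * norm y + R * norm y)"
      unfolding Q_def
      using bd(2)[of 0 x] bd(3)[of 0 x] bd(4)[of 0 x] n1 \<tau>
      by (intro abs_mult_bound a0(2) abs_diff_bound) (auto simp: divide_right_mono)
    then show ?thesis by (simp add: algebra_simps)
  qed
  have R0: "R > 0" using R4 by simp
    obtain Cf where Cf: "\<And>x. x \<in> {0..M} \<Longrightarrow> \<bar>- (1 / a x) * (f x / \<tau>)\<bar> \<le> Cf"
    proof (rule continuous_on_Icc_bounded)
      show "continuous_on {0..M} (\<lambda>x. - (1 / a x) * (f x / \<tau>))"
        using a0(1) \<tau> by (intro continuous_intros continuous_on_subset[OF ctsU(1)] a_cont) auto
    qed blast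
  have "\<exists>y. (\<forall>x. (y has_vector_derivative A x (y x) + g x) (at x)) \<and> (\<forall>x. y (x + M) = y x)"
  proof (rule periodic_linear_ode)
    show "linear (A x)" for x
      by (rule linearI) (auto simp: A_def Q_def algebra_simps add_divide_distrib)
    show "L > 0" unfolding L_def using R0 \<tau>(1) by (simp add: add_pos_nonneg)
    show "norm (A x y) \<le> L * norm y" for x y
    proof -
      have n1: "\<bar>fst (snd y)\<bar> \<le> norm y" "\<bar>snd (snd y)\<bar> \<le> norm y"
        using norm_snd_le[of "snd y" "fst y"] norm_fst_le[of "fst (snd y)" "snd (snd y)"] norm_snd_le[of "snd (snd y)" "fst (snd y)"]
        by auto
      have "norm (A x y) \<le> \<bar>fst (snd y)\<bar> + (\<bar>snd (snd y)\<bar> + \<bar>Q x y\<bar>)"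
        unfolding A_def using norm_Pair_le[of "fst (snd y)" "(snd (snd y), Q x y)"] norm_Pair_le[of "snd (snd y)" "Q x y"] by simp
      then show ?thesis using n1 nQ[of x y] by (simp add: L_def algebra_simps)
    qed
    show "continuous_on UNIV (\<lambda>p. A (fst p) (snd p))"
      unfolding A_def Q_def using a0(1) \<tau>
      by (intro continuous_intros continuous_on_compose2[OF ctsU(2)] continuous_on_compose2[OF ctsU(3)] continuous_on_compose2[OF ctsU(4)] continuous_on_compose2[OF ctsU(5)]) auto
    show "continuous_on UNIV g" unfolding g_def using a0(1) \<tau> by (intro continuous_intros ctsU) auto
    show "norm (g x) \<le> Cf" for x
    proof -
      have p: "periodic M (\<lambda>x. - (1 / a x) * (f x / \<tau>))" using Pa by (simp add: periodic_def)
      \<comment> \<open>Reduction modulo M carries the bound on the inhomogeneity from [0, M] to the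
        whole line.\<close>
      define x' where "x' = x - M * of_int \<lfloor>x / M\<rfloor>"
      have "x' \<in> {0..M}"
      proof -
        show ?thesis using floor_divide_lower[OF M(1), of x] floor_divide_upper[OF M(1), of x]
          by (simp add: x'_def algebra_simps)
      qed
      moreover have pp: "h x' = h x" if "periodic M h" for h :: "real \<Rightarrow> real"
      proof -
        have nn: "h (y + M * real k) = h y" for y k
        proof (induction k)
          case (Suc k)
          have "h (y + M * real (Suc k)) = h ((y + M * real k) + M)" by (simp add: algebra_simps)
          then show ?case using that Suc by (simp add: periodic_def)
        qed simp
        show ?thesis
        proof (cases "\<lfloor>x / M\<rfloor> \<ge> 0")
          case True then show ?thesis using nn[of x' "nat \<lfloor>x / M\<rfloor>"] by (simp add: x'_def)
        next
          case False then show ?thesis using nn[of x "nat (- \<lfloor>x / M\<rfloor>)"] by (simp add: x'_def)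
        qed
      qed
      ultimately have "\<bar>- (1 / a x) * (f x / \<tau>)\<bar> \<le> Cf" using Cf[of x'] unfolding pp[OF p] by blast
      moreover have "norm (0::real, 0::real, r) = \<bar>r\<bar>" for r :: real by (simp add: norm_Pair)
      ultimately show ?thesis unfolding g_def by presburger
    qed
    show "A (x + M) = A x" "g (x + M) = g x" for x using Pa by (auto simp: A_def Q_def g_def)
    fix y assume y: "\<And>x. (y has_vector_derivative A x (y x)) (at x)" and yM: "y M = y 0"
    let ?u = "\<lambda>x. fst (y x)" and ?v = "\<lambda>x. fst (snd (y x))" and ?w = "\<lambda>x. snd (snd (y x))"
    have D: "(?u has_real_derivative ?v x) (at x)" "(?v has_real_derivative ?w x) (at x)" "(?w has_real_derivative Q x (y x)) (at x)" for x
      using has_vector_derivative_fst[OF y[of x]] has_vector_derivative_fst[OF has_vector_derivative_snd[OF y[of x]]] has_vector_derivative_snd[OF has_vector_derivative_snd[OF y[of x]]]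
      by (auto simp: A_def has_real_derivative_iff_has_vector_derivative)
    have cy: "continuous_on UNIV ?u" "continuous_on UNIV ?v" "continuous_on UNIV ?w"
      by (auto intro: DERIV_continuous_on D)
    have cQ: "continuous_on UNIV (\<lambda>x. Q x (y x))"
      unfolding Q_def using a0(1) \<tau> by (intro continuous_intros ctsU cy) auto
    have eq: "?u x = \<tau> * (a x * Q x (y x) + b x * ?w x + c x * ?v x + d x * ?u x)" for x
      using a0(1)[of x] \<tau> by (simp add: Q_def field_simps)
    have u0: "?u x = 0" if "x \<in> {0..M}" for x
      using homogeneous_zero[OF \<tau> D cQ _ _ _ eq that] yM by simp
    \<comment> \<open>u is known to vanish on [0, M] only, so its derivatives vanish in the interior
      first and then at 0 by continuity.\<close>
    have v0: "?v x = 0" if "x \<in> {0<..<M}" for x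
    proof -
      have "((\<lambda>x. 0) has_real_derivative ?v x) (at x)"
        by (rule has_field_derivative_transform_within_open[OF D(1) open_greaterThanLessThan[of 0 M]]) (use u0 that in auto)
      then show ?thesis by (metis DERIV_const DERIV_unique)
    qed
    have w0: "?w x = 0" if "x \<in> {0<..<M}" for x
    proof -
      have "((\<lambda>x. 0) has_real_derivative ?w x) (at x)"
        by (rule has_field_derivative_transform_within_open[OF D(2) open_greaterThanLessThan[of 0 M]]) (use v0 that in auto)
      then show ?thesis by (metis DERIV_const DERIV_unique)
    qed
    have cl: "closure {0<..<M} = {0..M}" using M by (simp add: closure_greaterThanLessThan)
    have "?v 0 = 0" "?w 0 = 0"
      using continuous_constant_on_closure[of "{0<..<M}" ?v 0 0] continuous_constant_on_closure[of "{0<..<M}" ?w 0 0] v0 w0 M cy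
      by (auto simp: cl intro: continuous_on_subset)
    with u0[of 0] M show "y 0 = 0" by (simp add: prod_eq_iff)
  qed
  then obtain y where y: "\<And>x. (y has_vector_derivative A x (y x) + g x) (at x)" and yM: "\<And>x. y (x + M) = y x" by blast
  define u where "u = (\<lambda>x. fst (y x))"
  define v where "v = (\<lambda>x. fst (snd (y x)))"
  define w where "w = (\<lambda>x. snd (snd (y x)))"
  define z where "z = (\<lambda>x. (1 / a x) * (((1 / \<tau>) * (u x - f x)) - b x * w x - c x * v x - d x * u x))"
  have D: "(u has_real_derivative v x) (at x)" "(v has_real_derivative w x) (at x)" "(w has_real_derivative z x) (at x)" for x
  proof -
    have "Q x (y x) + (- (1 / a x) * (f x / \<tau>)) = z x" by (simp add: Q_def z_def u_def v_def w_def algebra_simps diff_divide_distrib)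
    then show "(u has_real_derivative v x) (at x)" "(v has_real_derivative w x) (at x)" "(w has_real_derivative z x) (at x)"
      using has_vector_derivative_fst[OF y[of x]] has_vector_derivative_fst[OF has_vector_derivative_snd[OF y[of x]]] has_vector_derivative_snd[OF has_vector_derivative_snd[OF y[of x]]]
      by (auto simp: A_def g_def u_def[abs_def] v_def[abs_def] w_def[abs_def] has_real_derivative_iff_has_vector_derivative)
  qed
  have der: "deriv u = v" "deriv v = w" "deriv w = z" by (rule ext, rule DERIV_imp_deriv, rule D)+
  have der3: "(deriv ^^ 2) u = w" "(deriv ^^ 3) u = z" by (simp_all add: eval_nat_numeral der)
  have cu: "continuous_on UNIV u" "continuous_on UNIV v" "continuous_on UNIV w"
    by (auto intro: DERIV_continuous_on D)
  have cz: "continuous_on UNIV z" unfolding z_def using a0(1) \<tau> by (intro continuous_intros ctsU cu) auto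
  have C3: "Cd 3 u"
    using D cz by (auto simp: eval_nat_numeral Cd_Suc Cd_0 der real_differentiable_def)
  \<comment> \<open>Bootstrapping: the equation expresses z by u, v, w and f, so m + 3 derivatives
    of u give m + 1 derivatives of z.\<close>
  have "m \<le> n \<Longrightarrow> Cd (m + 3) u" for m
  proof (induction m)
    case 0 then show ?case using C3 by simp
  next
    case (Suc m)
    then have IH: "Cd (m + 3) u" by simp
    have k: "Cd (Suc m) u" "Cd (Suc m) v" "Cd (Suc m) w"
      using Cd_mono[OF IH, of "Suc m"] Cd_deriv[of "Suc m" 1 u] Cd_mono[OF IH, of "Suc m + 1"] Cd_deriv[of "Suc m" 2 u] Cd_mono[OF IH, of "Suc m + 2"]
      by (auto simp: der der3)
    have cf: "Cd (Suc m) a" "Cd (Suc m) b" "Cd (Suc m) c" "Cd (Suc m) d" "Cd (Suc m) f"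
      using Cd_coefs fC(1) Suc.prems by (auto elim!: Cd_mono)
    have "Cd (Suc m) z" unfolding z_def
      using a0(1) by (intro Cd_mult Cd_diff Cd_inverse Cd_const k cf) auto
    then show ?case using Cd_raise[OF C3, of "Suc m"] by (simp add: der3)
  qed
  from this[of n] have "Ck M (n + 3) u" using yM by (simp add: Ck_iff periodic_def u_def)
  moreover have "u x - \<tau> * Aop a b c d u x = f x" for x
    using a0(1)[of x] \<tau> by (simp add: Aop_def der der3 z_def field_simps)
  ultimately show ?thesis by blast
qed

end

section \<open>The implicit Euler scheme\<close>

text \<open>\<open>eta_lipschitz\<close> produces 2 R^5 from the logarithm and (8/3) R^5 from the
  primitive and the mean.\<close>

definition LL :: "real \<Rightarrow> real" where "LL R = 6 * R ^ 5"

text \<open>Under the root: exp (\<open>Hbound\<close> R) for passing from the weighted to the plain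
  norm, the Gronwall factor over a time at most R, 1 + R for initial energy plus source, and the
  energy of data of size one.\<close>

definition KB :: "real \<Rightarrow> real" where
  "KB R = sqrt (exp (Hbound R) * (exp ((LL R + 2 * CS R) * R) * ((1 + R) * ((R + 1) * exp (Hbound R)))))"

lemma ln_diff_le:
  fixes p q :: real
  assumes "p > 0" "q > 0" "1 / q \<le> C"
  shows "ln p - ln q \<le> C * \<bar>p - q\<bar>"
proof -
  have "ln p - ln q = ln (p / q)" using assms by (simp add: ln_div)
  also have "\<dots> \<le> p / q - 1" using assms by (intro ln_le_minus_one) auto
  also have "\<dots> = 1 / q * (p - q)" using assms by (simp add: field_simps)
  also have "\<dots> \<le> 1 / q * \<bar>p - q\<bar>" using assms by (intro mult_left_mono) auto
  also have "\<dots> \<le> C * \<bar>p - q\<bar>" using assms by (intro mult_right_mono) auto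
  finally show ?thesis .
qed

lemma ln_abs_diff_le:
  fixes p q :: real
  assumes "p > 0" "q > 0" "1 / p \<le> C" "1 / q \<le> C"
  shows "\<bar>ln p - ln q\<bar> \<le> C * \<bar>p - q\<bar>"
  using ln_diff_le[OF assms(1,2,4)] ln_diff_le[OF assms(2,1,3)] by (simp add: abs_minus_commute abs_le_iff)

text \<open>For \<tau> C at most 1/2 the inverse of 1 - \<tau> C is at most exp (2 \<tau> C). The
  factor exp (L \<tau>) is the price of changing the weight between two time steps.\<close>

lemma discrete_Gronwall:
  fixes y :: "nat \<Rightarrow> real"
  assumes step: "\<And>k. k < N \<Longrightarrow> (1 - \<tau> * C) * y (Suc k) \<le> exp (L * \<tau>) * y k + \<tau> * A"
    and \<tau>: "\<tau> \<ge> 0" "\<tau> * C \<le> 1/2" "C \<ge> 0" "L \<ge> 0" "A \<ge> 0" and y: "\<And>k. y k \<ge> 0" and k: "k \<le> N"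
  shows "y k \<le> exp ((L + 2 * C) * (real k * \<tau>)) * (y 0 + real k * \<tau> * A)"
  using k
proof (induction k)
  case 0 then show ?case by simp
next
  case (Suc k)
  have e1: "1 \<le> exp (2 * (\<tau> * C)) * (1 - \<tau> * C)"
  proof -
    have "1 \<le> (1 + 2 * (\<tau> * C)) * (1 - \<tau> * C)"
    proof -
      have "0 \<le> \<tau> * C * (1 - 2 * (\<tau> * C))" using \<tau> by (intro mult_nonneg_nonneg) auto
      then show ?thesis by (simp add: algebra_simps)
    qed
    also have "\<dots> \<le> exp (2 * (\<tau> * C)) * (1 - \<tau> * C)"
      using \<tau> by (intro mult_right_mono exp_ge_add_one_self) auto
    finally show ?thesis .
  qed
  have "y (Suc k) * 1 \<le> y (Suc k) * (exp (2 * (\<tau> * C)) * (1 - \<tau> * C))"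
    by (rule mult_left_mono[OF e1 y])
  also have "\<dots> = exp (2 * (\<tau> * C)) * ((1 - \<tau> * C) * y (Suc k))" by simp
  also have "\<dots> \<le> exp (2 * (\<tau> * C)) * (exp (L * \<tau>) * y k + \<tau> * A)"
    using step[of k] Suc.prems by (intro mult_left_mono) auto
  also have "\<dots> \<le> exp (2 * (\<tau> * C)) * (exp (L * \<tau>) * y k + exp (L * \<tau>) * (\<tau> * A))"
  proof -
    have "1 * (\<tau> * A) \<le> exp (L * \<tau>) * (\<tau> * A)" using \<tau> by (intro mult_right_mono) auto
    then show ?thesis by (intro mult_left_mono) auto
  qed
  also have "\<dots> = exp ((L + 2 * C) * \<tau>) * (y k + \<tau> * A)"
  proof -
    have ee: "exp ((L + 2 * C) * \<tau>) = exp (2 * (\<tau> * C)) * exp (L * \<tau>)"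
      unfolding exp_add[symmetric] by (simp add: algebra_simps)
    show ?thesis unfolding ee by (simp add: algebra_simps)
  qed
  also have "\<dots> \<le> exp ((L + 2 * C) * \<tau>) * (exp ((L + 2 * C) * (real k * \<tau>)) * (y 0 + real k * \<tau> * A) + exp ((L + 2 * C) * (real k * \<tau>)) * (\<tau> * A))"
  proof (intro mult_left_mono add_mono)
    show "y k \<le> exp ((L + 2 * C) * (real k * \<tau>)) * (y 0 + real k * \<tau> * A)" using Suc by simp
    have "1 * (\<tau> * A) \<le> exp ((L + 2 * C) * (real k * \<tau>)) * (\<tau> * A)" using \<tau> by (intro mult_right_mono) auto
    then show "\<tau> * A \<le> exp ((L + 2 * C) * (real k * \<tau>)) * (\<tau> * A)" by simp
  qed simp
  also have "\<dots> = (exp ((L + 2 * C) * \<tau>) * exp ((L + 2 * C) * (real k * \<tau>))) * (y 0 + real (Suc k) * \<tau> * A)"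
    by (simp add: algebra_simps)
  also have "exp ((L + 2 * C) * \<tau>) * exp ((L + 2 * C) * (real k * \<tau>)) = exp ((L + 2 * C) * (real (Suc k) * \<tau>))"
    by (simp add: exp_add[symmetric] algebra_simps)
  finally show ?case by simp
qed

text \<open>Of the time derivatives of a and b only Lipschitz bounds survive, which is what the
  weights need. Joint continuity serves the passage to the limit and the measurability of the
  operator applied to a solution.\<close>

locale adm =
  fixes R M T :: real and n :: nat and a b c d :: "real \<Rightarrow> real \<Rightarrow> real"
  assumes T: "T > 0" "T \<le> R"
    and coefs: "\<And>t. t \<in> {0..T} \<Longrightarrow> coef R M n (\<lambda>x. a x t) (\<lambda>x. b x t) (\<lambda>x. c x t) (\<lambda>x. d x t)"
    and lip: "\<And>x s t. s \<in> {0..T} \<Longrightarrow> t \<in> {0..T} \<Longrightarrow> \<bar>a x t - a x s\<bar> \<le> R * \<bar>t - s\<bar>"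
      "\<And>x s t. s \<in> {0..T} \<Longrightarrow> t \<in> {0..T} \<Longrightarrow> \<bar>b x t - b x s\<bar> \<le> R * \<bar>t - s\<bar>"
    and joint: "continuous_on ({0..M} \<times> {0..T}) (\<lambda>p. a (fst p) (snd p))" "continuous_on ({0..M} \<times> {0..T}) (\<lambda>p. b (fst p) (snd p))"
      "continuous_on ({0..M} \<times> {0..T}) (\<lambda>p. c (fst p) (snd p))" "continuous_on ({0..M} \<times> {0..T}) (\<lambda>p. d (fst p) (snd p))"
begin

lemma coef0: "coef R M n (\<lambda>x. a x 0) (\<lambda>x. b x 0) (\<lambda>x. c x 0) (\<lambda>x. d x 0)"
  using T by (intro coefs) auto

lemmas M = coef.M[OF coef0] and n = coef.n[OF coef0] and R4 = coef.R4[OF coef0]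

abbreviation "AA t \<equiv> Aop (\<lambda>x. a x t) (\<lambda>x. b x t) (\<lambda>x. c x t) (\<lambda>x. d x t)"
abbreviation "W t j \<equiv> wt M j (\<lambda>x. a x t) (\<lambda>x. b x t)"
abbreviation "EE t u \<equiv> En M n (\<lambda>x. a x t) (\<lambda>x. b x t) (\<lambda>i. (deriv ^^ i) u)"

section \<open>Dependence of the weights on time\<close>

lemma eta_lipschitz:
  assumes s: "s \<in> {0..T}" and t: "t \<in> {0..T}" and j: "j \<le> n" and x: "x \<in> {0..M}"
  shows "\<bar>eta M j (\<lambda>x. a x t) (\<lambda>x. b x t) x - eta M j (\<lambda>x. a x s) (\<lambda>x. b x s) x\<bar> \<le> LL R * \<bar>t - s\<bar>"
proof -
  interpret s: coef R M n "\<lambda>x. a x s" "\<lambda>x. b x s" "\<lambda>x. c x s" "\<lambda>x. d x s" by (rule coefs[OF s])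
  interpret t: coef R M n "\<lambda>x. a x t" "\<lambda>x. b x t" "\<lambda>x. c x t" "\<lambda>x. d x t" by (rule coefs[OF t])
  let ?h = "\<bar>t - s\<bar>"
  have R0: "R \<ge> 0" using R4 by simp
  have A: "\<bar>a x t\<bar> \<le> R" "\<bar>a x s\<bar> \<le> R" "\<bar>b x t\<bar> \<le> R" "\<bar>b x s\<bar> \<le> R" "\<bar>1 / a x t\<bar> \<le> R" "\<bar>1 / a x s\<bar> \<le> R" "a x t \<noteq> 0" "a x s \<noteq> 0" for x
    using s.bd(1)[of 0 x] t.bd(1)[of 0 x] s.bd(2)[of 0 x] t.bd(2)[of 0 x] s.a0[of x] t.a0[of x] by auto
  have l: "\<bar>ln ((a x t)\<^sup>2) - ln ((a x s)\<^sup>2)\<bar> \<le> (R * R) * ((R + R) * (R * ?h))"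
  proof -
    have inv: "1 / z\<^sup>2 \<le> R * R" if "\<bar>1 / z\<bar> \<le> R" for z :: real
    proof -
      have "1 / z\<^sup>2 = \<bar>1 / z\<bar> * \<bar>1 / z\<bar>" by (simp add: power2_eq_square abs_mult_self)
      also have "\<dots> \<le> R * R" using that R0 by (intro mult_mono) auto
      finally show ?thesis .
    qed
    have "\<bar>ln ((a x t)\<^sup>2) - ln ((a x s)\<^sup>2)\<bar> \<le> (R * R) * \<bar>(a x t)\<^sup>2 - (a x s)\<^sup>2\<bar>"
      using A inv by (intro ln_abs_diff_le) auto
    also have "\<dots> \<le> (R * R) * ((R + R) * (R * ?h))"
    proof (rule mult_left_mono)
      have "(a x t)\<^sup>2 - (a x s)\<^sup>2 = (a x t + a x s) * (a x t - a x s)" by (simp add: power2_eq_square algebra_simps)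
      then show "\<bar>(a x t)\<^sup>2 - (a x s)\<^sup>2\<bar> \<le> (R + R) * (R * ?h)"
        by (simp only:) (intro abs_mult_bound abs_add_bound A lip s t)
    qed (use R0 in simp)
    finally show ?thesis .
  qed
  have q: "\<bar>b x t / a x t - b x s / a x s\<bar> \<le> 2 * R ^ 4 * ?h" for x
  proof -
    have "b x t / a x t - b x s / a x s = (b x t - b x s) * (1 / a x t) - b x s * (a x t - a x s) * ((1 / a x t) * (1 / a x s))"
      using A[of x] by (simp add: field_simps)
    then have "\<bar>b x t / a x t - b x s / a x s\<bar> \<le> R * ?h * R + R * (R * ?h) * (R * R)"
      by (simp only:) (intro abs_mult_bound abs_diff_bound A lip s t)
    also have "\<dots> \<le> 2 * R ^ 4 * ?h"
    proof -
      have "R ^ 2 \<le> R ^ 4" using R4 by (intro power_increasing) auto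
      then have "R ^ 2 * ?h \<le> R ^ 4 * ?h" by (intro mult_right_mono) auto
      then show ?thesis by (simp add: eval_nat_numeral algebra_simps)
    qed
    finally show ?thesis .
  qed
  have P: "\<bar>prim (\<lambda>y. b y t / a y t) z - prim (\<lambda>y. b y s / a y s) z\<bar> \<le> z * (2 * R ^ 4 * ?h)" if "z \<in> {0..M}" for z
  proof -
    have i: "set_integrable lborel {0..z} (\<lambda>y. b y t / a y t)" "set_integrable lborel {0..z} (\<lambda>y. b y s / a y s)"
      by (intro borel_integrable_atLeastAtMost' s.quot_cont t.quot_cont)+
    then have "prim (\<lambda>y. b y t / a y t) z - prim (\<lambda>y. b y s / a y s) z = prim (\<lambda>y. b y t / a y t - b y s / a y s) z"
      by simp
    moreover have "\<bar>prim (\<lambda>y. b y t / a y t - b y s / a y s) z\<bar> \<le> z * (2 * R ^ 4 * ?h)"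
      using that q i by (intro I_abs_le) auto
    ultimately show ?thesis by (simp only:)
  qed
  have P1: "\<bar>prim (\<lambda>y. b y t / a y t) x - prim (\<lambda>y. b y s / a y s) x\<bar> \<le> R * (2 * R ^ 4 * ?h)"
    using order_trans[OF P[OF x] mult_right_mono[of x R]] x M by auto
  have m: "\<bar>mu M (\<lambda>x. a x t) (\<lambda>x. b x t) - mu M (\<lambda>x. a x s) (\<lambda>x. b x s)\<bar> \<le> 2 * R ^ 4 * ?h"
    using P[of M] M by (simp add: mu_def diff_divide_distrib[symmetric] abs_divide field_simps)
  have k: "\<bar>real j / 3 - 1 / 2\<bar> \<le> R" using s.real_le_R[OF j] R4 by (simp add: abs_le_iff)
  have xR: "\<bar>x\<bar> \<le> R" using x M by auto
  have "eta M j (\<lambda>x. a x t) (\<lambda>x. b x t) x - eta M j (\<lambda>x. a x s) (\<lambda>x. b x s) x =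
    (real j / 3 - 1 / 2) * (ln ((a x t)\<^sup>2) - ln ((a x s)\<^sup>2)) + 2/3 * ((prim (\<lambda>y. b y t / a y t) x - prim (\<lambda>y. b y s / a y s) x)
      - x * (mu M (\<lambda>x. a x t) (\<lambda>x. b x t) - mu M (\<lambda>x. a x s) (\<lambda>x. b x s)))"
    by (simp add: eta_def algebra_simps)
  then have "\<bar>eta M j (\<lambda>x. a x t) (\<lambda>x. b x t) x - eta M j (\<lambda>x. a x s) (\<lambda>x. b x s) x\<bar> \<le> R * ((R * R) * ((R + R) * (R * ?h))) + 2/3 * (R * (2 * R ^ 4 * ?h) + R * (2 * R ^ 4 * ?h))"
    by (simp only:) (intro abs_add_bound abs_mult_bound abs_diff_bound k l P1 m xR, simp)
  also have "\<dots> \<le> LL R * ?h"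
    using R0 by (simp add: LL_def eval_nat_numeral)
  finally show ?thesis .
qed

lemma LL_nonneg: "LL R \<ge> 0" using R4 by (simp add: LL_def)

text \<open>The multiplicative form compares the energy of one function at two times order by order,
  with exactly the factor that \<open>discrete_Gronwall\<close> expects.\<close>

lemma W_lipschitz:
  assumes "s \<in> {0..T}" "t \<in> {0..T}" "j \<le> n" "x \<in> {0..M}"
  shows "W t j x \<le> exp (LL R * \<bar>t - s\<bar>) * W s j x"
  using eta_lipschitz[OF assms] by (simp add: exp_add[symmetric] abs_le_iff)

lemma W_sq_integrable: "t \<in> {0..T} \<Longrightarrow> sq M f \<Longrightarrow> set_integrable lborel {0..M} (\<lambda>x. W t j x * (f x)\<^sup>2)"
proof -
  assume t: "t \<in> {0..T}" and f: "sq M f"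
  have "continuous_on {0..M} (W t j)" by (rule coef.wt_cont[OF coefs[OF t]])
  from sq_mult_integrable[OF sq_cmult_cont[OF this f] f] show ?thesis by (simp add: power2_eq_square mult.assoc)
qed

lemma W_sq_lipschitz:
  assumes s: "s \<in> {0..T}" and t: "t \<in> {0..T}" and j: "j \<le> n" and f: "sq M f"
  shows "I M (\<lambda>x. W t j x * (f x)\<^sup>2) \<le> exp (LL R * \<bar>t - s\<bar>) * I M (\<lambda>x. W s j x * (f x)\<^sup>2)"
proof -
  have "I M (\<lambda>x. W t j x * (f x)\<^sup>2) \<le> I M (\<lambda>x. exp (LL R * \<bar>t - s\<bar>) * (W s j x * (f x)\<^sup>2))"
  proof (rule I_mono)
    show "W t j x * (f x)\<^sup>2 \<le> exp (LL R * \<bar>t - s\<bar>) * (W s j x * (f x)\<^sup>2)" if "x \<in> {0..M}" for x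
      unfolding mult.assoc[symmetric] by (intro mult_right_mono W_lipschitz s t j that) simp
  qed (use W_sq_integrable[OF s f] W_sq_integrable[OF t f] in auto)
  then show ?thesis by simp
qed

lemma W_sq_bounds:
  assumes t: "t \<in> {0..T}" and j: "j \<le> n" and f: "sq M f"
  shows "I M (\<lambda>x. W t j x * (f x)\<^sup>2) \<le> exp (Hbound R) * (L2_norm M f)\<^sup>2"
    "(L2_norm M f)\<^sup>2 \<le> exp (Hbound R) * I M (\<lambda>x. W t j x * (f x)\<^sup>2)"
proof -
  interpret t: coef R M n "\<lambda>x. a x t" "\<lambda>x. b x t" "\<lambda>x. c x t" "\<lambda>x. d x t" by (rule coefs[OF t])
  have fi: "set_integrable lborel {0..M} (\<lambda>x. (f x)\<^sup>2)" using f by (simp add: sq_def)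
  have "I M (\<lambda>x. W t j x * (f x)\<^sup>2) \<le> I M (\<lambda>x. exp (Hbound R) * (f x)\<^sup>2)"
    using t.wt_bounds(1)[OF j] W_sq_integrable[OF t f] fi by (intro I_mono) (auto intro!: mult_right_mono)
  then show "I M (\<lambda>x. W t j x * (f x)\<^sup>2) \<le> exp (Hbound R) * (L2_norm M f)\<^sup>2" by (simp add: L2_norm_sq)
  have "I M (\<lambda>x. (f x)\<^sup>2) \<le> I M (\<lambda>x. exp (Hbound R) * (W t j x * (f x)\<^sup>2))"
  proof (rule I_mono)
    fix x assume x: "x \<in> {0..M}"
    have "1 \<le> exp (Hbound R) * W t j x" using t.wt_bounds(2)[OF j x] by (simp add: exp_minus field_simps)
    then show "(f x)\<^sup>2 \<le> exp (Hbound R) * (W t j x * (f x)\<^sup>2)"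
      using mult_right_mono[of 1 "exp (Hbound R) * W t j x" "(f x)\<^sup>2"] by (simp add: mult.assoc)
  qed (use W_sq_integrable[OF t f] fi in auto)
  then show "(L2_norm M f)\<^sup>2 \<le> exp (Hbound R) * I M (\<lambda>x. W t j x * (f x)\<^sup>2)" by (simp add: L2_norm_sq)
qed

lemma Ck_sq: "Ck M n u \<Longrightarrow> j \<le> n \<Longrightarrow> sq M ((deriv ^^ j) u)"
  using Hn_derivs_sq[OF Hn_derivs_classical[OF M(1)]] by blast

lemma EE_lipschitz:
  assumes s: "s \<in> {0..T}" and t: "t \<in> {0..T}" and u: "Ck M n u"
  shows "EE t u \<le> exp (LL R * \<bar>t - s\<bar>) * EE s u"
  unfolding En_def sum_distrib_left by (intro sum_mono W_sq_lipschitz s t Ck_sq u) auto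

lemma EE_le:
  assumes t: "t \<in> {0..T}" and u: "Ck M n u" and E: "\<And>j. j \<le> n \<Longrightarrow> L2_norm M ((deriv ^^ j) u) \<le> E"
  shows "EE t u \<le> (R + 1) * (exp (Hbound R) * E\<^sup>2)"
proof -
  have "EE t u \<le> (\<Sum>i\<le>n. exp (Hbound R) * E\<^sup>2)"
    unfolding En_def
  proof (rule sum_mono)
    fix i assume "i \<in> {..n}"
    then have i: "i \<le> n" by simp
    show "I M (\<lambda>x. W t i x * ((deriv ^^ i) u x)\<^sup>2) \<le> exp (Hbound R) * E\<^sup>2"
      by (rule order_trans[OF W_sq_bounds(1)[OF t i Ck_sq[OF u i]]]) (intro mult_left_mono power_mono E i L2_norm_nonneg, simp)
  qed
  also have "\<dots> = (real n + 1) * (exp (Hbound R) * E\<^sup>2)" by (simp add: add.commute)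
  also have "\<dots> \<le> (R + 1) * (exp (Hbound R) * E\<^sup>2)" using n by (intro mult_right_mono) auto
  finally show ?thesis .
qed

lemma L2_le_EE:
  assumes t: "t \<in> {0..T}" and u: "Ck M n u" and j: "j \<le> n"
  shows "(L2_norm M ((deriv ^^ j) u))\<^sup>2 \<le> exp (Hbound R) * EE t u"
proof (rule order_trans[OF W_sq_bounds(2)[OF t j Ck_sq[OF u j]]])
  show "exp (Hbound R) * I M (\<lambda>x. W t j x * ((deriv ^^ j) u x)\<^sup>2) \<le> exp (Hbound R) * EE t u"
    unfolding En_def using j coef.wt_sq_nonneg[OF coefs[OF t]]
    by (intro mult_left_mono member_le_sum[of j "{..n}" "\<lambda>j. I M (\<lambda>x. W t j x * ((deriv ^^ j) u x)\<^sup>2)"]) auto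
qed

lemma CS_nonneg: "CS R \<ge> 0"
  using coef.CL_nonneg[OF coef0] R4 by (simp add: CS_def)

lemma Ck_weaken: "Ck M (n + 3) u \<Longrightarrow> Ck M n u"
  by (auto simp: Ck_iff elim: Cd_mono)

text \<open>The point is that \<open>KB R\<close> does not involve N. The function g k stands for
  the source during step k, and the coefficients are taken at the new time.\<close>

lemma Rothe:
  assumes N: "N > 0" "T / real N * CS R \<le> 1/2" "T / real N * (Ybound R + R) < 1"
    and p: "Ck M n p" "\<And>j. j \<le> n \<Longrightarrow> L2_norm M ((deriv ^^ j) p) \<le> E"
    and g: "\<And>k. Ck M n (g k)" "\<And>k j. j \<le> n \<Longrightarrow> L2_norm M ((deriv ^^ j) (g k)) \<le> E"
  shows "\<exists>u. u 0 = p \<and> (\<forall>k\<le>N. Ck M n (u k) \<and> (\<forall>j\<le>n. L2_norm M ((deriv ^^ j) (u k)) \<le> KB R * E)) \<and>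
     (\<forall>k<N. \<forall>x. u (Suc k) x = u k x + T / real N * (AA (real (Suc k) * (T / real N)) (u (Suc k)) x + g k x))"
proof -
  define \<tau> where "\<tau> = T / real N"
  have \<tau>: "\<tau> > 0" using N T by (simp add: \<tau>_def)
  have tk: "real k * \<tau> \<in> {0..T}" if "k \<le> N" for k
    using that N T by (auto simp: \<tau>_def field_simps mult_right_mono)
  define P where "P = (\<lambda>k q u. Ck M (n + 3) u \<and> (\<forall>x. u x - \<tau> * AA (real (Suc k) * \<tau>) u x = q x + \<tau> * g k x))"
  have ex: "\<exists>u. P k q u" if "k < N" "Ck M n q" for k q
  proof -
    have "Ck M n (\<lambda>x. q x + \<tau> * g k x)"
      using that(2) g(1)[of k] by (auto simp: Ck_iff Cd_add Cd_cmult periodic_def)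
    from coef.resolvent[OF coefs[OF tk] \<tau> _ this, of "Suc k"] that(1) N(3) show ?thesis by (simp add: P_def \<tau>_def)
  qed
  \<comment> \<open>The choice is justified only while k < N, because the new time has to lie in
    [0, T]; hence the bound on k in \<open>uP\<close>.\<close>
  define u where "u = rec_nat p (\<lambda>k q. SOME u. P k q u)"
  have u0: "u 0 = p" and uS: "u (Suc k) = (SOME v. P k (u k) v)" for k by (simp_all add: u_def)
  have uP: "Ck M n (u k) \<and> (\<forall>i<k. P i (u i) (u (Suc i)))" if "k \<le> N" for k
    using that
  proof (induction k)
    case 0 then show ?case using p by (simp add: u0)
  next
    case (Suc k)
    then have "\<exists>v. P k (u k) v" by (intro ex) auto
    then have "P k (u k) (u (Suc k))" unfolding uS by (rule someI_ex)
    then show ?case using Suc by (auto simp: P_def less_Suc_eq intro: Ck_weaken)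
  qed
  have uPk: "P k (u k) (u (Suc k))" if "k < N" for k using uP[of N] that by simp
  define G where "G = (R + 1) * (exp (Hbound R) * E\<^sup>2)"
  \<comment> \<open>Continued by zero beyond N, since \<open>discrete_Gronwall\<close> asks for
    nonnegative values at every index.\<close>
  define y where "y = (\<lambda>k. if k \<le> N then EE (real k * \<tau>) (u k) else 0)"
  have ynn: "y k \<ge> 0" for k
    using coef.En_nonneg[OF coefs[OF tk]] by (simp add: y_def)
  have G0: "G \<ge> 0" using R4 by (simp add: G_def)
  have step: "(1 - \<tau> * CS R) * y (Suc k) \<le> exp (LL R * \<tau>) * y k + \<tau> * G" if k: "k < N" for k
  proof -
    let ?t = "real (Suc k) * \<tau>" and ?s = "real k * \<tau>"
    have t: "?t \<in> {0..T}" and s: "?s \<in> {0..T}" using tk[of "Suc k"] tk[of k] k by auto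
    have uk: "Ck M n (u k)" using uP[of k] k by simp
    have "(1 - \<tau> * CS R) * EE ?t (u (Suc k)) \<le> EE ?t (u k) + \<tau> * EE ?t (g k)"
      using uPk[OF k] \<tau> by (intro coef.step_energy[OF coefs[OF t]] uk g) (auto simp: P_def)
    also have "EE ?t (u k) \<le> exp (LL R * \<bar>?t - ?s\<bar>) * EE ?s (u k)" by (rule EE_lipschitz[OF s t uk])
    also have "\<bar>?t - ?s\<bar> = \<tau>" using \<tau> by (simp add: algebra_simps)
    also have "EE ?t (g k) \<le> G" unfolding G_def by (rule EE_le[OF t g(1) g(2)])
    finally show ?thesis using k \<tau> by (simp add: y_def)
  qed
  have bound: "L2_norm M ((deriv ^^ j) (u k)) \<le> KB R * E" if k: "k \<le> N" and j: "j \<le> n" for k j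
  proof -
    have E0: "E \<ge> 0" using p(2)[of 0] L2_norm_nonneg[of M p] by simp
    have kT: "real k * \<tau> \<le> R" "real k * \<tau> \<ge> 0" using tk[OF k] T by auto
    have "y k \<le> exp ((LL R + 2 * CS R) * (real k * \<tau>)) * (y 0 + real k * \<tau> * G)"
      using N \<tau> CS_nonneg LL_nonneg G0 ynn k by (intro discrete_Gronwall[of N] step) (auto simp: \<tau>_def)
    also have "\<dots> \<le> exp ((LL R + 2 * CS R) * R) * (G + R * G)"
    proof (intro mult_mono add_mono)
      show "exp ((LL R + 2 * CS R) * (real k * \<tau>)) \<le> exp ((LL R + 2 * CS R) * R)"
        using kT LL_nonneg CS_nonneg by (auto intro!: mult_left_mono)
      show "y 0 \<le> G" unfolding y_def G_def using EE_le[OF tk[of 0] p] by (simp add: u0)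
    qed (use kT G0 ynn in auto)
    finally have "y k \<le> exp ((LL R + 2 * CS R) * R) * ((1 + R) * G)" by (simp add: algebra_simps)
    then have "exp (Hbound R) * y k \<le> exp (Hbound R) * (exp ((LL R + 2 * CS R) * R) * ((1 + R) * G))"
      by (intro mult_left_mono) auto
    also have "\<dots> = (KB R * E)\<^sup>2"
      using R4 by (simp add: KB_def G_def power_mult_distrib algebra_simps)
    finally have "(L2_norm M ((deriv ^^ j) (u k)))\<^sup>2 \<le> (KB R * E)\<^sup>2"
      using L2_le_EE[OF tk[OF k] _ j, of "u k"] uP[OF k] k by (simp add: y_def)
    then show ?thesis by (rule power2_le_imp_le) (use E0 R4 in \<open>simp add: KB_def\<close>)
  qed
  have eqn: "u (Suc k) x = u k x + \<tau> * (AA (real (Suc k) * \<tau>) (u (Suc k)) x + g k x)" if "k < N" for k x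
  proof -
    have "u (Suc k) x - \<tau> * AA (real (Suc k) * \<tau>) (u (Suc k)) x = u k x + \<tau> * g k x"
      using uPk[OF that] unfolding P_def by blast
    then show ?thesis unfolding distrib_left by argo
  qed
  show ?thesis
    using u0 uP bound eqn unfolding \<tau>_def[symmetric] by (intro exI[of _ u]) auto
qed

end

section \<open>Integration in time\<close>

lemma integral_abs_le_AE:
  fixes h :: "real \<Rightarrow> real"
  assumes i: "set_integrable lborel {s..t} h" and b: "AE r in lborel. r \<in> {s..t} \<longrightarrow> \<bar>h r\<bar> \<le> C" and st: "s \<le> t"
  shows "\<bar>LINT r:{s..t}|lborel. h r\<bar> \<le> (t - s) * C"
proof -
  have ci: "set_integrable lborel {s..t} (\<lambda>r. C)" by (intro borel_integrable_atLeastAtMost' continuous_intros)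
  have "\<bar>LINT r:{s..t}|lborel. h r\<bar> \<le> (LINT r:{s..t}|lborel. \<bar>h r\<bar>)"
    using set_integral_norm_bound[OF i] by simp
  also have "\<dots> \<le> (LINT r:{s..t}|lborel. C)"
    using b by (intro set_integral_mono_AE set_integrable_abs i ci) auto
  also have "\<dots> = (t - s) * C" using st by (simp add: set_lebesgue_integral_def)
  finally show ?thesis .
qed

text \<open>Joint measurability and an L2 bound on almost every time slice: shared by the source
  and, in the uniqueness proof, by the operator applied to a solution.\<close>

locale time_int =
  fixes M T C :: real and G :: "real \<Rightarrow> real \<Rightarrow> real"
  assumes MT: "M > 0" "T > 0"
    and Gm: "set_borel_measurable lborel ({0..M} \<times> {0..T}) (\<lambda>p. G (fst p) (snd p))"
    and Gs: "AE r in lborel. r \<in> {0..T} \<longrightarrow> sq M (\<lambda>x. G x r) \<and> L2_norm M (\<lambda>x. G x r) \<le> C"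
begin

text \<open>Extension by zero, so that Fubini can be used on the whole plane.\<close>

definition GG :: "real \<times> real \<Rightarrow> real" where
  "GG = (\<lambda>p. indicator ({0..M} \<times> {0..T}) p * G (fst p) (snd p))"

lemma GG_eq: "x \<in> {0..M} \<Longrightarrow> r \<in> {0..T} \<Longrightarrow> GG (x, r) = G x r" "x \<notin> {0..M} \<Longrightarrow> GG (x, r) = 0" "r \<notin> {0..T} \<Longrightarrow> GG (x, r) = 0"
  by (auto simp: GG_def indicator_def)

lemma GG_meas: "GG \<in> borel_measurable (lborel \<Otimes>\<^sub>M lborel)"
  using Gm unfolding set_borel_measurable_def GG_def lborel_prod by simp

lemma C_nonneg: "C \<ge> 0"
proof (rule ccontr)
  assume C: "\<not> C \<ge> 0"
  have "AE r in lborel. r \<notin> {0..T}"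
    using Gs
  proof eventually_elim
    case (elim r)
    then show ?case using C L2_norm_nonneg[of M "\<lambda>x. G x r"] by force
  qed
  then have "emeasure lborel {0..T} = 0"
    by (subst (asm) AE_iff_measurable[of "{0..T}"]) auto
  then show False using MT by simp
qed

lemma GG_sq_integrable: "integrable (lborel \<Otimes>\<^sub>M lborel) (\<lambda>p. (GG p)\<^sup>2)"
proof (rule integrableI_bounded)
  note [measurable] = GG_meas
  show "(\<lambda>p. (GG p)\<^sup>2) \<in> borel_measurable (lborel \<Otimes>\<^sub>M lborel)" by measurable
  have "(\<integral>\<^sup>+p. ennreal (norm ((GG p)\<^sup>2)) \<partial>(lborel \<Otimes>\<^sub>M lborel)) = (\<integral>\<^sup>+r. (\<integral>\<^sup>+x. ennreal ((GG (x, r))\<^sup>2) \<partial>lborel) \<partial>lborel)"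
    by (subst lborel_pair.nn_integral_snd[symmetric]) auto
  also have "\<dots> \<le> (\<integral>\<^sup>+r. ennreal (C\<^sup>2) * indicator {0..T} r \<partial>lborel)"
  proof (rule nn_integral_mono_AE)
    show "AE r in lborel. (\<integral>\<^sup>+x. ennreal ((GG (x, r))\<^sup>2) \<partial>lborel) \<le> ennreal (C\<^sup>2) * indicator {0..T} r"
      using Gs
    proof eventually_elim
      case (elim r)
      show ?case
      proof (cases "r \<in> {0..T}")
        case True
        then have s: "sq M (\<lambda>x. G x r)" and l: "L2_norm M (\<lambda>x. G x r) \<le> C" using elim by auto
        have eq: "(GG (x, r))\<^sup>2 = indicator {0..M} x *\<^sub>R (G x r)\<^sup>2" for x
          using True by (auto simp: GG_def indicator_def)
        have "integrable lborel (\<lambda>x. indicator {0..M} x *\<^sub>R (G x r)\<^sup>2)" using s by (simp add: sq_def set_integrable_def)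
        from nn_integral_eq_integral[OF this]
        have "(\<integral>\<^sup>+x. ennreal ((GG (x, r))\<^sup>2) \<partial>lborel) = ennreal ((L2_norm M (\<lambda>x. G x r))\<^sup>2)"
          unfolding eq L2_norm_sq set_lebesgue_integral_def by simp
        also have "\<dots> \<le> ennreal (C\<^sup>2)" by (intro ennreal_leI power_mono l L2_norm_nonneg)
        finally show ?thesis using True by simp
      next
        case False
        then show ?thesis by (simp add: GG_eq)
      qed
    qed
  qed
  also have "\<dots> = ennreal (C\<^sup>2) * ennreal T" using MT by (subst nn_integral_cmult_indicator) auto
  also have "\<dots> < \<infinity>" by (simp add: ennreal_mult_less_top)
  finally show "(\<integral>\<^sup>+p. ennreal (norm ((GG p)\<^sup>2)) \<partial>(lborel \<Otimes>\<^sub>M lborel)) < \<infinity>" .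
qed

lemma product_integrable:
  fixes f h :: "real \<Rightarrow> real"
  assumes f: "integrable lborel f" and h: "integrable lborel h"
  shows "integrable (lborel \<Otimes>\<^sub>M lborel) (\<lambda>p. f (fst p) * h (snd p))"
proof (rule lborel_pair.Fubini_integrable)
  have [measurable]: "f \<in> borel_measurable borel" "h \<in> borel_measurable borel"
    using borel_measurable_integrable[OF f] borel_measurable_integrable[OF h] by auto
  show "(\<lambda>p. f (fst p) * h (snd p)) \<in> borel_measurable (lborel \<Otimes>\<^sub>M lborel)" by measurable
  show "integrable lborel (\<lambda>x. LINT y|lborel. norm (f (fst (x, y)) * h (snd (x, y))))"
    using f by (simp add: abs_mult)
  show "AE x in lborel. integrable lborel (\<lambda>y. f (fst (x, y)) * h (snd (x, y)))" using h by simp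
qed

text \<open>Dominated by the square of \<open>GG\<close> plus the square of f on the strip, both
  integrable over the plane.\<close>

lemma weighted_integrable:
  assumes f: "sq M f" and st: "0 \<le> s" "s \<le> t" "t \<le> T"
  shows "integrable (lborel \<Otimes>\<^sub>M lborel) (\<lambda>(x, r). indicator {s..t} r * (GG (x, r) * f x))"
proof (rule Bochner_Integration.integrable_bound)
  note [measurable] = GG_meas
  define ff where "ff = (\<lambda>x. indicator {0..M} x * f x)"
  have ffm [measurable]: "ff \<in> borel_measurable borel" using f by (simp add: ff_def sq_def set_borel_measurable_def)
  have "(\<lambda>x. (ff x)\<^sup>2) = (\<lambda>x. indicator {0..M} x *\<^sub>R (f x)\<^sup>2)" by (auto simp: ff_def indicator_def)
  then have fi: "integrable lborel (\<lambda>x. (ff x)\<^sup>2)" using f by (simp add: sq_def set_integrable_def)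
  show "integrable (lborel \<Otimes>\<^sub>M lborel) (\<lambda>p. (GG p)\<^sup>2 + (ff (fst p))\<^sup>2 * indicator {s..t} (snd p))"
    by (intro Bochner_Integration.integrable_add GG_sq_integrable product_integrable fi integrable_indicator_Icc)
  have eq: "(\<lambda>(x, r). indicator {s..t} r * (GG (x, r) * f x)) = (\<lambda>p. indicator {s..t} (snd p) * (GG p * ff (fst p)))"
    by (auto simp: fun_eq_iff ff_def GG_def indicator_def)
  show "(\<lambda>(x, r). indicator {s..t} r * (GG (x, r) * f x)) \<in> borel_measurable (lborel \<Otimes>\<^sub>M lborel)"
    unfolding eq by measurable
  show "AE p in lborel \<Otimes>\<^sub>M lborel. norm (case p of (x, r) \<Rightarrow> indicator {s..t} r * (GG (x, r) * f x))
     \<le> norm ((GG p)\<^sup>2 + (ff (fst p))\<^sup>2 * indicator {s..t} (snd p))"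
  proof (rule AE_I2)
    fix p :: "real \<times> real"
    have "norm (indicator {s..t} (snd p) * (GG p * ff (fst p))) \<le> (GG p)\<^sup>2 + (ff (fst p))\<^sup>2 * indicator {s..t} (snd p)"
    proof (cases "snd p \<in> {s..t}")
      case True
      have h: "2 * (\<bar>GG p\<bar> * \<bar>ff (fst p)\<bar>) \<le> \<bar>GG p\<bar>\<^sup>2 + \<bar>ff (fst p)\<bar>\<^sup>2"
        using sum_squares_bound[of "\<bar>GG p\<bar>" "\<bar>ff (fst p)\<bar>"] by (simp only: mult.assoc)
      have aux: "m \<le> S" if "2 * m \<le> S" "0 \<le> m" for m S :: real using that by simp
      have "\<bar>GG p\<bar> * \<bar>ff (fst p)\<bar> \<le> \<bar>GG p\<bar>\<^sup>2 + \<bar>ff (fst p)\<bar>\<^sup>2"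
        by (rule aux[OF h]) simp
      then show ?thesis using True by (simp add: abs_mult)
    qed simp
    also have "\<dots> \<le> norm ((GG p)\<^sup>2 + (ff (fst p))\<^sup>2 * indicator {s..t} (snd p))" by simp
    finally show "norm (case p of (x, r) \<Rightarrow> indicator {s..t} r * (GG (x, r) * f x)) \<le> norm ((GG p)\<^sup>2 + (ff (fst p))\<^sup>2 * indicator {s..t} (snd p))"
      using fun_cong[OF eq, of p] by simp
  qed
qed

lemma slice_eq:
  assumes "0 \<le> s" "t \<le> T" "x \<in> {0..M}"
  shows "(LINT r|lborel. indicator {s..t} r * (GG (x, r) * f x)) = (LINT r:{s..t}|lborel. G x r) * f x"
proof -
  have "(LINT r|lborel. indicator {s..t} r * (GG (x, r) * f x)) = (LINT r|lborel. (indicator {s..t} r *\<^sub>R G x r) * f x)"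
    using assms by (intro Bochner_Integration.integral_cong) (auto simp: indicator_def GG_eq)
  then show ?thesis by (simp add: set_lebesgue_integral_def)
qed

text \<open>Fubini for the square of \<open>GG\<close>. Time integrals at fixed x are therefore
  available for almost every x only, and identities between them hold in that sense.\<close>

lemma AE_slice: "AE x in lborel. x \<in> {0..M} \<longrightarrow> sq T (G x) "
proof -
  note [measurable] = GG_meas
  have 1: "AE x in lborel. integrable lborel (\<lambda>r. (GG (x, r))\<^sup>2)" 
    by (rule lborel_pair.AE_integrable_fst'[OF GG_sq_integrable])
  have 2: "(\<lambda>r. GG (x, r)) \<in> borel_measurable lborel" for x by measurable
  show ?thesis using 1
  proof eventually_elim
    case (elim x)
    show ?case
    proof
      assume x: "x \<in> {0..M}"
      have e: "(\<lambda>r. GG (x, r)) = (\<lambda>r. indicator {0..T} r *\<^sub>R G x r)" using x by (auto simp: GG_def indicator_def)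
      have e2: "(\<lambda>r. (GG (x, r))\<^sup>2) = (\<lambda>r. indicator {0..T} r *\<^sub>R (G x r)\<^sup>2)" using x by (auto simp: GG_def indicator_def)
      show "sq T (G x)" using elim 2[of x] unfolding sq_def set_borel_measurable_def set_integrable_def e e2 by simp
    qed
  qed
qed

lemma AE_integrable: "AE x in lborel. x \<in> {0..M} \<longrightarrow> set_integrable lborel {0..T} (G x)"
  using AE_slice by eventually_elim (auto intro: sq_integrable)

text \<open>The norm bound is Minkowski's inequality by duality: pairing f with itself and
  exchanging the integrals bounds the square of its norm by (t - s) C times the norm. Square
  integrability of f comes before, from Cauchy-Schwarz in time.\<close>

lemma time_integral:
  assumes st: "0 \<le> s" "s \<le> t" "t \<le> T"
  defines "f \<equiv> (\<lambda>x. LINT r:{s..t}|lborel. G x r)"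
  shows time_integral_sq: "sq M f"
    and time_integral_Fubini: "\<And>\<phi>. sq M \<phi> \<Longrightarrow> I M (\<lambda>x. f x * \<phi> x) = (LINT r:{s..t}|lborel. I M (\<lambda>x. G x r * \<phi> x))"
    and time_integral_integrable: "\<And>\<phi>. sq M \<phi> \<Longrightarrow> set_integrable lborel {s..t} (\<lambda>r. I M (\<lambda>x. G x r * \<phi> x))"
    and time_integral_norm: "L2_norm M f \<le> (t - s) * C"
proof -
  note [measurable] = GG_meas
  note H = weighted_integrable[OF _ st]
  have inner: "(LINT x|lborel. indicator {s..t} r * (GG (x, r) * \<phi> x)) = indicator {s..t} r *\<^sub>R I M (\<lambda>x. G x r * \<phi> x)" for r \<phi>
  proof (cases "r \<in> {s..t}")
    case True
    then show ?thesis unfolding set_lebesgue_integral_def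
      using st by (auto simp: GG_def indicator_def intro!: Bochner_Integration.integral_cong)
  qed simp
  have outer: "(LINT r|lborel. indicator {s..t} r * (GG (x, r) * \<phi> x)) = indicator {0..M} x *\<^sub>R (f x * \<phi> x)" for x \<phi>
  proof (cases "x \<in> {0..M}")
    case True then show ?thesis using slice_eq[of s t x \<phi>] st by (simp add: f_def)
  qed (simp add: GG_eq)
  show F: "I M (\<lambda>x. f x * \<phi> x) = (LINT r:{s..t}|lborel. I M (\<lambda>x. G x r * \<phi> x))" if "sq M \<phi>" for \<phi>
    using lborel_pair.Fubini_integral[OF H[OF that]] by (simp only: inner outer set_lebesgue_integral_def)
  show i: "set_integrable lborel {s..t} (\<lambda>r. I M (\<lambda>x. G x r * \<phi> x))" if "sq M \<phi>" for \<phi>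
    using lborel_pair.integrable_snd[OF H[OF that]] unfolding set_integrable_def by (simp only: inner)
  have fm: "set_borel_measurable lborel {0..M} f"
  proof -
    have "integrable lborel (\<lambda>x. indicator {0..M} x *\<^sub>R (f x * 1))"
      unfolding outer[where \<phi> = "\<lambda>x. 1", symmetric]
      by (rule lborel_pair.integrable_fst[OF H[OF sq_const[of M 1]]])
    from borel_measurable_integrable[OF this] show ?thesis by (simp add: set_borel_measurable_def)
  qed
  have L: "integrable lborel (\<lambda>x. LINT r|lborel. (GG (x, r))\<^sup>2)"
    by (rule lborel_pair.integrable_fst'[OF GG_sq_integrable])
  have "set_integrable lborel {0..M} (\<lambda>x. (f x)\<^sup>2)"
    unfolding set_integrable_def
  proof (rule Bochner_Integration.integrable_bound)
    show "integrable lborel (\<lambda>x. (t - s) * (LINT r|lborel. (GG (x, r))\<^sup>2))" using L by simp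
    show "(\<lambda>x. indicator {0..M} x *\<^sub>R (f x)\<^sup>2) \<in> borel_measurable lborel"
      using set_measurable_mult[OF fm fm] by (simp add: set_borel_measurable_def power2_eq_square)
    show "AE x in lborel. norm (indicator {0..M} x *\<^sub>R (f x)\<^sup>2) \<le> norm ((t - s) * (LINT r|lborel. (GG (x, r))\<^sup>2))"
      using AE_slice
    proof eventually_elim
      case (elim x)
      show ?case
      proof (cases "x \<in> {0..M}")
        case True
        with elim have g: "sq T (G x)" by simp
        have "f x = prim (G x) t - prim (G x) s"
          unfolding f_def using prim_diff(1)[OF sq_integrable[OF g] st] by simp
        then have "\<bar>f x\<bar> \<le> sqrt (t - s) * L2_norm T (G x)"
          using prim_L2_bound[OF MT(2) g st] by simp
        then have "\<bar>f x\<bar>\<^sup>2 \<le> (sqrt (t - s) * L2_norm T (G x))\<^sup>2" by (intro power_mono) auto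
        also have "\<dots> = (t - s) * I T (\<lambda>r. (G x r)\<^sup>2)" using st by (simp add: power_mult_distrib L2_norm_sq)
        also have "I T (\<lambda>r. (G x r)\<^sup>2) = (LINT r|lborel. (GG (x, r))\<^sup>2)"
          unfolding set_lebesgue_integral_def using True
          by (intro Bochner_Integration.integral_cong) (auto simp: GG_def indicator_def)
        finally show ?thesis using True by simp
      qed simp
    qed
  qed
  with fm show sf: "sq M f" by (simp add: sq_def)
  have "(L2_norm M f)\<^sup>2 = I M (\<lambda>x. f x * f x)" unfolding L2_norm_sq by (simp only: power2_eq_square)
  also have "\<dots> = (LINT r:{s..t}|lborel. I M (\<lambda>x. G x r * f x))" by (rule F[OF sf])
  also have "\<dots> \<le> (t - s) * (C * L2_norm M f)"
  proof (rule order_trans[OF abs_ge_self integral_abs_le_AE[OF i[OF sf] _ st(2)]])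
    show "AE r in lborel. r \<in> {s..t} \<longrightarrow> \<bar>I M (\<lambda>x. G x r * f x)\<bar> \<le> C * L2_norm M f"
      using Gs
    proof eventually_elim
      case (elim r)
      show ?case
      proof
        assume "r \<in> {s..t}"
        then have g: "sq M (\<lambda>x. G x r)" "L2_norm M (\<lambda>x. G x r) \<le> C" using elim st by auto
        show "\<bar>I M (\<lambda>x. G x r * f x)\<bar> \<le> C * L2_norm M f"
          using Cauchy_Schwarz_I[OF g(1) sf] mult_right_mono[OF g(2) L2_norm_nonneg[of M f]] by linarith
      qed
    qed
  qed
  finally have "L2_norm M f * L2_norm M f \<le> ((t - s) * C) * L2_norm M f" by (simp add: power2_eq_square mult.assoc)
  then show "L2_norm M f \<le> (t - s) * C"
    using L2_norm_nonneg[of M f] st C_nonneg by (cases "L2_norm M f = 0") auto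
qed

end

lemma Hn_derivs_by_parts:
  assumes D: "Hn_derivs M n f D" and j: "j \<le> n" and t: "test_fn M \<phi>"
  shows "I M (\<lambda>x. f x * (deriv ^^ j) \<phi> x) = (-1) ^ j * I M (\<lambda>x. D j x * \<phi> x)"
  using j t
proof (induction j arbitrary: \<phi>)
  case 0 then show ?case using D by (simp add: Hn_derivs_def)
next
  case (Suc j)
  have "I M (\<lambda>x. f x * (deriv ^^ Suc j) \<phi> x) = (-1) ^ j * I M (\<lambda>x. D j x * deriv \<phi> x)"
    unfolding funpow_deriv_Suc using Suc.IH[of "deriv \<phi>"] Suc.prems test_fn_deriv[of M \<phi> 1] by simp
  also have "I M (\<lambda>x. D j x * deriv \<phi> x) = - I M (\<lambda>x. D (Suc j) x * \<phi> x)"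
    using D Suc.prems by (auto simp: Hn_derivs_def weak_deriv_def)
  finally show ?case by simp
qed

text \<open>The derivatives of e exist slice by slice, with no joint measurability to integrate them
  in time. They are therefore moved onto the test function within each slice, and the integrated
  pairings are fed to \<open>Hn_derivs_dual\<close>.\<close>

lemma time_integral_Hn:
  assumes M: "M > 0" and T: "T > 0" and e: "in_Linf_Hn M n T e"
    and E: "AE r in lborel. r \<in> {0..T} \<longrightarrow> Hn_norm M n (\<lambda>x. e x r) \<le> E"
  shows "time_int M T E e"
    and "0 \<le> s \<Longrightarrow> s \<le> t \<Longrightarrow> t \<le> T \<Longrightarrow>
      \<exists>D. Hn_derivs M n (per M (\<lambda>x. LINT r:{s..t}|lborel. e x r)) D \<and> (\<forall>j\<le>n. L2_norm M (D j) \<le> (t - s) * E)"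
proof -
  have H: "AE r in lborel. r \<in> {0..T} \<longrightarrow> in_Hn M n (\<lambda>x. e x r)" using e by (simp add: in_Linf_Hn_def)
  show ti: "time_int M T E e"
  proof
    show "set_borel_measurable lborel ({0..M} \<times> {0..T}) (\<lambda>p. e (fst p) (snd p))" using e by (simp add: in_Linf_Hn_def)
    show "AE r in lborel. r \<in> {0..T} \<longrightarrow> sq M (\<lambda>x. e x r) \<and> L2_norm M (\<lambda>x. e x r) \<le> E"
      using H E
    proof eventually_elim
      case (elim r)
      show ?case
      proof
        assume r: "r \<in> {0..T}"
        then obtain D where D: "Hn_derivs M n (\<lambda>x. e x r) D" using elim by (auto simp: in_Hn_def)
        have "D 0 = (\<lambda>x. e x r)" using D by (simp add: Hn_derivs_def)
        then show "sq M (\<lambda>x. e x r) \<and> L2_norm M (\<lambda>x. e x r) \<le> E"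
          using Hn_derivs_sq[OF D, of 0] L2_norm_le_Hn_norm[OF M D, of 0] elim r by auto
      qed
    qed
  qed (use M T in auto)
  interpret time_int M T E e by (rule ti)
  assume st: "0 \<le> s" "s \<le> t" "t \<le> T"
  let ?f = "\<lambda>x. LINT r:{s..t}|lborel. e x r"
  have sf: "sq M ?f" by (rule time_integral_sq[OF st])
  show "\<exists>D. Hn_derivs M n (per M ?f) D \<and> (\<forall>j\<le>n. L2_norm M (D j) \<le> (t - s) * E)"
  proof (rule Hn_derivs_dual[OF M])
    show L: "L2 M (per M ?f)" by (rule L2_per[OF M sf])
    have "L2_norm M (per M ?f) = L2_norm M ?f"
      using L sf by (intro L2_norm_cong_AE AE_per M) (auto simp: L2_iff)
    then show "L2_norm M (per M ?f) \<le> (t - s) * E" using time_integral_norm[OF st] by simp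
    fix j \<phi> assume j: "j \<le> n" and t: "test_fn M \<phi>"
    note s\<phi> = test_fn_sq[OF test_fn_deriv[OF t, of j]]
    have "I M (\<lambda>x. per M ?f x * (deriv ^^ j) \<phi> x) = I M (\<lambda>x. ?f x * (deriv ^^ j) \<phi> x)"
    proof (rule I_cong_AE)
      show "AE x in lborel. x \<in> {0..M} \<longrightarrow> per M ?f x * (deriv ^^ j) \<phi> x = ?f x * (deriv ^^ j) \<phi> x"
        using AE_per[OF M, of ?f] by eventually_elim auto
    qed (use L sf s\<phi> in \<open>auto simp: L2_iff sq_def intro!: set_measurable_mult\<close>)
    also have "\<dots> = (LINT r:{s..t}|lborel. I M (\<lambda>x. e x r * (deriv ^^ j) \<phi> x))"
      by (rule time_integral_Fubini[OF st s\<phi>])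
    also have "\<bar>\<dots>\<bar> \<le> (t - s) * (E * L2_norm M \<phi>)"
    proof (rule integral_abs_le_AE[OF time_integral_integrable[OF st s\<phi>] _ st(2)])
      show "AE r in lborel. r \<in> {s..t} \<longrightarrow> \<bar>I M (\<lambda>x. e x r * (deriv ^^ j) \<phi> x)\<bar> \<le> E * L2_norm M \<phi>"
        using H E
      proof eventually_elim
        case (elim r)
        show ?case
        proof
          assume "r \<in> {s..t}"
          then have r: "r \<in> {0..T}" using st by auto
          then obtain D where D: "Hn_derivs M n (\<lambda>x. e x r) D" using elim by (auto simp: in_Hn_def)
          have "\<bar>I M (\<lambda>x. e x r * (deriv ^^ j) \<phi> x)\<bar> = \<bar>I M (\<lambda>x. D j x * \<phi> x)\<bar>"
            using Hn_derivs_by_parts[OF D j t] by (simp add: abs_mult power_abs)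
          also have "\<dots> \<le> L2_norm M (D j) * L2_norm M \<phi>"
            by (rule Cauchy_Schwarz_I[OF Hn_derivs_sq[OF D j] test_fn_sq[OF t]])
          also have "\<dots> \<le> E * L2_norm M \<phi>"
            using L2_norm_le_Hn_norm[OF M D j] elim r by (intro mult_right_mono L2_norm_nonneg) auto
          finally show "\<bar>I M (\<lambda>x. e x r * (deriv ^^ j) \<phi> x)\<bar> \<le> E * L2_norm M \<phi>" .
        qed
      qed
    qed
    finally show "\<bar>I M (\<lambda>x. per M ?f x * (deriv ^^ j) \<phi> x)\<bar> \<le> (t - s) * E * L2_norm M \<phi>" by (simp add: mult.assoc)
  qed
qed

section \<open>Convergence of the scheme\<close>

lemma continuous_AE_zero:
  fixes f :: "real \<Rightarrow> real"
  assumes M: "M > 0" and c: "continuous_on {0..M} f" and ae: "AE x in lborel. x \<in> {0..M} \<longrightarrow> f x = 0" and x: "x \<in> {0..M}"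
  shows "f x = 0"
proof -
  have c2: "continuous_on {0..M} (\<lambda>x. (f x)\<^sup>2)" by (intro continuous_intros c)
  have "I M (\<lambda>x. (f x)\<^sup>2) = I M (\<lambda>x. 0)"
  proof (rule I_cong_AE)
    show "AE x in lborel. x \<in> {0..M} \<longrightarrow> (f x)\<^sup>2 = 0" using ae by eventually_elim auto
  qed (use sq_continuous[OF c2] sq_const[of M 0] in \<open>auto simp: sq_def\<close>)
  moreover have "I M (\<lambda>x. (f x)\<^sup>2) = integral {0..M} (\<lambda>x. (f x)\<^sup>2)"
    by (rule set_borel_integral_eq_integral(2)[OF borel_integrable_atLeastAtMost'[OF c2]])
  ultimately have "integral {0..M} (\<lambda>x. (f x)\<^sup>2) = 0" by simp
  then have "(f x)\<^sup>2 = 0" using integral_eq_0_iff[OF c2] M x by auto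
  then show ?thesis by simp
qed

lemma set_integral_const_Icc: "s \<le> t \<Longrightarrow> (LINT z:{s..t}|lborel. C) = (t - s) * (C::real)"
  by (simp add: set_lebesgue_integral_def)

text \<open>Values are compared at right end points, where the implicit scheme evaluates the
  operator; \<epsilon> is the error of the values and \<omega> the oscillation of f within one
  step.\<close>

lemma riemann_sum_estimate:
  fixes f :: "real \<Rightarrow> real" and \<tau> :: real
  assumes c: "continuous_on {0..T} f" and \<tau>: "\<tau> \<ge> 0"
    and w: "\<And>s s'. s \<in> {0..T} \<Longrightarrow> s' \<in> {0..T} \<Longrightarrow> \<bar>s - s'\<bar> \<le> \<tau> \<Longrightarrow> \<bar>f s - f s'\<bar> \<le> \<omega>"
    and k: "real k * \<tau> \<le> T" and h: "\<And>l. l < k \<Longrightarrow> \<bar>h l - f (real (Suc l) * \<tau>)\<bar> \<le> \<epsilon>"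
  shows "\<bar>(\<Sum>l<k. \<tau> * h l) - prim f (real k * \<tau>)\<bar> \<le> real k * \<tau> * (\<epsilon> + \<omega>)"
  using k h
proof (induction k)
  case 0 then show ?case by (simp add: prim_sing)
next
  case (Suc k)
  let ?s = "real k * \<tau>" and ?t = "real (Suc k) * \<tau>"
  have st: "0 \<le> ?s" "?s \<le> ?t" "?t \<le> T" "?t - ?s = \<tau>" using Suc.prems(1) \<tau> by (auto simp: algebra_simps)
  have i: "set_integrable lborel {0..T} f" by (rule borel_integrable_atLeastAtMost'[OF c])
  have IH: "\<bar>(\<Sum>l<k. \<tau> * h l) - prim f ?s\<bar> \<le> ?s * (\<epsilon> + \<omega>)"
    using Suc.prems st by (intro Suc.IH) auto
  have i': "set_integrable lborel {?s..?t} f" and d: "prim f ?t - prim f ?s = (LINT z:{?s..?t}|lborel. f z)"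
    using prim_diff[OF i st(1-3)] by auto
  have ci: "set_integrable lborel {?s..?t} (\<lambda>z. C)" for C :: real by (intro borel_integrable_atLeastAtMost' continuous_intros)
  have "(LINT z:{?s..?t}|lborel. f z - h k) = (LINT z:{?s..?t}|lborel. f z) - \<tau> * h k"
    unfolding set_integral_diff(2)[OF i' ci] set_integral_const_Icc[OF st(2)] st(4) ..
  moreover have "\<bar>LINT z:{?s..?t}|lborel. f z - h k\<bar> \<le> (?t - ?s) * (\<epsilon> + \<omega>)"
  proof (rule integral_abs_le_AE[OF set_integral_diff(1)[OF i' ci] _ st(2)], rule AE_I2, rule impI)
    fix z assume z: "z \<in> {?s..?t}"
    from z have z1: "?s \<le> z" "z \<le> ?t" by auto
    have "0 \<le> z" "z \<le> T" "0 \<le> ?t" using z1 st(1-3) by (meson order_trans)+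
    moreover have "\<bar>z - ?t\<bar> \<le> \<tau>" using z1 st(4) by arith
    ultimately have "\<bar>f z - f ?t\<bar> \<le> \<omega>" using st(3) by (intro w) auto
    moreover have "\<bar>h k - f ?t\<bar> \<le> \<epsilon>" using Suc.prems by simp
    ultimately show "\<bar>f z - h k\<bar> \<le> \<epsilon> + \<omega>" by arith
  qed
  ultimately have 1: "\<bar>(LINT z:{?s..?t}|lborel. f z) - \<tau> * h k\<bar> \<le> \<tau> * (\<epsilon> + \<omega>)" using st(4) by simp
  have "\<bar>(\<Sum>l<Suc k. \<tau> * h l) - prim f ?t\<bar> = \<bar>((\<Sum>l<k. \<tau> * h l) - prim f ?s) - ((LINT z:{?s..?t}|lborel. f z) - \<tau> * h k)\<bar>"
    using d by simp
  also have "\<dots> \<le> ?s * (\<epsilon> + \<omega>) + \<tau> * (\<epsilon> + \<omega>)" by (rule abs_diff_bound[OF IH 1])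
  also have "\<dots> = ?t * (\<epsilon> + \<omega>)" by (simp add: algebra_simps)
  finally show ?case .
qed

text \<open>Arzela-Ascoli for functions that need not be continuous: the iterates jump in time, and
  equicontinuity holds only from some index on, when the jumps have become small. Convergence on a
  countable dense set and a finite cover give the uniform Cauchy property.\<close>

lemma approx_equicontinuous_subsequence:
  fixes F :: "nat \<Rightarrow> 'a::euclidean_space \<Rightarrow> real"
  assumes K: "compact K" and bnd: "\<And>m x. x \<in> K \<Longrightarrow> \<bar>F m x\<bar> \<le> C"
    and eq: "\<And>\<epsilon>. \<epsilon> > 0 \<Longrightarrow> \<exists>\<delta>>0. \<exists>m0. \<forall>m\<ge>m0. \<forall>x\<in>K. \<forall>y\<in>K. dist x y < \<delta> \<longrightarrow> \<bar>F m x - F m y\<bar> < \<epsilon>"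
  obtains r :: "nat \<Rightarrow> nat" and U where "strict_mono r" "uniform_limit K (\<lambda>i. F (r i)) U sequentially"
proof -
  obtain S where S: "countable S" "S \<subseteq> K" "K \<subseteq> closure S" using separable by blast
  obtain r :: "nat \<Rightarrow> nat" where r: "strict_mono r" "\<And>x. x \<in> S \<Longrightarrow> \<exists>l. (\<lambda>i. F (r i) x) \<longlonglongrightarrow> l"
    by (rule function_convergent_subsequence[OF S(1), of F C]) (use bnd S(2) in auto)
  have "uniformly_Cauchy_on K (\<lambda>i. F (r i))"
    unfolding uniformly_Cauchy_on_def
  proof (intro allI impI)
    fix e :: real assume e: "e > 0"
    obtain \<delta> m0 where \<delta>: "\<delta> > 0" and m0: "\<And>m x y. m \<ge> m0 \<Longrightarrow> x \<in> K \<Longrightarrow> y \<in> K \<Longrightarrow> dist x y < \<delta> \<Longrightarrow> \<bar>F m x - F m y\<bar> < e / 3"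
    proof -
      have "e / 3 > 0" using e by simp
      from eq[OF this] show ?thesis using that by blast
    qed
    have "K \<subseteq> (\<Union>s\<in>S. ball s \<delta>)"
    proof
      fix x assume "x \<in> K"
      then have "x \<in> closure S" using S by auto
      then show "x \<in> (\<Union>s\<in>S. ball s \<delta>)" using \<delta> by (auto simp: closure_approachable)
    qed
    then obtain S' where S': "S' \<subseteq> S" "finite S'" "K \<subseteq> (\<Union>s\<in>S'. ball s \<delta>)"
      using compactE_image[OF K, of S "\<lambda>s. ball s \<delta>"] by auto
    have "\<exists>N. \<forall>i\<ge>N. \<forall>j\<ge>N. \<bar>F (r i) s - F (r j) s\<bar> < e / 3" if "s \<in> S" for s
    proof -
      obtain l where "(\<lambda>i. F (r i) s) \<longlonglongrightarrow> l" using r(2)[OF \<open>s \<in> S\<close>] by blast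
      then have "Cauchy (\<lambda>i. F (r i) s)" by (rule LIMSEQ_imp_Cauchy)
      then show ?thesis using e unfolding Cauchy_def dist_real_def by (meson divide_pos_pos zero_less_numeral)
    qed
    then obtain N where N: "\<And>s i j. s \<in> S \<Longrightarrow> i \<ge> N s \<Longrightarrow> j \<ge> N s \<Longrightarrow> \<bar>F (r i) s - F (r j) s\<bar> < e / 3" by metis
    define N' where "N' = Max (insert m0 (N ` S'))"
    have N': "N' \<ge> m0" "\<And>s. s \<in> S' \<Longrightarrow> N' \<ge> N s" using S'(2) by (auto simp: N'_def)
    show "\<exists>N. \<forall>x\<in>K. \<forall>m\<ge>N. \<forall>n\<ge>N. dist (F (r m) x) (F (r n) x) < e"
    proof (intro exI[of _ N'] ballI allI impI)
      fix x i j assume x: "x \<in> K" and ij: "i \<ge> N'" "j \<ge> N'"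
      obtain s where s: "s \<in> S'" "dist s x < \<delta>" using S'(3) x by auto
      have sK: "s \<in> K" "s \<in> S" using s S' S by auto
      have ri: "r i \<ge> m0" "r j \<ge> m0" using seq_suble[OF r(1), of i] seq_suble[OF r(1), of j] ij N' by auto
      have "\<bar>F (r i) x - F (r i) s\<bar> < e / 3" "\<bar>F (r j) x - F (r j) s\<bar> < e / 3"
        using m0[OF ri(1) x sK(1)] m0[OF ri(2) x sK(1)] s(2) by (auto simp: dist_commute)
      moreover have "\<bar>F (r i) s - F (r j) s\<bar> < e / 3"
        using N[OF sK(2)] ij N'(2)[OF s(1)] by auto
      ultimately show "dist (F (r i) x) (F (r j) x) < e" unfolding dist_real_def by arith
    qed
  qed
  then obtain U where "uniform_limit K (\<lambda>i. F (r i)) U sequentially"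
    using Cauchy_uniformly_convergent uniformly_convergent_on_def by blast
  with r(1) that show ?thesis by blast
qed

lemma prim_eq_split:
  assumes "set_integrable lborel {0..T} f" "\<tau> \<ge> 0" "real k * \<tau> \<le> T"
  shows "(\<Sum>l<k. LINT r:{real l * \<tau>..real (Suc l) * \<tau>}|lborel. f r) = prim f (real k * \<tau>)"
  using assms(3)
proof (induction k)
  case 0 then show ?case by (simp add: prim_sing)
next
  case (Suc k)
  have st: "0 \<le> real k * \<tau>" "real k * \<tau> \<le> real (Suc k) * \<tau>" "real (Suc k) * \<tau> \<le> T" "real k * \<tau> \<le> T"
    using Suc.prems assms(2) by (auto simp: algebra_simps)
  show ?case using Suc.IH[OF st(4)] prim_diff(1)[OF assms(1) st(1-3)] by simp
qed

text \<open>The mth run has N m steps of length \<tau> m. The number \<delta> m bounds the error of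
  the initial value and, relative to the step length, the error of the source on each step; B and Sg
  are independent of m.\<close>

locale rothe = adm +
  fixes e :: "real \<Rightarrow> real \<Rightarrow> real" and u0 :: "real \<Rightarrow> real" and E B Sg :: real and N :: "nat \<Rightarrow> nat"
    and g u :: "nat \<Rightarrow> nat \<Rightarrow> real \<Rightarrow> real" and \<delta> \<tau> :: "nat \<Rightarrow> real"
  assumes ti: "time_int M T E e" and u0: "sq M u0"
    and \<tau>: "\<And>m. \<tau> m = T / real (N m)" and N: "\<And>m. N m > 0" "\<And>m. N m \<ge> m" and \<delta>: "\<delta> \<longlonglongrightarrow> 0" "\<And>m. \<delta> m \<ge> 0"
    and uC: "\<And>m k. k \<le> N m \<Longrightarrow> Ck M n (u m k)" and uB: "\<And>m k j. k \<le> N m \<Longrightarrow> j \<le> n \<Longrightarrow> L2_norm M ((deriv ^^ j) (u m k)) \<le> B"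
    and rec: "\<And>m k x. k < N m \<Longrightarrow> u m (Suc k) x = u m k x + \<tau> m * (AA (real (Suc k) * \<tau> m) (u m (Suc k)) x + g m k x)"
    and gC: "\<And>m k. Ck M n (g m k)" and gS: "\<And>m k x. x \<in> {0..M} \<Longrightarrow> \<bar>g m k x\<bar> \<le> Sg"
    and init: "\<And>m. L2_norm M (\<lambda>x. u m 0 x - u0 x) \<le> \<delta> m"
    and gE: "\<And>m k. k < N m \<Longrightarrow> L2_norm M (\<lambda>x. \<tau> m * g m k x - (LINT r:{real k * \<tau> m..real (Suc k) * \<tau> m}|lborel. e x r)) \<le> \<tau> m * \<delta> m"
begin

lemma \<tau>_pos: "\<tau> m > 0" using T N \<tau> by simp

lemma \<tau>_lim: "\<tau> \<longlonglongrightarrow> 0"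
proof (rule tendsto_sandwich[OF _ _ tendsto_const])
  show "\<forall>\<^sub>F m in sequentially. 0 \<le> \<tau> m" by (intro always_eventually allI less_imp_le[OF \<tau>_pos])
  show "\<forall>\<^sub>F m in sequentially. \<tau> m \<le> T / real m"
    using eventually_gt_at_top[of 0]
  proof eventually_elim
    case (elim m)
    then show ?case unfolding \<tau> using T N(2)[of m] by (intro divide_left_mono) auto
  qed
  show "(\<lambda>m. T / real m) \<longlonglongrightarrow> 0" by (rule lim_const_over_n)
qed

lemma N\<tau>: "real (N m) * \<tau> m = T" using N[of m] \<tau>[of m] by simp

lemma k\<tau>: "k \<le> N m \<Longrightarrow> real k * \<tau> m \<in> {0..T}"
  using N\<tau>[of m] \<tau>_pos[of m] by (auto intro: mult_right_mono simp flip: N\<tau>[of m])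

text \<open>The sup bound of \<open>sup_bound_Hc\<close> for derivatives below n. As n is at least
  4, it covers the third derivative too and hence all four terms of the operator, which gives the
  time Lipschitz constant \<open>Lip\<close>.\<close>

definition S where "S = B / sqrt M + B * sqrt M"
definition Lip where "Lip = 4 * (R * S) + Sg"

lemma uHc: "k \<le> N m \<Longrightarrow> Hc M n B (\<lambda>j. (deriv ^^ j) (u m k))"
  by (rule Hc_classical[OF M(1) uC uB])

lemma u_sup: "k \<le> N m \<Longrightarrow> j < n \<Longrightarrow> x \<in> {0..M} \<Longrightarrow> \<bar>(deriv ^^ j) (u m k) x\<bar> \<le> S"
  unfolding S_def using sup_bound_Hc[OF M(1) uHc, of k m j x] uB[of k m j] by simp

lemma B_nonneg: "B \<ge> 0"
  using uB[of 0 0 0] L2_norm_nonneg[of M "u 0 0"] by simp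

lemma S_nonneg: "S \<ge> 0" using B_nonneg M by (simp add: S_def)

lemma Sg_nonneg: "Sg \<ge> 0" using gS[of 0 0 0] M by fastforce

lemma Lip_nonneg: "Lip \<ge> 0" using S_nonneg Sg_nonneg R4 by (simp add: Lip_def)

lemma coef_le: "t \<in> {0..T} \<Longrightarrow> \<bar>a x t\<bar> \<le> R \<and> \<bar>b x t\<bar> \<le> R \<and> \<bar>c x t\<bar> \<le> R \<and> \<bar>d x t\<bar> \<le> R"
  using coef.bd[OF coefs, of t 0 x] by auto

lemma AA_le:
  assumes "t \<in> {0..T}" "k \<le> N m" "x \<in> {0..M}"
  shows "\<bar>AA t (u m k) x\<bar> \<le> 4 * (R * S)"
proof -
  have "\<bar>AA t (u m k) x\<bar> \<le> R * S + R * S + R * S + R * S"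
    unfolding Aop_def using coef_le[OF assms(1), of x] u_sup[OF assms(2) _ assms(3), of 0] u_sup[OF assms(2) _ assms(3), of 1]
      u_sup[OF assms(2) _ assms(3), of 2] u_sup[OF assms(2) _ assms(3), of 3] n
    by (intro abs_add_bound abs_mult_bound) auto
  then show ?thesis by simp
qed

lemma u_time_lip:
  assumes "k \<le> N m" "l \<le> k" "x \<in> {0..M}"
  shows "\<bar>u m k x - u m l x\<bar> \<le> Lip * ((real k - real l) * \<tau> m)"
  using assms
proof (induction k)
  case 0 then show ?case by simp
next
  case (Suc k)
  show ?case
  proof (cases "l = Suc k")
    case False
    then have IH: "\<bar>u m k x - u m l x\<bar> \<le> Lip * ((real k - real l) * \<tau> m)" using Suc by auto
    have "\<bar>AA (real (Suc k) * \<tau> m) (u m (Suc k)) x + g m k x\<bar> \<le> Lip"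
      unfolding Lip_def using Suc.prems by (intro abs_add_bound AA_le k\<tau> gS) auto
    then have "\<bar>\<tau> m * (AA (real (Suc k) * \<tau> m) (u m (Suc k)) x + g m k x)\<bar> \<le> \<tau> m * Lip"
      using \<tau>_pos[of m] by (intro abs_mult_bound) auto
    from abs_add_bound[OF IH this]
    have "\<bar>(u m k x - u m l x) + \<tau> m * (AA (real (Suc k) * \<tau> m) (u m (Suc k)) x + g m k x)\<bar> \<le> Lip * ((real k - real l) * \<tau> m) + \<tau> m * Lip" .
    then show ?thesis using rec[of k m x] Suc.prems by (simp add: algebra_simps)
  qed simp
qed

text \<open>Rounding up: on each step the interpolant takes the value at the right end, in agreement
  with the implicit scheme, and the rounding error stays below one step.\<close>

definition \<kappa> :: "nat \<Rightarrow> real \<Rightarrow> nat" where "\<kappa> m t = nat \<lceil>t / \<tau> m\<rceil>"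

lemma \<kappa>:
  assumes t: "t \<in> {0..T}"
  shows "\<kappa> m t \<le> N m" "t \<le> real (\<kappa> m t) * \<tau> m" "real (\<kappa> m t) * \<tau> m < t + \<tau> m"
proof -
  have p: "t / \<tau> m \<ge> 0" using t \<tau>_pos[of m] by simp
  have 1: "real (\<kappa> m t) = of_int \<lceil>t / \<tau> m\<rceil>" using p by (simp add: \<kappa>_def)
  have "t / \<tau> m \<le> real (N m)" using t N\<tau>[of m] \<tau>_pos[of m] by (simp add: field_simps)
  then show "\<kappa> m t \<le> N m" unfolding \<kappa>_def by (simp add: ceiling_le_iff nat_le_iff)
  show "t \<le> real (\<kappa> m t) * \<tau> m" "real (\<kappa> m t) * \<tau> m < t + \<tau> m"
  proof -
    have "t \<le> of_int \<lceil>t / \<tau> m\<rceil> * \<tau> m"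
      by (rule iffD1[OF pos_divide_le_eq[OF \<tau>_pos]]) (rule le_of_int_ceiling)
    moreover have "of_int \<lceil>t / \<tau> m\<rceil> - 1 < t / \<tau> m" using ceiling_correct[of "t / \<tau> m"] by auto
    then have "(of_int \<lceil>t / \<tau> m\<rceil> - 1) * \<tau> m < t" using \<tau>_pos[of m] by (simp add: pos_less_divide_eq)
    ultimately show "t \<le> real (\<kappa> m t) * \<tau> m" "real (\<kappa> m t) * \<tau> m < t + \<tau> m"
      unfolding 1 by (simp_all add: left_diff_distrib)
  qed
qed

lemma \<kappa>_grid: "\<kappa> m (real k * \<tau> m) = k"
  using \<tau>_pos[of m] by (simp add: \<kappa>_def)

lemma \<kappa>_0: "\<kappa> m 0 = 0" by (simp add: \<kappa>_def)

definition ub :: "nat \<Rightarrow> real \<times> real \<Rightarrow> real" where "ub m p = u m (\<kappa> m (snd p)) (fst p)"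

text \<open>The extra \<tau> m is the jump: two arbitrarily close times may belong to different
  steps.\<close>

lemma ub_time:
  assumes t: "t \<in> {0..T}" and s: "s \<in> {0..T}" and x: "x \<in> {0..M}"
  shows "\<bar>ub m (x, t) - ub m (x, s)\<bar> \<le> Lip * (\<bar>t - s\<bar> + \<tau> m)"
proof -
  have *: "\<bar>ub m (x, t) - ub m (x, s)\<bar> \<le> Lip * (\<bar>t - s\<bar> + \<tau> m)" if t: "t \<in> {0..T}" and s: "s \<in> {0..T}" and "\<kappa> m s \<le> \<kappa> m t" for t s
  proof -
    have "\<bar>ub m (x, t) - ub m (x, s)\<bar> \<le> Lip * ((real (\<kappa> m t) - real (\<kappa> m s)) * \<tau> m)"
      unfolding ub_def using u_time_lip[OF \<kappa>(1)[OF t] that(3) x] by simp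
    also have "\<dots> \<le> Lip * (\<bar>t - s\<bar> + \<tau> m)"
    proof (rule mult_left_mono[OF _ Lip_nonneg])
      have "(real (\<kappa> m t) - real (\<kappa> m s)) * \<tau> m = real (\<kappa> m t) * \<tau> m - real (\<kappa> m s) * \<tau> m" by (simp add: algebra_simps)
      also have "\<dots> \<le> \<bar>t - s\<bar> + \<tau> m" using \<kappa>(3)[OF t, of m] \<kappa>(2)[OF s, of m] by arith
      finally show "(real (\<kappa> m t) - real (\<kappa> m s)) * \<tau> m \<le> \<bar>t - s\<bar> + \<tau> m" .
    qed
    finally show ?thesis .
  qed
  show ?thesis using *[OF t s] *[OF s t] by (cases "\<kappa> m s \<le> \<kappa> m t") (auto simp: abs_minus_commute)
qed

lemma ub_space:
  assumes t: "t \<in> {0..T}" and x: "x \<in> {0..M}" "y \<in> {0..M}"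
  shows "\<bar>ub m (x, t) - ub m (y, t)\<bar> \<le> B * sqrt \<bar>x - y\<bar>"
  using uHc[OF \<kappa>(1)[OF t, of m]] x n unfolding Hc_def ub_def by fastforce

lemma subsequence_exists:
  obtains r U where "strict_mono r" "uniform_limit ({0..M} \<times> {0..T}) (\<lambda>i. ub (r i)) U sequentially"
proof (rule approx_equicontinuous_subsequence)
  show "compact ({0..M} \<times> {0..T})" by (intro compact_Times compact_Icc)
  show "\<bar>ub m p\<bar> \<le> S" if "p \<in> {0..M} \<times> {0..T}" for m p
  proof -
    have "snd p \<in> {0..T}" "fst p \<in> {0..M}" using that by auto
    then show ?thesis unfolding ub_def using u_sup[OF \<kappa>(1), where j = 0] n by simp
  qed
  fix \<epsilon> :: real assume \<epsilon>: "\<epsilon> > 0"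
  \<comment> \<open>One radius for both variables; through m0 it also bounds the jump \<tau> m, so
    that the time increment stays below 2 h.\<close>
  define h where "h = min (\<epsilon> / (4 * (Lip + 1))) ((\<epsilon> / (4 * (B + 1)))\<^sup>2)"
  have h: "h > 0" using \<epsilon> Lip_nonneg B_nonneg by (simp add: h_def)
  obtain m0 where m0: "\<And>m. m \<ge> m0 \<Longrightarrow> \<tau> m < h"
    using order_tendstoD(2)[OF \<tau>_lim h] by (auto simp: eventually_sequentially)
  show "\<exists>\<delta>>0. \<exists>m0. \<forall>m\<ge>m0. \<forall>x\<in>{0..M} \<times> {0..T}. \<forall>y\<in>{0..M} \<times> {0..T}. dist x y < \<delta> \<longrightarrow> \<bar>ub m x - ub m y\<bar> < \<epsilon>"
  proof (intro exI[of _ h] conjI h exI[of _ m0] allI impI ballI)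
    fix m p q assume m: "m \<ge> m0" and p: "p \<in> {0..M} \<times> {0..T}" and q: "q \<in> {0..M} \<times> {0..T}" and d: "dist p q < h"
    obtain x t where pe: "p = (x, t)" by (cases p)
    obtain y s where qe: "q = (y, s)" by (cases q)
    have P: "x \<in> {0..M}" "t \<in> {0..T}" "y \<in> {0..M}" "s \<in> {0..T}" using p q by (auto simp: pe qe)
    have dx: "\<bar>x - y\<bar> < h" "\<bar>t - s\<bar> < h"
      using d dist_fst_le[of p q] dist_snd_le[of p q] by (auto simp: pe qe dist_real_def)
    have 1: "\<bar>ub m (x, t) - ub m (y, t)\<bar> \<le> \<epsilon> / 4"
    proof -
      have "sqrt \<bar>x - y\<bar> \<le> \<epsilon> / (4 * (B + 1))"
        using dx \<epsilon> B_nonneg by (intro real_le_lsqrt) (auto simp: h_def)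
      then have "B * sqrt \<bar>x - y\<bar> \<le> B * (\<epsilon> / (4 * (B + 1)))" using B_nonneg by (intro mult_left_mono) auto
      also have "\<dots> \<le> \<epsilon> / 4" using \<epsilon> B_nonneg by (simp add: field_simps)
      finally show ?thesis using ub_space[OF P(2) P(1) P(3), of m] by linarith
    qed
    have 2: "\<bar>ub m (y, t) - ub m (y, s)\<bar> \<le> \<epsilon> / 2"
    proof -
      have "\<bar>t - s\<bar> + \<tau> m \<le> 2 * (\<epsilon> / (4 * (Lip + 1)))" using dx m0[OF m] by (simp add: h_def)
      then have "Lip * (\<bar>t - s\<bar> + \<tau> m) \<le> Lip * (2 * (\<epsilon> / (4 * (Lip + 1))))" using Lip_nonneg by (intro mult_left_mono) auto
      also have "\<dots> \<le> \<epsilon> / 2" using \<epsilon> Lip_nonneg by (simp add: field_simps)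
      finally show ?thesis using ub_time[OF P(2,4,3), of m] by linarith
    qed
    show "\<bar>ub m p - ub m q\<bar> < \<epsilon>" using 1 2 \<epsilon> unfolding pe qe by arith
  qed
qed blast

end

section \<open>Passage to the limit in the scheme\<close>

lemma L2_norm_sum_le:
  assumes "finite A" "\<And>l. l \<in> A \<Longrightarrow> sq M (f l)"
  shows "L2_norm M (\<lambda>x. \<Sum>l\<in>A. f l x) \<le> (\<Sum>l\<in>A. L2_norm M (f l))"
  using assms
proof (induction A rule: finite_induct)
  case empty then show ?case by (simp add: L2_norm_def)
next
  case (insert l A)
  have "L2_norm M (\<lambda>x. f l x + (\<Sum>l\<in>A. f l x)) \<le> L2_norm M (f l) + L2_norm M (\<lambda>x. \<Sum>l\<in>A. f l x)"
    using insert by (intro L2_norm_triangle sq_sum) auto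
  then show ?case using insert by simp
qed

context rothe begin

lemma rec_sum: "k \<le> N m \<Longrightarrow> u m k x - u m 0 x = (\<Sum>l<k. \<tau> m * AA (real (Suc l) * \<tau> m) (u m (Suc l)) x) + (\<Sum>l<k. \<tau> m * g m l x)"
proof (induction k)
  case (Suc k)
  then have "u m k x - u m 0 x = (\<Sum>l<k. \<tau> m * AA (real (Suc l) * \<tau> m) (u m (Suc l)) x) + (\<Sum>l<k. \<tau> m * g m l x)" by simp
  moreover have "u m (Suc k) x = u m k x + (\<tau> m * AA (real (Suc k) * \<tau> m) (u m (Suc k)) x + \<tau> m * g m k x)"
    using rec[of k m x] Suc.prems by (simp add: distrib_left)
  ultimately show ?case by simp
qed simp

lemma sq_u: "k \<le> N m \<Longrightarrow> j \<le> n \<Longrightarrow> sq M ((deriv ^^ j) (u m k))"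
  by (rule Ck_sq[OF uC])

text \<open>The iterates converge uniformly with all derivatives below n, so the operator part of
  the integrated equation converges uniformly. The source sums converge in L2 only, which is why at
  each t the equation is obtained for almost every x.\<close>

theorem limit_exists:
  "\<exists>V. (\<forall>t\<in>{0..T}. Hn_derivs M n (\<lambda>x. V 0 x t) (\<lambda>j x. V j x t) \<and> (\<forall>j\<le>n. L2_norm M (\<lambda>x. V j x t) \<le> B))
    \<and> (\<forall>j<n. continuous_on ({0..M} \<times> {0..T}) (\<lambda>p. V j (fst p) (snd p)))
    \<and> (AE x in lborel. x \<in> {0..M} \<longrightarrow> V 0 x 0 = u0 x)
    \<and> (\<forall>t\<in>{0..T}. AE x in lborel. x \<in> {0..M} \<longrightarrow> V 0 x t = V 0 x 0 +
        prim (\<lambda>s. a x s * V 3 x s + b x s * V 2 x s + c x s * V 1 x s + d x s * V 0 x s) t + prim (e x) t)"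
proof -
  let ?K = "{0..M} \<times> {0..T}"
  obtain r U where r: "strict_mono r" and U: "uniform_limit ?K (\<lambda>i. ub (r i)) U sequentially"
    by (rule subsequence_exists)
  have unif: "\<exists>i0. \<forall>i\<ge>i0. \<forall>x\<in>{0..M}. \<forall>t\<in>{0..T}. \<bar>ub (r i) (x, t) - U (x, t)\<bar> < \<epsilon>" if "\<epsilon> > 0" for \<epsilon>
    using uniform_limitD[OF U that] unfolding eventually_sequentially dist_real_def by auto
  have pt: "(\<lambda>i. ub (r i) (x, t)) \<longlonglongrightarrow> U (x, t)" if "x \<in> {0..M}" "t \<in> {0..T}" for x t
    using tendsto_uniform_limitI[OF U, of "(x, t)"] that by auto
  have \<tau>r: "(\<lambda>i. \<tau> (r i)) \<longlonglongrightarrow> 0" using LIMSEQ_subseq_LIMSEQ[OF \<tau>_lim r] by (simp add: o_def)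
  have \<delta>r: "(\<lambda>i. \<delta> (r i)) \<longlonglongrightarrow> 0" using LIMSEQ_subseq_LIMSEQ[OF \<delta>(1) r] by (simp add: o_def)
  have Usp: "\<bar>U (x, t) - U (y, t)\<bar> \<le> B * sqrt \<bar>x - y\<bar>" if "x \<in> {0..M}" "y \<in> {0..M}" "t \<in> {0..T}" for x y t
    using that ub_space by (intro LIMSEQ_le_const2[OF tendsto_rabs[OF tendsto_diff[OF pt pt]]]) auto
  have Ut: "\<bar>U (x, t) - U (x, s)\<bar> \<le> Lip * \<bar>t - s\<bar>" if x: "x \<in> {0..M}" and t: "t \<in> {0..T}" and s: "s \<in> {0..T}" for x t s
  proof -
    have "(\<lambda>i. Lip * (\<bar>t - s\<bar> + \<tau> (r i))) \<longlonglongrightarrow> Lip * (\<bar>t - s\<bar> + 0)" by (intro tendsto_intros \<tau>r)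
    then show ?thesis
      using LIMSEQ_le[OF tendsto_rabs[OF tendsto_diff[OF pt[OF x t] pt[OF x s]]]] ub_time[OF t s x] by auto
  qed
  have Uc: "continuous_on {0..M} (\<lambda>x. U (x, t))" if "t \<in> {0..T}" for t
    using Hc_continuous[of M 1 B "\<lambda>j x. U (x, t)" 0] Usp that M by (simp add: Hc_def)
  have UM: "U (M, t) = U (0, t)" if t: "t \<in> {0..T}" for t
  proof -
    have "ub (r i) (M, t) = ub (r i) (0, t)" for i
      using uC[OF \<kappa>(1)[OF t, of "r i"]] unfolding ub_def Ck_iff periodic_def by (metis add_0 fst_conv snd_conv)
    then show ?thesis using pt[of M t] pt[of 0 t] t M by (auto intro: LIMSEQ_unique)
  qed
  have sU: "sq M (\<lambda>x. U (x, t))" if "t \<in> {0..T}" for t by (rule sq_continuous[OF Uc[OF that]])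
  have subi: "sq M (\<lambda>x. ub i (x, t))" if "t \<in> {0..T}" for i t
    using sq_u[OF \<kappa>(1)[OF that], of 0 i] by (simp add: ub_def)
  have L2c: "(\<lambda>i. L2_norm M (\<lambda>x. ub (r i) (x, t) - U (x, t))) \<longlonglongrightarrow> 0" if t: "t \<in> {0..T}" for t
  proof (rule LIMSEQ_I)
    fix \<epsilon> :: real assume "\<epsilon> > 0"
    then have e': "\<epsilon> / (2 * sqrt M) > 0" using M by simp
    obtain i0 where i0: "\<And>i x. i \<ge> i0 \<Longrightarrow> x \<in> {0..M} \<Longrightarrow> \<bar>ub (r i) (x, t) - U (x, t)\<bar> < \<epsilon> / (2 * sqrt M)"
      using unif[OF e'] t by blast
    have "L2_norm M (\<lambda>x. ub (r i) (x, t) - U (x, t)) < \<epsilon>" if "i \<ge> i0" for i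
    proof -
      have "L2_norm M (\<lambda>x. ub (r i) (x, t) - U (x, t)) \<le> sqrt M * (\<epsilon> / (2 * sqrt M))"
        using i0[OF that] M by (intro L2_norm_sup sq_diff subi sU t) (auto intro: less_imp_le)
      also have "\<dots> < \<epsilon>" using M \<open>\<epsilon> > 0\<close> by simp
      finally show ?thesis .
    qed
    then show "\<exists>no. \<forall>i\<ge>no. norm (L2_norm M (\<lambda>x. ub (r i) (x, t) - U (x, t)) - 0) < \<epsilon>"
      by (auto simp: L2_norm_nonneg)
  qed
  \<comment> \<open>Bounds on pairings with derivatives of test functions survive the limit, so at
    each time U lies in H^n with the same bound B; its continuous representative agrees with U
    everywhere on [0, M].\<close>
  have "\<exists>W. Hn_derivs M n (W 0) W \<and> (\<forall>j\<le>n. L2_norm M (W j) \<le> B) \<and> Hc M n B W \<and> (\<forall>x\<in>{0..M}. W 0 x = U (x, t))"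
    if t: "t \<in> {0..T}" for t
  proof -
    let ?f = "\<lambda>x. U (x, t)"
    have pe: "per M ?f x = ?f x" if "x \<in> {0..M}" for x by (rule per_eq'[OF M(1) _ that]) (rule UM[OF t])
    have L: "L2 M (per M ?f)" by (rule L2_per[OF M(1) sU[OF t]])
    have aeq: "AE x in lborel. x \<in> {0..M} \<longrightarrow> per M ?f x = ?f x" using pe by auto
    have "\<exists>D. Hn_derivs M n (per M ?f) D \<and> (\<forall>j\<le>n. L2_norm M (D j) \<le> B)"
    proof (rule Hn_derivs_dual[OF M(1) L])
      have "L2_norm M (per M ?f) = L2_norm M ?f" 
        using L sU[OF t] by (intro L2_norm_cong_AE aeq) (auto simp: L2_iff)
      also have "\<dots> \<le> B"
        using uB[OF \<kappa>(1)[OF t], of 0] by (intro LIMSEQ_le_const2[OF L2_norm_tendsto[OF subi[OF t] sU[OF t] L2c[OF t]]]) (auto simp: ub_def)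
      finally show "L2_norm M (per M ?f) \<le> B" .
      fix j \<phi> assume j: "j \<le> n" and \<phi>: "test_fn M \<phi>"
      note s\<phi> = test_fn_sq[OF test_fn_deriv[OF \<phi>, of j]]
      have "I M (\<lambda>x. per M ?f x * (deriv ^^ j) \<phi> x) = I M (\<lambda>x. ?f x * (deriv ^^ j) \<phi> x)"
      proof (rule I_cong_AE)
        show "AE x in lborel. x \<in> {0..M} \<longrightarrow> per M ?f x * (deriv ^^ j) \<phi> x = ?f x * (deriv ^^ j) \<phi> x"
          using aeq by eventually_elim auto
      qed (use L sU[OF t] s\<phi> in \<open>auto simp: L2_iff sq_def intro!: set_measurable_mult\<close>)
      moreover have "\<bar>I M (\<lambda>x. ?f x * (deriv ^^ j) \<phi> x)\<bar> \<le> B * L2_norm M \<phi>"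
      proof (rule LIMSEQ_le_const2[OF tendsto_rabs[OF I_tendsto[OF subi[OF t] sU[OF t] s\<phi> L2c[OF t]]]], intro exI[of _ 0] allI impI)
        fix i
        let ?k = "\<kappa> (r i) t"
        have k: "?k \<le> N (r i)" by (rule \<kappa>(1)[OF t])
        have "\<bar>I M (\<lambda>x. u (r i) ?k x * (deriv ^^ j) \<phi> x)\<bar> = \<bar>I M (\<lambda>x. (deriv ^^ j) (u (r i) ?k) x * \<phi> x)\<bar>"
          using Hn_derivs_by_parts[OF Hn_derivs_classical[OF M(1) uC[OF k]] j \<phi>] by (simp add: abs_mult power_abs)
        also have "\<dots> \<le> L2_norm M ((deriv ^^ j) (u (r i) ?k)) * L2_norm M \<phi>"
          by (rule Cauchy_Schwarz_I[OF sq_u[OF k j] test_fn_sq[OF \<phi>]])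
        also have "\<dots> \<le> B * L2_norm M \<phi>" by (intro mult_right_mono uB k j L2_norm_nonneg)
        finally show "\<bar>I M (\<lambda>x. ub (r i) (x, t) * (deriv ^^ j) \<phi> x)\<bar> \<le> B * L2_norm M \<phi>" by (simp add: ub_def)
      qed
      ultimately show "\<bar>I M (\<lambda>x. per M ?f x * (deriv ^^ j) \<phi> x)\<bar> \<le> B * L2_norm M \<phi>" by simp
    qed
    then obtain D where D: "Hn_derivs M n (per M ?f) D" "\<And>j. j \<le> n \<Longrightarrow> L2_norm M (D j) \<le> B" by blast
    obtain W where W: "Hn_derivs M n (W 0) W" "\<And>j. j \<le> n \<Longrightarrow> AE x in lborel. x \<in> {0..M} \<longrightarrow> D j x = W j x"
      "\<And>j. j \<le> n \<Longrightarrow> L2_norm M (W j) = L2_norm M (D j)"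
      "\<And>B. (\<And>j. j \<le> n \<Longrightarrow> L2_norm M (D j) \<le> B) \<Longrightarrow> Hc M n B W" "\<And>j. j < n \<Longrightarrow> continuous_on {0..M} (W j)"
      "\<And>j. j \<le> n \<Longrightarrow> periodic M (W j)"
      by (rule Hn_representative[OF M(1) D(1)]) blast
    have D0: "D 0 = per M ?f" using D(1) by (simp add: Hn_derivs_def)
    have W20: "AE x in lborel. x \<in> {0..M} \<longrightarrow> per M ?f x = W 0 x" using W(2)[of 0] by (simp add: D0)
    have "W 0 x - U (x, t) = 0" if x: "x \<in> {0..M}" for x
    proof (rule continuous_AE_zero[OF M(1) _ _ x])
      show "continuous_on {0..M} (\<lambda>x. W 0 x - U (x, t))" using n by (intro continuous_intros W(5) Uc t) auto
      show "AE x in lborel. x \<in> {0..M} \<longrightarrow> W 0 x - U (x, t) = 0"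
        using W20 aeq by eventually_elim auto
    qed
    then show ?thesis using W(1) W(3) D(2) W(4)[of B] by (intro exI[of _ W]) auto
  qed
  then have "\<forall>t. \<exists>W. t \<in> {0..T} \<longrightarrow> Hn_derivs M n (W 0) W \<and> (\<forall>j\<le>n. L2_norm M (W j) \<le> B) \<and> Hc M n B W \<and> (\<forall>x\<in>{0..M}. W 0 x = U (x, t))"
    by blast
  from choice[OF this] obtain W where W: "\<And>t. t \<in> {0..T} \<Longrightarrow> Hn_derivs M n (W t 0) (W t)" "\<And>t j. t \<in> {0..T} \<Longrightarrow> j \<le> n \<Longrightarrow> L2_norm M (W t j) \<le> B"
      "\<And>t. t \<in> {0..T} \<Longrightarrow> Hc M n B (W t)" "\<And>t x. t \<in> {0..T} \<Longrightarrow> x \<in> {0..M} \<Longrightarrow> W t 0 x = U (x, t)"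
    by blast
  have BB: "B + B \<ge> 0" using B_nonneg by simp
  \<comment> \<open>The difference of iterate and limit satisfies \<open>Hc\<close> with constant 2
    B and is uniformly small, so interpolation makes its derivatives below n small, uniformly in
    time.\<close>
  have conv: "\<exists>i0. \<forall>i\<ge>i0. \<forall>t\<in>{0..T}. \<forall>j<n. \<forall>x\<in>{0..M}. \<bar>(deriv ^^ j) (u (r i) (\<kappa> (r i) t)) x - W t j x\<bar> \<le> \<epsilon>" if \<epsilon>: "\<epsilon> > 0" for \<epsilon>
  proof -
    obtain h where h: "h > 0" "\<And>V. Hc M n (B + B) V \<Longrightarrow> (\<forall>x\<in>{0..M}. \<bar>V 0 x\<bar> \<le> h) \<Longrightarrow> (\<forall>j<n. \<forall>x\<in>{0..M}. \<bar>V j x\<bar> \<le> \<epsilon>)"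
      using interpolation_all[OF M(1) BB \<epsilon>, of n] by blast
    obtain i0 where i0: "\<And>i x t. i \<ge> i0 \<Longrightarrow> x \<in> {0..M} \<Longrightarrow> t \<in> {0..T} \<Longrightarrow> \<bar>ub (r i) (x, t) - U (x, t)\<bar> < h"
      using unif[OF h(1)] by blast
    show ?thesis
    proof (intro exI[of _ i0] allI impI ballI)
      fix i t j x assume A: "i \<ge> i0" "t \<in> {0..T}" "j < n" "x \<in> {0..M}"
      have "Hc M n (B + B) (\<lambda>j x. (deriv ^^ j) (u (r i) (\<kappa> (r i) t)) x - W t j x)"
        by (intro Hc_diff uHc \<kappa>(1) W(3) A)
      moreover have "\<forall>x\<in>{0..M}. \<bar>(deriv ^^ 0) (u (r i) (\<kappa> (r i) t)) x - W t 0 x\<bar> \<le> h"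
        using i0[OF A(1) _ A(2)] W(4)[OF A(2)] by (auto simp: ub_def intro: less_imp_le)
      ultimately show "\<bar>(deriv ^^ j) (u (r i) (\<kappa> (r i) t)) x - W t j x\<bar> \<le> \<epsilon>"
        using h(2) A by blast
    qed
  qed
  \<comment> \<open>The same interpolation, now for the limit at two different times.\<close>
  have tcont: "\<exists>h>0. \<forall>t\<in>{0..T}. \<forall>s\<in>{0..T}. \<bar>t - s\<bar> \<le> h \<longrightarrow> (\<forall>j<n. \<forall>x\<in>{0..M}. \<bar>W t j x - W s j x\<bar> \<le> \<epsilon>)" if \<epsilon>: "\<epsilon> > 0" for \<epsilon>
  proof -
    obtain h where h: "h > 0" "\<And>V. Hc M n (B + B) V \<Longrightarrow> (\<forall>x\<in>{0..M}. \<bar>V 0 x\<bar> \<le> h) \<Longrightarrow> (\<forall>j<n. \<forall>x\<in>{0..M}. \<bar>V j x\<bar> \<le> \<epsilon>)"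
      using interpolation_all[OF M(1) BB \<epsilon>, of n] by blast
    show ?thesis
    proof (intro exI[of _ "h / (Lip + 1)"] conjI ballI impI)
      show "h / (Lip + 1) > 0" using h Lip_nonneg by simp
      fix t s assume ts: "t \<in> {0..T}" "s \<in> {0..T}" "\<bar>t - s\<bar> \<le> h / (Lip + 1)"
      have "Lip * \<bar>t - s\<bar> \<le> Lip * (h / (Lip + 1))" using ts Lip_nonneg by (intro mult_left_mono) auto
      also have "\<dots> \<le> h" using h Lip_nonneg by (simp add: field_simps)
      finally have Lh: "Lip * \<bar>t - s\<bar> \<le> h" .
      have "\<forall>x\<in>{0..M}. \<bar>W t 0 x - W s 0 x\<bar> \<le> h"
      proof
        fix x assume x: "x \<in> {0..M}"
        show "\<bar>W t 0 x - W s 0 x\<bar> \<le> h"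
          unfolding W(4)[OF ts(1) x] W(4)[OF ts(2) x] by (rule order_trans[OF Ut[OF x ts(1,2)] Lh])
      qed
      with h(2)[OF Hc_diff[OF W(3)[OF ts(1)] W(3)[OF ts(2)]]]
      show "\<forall>j<n. \<forall>x\<in>{0..M}. \<bar>W t j x - W s j x\<bar> \<le> \<epsilon>" by blast
    qed
  qed
  have joint_W: "continuous_on ?K (\<lambda>p. W (snd p) j (fst p))" if j: "j < n" for j
    unfolding continuous_on_iff
  proof (intro ballI allI impI)
    fix p \<epsilon> assume p: "p \<in> ?K" and \<epsilon>: "(0::real) < \<epsilon>"
    obtain h where h: "h > 0" "\<And>t s x. t \<in> {0..T} \<Longrightarrow> s \<in> {0..T} \<Longrightarrow> \<bar>t - s\<bar> \<le> h \<Longrightarrow> x \<in> {0..M} \<Longrightarrow> \<bar>W t j x - W s j x\<bar> \<le> \<epsilon> / 4"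
      using tcont[of "\<epsilon> / 4"] \<epsilon> j by auto
    define h' where "h' = min h ((\<epsilon> / (4 * (B + 1)))\<^sup>2)"
    show "\<exists>d>0. \<forall>q\<in>?K. dist q p < d \<longrightarrow> dist (W (snd q) j (fst q)) (W (snd p) j (fst p)) < \<epsilon>"
    proof (intro exI[of _ h'] conjI ballI impI)
      show "h' > 0" using h \<epsilon> B_nonneg by (simp add: h'_def)
      fix q assume q: "q \<in> ?K" "dist q p < h'"
      have P: "fst p \<in> {0..M}" "snd p \<in> {0..T}" "fst q \<in> {0..M}" "snd q \<in> {0..T}" using p q by auto
      have dx: "\<bar>fst q - fst p\<bar> < h'" "\<bar>snd q - snd p\<bar> < h'"
        using q(2) dist_fst_le[of q p] dist_snd_le[of q p] by (auto simp: dist_real_def)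
      have 1: "\<bar>W (snd q) j (fst q) - W (snd p) j (fst q)\<bar> \<le> \<epsilon> / 4"
        using P dx by (intro h(2)) (auto simp: h'_def)
      have "\<bar>W (snd p) j (fst q) - W (snd p) j (fst p)\<bar> \<le> B * sqrt \<bar>fst q - fst p\<bar>"
        using W(3)[OF P(2)] j P unfolding Hc_def by blast
      also have "\<dots> \<le> B * (\<epsilon> / (4 * (B + 1)))"
      proof (rule mult_left_mono[OF _ B_nonneg])
        show "sqrt \<bar>fst q - fst p\<bar> \<le> \<epsilon> / (4 * (B + 1))"
          using dx \<epsilon> B_nonneg by (intro real_le_lsqrt) (auto simp: h'_def)
      qed
      also have "\<dots> \<le> \<epsilon> / 4" using \<epsilon> B_nonneg by (simp add: field_simps)
      finally show "dist (W (snd q) j (fst q)) (W (snd p) j (fst p)) < \<epsilon>"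
        using 1 \<epsilon> unfolding dist_real_def by arith
    qed
  qed
  define Fl where "Fl = (\<lambda>x s. a x s * W s 3 x + b x s * W s 2 x + c x s * W s 1 x + d x s * W s 0 x)"
  have Flc: "continuous_on ?K (\<lambda>p. Fl (fst p) (snd p))"
    unfolding Fl_def using n by (intro continuous_intros joint joint_W) auto
  obtain SF where SF: "\<And>x s. x \<in> {0..M} \<Longrightarrow> s \<in> {0..T} \<Longrightarrow> \<bar>Fl x s\<bar> \<le> SF"
  proof -
    have "bounded ((\<lambda>p. Fl (fst p) (snd p)) ` ?K)"
      by (intro compact_imp_bounded compact_continuous_image Flc compact_Times compact_Icc)
    then obtain SF where "\<forall>p\<in>?K. \<bar>Fl (fst p) (snd p)\<bar> \<le> SF" by (auto simp: bounded_iff)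
    then show ?thesis using that[of SF] by fastforce
  qed
  have Fls: "continuous_on {0..T} (Fl x)" if x: "x \<in> {0..M}" for x
  proof -
    have "continuous_on {0..T} (\<lambda>s. (x, s))" by (intro continuous_intros)
    moreover have "(\<lambda>s. (x, s)) ` {0..T} \<subseteq> ?K" using x by auto
    ultimately have "continuous_on {0..T} (\<lambda>s. Fl (fst (x, s)) (snd (x, s)))" by (rule continuous_on_compose2[OF Flc])
    then show ?thesis by simp
  qed
  have Flu: "\<exists>h>0. \<forall>x\<in>{0..M}. \<forall>s\<in>{0..T}. \<forall>s'\<in>{0..T}. \<bar>s - s'\<bar> < h \<longrightarrow> \<bar>Fl x s - Fl x s'\<bar> < \<omega>" if \<omega>: "\<omega> > 0" for \<omega>
  proof -
    have "uniformly_continuous_on ?K (\<lambda>p. Fl (fst p) (snd p))"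
      by (intro compact_uniformly_continuous Flc compact_Times compact_Icc)
    then obtain h where h: "h > 0" "\<And>p q. p \<in> ?K \<Longrightarrow> q \<in> ?K \<Longrightarrow> dist q p < h \<Longrightarrow> dist (Fl (fst q) (snd q)) (Fl (fst p) (snd p)) < \<omega>"
      unfolding uniformly_continuous_on_def using \<omega> by meson
    have "\<bar>Fl x s - Fl x s'\<bar> < \<omega>" if "x \<in> {0..M}" "s \<in> {0..T}" "s' \<in> {0..T}" "\<bar>s - s'\<bar> < h" for x s s'
      using h(2)[of "(x, s')" "(x, s)"] that by (auto simp: dist_Pair_Pair dist_real_def)
    with h(1) show ?thesis by blast
  qed
  have SF0: "SF \<ge> 0" using SF[of 0 0] M T by fastforce
  interpret time_int M T E e by (rule ti)
  have main: "AE x in lborel. x \<in> {0..M} \<longrightarrow> W t 0 x = W 0 0 x + prim (Fl x) t + prim (e x) t" if t: "t \<in> {0..T}" for t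
  proof -
    have z0: "0 \<in> {0..T}" using T by simp
    \<comment> \<open>Z is what the source has to account for in the limit equation, and G is its
      counterpart in the scheme.\<close>
    define Z where "Z = (\<lambda>x. W t 0 x - W 0 0 x - prim (Fl x) t)"
    define G where "G = (\<lambda>i x. \<Sum>l<\<kappa> (r i) t. \<tau> (r i) * g (r i) l x)"
    have ZG: "\<exists>i0. \<forall>i\<ge>i0. \<forall>x\<in>{0..M}. \<bar>Z x - G i x\<bar> \<le> \<epsilon>" if \<epsilon>: "\<epsilon> > 0" for \<epsilon>
    proof -
      \<comment> \<open>Each of the following takes a quarter of \<epsilon>: the errors of iterate,
        initial value and operator together; the oscillation \<omega> within a step; the rounding of
        t.\<close>
      define \<epsilon>1 where "\<epsilon>1 = \<epsilon> / (4 * (2 + 4 * (T * R)))"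
      have pos: "2 + 4 * (T * R) > 0" using T R4 by (intro add_pos_nonneg) auto
      have canc: "D * (\<epsilon> / (4 * D)) = \<epsilon> / 4" if "D > 0" for D :: real using that by simp
      have \<epsilon>1: "\<epsilon>1 > 0" "(2 + 4 * (T * R)) * \<epsilon>1 = \<epsilon> / 4" 
        unfolding \<epsilon>1_def by (intro divide_pos_pos mult_pos_pos pos \<epsilon>, simp) (rule canc[OF pos])
      define \<omega> where "\<omega> = \<epsilon> / (4 * T)"
      have \<omega>: "\<omega> > 0" "T * \<omega> = \<epsilon> / 4" using T \<epsilon> by (auto simp: \<omega>_def)
      obtain h where h: "h > 0" "\<And>x s s'. x \<in> {0..M} \<Longrightarrow> s \<in> {0..T} \<Longrightarrow> s' \<in> {0..T} \<Longrightarrow> \<bar>s - s'\<bar> < h \<Longrightarrow> \<bar>Fl x s - Fl x s'\<bar> < \<omega>"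
        using Flu[OF \<omega>(1)] by blast
      obtain i1 where i1: "\<And>i t j x. i \<ge> i1 \<Longrightarrow> t \<in> {0..T} \<Longrightarrow> j < n \<Longrightarrow> x \<in> {0..M} \<Longrightarrow> \<bar>(deriv ^^ j) (u (r i) (\<kappa> (r i) t)) x - W t j x\<bar> \<le> \<epsilon>1"
        using conv[OF \<epsilon>1(1)] by blast
      define h2 where "h2 = min h (\<epsilon> / (4 * (SF + 1)))"
      have h2: "h2 > 0" using h \<epsilon> SF0 by (simp add: h2_def)
      obtain i2 where i2: "\<And>i. i \<ge> i2 \<Longrightarrow> \<tau> (r i) < h2"
        using order_tendstoD(2)[OF \<tau>r h2] by (auto simp: eventually_sequentially)
      show ?thesis
      proof (intro exI[of _ "max i1 i2"] allI impI ballI)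
        fix i x assume i: "max i1 i2 \<le> i" and x: "x \<in> {0..M}"
        let ?m = "r i" and ?k = "\<kappa> (r i) t"
        have ii: "i \<ge> i1" "i \<ge> i2" using i by auto
        have k: "?k \<le> N ?m" by (rule \<kappa>(1)[OF t])
        have kT: "real ?k * \<tau> ?m \<in> {0..T}" by (rule k\<tau>[OF k])
        have A1: "\<bar>u ?m ?k x - W t 0 x\<bar> \<le> \<epsilon>1" using i1[OF ii(1) t, of 0 x] n x by simp
        have A2: "\<bar>u ?m 0 x - W 0 0 x\<bar> \<le> \<epsilon>1" using i1[OF ii(1) z0, of 0 x] n x by (simp add: \<kappa>_0)
        have A3: "\<bar>(\<Sum>l<?k. \<tau> ?m * AA (real (Suc l) * \<tau> ?m) (u ?m (Suc l)) x) - prim (Fl x) (real ?k * \<tau> ?m)\<bar> \<le> real ?k * \<tau> ?m * (4 * (R * \<epsilon>1) + \<omega>)"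
        proof (rule riemann_sum_estimate[OF Fls[OF x]])
          show "\<tau> ?m \<ge> 0" using \<tau>_pos[of ?m] by simp
          show "real ?k * \<tau> ?m \<le> T" using kT by simp
          show "\<bar>Fl x s - Fl x s'\<bar> \<le> \<omega>" if "s \<in> {0..T}" "s' \<in> {0..T}" "\<bar>s - s'\<bar> \<le> \<tau> ?m" for s s'
          proof -
            have "\<bar>s - s'\<bar> < h" using that(3) i2[OF ii(2)] by (simp add: h2_def)
            then show ?thesis using h(2)[OF x that(1,2)] by simp
          qed
          fix l assume l: "l < ?k"
          then have lN: "Suc l \<le> N ?m" using k by simp
          let ?t = "real (Suc l) * \<tau> ?m"
          have tl: "?t \<in> {0..T}" by (rule k\<tau>[OF lN])
          have D: "\<bar>(deriv ^^ j) (u ?m (Suc l)) x - W ?t j x\<bar> \<le> \<epsilon>1" if "j < n" for j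
            using i1[OF ii(1) tl that x] by (simp only: \<kappa>_grid)
          have "AA ?t (u ?m (Suc l)) x - Fl x ?t = a x ?t * ((deriv ^^ 3) (u ?m (Suc l)) x - W ?t 3 x) + b x ?t * ((deriv ^^ 2) (u ?m (Suc l)) x - W ?t 2 x)
             + c x ?t * ((deriv ^^ 1) (u ?m (Suc l)) x - W ?t 1 x) + d x ?t * ((deriv ^^ 0) (u ?m (Suc l)) x - W ?t 0 x)"
            by (simp add: Aop_def Fl_def algebra_simps)
          also have "\<bar>\<dots>\<bar> \<le> R * \<epsilon>1 + R * \<epsilon>1 + R * \<epsilon>1 + R * \<epsilon>1"
            using coef_le[OF tl, of x] n by (intro abs_add_bound abs_mult_bound D) auto
          finally show "\<bar>AA ?t (u ?m (Suc l)) x - Fl x ?t\<bar> \<le> 4 * (R * \<epsilon>1)" by simp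
        qed
        have "real ?k * \<tau> ?m * (4 * (R * \<epsilon>1) + \<omega>) \<le> T * (4 * (R * \<epsilon>1) + \<omega>)"
          using kT R4 \<epsilon>1 \<omega> by (intro mult_right_mono) auto
        with A3 have A3': "\<bar>(\<Sum>l<?k. \<tau> ?m * AA (real (Suc l) * \<tau> ?m) (u ?m (Suc l)) x) - prim (Fl x) (real ?k * \<tau> ?m)\<bar> \<le> T * (4 * (R * \<epsilon>1) + \<omega>)"
          by linarith
        have Fi: "set_integrable lborel {0..T} (Fl x)" by (rule borel_integrable_atLeastAtMost'[OF Fls[OF x]])
        have st: "0 \<le> t" "t \<le> real ?k * \<tau> ?m" "real ?k * \<tau> ?m \<le> T" using t \<kappa>(2)[OF t] kT by auto
        have "\<bar>prim (Fl x) (real ?k * \<tau> ?m) - prim (Fl x) t\<bar> \<le> (real ?k * \<tau> ?m - t) * SF"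
          unfolding prim_diff(1)[OF Fi st] using SF[OF x] st
          by (intro integral_abs_le_AE prim_diff(2)[OF Fi st]) auto
        also have "\<dots> \<le> (\<epsilon> / (4 * (SF + 1))) * SF"
          using \<kappa>(3)[OF t, of ?m] i2[OF ii(2)] SF0 by (intro mult_right_mono) (auto simp: h2_def)
        also have "\<dots> \<le> \<epsilon> / 4" using \<epsilon> SF0 by (simp add: field_simps)
        finally have A4: "\<bar>prim (Fl x) (real ?k * \<tau> ?m) - prim (Fl x) t\<bar> \<le> \<epsilon> / 4" .
        have "Z x - G i x = ((((\<Sum>l<?k. \<tau> ?m * AA (real (Suc l) * \<tau> ?m) (u ?m (Suc l)) x) - prim (Fl x) (real ?k * \<tau> ?m))
             + (prim (Fl x) (real ?k * \<tau> ?m) - prim (Fl x) t)) - (u ?m ?k x - W t 0 x)) + (u ?m 0 x - W 0 0 x)"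
          using rec_sum[OF k, of x] by (simp add: Z_def G_def)
        also have "\<bar>\<dots>\<bar> \<le> ((T * (4 * (R * \<epsilon>1) + \<omega>) + \<epsilon> / 4) + \<epsilon>1) + \<epsilon>1"
          by (rule abs_add_bound[OF abs_diff_bound[OF abs_add_bound[OF A3' A4] A1] A2])
        also have "\<dots> = (2 + 4 * (T * R)) * \<epsilon>1 + T * \<omega> + \<epsilon> / 4" by (simp add: algebra_simps)
        also have "\<dots> \<le> \<epsilon>" unfolding \<epsilon>1(2) \<omega>(2) using \<epsilon> by simp
        finally show "\<bar>Z x - G i x\<bar> \<le> \<epsilon>" .
      qed
    qed
    have gc: "continuous_on {0..M} (g m l)" for m l
      using gC[of m l] Cd_continuous_on[of n "g m l" 0] by (auto simp: Ck_iff)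
    have Gc: "continuous_on {0..M} (G i)" for i
      unfolding G_def by (intro continuous_intros gc)
    have Zc: "continuous_on {0..M} Z"
    proof (rule uniform_limit_theorem)
      show "uniform_limit {0..M} G Z sequentially"
      proof (rule uniform_limitI)
        fix \<epsilon> :: real assume "\<epsilon> > 0"
        then obtain i0 where "\<forall>i\<ge>i0. \<forall>x\<in>{0..M}. \<bar>Z x - G i x\<bar> \<le> \<epsilon> / 2" using ZG[of "\<epsilon> / 2"] by auto
        then show "\<forall>\<^sub>F i in sequentially. \<forall>x\<in>{0..M}. dist (G i x) (Z x) < \<epsilon>"
          using \<open>\<epsilon> > 0\<close> unfolding eventually_sequentially dist_real_def by (metis abs_minus_commute field_sum_of_halves less_add_same_cancel1 half_gt_zero le_less_trans)
      qed
    qed (use Gc in auto)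
    define f where "f = (\<lambda>x. prim (e x) t)"
    have tt: "0 \<le> t" "t \<le> T" using t by auto
    have sf: "sq M f" unfolding f_def by (rule time_integral_sq[OF order_refl tt])
    have sZ: "sq M Z" by (rule sq_continuous[OF Zc])
    have sG: "sq M (G i)" for i by (rule sq_continuous[OF Gc])
    \<comment> \<open>T \<delta> adds up the source errors of all steps, and \<tau> E bounds the
      source between t and the grid time above it.\<close>
    have est: "L2_norm M (\<lambda>x. G i x - f x) \<le> T * \<delta> (r i) + \<tau> (r i) * E" for i
    proof -
      let ?m = "r i" and ?k = "\<kappa> (r i) t"
      have k: "?k \<le> N ?m" by (rule \<kappa>(1)[OF t])
      have kT: "0 \<le> real ?k * \<tau> ?m" "real ?k * \<tau> ?m \<le> T" using k\<tau>[OF k] by auto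
      define fk where "fk = (\<lambda>x. prim (e x) (real ?k * \<tau> ?m))"
      have sfk: "sq M fk" unfolding fk_def by (rule time_integral_sq[OF order_refl kT])
      define q where "q = (\<lambda>l x. \<tau> ?m * g ?m l x - (LINT z:{real l * \<tau> ?m..real (Suc l) * \<tau> ?m}|lborel. e x z))"
      have lT: "0 \<le> real l * \<tau> ?m \<and> real l * \<tau> ?m \<le> real (Suc l) * \<tau> ?m \<and> real (Suc l) * \<tau> ?m \<le> T" if "l < ?k" for l
        using k\<tau>[of l ?m] k\<tau>[of "Suc l" ?m] that k \<tau>_pos[of ?m] by (auto intro: mult_right_mono)
      have sq_q: "sq M (q l)" if "l < ?k" for l
        unfolding q_def using lT[OF that] by (intro sq_diff sq_cmult sq_continuous[OF gc] time_integral_sq) auto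
      have "L2_norm M (\<lambda>x. G i x - fk x) = L2_norm M (\<lambda>x. \<Sum>l<?k. q l x)"
      proof (rule L2_norm_cong_AE)
        show "AE x in lborel. x \<in> {0..M} \<longrightarrow> G i x - fk x = (\<Sum>l<?k. q l x)"
          using AE_integrable
        proof eventually_elim
          case (elim x)
          show ?case
          proof
            assume "x \<in> {0..M}"
            then have "set_integrable lborel {0..T} (e x)" using elim by simp
            from prim_eq_split[OF this _ kT(2)] \<tau>_pos[of ?m]
            show "G i x - fk x = (\<Sum>l<?k. q l x)" by (simp add: G_def fk_def q_def sum_subtractf)
          qed
        qed
      qed (intro sq_diff sG sfk sq_sum; use sq_q in auto)+
      also have "\<dots> \<le> (\<Sum>l<?k. L2_norm M (q l))" using sq_q by (intro L2_norm_sum_le) auto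
      also have "\<dots> \<le> (\<Sum>l<?k. \<tau> ?m * \<delta> ?m)" unfolding q_def using k by (intro sum_mono gE) auto
      also have "\<dots> = (real ?k * \<tau> ?m) * \<delta> ?m" by simp
      also have "\<dots> \<le> T * \<delta> ?m" using kT \<delta>(2)[of ?m] by (intro mult_right_mono) auto
      finally have 1: "L2_norm M (\<lambda>x. G i x - fk x) \<le> T * \<delta> ?m" .
      have "L2_norm M (\<lambda>x. fk x - f x) = L2_norm M (\<lambda>x. LINT z:{t..real ?k * \<tau> ?m}|lborel. e x z)"
      proof (rule L2_norm_cong_AE)
        show "sq M (\<lambda>x. LINT z:{t..real ?k * \<tau> ?m}|lborel. e x z)" by (rule time_integral_sq[OF tt(1) \<kappa>(2)[OF t] kT(2)])
        show "AE x in lborel. x \<in> {0..M} \<longrightarrow> fk x - f x = (LINT z:{t..real ?k * \<tau> ?m}|lborel. e x z)"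
          using AE_integrable
        proof eventually_elim
          case (elim x)
          then show ?case unfolding fk_def f_def using prim_diff(1)[OF _ tt(1) \<kappa>(2)[OF t] kT(2)] by blast
        qed
      qed (intro sq_diff sfk sf)
      also have "\<dots> \<le> (real ?k * \<tau> ?m - t) * E" by (rule time_integral_norm[OF tt(1) \<kappa>(2)[OF t] kT(2)])
      also have "\<dots> \<le> \<tau> ?m * E" using \<kappa>(3)[OF t, of ?m] C_nonneg by (intro mult_right_mono) auto
      finally have 2: "L2_norm M (\<lambda>x. fk x - f x) \<le> \<tau> ?m * E" .
      show ?thesis using L2_norm_triangle_sub[OF sG[of i] sfk sf] 1 2 by linarith
    qed
    have "L2_norm M (\<lambda>x. Z x - f x) \<le> 0"
    proof (rule field_le_epsilon)
      fix \<epsilon> :: real assume \<epsilon>: "\<epsilon> > 0"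
      then have "\<epsilon> / (2 * sqrt M) > 0" using M by simp
      from ZG[OF this] obtain i0 where i0: "\<And>i x. i \<ge> i0 \<Longrightarrow> x \<in> {0..M} \<Longrightarrow> \<bar>Z x - G i x\<bar> \<le> \<epsilon> / (2 * sqrt M)" by blast
      have "(\<lambda>i. T * \<delta> (r i) + \<tau> (r i) * E) \<longlonglongrightarrow> T * 0 + 0 * E" by (intro tendsto_intros \<delta>r \<tau>r)
      then have "(\<lambda>i. T * \<delta> (r i) + \<tau> (r i) * E) \<longlonglongrightarrow> 0" by simp
      from order_tendstoD(2)[OF this, of "\<epsilon> / 2"] obtain i1 where i1: "\<And>i. i \<ge> i1 \<Longrightarrow> T * \<delta> (r i) + \<tau> (r i) * E < \<epsilon> / 2"
        using \<epsilon> by (auto simp: eventually_sequentially)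
      let ?i = "max i0 i1"
      have "L2_norm M (\<lambda>x. Z x - G ?i x) \<le> sqrt M * (\<epsilon> / (2 * sqrt M))"
        using i0[of ?i] M by (intro L2_norm_sup sq_diff sZ sG) auto
      also have "\<dots> = \<epsilon> / 2" using M by simp
      finally have "L2_norm M (\<lambda>x. Z x - G ?i x) \<le> \<epsilon> / 2" .
      then show "L2_norm M (\<lambda>x. Z x - f x) \<le> 0 + \<epsilon>"
        using L2_norm_triangle_sub[OF sZ sG[of ?i] sf] est[of ?i] i1[of ?i] by simp
    qed
    then have "L2_norm M (\<lambda>x. Z x - f x) = 0" using L2_norm_nonneg[of M "\<lambda>x. Z x - f x"] by simp
    from L2_norm_zero_AE[OF sq_diff[OF sZ sf] this]
    show ?thesis by eventually_elim (auto simp: Z_def f_def)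
  qed
  have initial: "AE x in lborel. x \<in> {0..M} \<longrightarrow> W 0 0 x = u0 x"
  proof -
    have z0: "0 \<in> {0..T}" using T by simp
    have "(\<lambda>i. L2_norm M (\<lambda>x. ub (r i) (x, 0) - U (x, 0)) + \<delta> (r i)) \<longlonglongrightarrow> 0 + 0" by (intro tendsto_intros L2c[OF z0] \<delta>r)
    moreover have "L2_norm M (\<lambda>x. U (x, 0) - u0 x) \<le> L2_norm M (\<lambda>x. ub (r i) (x, 0) - U (x, 0)) + \<delta> (r i)" for i
      using L2_norm_triangle_sub[OF sU[OF z0] subi[OF z0, of "r i"] u0] init[of "r i"]
      by (simp add: L2_norm_diff_commute[of M "\<lambda>x. U (x, 0)" "\<lambda>x. ub (r i) (x, 0)"]) (simp add: ub_def \<kappa>_0)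
    ultimately have "L2_norm M (\<lambda>x. U (x, 0) - u0 x) \<le> 0" by (intro LIMSEQ_le_const[where X = "\<lambda>i. L2_norm M (\<lambda>x. ub (r i) (x, 0) - U (x, 0)) + \<delta> (r i)"]) auto
    then have "L2_norm M (\<lambda>x. U (x, 0) - u0 x) = 0" using L2_norm_nonneg[of M "\<lambda>x. U (x, 0) - u0 x"] by simp
    from L2_norm_zero_AE[OF sq_diff[OF sU[OF z0] u0] this]
    show ?thesis by eventually_elim (use W(4)[OF z0] in auto)
  qed
  show ?thesis
    using W(1,2) joint_W initial main unfolding Fl_def
    by (intro exI[of _ "\<lambda>j x t. W t j x"]) auto
qed

end

section \<open>Existence for H^n data and the energy of a rough solution\<close>

lemma exp_diff_le:
  fixes x y :: real
  assumes "x \<le> H" "y \<le> H" shows "\<bar>exp x - exp y\<bar> \<le> exp H * \<bar>x - y\<bar>"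
proof -
  have *: "exp x - exp y \<le> exp H * \<bar>x - y\<bar>" if "x \<le> H" for x y :: real
  proof -
    have "exp x * (1 + (y - x)) \<le> exp x * exp (y - x)" by (intro mult_left_mono exp_ge_add_one_self) simp
    also have "\<dots> = exp y" by (simp add: exp_add[symmetric])
    finally have "exp x - exp y \<le> exp x * (x - y)" by (simp add: algebra_simps)
    also have "\<dots> \<le> exp x * \<bar>x - y\<bar>" by (intro mult_left_mono) auto
    also have "\<dots> \<le> exp H * \<bar>x - y\<bar>" using that by (intro mult_right_mono) auto
    finally show ?thesis .
  qed
  show ?thesis using *[OF assms(1), of y] *[OF assms(2), of x] by (simp add: abs_le_iff abs_minus_commute)
qed

lemma L2_norm_mult_le:
  assumes c: "continuous_on {0..M} g" and f: "sq M f" and g: "\<And>x. x \<in> {0..M} \<Longrightarrow> \<bar>g x\<bar> \<le> C" and C: "C \<ge> 0"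
  shows "L2_norm M (\<lambda>x. g x * f x) \<le> C * L2_norm M f"
proof (rule L2_norm_le)
  have "I M (\<lambda>x. (g x * f x)\<^sup>2) \<le> I M (\<lambda>x. C\<^sup>2 * (f x)\<^sup>2)"
  proof (rule I_mono)
    show "set_integrable lborel {0..M} (\<lambda>x. (g x * f x)\<^sup>2)" using sq_cmult_cont[OF c f] by (simp add: sq_def)
    show "set_integrable lborel {0..M} (\<lambda>x. C\<^sup>2 * (f x)\<^sup>2)" using f by (simp add: sq_def)
    show "(g x * f x)\<^sup>2 \<le> C\<^sup>2 * (f x)\<^sup>2" if "x \<in> {0..M}" for x
      using power_mono[OF g[OF that] abs_ge_zero, of 2] by (simp add: power_mult_distrib mult_right_mono)
  qed
  then show "I M (\<lambda>x. (g x * f x)\<^sup>2) \<le> (C * L2_norm M f)\<^sup>2" by (simp add: power_mult_distrib L2_norm_sq)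
qed (use C L2_norm_nonneg in auto)

context adm begin

text \<open>Supplies the input of \<open>rothe\<close>: test functions close to u0 and to the
  averages of e over each step. Errors of at most E keep all of them below 2 E, hence the factor 2
  in the bound.\<close>

theorem existence:
  assumes e: "in_Linf_Hn M n T e" and E: "E > 0" "AE r in lborel. r \<in> {0..T} \<longrightarrow> Hn_norm M n (\<lambda>x. e x r) \<le> E"
    and u0: "Hn_derivs M n u0 D0" "\<And>j. j \<le> n \<Longrightarrow> L2_norm M (D0 j) \<le> E"
  shows "\<exists>V. (\<forall>t\<in>{0..T}. Hn_derivs M n (\<lambda>x. V 0 x t) (\<lambda>j x. V j x t) \<and> (\<forall>j\<le>n. L2_norm M (\<lambda>x. V j x t) \<le> KB R * (2 * E)))
    \<and> (\<forall>j<n. continuous_on ({0..M} \<times> {0..T}) (\<lambda>p. V j (fst p) (snd p)))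
    \<and> (AE x in lborel. x \<in> {0..M} \<longrightarrow> V 0 x 0 = u0 x)
    \<and> (\<forall>t\<in>{0..T}. AE x in lborel. x \<in> {0..M} \<longrightarrow> V 0 x t = V 0 x 0 +
        prim (\<lambda>s. a x s * V 3 x s + b x s * V 2 x s + c x s * V 1 x s + d x s * V 0 x s) t + prim (e x) t)"
proof -
  note ti = time_integral_Hn(1)[OF M(1) T(1) e E(2)]
  interpret time_int M T E e by (rule ti)
  \<comment> \<open>Large enough for both step size conditions of \<open>Rothe\<close> to hold in
    every run.\<close>
  obtain N0 where N0: "real N0 > 2 * T * CS R + T * (Ybound R + R)" using reals_Archimedean2 by blast
  define N where "N = (\<lambda>m. N0 + m + 1)"
  have Npos: "N m > 0" "N m \<ge> m" for m by (auto simp: N_def)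
  define \<tau> where "\<tau> = (\<lambda>m. T / real (N m))"
  have \<tau>pos: "\<tau> m > 0" for m using T Npos by (simp add: \<tau>_def)
  have small: "T / real (N m) * CS R \<le> 1/2" "T / real (N m) * (Ybound R + R) < 1" for m
  proof -
    have nn: "T * CS R \<ge> 0" "T * (Ybound R + R) \<ge> 0" using T CS_nonneg Ybound_nonneg[of R] R4 by auto
    have "real (N m) > 2 * T * CS R + T * (Ybound R + R)" using N0 by (simp add: N_def)
    then have "2 * (T * CS R) \<le> real (N m)" "T * (Ybound R + R) < real (N m)" using nn by auto
    then show "T / real (N m) * CS R \<le> 1/2" "T / real (N m) * (Ybound R + R) < 1"
      using Npos(1)[of m] by (simp_all add: field_simps)
  qed
  define \<delta> where "\<delta> = (\<lambda>m. min E (1 / real (Suc m)))"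
  have \<delta>: "\<delta> m > 0" "\<delta> m \<le> E" for m using E by (auto simp: \<delta>_def)
  have \<delta>lim: "\<delta> \<longlonglongrightarrow> 0"
  proof (rule tendsto_sandwich[OF _ _ tendsto_const LIMSEQ_inverse_real_of_nat])
    show "\<forall>\<^sub>F m in sequentially. \<delta> m \<le> inverse (real (Suc m))" by (intro always_eventually allI) (simp add: \<delta>_def inverse_eq_divide)
    show "\<forall>\<^sub>F m in sequentially. 0 \<le> \<delta> m" by (intro always_eventually allI less_imp_le \<delta>)
  qed
  have "\<exists>p. test_fn M p \<and> (\<forall>j\<le>n. L2_norm M (\<lambda>x. (deriv ^^ j) p x - D0 j x) < \<delta> m)" for m
    by (rule tests_dense[OF M(1) u0(1) \<delta>(1)])
  then obtain p where p: "\<And>m. test_fn M (p m)" "\<And>m j. j \<le> n \<Longrightarrow> L2_norm M (\<lambda>x. (deriv ^^ j) (p m) x - D0 j x) < \<delta> m" by metis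
  have tsq: "test_fn M \<phi> \<Longrightarrow> sq M ((deriv ^^ j) \<phi>)" for \<phi> j by (intro test_fn_sq test_fn_deriv)
  have tC: "test_fn M \<phi> \<Longrightarrow> Ck M n \<phi>" for \<phi> by (auto simp: test_fn_iff)
  have p2: "L2_norm M ((deriv ^^ j) (p m)) \<le> 2 * E" if "j \<le> n" for m j
    using L2_norm_diff_le[OF tsq[OF p(1)[of m], of j] Hn_derivs_sq[OF u0(1) that]] p(2)[OF that, of m] u0(2)[OF that] \<delta>(2)[of m] by simp
  have exg: "\<exists>g. test_fn M g \<and> (\<forall>j\<le>n. L2_norm M ((deriv ^^ j) g) \<le> 2 * E) \<and>
     (k < N m \<longrightarrow> L2_norm M (\<lambda>x. \<tau> m * g x - (LINT r:{real k * \<tau> m..real (Suc k) * \<tau> m}|lborel. e x r)) \<le> \<tau> m * \<delta> m)" for m k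
  proof (cases "k < N m")
    \<comment> \<open>Beyond the last step any bounded test function serves; the choice of g needs
      one for every k.\<close>
    case False
    have "L2_norm M ((deriv ^^ j) (\<lambda>x. 0)) \<le> 2 * E" for j
    proof -
      have "deriv (\<lambda>x. 0::real) = (\<lambda>x. 0)" by (rule ext) simp
      then have "(deriv ^^ j) (\<lambda>x. 0::real) = (\<lambda>x. 0)" by (induction j) simp_all
      then show ?thesis using E by (simp add: L2_norm_def)
    qed
    then show ?thesis using False by (intro exI[of _ "\<lambda>x. 0"]) (auto simp: test_fn_const)
  next
    case True
    let ?f = "\<lambda>x. LINT r:{real k * \<tau> m..real (Suc k) * \<tau> m}|lborel. e x r"
    have st: "0 \<le> real k * \<tau> m" "real k * \<tau> m \<le> real (Suc k) * \<tau> m" "real (Suc k) * \<tau> m \<le> T"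
    proof -
      show "0 \<le> real k * \<tau> m" "real k * \<tau> m \<le> real (Suc k) * \<tau> m" using \<tau>pos[of m] by (auto intro: mult_right_mono)
      have "real (Suc k) * \<tau> m \<le> real (N m) * \<tau> m" using True \<tau>pos[of m] by (intro mult_right_mono) auto
      then show "real (Suc k) * \<tau> m \<le> T" using Npos[of m] by (simp add: \<tau>_def)
    qed
    obtain D where D: "Hn_derivs M n (per M ?f) D" "\<And>j. j \<le> n \<Longrightarrow> L2_norm M (D j) \<le> (real (Suc k) * \<tau> m - real k * \<tau> m) * E"
      using time_integral_Hn(2)[OF M(1) T(1) e E(2) st] by blast
    have D2: "L2_norm M (D j) \<le> \<tau> m * E" if "j \<le> n" for j
      using D(2)[OF that] by (simp add: algebra_simps)
    obtain \<phi> where \<phi>: "test_fn M \<phi>" "\<And>j. j \<le> n \<Longrightarrow> L2_norm M (\<lambda>x. (deriv ^^ j) \<phi> x - D j x) < \<tau> m * \<delta> m"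
      using tests_dense[OF M(1) D(1), of "\<tau> m * \<delta> m"] \<tau>pos[of m] \<delta>(1)[of m] by auto
    \<comment> \<open>An integral over one step becomes an average on division by \<tau> m; for this
      reason the approximation error was taken proportional to \<tau> m.\<close>
    let ?g = "\<lambda>x. 1 / \<tau> m * \<phi> x"
    have "L2_norm M ((deriv ^^ j) ?g) \<le> 2 * E" if j: "j \<le> n" for j
    proof -
      have "L2_norm M ((deriv ^^ j) \<phi>) \<le> \<tau> m * \<delta> m + \<tau> m * E"
        using L2_norm_diff_le[OF tsq[OF \<phi>(1), of j] Hn_derivs_sq[OF D(1) j]] \<phi>(2)[OF j] D2[OF j] by simp
      also have "\<dots> \<le> \<tau> m * (2 * E)" using \<delta>(2)[of m] \<tau>pos[of m] by (simp add: distrib_left[symmetric])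
      finally have "1 / \<tau> m * L2_norm M ((deriv ^^ j) \<phi>) \<le> 1 / \<tau> m * (\<tau> m * (2 * E))"
        using \<tau>pos[of m] by (intro mult_left_mono) auto
      then show ?thesis
        unfolding funpow_deriv_cmult[OF test_fn_Cd[OF \<phi>(1)] order_refl] L2_norm_cmult using \<tau>pos[of m] by simp
    qed
    moreover have "L2_norm M (\<lambda>x. \<tau> m * ?g x - ?f x) \<le> \<tau> m * \<delta> m"
    proof -
      have D0: "D 0 = per M ?f" using D(1) by (simp add: Hn_derivs_def)
      have sf: "sq M ?f" by (rule time_integral_sq[OF st])
      have "L2_norm M (\<lambda>x. \<tau> m * ?g x - ?f x) = L2_norm M (\<lambda>x. \<phi> x - D 0 x)"
      proof (rule L2_norm_cong_AE)
        show "sq M (\<lambda>x. \<tau> m * ?g x - ?f x)" by (intro sq_diff sq_cmult sf test_fn_sq \<phi>)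
        show "sq M (\<lambda>x. \<phi> x - D 0 x)" using Hn_derivs_sq[OF D(1), of 0] by (intro sq_diff[OF test_fn_sq[OF \<phi>(1)]]) simp
        show "AE x in lborel. x \<in> {0..M} \<longrightarrow> \<tau> m * ?g x - ?f x = \<phi> x - D 0 x"
          using AE_per[OF M(1), of ?f] unfolding D0 by eventually_elim (use \<tau>pos[of m] in auto)
      qed
      then show ?thesis using \<phi>(2)[of 0] by simp
    qed
    moreover have "test_fn M ?g" by (intro test_fn_mult test_fn_const \<phi>)
    ultimately show ?thesis by blast
  qed
  have "\<exists>g. \<forall>m k. test_fn M (g m k) \<and> (\<forall>j\<le>n. L2_norm M ((deriv ^^ j) (g m k)) \<le> 2 * E) \<and>
     (k < N m \<longrightarrow> L2_norm M (\<lambda>x. \<tau> m * (g m k) x - (LINT r:{real k * \<tau> m..real (Suc k) * \<tau> m}|lborel. e x r)) \<le> \<tau> m * \<delta> m)"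
    by (intro choice allI exg)
  then obtain g where g: "\<And>m k. test_fn M (g m k)" "\<And>m k j. j \<le> n \<Longrightarrow> L2_norm M ((deriv ^^ j) (g m k)) \<le> 2 * E"
     "\<And>m k. k < N m \<Longrightarrow> L2_norm M (\<lambda>x. \<tau> m * g m k x - (LINT r:{real k * \<tau> m..real (Suc k) * \<tau> m}|lborel. e x r)) \<le> \<tau> m * \<delta> m"
    by auto
  have exu: "\<exists>u. u 0 = p m \<and> (\<forall>k\<le>N m. Ck M n (u k) \<and> (\<forall>j\<le>n. L2_norm M ((deriv ^^ j) (u k)) \<le> KB R * (2 * E))) \<and>
     (\<forall>k<N m. \<forall>x. u (Suc k) x = u k x + T / real (N m) * (AA (real (Suc k) * (T / real (N m))) (u (Suc k)) x + g m k x))" for m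
    by (rule Rothe[OF Npos(1) small tC[OF p(1)] p2 tC[OF g(1)] g(2)])
  have "\<exists>u. \<forall>m. (u m) 0 = p m \<and> (\<forall>k\<le>N m. Ck M n ((u m) k) \<and> (\<forall>j\<le>n. L2_norm M ((deriv ^^ j) ((u m) k)) \<le> KB R * (2 * E))) \<and>
     (\<forall>k<N m. \<forall>x. (u m) (Suc k) x = (u m) k x + T / real (N m) * (AA (real (Suc k) * (T / real (N m))) ((u m) (Suc k)) x + g m k x))"
    by (intro choice allI exu)
  then obtain u where u: "\<And>m. u m 0 = p m" "\<And>m k. k \<le> N m \<Longrightarrow> Ck M n (u m k)"
      "\<And>m k j. k \<le> N m \<Longrightarrow> j \<le> n \<Longrightarrow> L2_norm M ((deriv ^^ j) (u m k)) \<le> KB R * (2 * E)"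
      "\<And>m k x. k < N m \<Longrightarrow> u m (Suc k) x = u m k x + T / real (N m) * (AA (real (Suc k) * (T / real (N m))) (u m (Suc k)) x + g m k x)"
    by blast
  have D00: "D0 0 = u0" using u0(1) by (simp add: Hn_derivs_def)
  have "rothe R M T n a b c d e u0 E (KB R * (2 * E)) (2 * E / sqrt M + 2 * E * sqrt M) N g u \<delta> \<tau>"
  proof (unfold_locales)
    show "sq M u0" using Hn_derivs_sq[OF u0(1), of 0] by (simp add: D00)
    show "\<bar>g m k x\<bar> \<le> 2 * E / sqrt M + 2 * E * sqrt M" if "x \<in> {0..M}" for m k x
      using sup_bound_Hc[OF M(1) Hc_classical[OF M(1) tC[OF g(1)[of m k]] g(2)], of 0 x] n that g(2)[of 0 m k] by simp
    show "L2_norm M (\<lambda>x. u m 0 x - u0 x) \<le> \<delta> m" for m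
      using p(2)[of 0 m] by (simp add: u(1) D00)
    show "u m (Suc k) x = u m k x + \<tau> m * (AA (real (Suc k) * \<tau> m) (u m (Suc k)) x + g m k x)" if "k < N m" for m k x
      unfolding \<tau>_def by (rule u(4)[OF that])
  qed (use Npos \<delta>lim \<delta>(1) u(2,3) g(3) tC[OF g(1)] in \<open>auto simp: \<tau>_def intro: less_imp_le\<close>)
  from rothe.limit_exists[OF this] show ?thesis .
qed

text \<open>w is only Lipschitz in time with values in L2, so its energy is compared at the ends of
  short intervals. From r to t, convexity of the square leaves the pairing of w t - w r with W w at
  time t. Inside the time integral, W w is moved to time s, where \<open>en\<close> applies, and the
  energy back to time t; the error per interval is quadratic in t - r, so N intervals leave an error
  of order 1/N.\<close>

lemma zero_solution:
  assumes ti: "time_int M T CG G" and w: "\<And>t. t \<in> {0..T} \<Longrightarrow> sq M (\<lambda>x. w x t)"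
    and eq: "\<And>t. t \<in> {0..T} \<Longrightarrow> AE x in lborel. x \<in> {0..M} \<longrightarrow> w x t = prim (G x) t"
    and en: "AE s in lborel. s \<in> {0..T} \<longrightarrow> I M (\<lambda>x. G x s * (W s 0 x * w x s)) \<le> Q * I M (\<lambda>x. W s 0 x * (w x s)\<^sup>2)"
    and Q: "Q \<ge> 0" and t: "t \<in> {0..T}"
  shows "AE x in lborel. x \<in> {0..M} \<longrightarrow> w x t = 0"
proof -
  interpret time_int M T CG G by (rule ti)
  let ?y = "\<lambda>s. I M (\<lambda>x. W s 0 x * (w x s)\<^sup>2)"
  let ?H = "exp (Hbound R)"
  have Wc: "continuous_on {0..M} (W s 0)" if "s \<in> {0..T}" for s by (rule coef.wt_cont[OF coefs[OF that]])
  have Wb: "\<bar>W s 0 x\<bar> \<le> ?H" if "s \<in> {0..T}" "x \<in> {0..M}" for s x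
    using coef.wt_bounds(1)[OF coefs[OF that(1)], of 0 x] that(2) by simp
  have diff: "AE x in lborel. x \<in> {0..M} \<longrightarrow> w x t - w x r = (LINT z:{r..t}|lborel. G x z)" if "0 \<le> r" "r \<le> t" "t \<le> T" for r t
  proof -
    have rt: "r \<in> {0..T}" "t \<in> {0..T}" using that by auto
    show ?thesis using eq[OF rt(1)] eq[OF rt(2)] AE_integrable
    proof eventually_elim
      case (elim x)
      then show ?case using prim_diff(1)[OF _ that] by auto
    qed
  qed
  have lipw: "L2_norm M (\<lambda>x. w x t - w x r) \<le> (t - r) * CG" if "0 \<le> r" "r \<le> t" "t \<le> T" for r t
  proof -
    have "L2_norm M (\<lambda>x. w x t - w x r) = L2_norm M (\<lambda>x. LINT z:{r..t}|lborel. G x z)"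
      using that by (intro L2_norm_cong_AE diff sq_diff w time_integral_sq) auto
    then show ?thesis using time_integral_norm[OF that] by simp
  qed
  have w0: "L2_norm M (\<lambda>x. w x t) \<le> T * CG" if t: "t \<in> {0..T}" for t
  proof -
    have "L2_norm M (\<lambda>x. w x t) = L2_norm M (\<lambda>x. prim (G x) t)"
      using t by (intro L2_norm_cong_AE eq w time_integral_sq) auto
    also have "\<dots> \<le> (t - 0) * CG" using t by (intro time_integral_norm) auto
    also have "\<dots> \<le> T * CG" using t C_nonneg by (intro mult_right_mono) auto
    finally show ?thesis .
  qed
  \<comment> \<open>Lipschitz constant in time of the product W w: the first part from w, the second
    from the weight.\<close>
  define C2 where "C2 = ?H * CG + ?H * LL R * (T * CG)"
  have C2: "C2 \<ge> 0" using C_nonneg LL_nonneg T by (simp add: C2_def)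
  have sW: "sq M (\<lambda>x. W s 0 x * w x s)" if "s \<in> {0..T}" for s by (rule sq_cmult_cont[OF Wc[OF that] w[OF that]])
  have Wdiff: "L2_norm M (\<lambda>x. W t 0 x * w x t - W s 0 x * w x s) \<le> C2 * (t - s)" if st: "0 \<le> s" "s \<le> t" "t \<le> T" for s t
  proof -
    have ST: "s \<in> {0..T}" "t \<in> {0..T}" using st by auto
    have cd: "continuous_on {0..M} (\<lambda>x. W t 0 x - W s 0 x)" by (intro continuous_on_diff Wc ST)
    have "L2_norm M (\<lambda>x. W t 0 x * w x t - W s 0 x * w x s) = L2_norm M (\<lambda>x. W t 0 x * (w x t - w x s) + (W t 0 x - W s 0 x) * w x s)"
      by (simp add: algebra_simps)
    also have "\<dots> \<le> L2_norm M (\<lambda>x. W t 0 x * (w x t - w x s)) + L2_norm M (\<lambda>x. (W t 0 x - W s 0 x) * w x s)"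
      by (intro L2_norm_triangle sq_cmult_cont Wc ST cd sq_diff w)
    also have "L2_norm M (\<lambda>x. W t 0 x * (w x t - w x s)) \<le> ?H * L2_norm M (\<lambda>x. w x t - w x s)"
      using Wb ST by (intro L2_norm_mult_le Wc sq_diff w) auto
    also have "L2_norm M (\<lambda>x. (W t 0 x - W s 0 x) * w x s) \<le> (?H * (LL R * (t - s))) * L2_norm M (\<lambda>x. w x s)"
    proof (rule L2_norm_mult_le[OF cd w[OF ST(1)]])
      fix x assume x: "x \<in> {0..M}"
      let ?e = "\<lambda>t. eta M 0 (\<lambda>x. a x t) (\<lambda>x. b x t) x"
      have "\<bar>exp (?e t) - exp (?e s)\<bar> \<le> ?H * \<bar>?e t - ?e s\<bar>"
        using coef.eta_le[OF coefs[OF ST(1)], of 0 x] coef.eta_le[OF coefs[OF ST(2)], of 0 x] x by (intro exp_diff_le) auto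
      also have "\<dots> \<le> ?H * (LL R * \<bar>t - s\<bar>)" by (intro mult_left_mono eta_lipschitz ST x) auto
      finally show "\<bar>W t 0 x - W s 0 x\<bar> \<le> ?H * (LL R * (t - s))" using st by simp
    qed (use LL_nonneg st in simp)
    finally have "L2_norm M (\<lambda>x. W t 0 x * w x t - W s 0 x * w x s) \<le> ?H * L2_norm M (\<lambda>x. w x t - w x s) + (?H * (LL R * (t - s))) * L2_norm M (\<lambda>x. w x s)" by simp
    also have "\<dots> \<le> ?H * ((t - s) * CG) + (?H * (LL R * (t - s))) * (T * CG)"
      using LL_nonneg st by (intro add_mono mult_left_mono lipw w0 ST st) auto
    also have "\<dots> = C2 * (t - s)" by (simp add: C2_def algebra_simps)
    finally show ?thesis .
  qed
  have nW: "L2_norm M (\<lambda>x. W s 0 x * w x s) \<le> ?H * (T * CG)" if s: "s \<in> {0..T}" for s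
  proof -
    have "L2_norm M (\<lambda>x. W s 0 x * w x s) \<le> ?H * L2_norm M (\<lambda>x. w x s)"
      using Wb s by (intro L2_norm_mult_le Wc w) auto
    also have "\<dots> \<le> ?H * (T * CG)" by (intro mult_left_mono w0 s) simp
    finally show ?thesis .
  qed
  \<comment> \<open>Lipschitz constant of the energy; \<open>en\<close> yields the energy at the
    intermediate time s, which has to be moved to t.\<close>
  define C4 where "C4 = C2 * (T * CG) + ?H * (T * CG) * CG"
  have C4: "C4 \<ge> 0" using C2 C_nonneg T by (simp add: C4_def)
  have y_alt: "?y s = I M (\<lambda>x. (W s 0 x * w x s) * w x s)" for s by (simp add: power2_eq_square mult.assoc)
  have ydiff: "?y s \<le> ?y t + C4 * (t - s)" if st: "0 \<le> s" "s \<le> t" "t \<le> T" for s t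
  proof -
    have ST: "s \<in> {0..T}" "t \<in> {0..T}" using st by auto
    let ?Z = "\<lambda>s x. W s 0 x * w x s"
    have i: "set_integrable lborel {0..M} (\<lambda>x. ?Z p x * w x q)" if "p \<in> {0..T}" "q \<in> {0..T}" for p q
      by (intro sq_mult_integrable sW w that)
    have e: "?y s - ?y t = I M (\<lambda>x. (?Z s x - ?Z t x) * w x s) + I M (\<lambda>x. ?Z t x * (w x s - w x t))"
      using i[OF ST(1,1)] i[OF ST(2,1)] i[OF ST(2,2)] unfolding y_alt by (simp add: left_diff_distrib right_diff_distrib)
    have e1: "I M (\<lambda>x. (?Z s x - ?Z t x) * w x s) \<le> C2 * (t - s) * (T * CG)"
    proof -
      have "I M (\<lambda>x. (?Z s x - ?Z t x) * w x s) \<le> L2_norm M (\<lambda>x. ?Z s x - ?Z t x) * L2_norm M (\<lambda>x. w x s)"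
        by (rule order_trans[OF abs_ge_self Cauchy_Schwarz_I]) (intro sq_diff sW w ST)+
      also have "\<dots> \<le> C2 * (t - s) * (T * CG)"
        unfolding L2_norm_diff_commute[of M "?Z s"] using C2 st by (intro mult_mono Wdiff w0 ST st L2_norm_nonneg) auto
      finally show ?thesis .
    qed
    have e2: "I M (\<lambda>x. ?Z t x * (w x s - w x t)) \<le> ?H * (T * CG) * ((t - s) * CG)"
    proof -
      have "I M (\<lambda>x. ?Z t x * (w x s - w x t)) \<le> L2_norm M (?Z t) * L2_norm M (\<lambda>x. w x s - w x t)"
        by (rule order_trans[OF abs_ge_self Cauchy_Schwarz_I]) (intro sq_diff sW w ST)+
      also have "\<dots> \<le> ?H * (T * CG) * ((t - s) * CG)"
        unfolding L2_norm_diff_commute[of M "\<lambda>x. w x s"] using C_nonneg T by (intro mult_mono nW lipw ST st L2_norm_nonneg) auto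
      finally show ?thesis .
    qed
    show ?thesis using e e1 e2 unfolding C4_def by (simp add: algebra_simps)
  qed
  \<comment> \<open>The quadratic error per interval: \<open>C4\<close> from moving the energy,
    \<open>C2\<close> from moving the factor W w; the 2 is the one in front of the pairing.\<close>
  define A where "A = 2 * (Q * C4 + C2 * CG)"
  have A: "A \<ge> 0" using Q C4 C2 C_nonneg by (simp add: A_def)
  have step: "(1 - (t - r) * (2 * Q)) * ?y t \<le> exp (LL R * (t - r)) * ?y r + (t - r) * (A * (t - r))" if rt: "0 \<le> r" "r \<le> t" "t \<le> T" for r t
  proof -
    have RT: "r \<in> {0..T}" "t \<in> {0..T}" using rt by auto
    let ?Z = "\<lambda>s x. W s 0 x * w x s"
    have "?y t \<le> I M (\<lambda>x. W t 0 x * (w x r)\<^sup>2 + 2 * ((w x t - w x r) * ?Z t x))"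
    proof (rule I_mono)
      show "set_integrable lborel {0..M} (\<lambda>x. W t 0 x * (w x t)\<^sup>2)" by (rule W_sq_integrable[OF RT(2) w[OF RT(2)]])
      show "set_integrable lborel {0..M} (\<lambda>x. W t 0 x * (w x r)\<^sup>2 + 2 * ((w x t - w x r) * ?Z t x))"
        using W_sq_integrable[OF RT(2) w[OF RT(1)], of 0] sq_mult_integrable[OF sq_diff[OF w[OF RT(2)] w[OF RT(1)]] sW[OF RT(2)]]
        by (intro set_integral_add(1)) auto
      show "W t 0 x * (w x t)\<^sup>2 \<le> W t 0 x * (w x r)\<^sup>2 + 2 * ((w x t - w x r) * ?Z t x)" for x
      proof -
        have "0 \<le> W t 0 x * (w x t - w x r)\<^sup>2" by simp
        then show ?thesis by (simp add: power2_eq_square algebra_simps)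
      qed
    qed
    also have "\<dots> = I M (\<lambda>x. W t 0 x * (w x r)\<^sup>2) + 2 * I M (\<lambda>x. (w x t - w x r) * ?Z t x)"
      using W_sq_integrable[OF RT(2) w[OF RT(1)], of 0] sq_mult_integrable[OF sq_diff[OF w[OF RT(2)] w[OF RT(1)]] sW[OF RT(2)]] by simp
    also have "\<dots> \<le> exp (LL R * (t - r)) * ?y r + 2 * ((t - r) * (Q * (?y t + C4 * (t - r)) + CG * (C2 * (t - r))))"
    proof (intro add_mono mult_left_mono)
      show "I M (\<lambda>x. W t 0 x * (w x r)\<^sup>2) \<le> exp (LL R * (t - r)) * ?y r"
        using W_sq_lipschitz[OF RT _ w[OF RT(1)], of 0] rt by simp
      have "I M (\<lambda>x. (w x t - w x r) * ?Z t x) = I M (\<lambda>x. (LINT z:{r..t}|lborel. G x z) * ?Z t x)"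
      proof (rule I_cong_AE)
        show "AE x in lborel. x \<in> {0..M} \<longrightarrow> (w x t - w x r) * ?Z t x = (LINT z:{r..t}|lborel. G x z) * ?Z t x"
          using diff[OF rt] by eventually_elim auto
      qed (use sq_diff[OF w[OF RT(2)] w[OF RT(1)]] sW[OF RT(2)] time_integral_sq[OF rt] in \<open>auto simp: sq_def intro!: set_measurable_mult\<close>)
      also have "\<dots> = (LINT s:{r..t}|lborel. I M (\<lambda>x. G x s * ?Z t x))" by (rule time_integral_Fubini[OF rt sW[OF RT(2)]])
      also have "\<dots> \<le> (LINT s:{r..t}|lborel. Q * (?y t + C4 * (t - r)) + CG * (C2 * (t - r)))"
      proof (rule set_integral_mono_AE[OF time_integral_integrable[OF rt sW[OF RT(2)]]])
        show "set_integrable lborel {r..t} (\<lambda>s. Q * (?y t + C4 * (t - r)) + CG * (C2 * (t - r)))"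
          by (intro borel_integrable_atLeastAtMost' continuous_intros)
        show "AE s\<in>{r..t} in lborel. I M (\<lambda>x. G x s * ?Z t x) \<le> Q * (?y t + C4 * (t - r)) + CG * (C2 * (t - r))"
          using en Gs
        proof eventually_elim
          case (elim s)
          show ?case
          proof
            assume s: "s \<in> {r..t}"
            then have S: "s \<in> {0..T}" "0 \<le> s" "s \<le> t" "r \<le> s" using rt by auto
            then have gs: "sq M (\<lambda>x. G x s)" "L2_norm M (\<lambda>x. G x s) \<le> CG" and e: "I M (\<lambda>x. G x s * ?Z s x) \<le> Q * ?y s"
              using elim by auto
            have "I M (\<lambda>x. G x s * ?Z t x) = I M (\<lambda>x. G x s * ?Z s x) + I M (\<lambda>x. G x s * (?Z t x - ?Z s x))"
              using sq_mult_integrable[OF gs(1) sW[OF RT(2)]] sq_mult_integrable[OF gs(1) sW[OF S(1)]] by (simp add: right_diff_distrib)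
            moreover have "I M (\<lambda>x. G x s * (?Z t x - ?Z s x)) \<le> CG * (C2 * (t - r))"
            proof -
              have "I M (\<lambda>x. G x s * (?Z t x - ?Z s x)) \<le> L2_norm M (\<lambda>x. G x s) * L2_norm M (\<lambda>x. ?Z t x - ?Z s x)"
                by (rule order_trans[OF abs_ge_self Cauchy_Schwarz_I[OF gs(1)]]) (intro sq_diff sW RT S)
              also have "\<dots> \<le> CG * (C2 * (t - s))"
                using C_nonneg by (intro mult_mono gs Wdiff S rt L2_norm_nonneg) auto
              also have "\<dots> \<le> CG * (C2 * (t - r))" using C_nonneg C2 S by (intro mult_left_mono) auto
              finally show ?thesis .
            qed
            moreover have "Q * ?y s \<le> Q * (?y t + C4 * (t - r))"
            proof (rule mult_left_mono[OF _ Q])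
              have "C4 * (t - s) \<le> C4 * (t - r)" using C4 S by (intro mult_left_mono) auto
              then show "?y s \<le> ?y t + C4 * (t - r)" using ydiff[OF S(2,3) rt(3)] by simp
            qed
            ultimately show "I M (\<lambda>x. G x s * ?Z t x) \<le> Q * (?y t + C4 * (t - r)) + CG * (C2 * (t - r))" using e by linarith
          qed
        qed
      qed
      also have "\<dots> = (t - r) * (Q * (?y t + C4 * (t - r)) + CG * (C2 * (t - r)))" by (rule set_integral_const_Icc[OF rt(2)])
      finally show "I M (\<lambda>x. (w x t - w x r) * ?Z t x) \<le> (t - r) * (Q * (?y t + C4 * (t - r)) + CG * (C2 * (t - r)))" .
    qed simp
    finally show ?thesis by (simp add: A_def algebra_simps)
  qed
  have ynn: "?y s \<ge> 0" for s by (auto simp: set_lebesgue_integral_def intro!: integral_nonneg)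
  have y0: "?y 0 = 0"
  proof -
    have z: "0 \<in> {0..T}" using T by simp
    have "?y 0 = I M (\<lambda>x. 0)"
    proof (rule I_cong_AE)
      show "AE x in lborel. x \<in> {0..M} \<longrightarrow> W 0 0 x * (w x 0)\<^sup>2 = 0"
        using eq[OF z] by eventually_elim (auto simp: prim_sing)
      show "set_borel_measurable lborel {0..M} (\<lambda>x. W 0 0 x * (w x 0)\<^sup>2)"
        using W_sq_integrable[OF z w[OF z], of 0] by (auto simp: set_integrable_def set_borel_measurable_def)
    qed (simp add: set_borel_measurable_def)
    then show ?thesis by simp
  qed
  \<comment> \<open>Discrete Gronwall from the vanishing initial energy with source A \<tau>, which
    tends to 0 under refinement.\<close>
  have yt: "?y t \<le> exp ((LL R + 2 * (2 * Q)) * t) * (t * (A * (t / real N)))" if N: "N > 0" "t / real N * (2 * Q) \<le> 1/2" for N :: nat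
  proof -
    define \<tau> where "\<tau> = t / real N"
    have \<tau>: "\<tau> \<ge> 0" "real N * \<tau> = t" using t N by (auto simp: \<tau>_def)
    have kt: "0 \<le> real k * \<tau>" "real k * \<tau> \<le> real (Suc k) * \<tau>" "real (Suc k) * \<tau> \<le> T" if "k < N" for k
    proof -
      show "0 \<le> real k * \<tau>" "real k * \<tau> \<le> real (Suc k) * \<tau>" using \<tau>(1) by (auto intro: mult_right_mono)
      have "real (Suc k) * \<tau> \<le> real N * \<tau>" using that \<tau>(1) by (intro mult_right_mono) auto
      then show "real (Suc k) * \<tau> \<le> T" using \<tau>(2) t by simp
    qed
    have "?y (real N * \<tau>) \<le> exp ((LL R + 2 * (2 * Q)) * (real N * \<tau>)) * (?y (real 0 * \<tau>) + real N * \<tau> * (A * \<tau>))"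
    proof (rule discrete_Gronwall[of N \<tau> "2 * Q" "\<lambda>k. ?y (real k * \<tau>)"])
      show "(1 - \<tau> * (2 * Q)) * ?y (real (Suc k) * \<tau>) \<le> exp (LL R * \<tau>) * ?y (real k * \<tau>) + \<tau> * (A * \<tau>)" if "k < N" for k
      proof -
        have "real (Suc k) * \<tau> - real k * \<tau> = \<tau>" by (simp add: algebra_simps)
        then show ?thesis using step[OF kt[OF that]] by (simp only:)
      qed
    qed (use \<tau>(1) Q LL_nonneg ynn mult_nonneg_nonneg[OF A \<tau>(1)] N(2)[folded \<tau>_def] in auto)
    then show ?thesis using \<tau>(2) y0 by (simp add: \<tau>_def)
  qed
  have "?y t \<le> 0"
  proof (rule LIMSEQ_le_const)
    have "(\<lambda>N. t / real N) \<longlonglongrightarrow> 0" by (rule lim_const_over_n)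
    then have "(\<lambda>N. exp ((LL R + 2 * (2 * Q)) * t) * (t * (A * (t / real N)))) \<longlonglongrightarrow> exp ((LL R + 2 * (2 * Q)) * t) * (t * (A * 0))"
      by (intro tendsto_intros)
    then show "(\<lambda>N. exp ((LL R + 2 * (2 * Q)) * t) * (t * (A * (t / real N)))) \<longlonglongrightarrow> 0" by simp
    obtain N0 :: nat where N0: "real N0 > t * (2 * Q) * 2" using reals_Archimedean2 by blast
    have "?y t \<le> exp ((LL R + 2 * (2 * Q)) * t) * (t * (A * (t / real N)))" if "N \<ge> N0 + 1" for N
    proof (rule yt)
      show N: "N > 0" using that by simp
      have "real N \<ge> t * (2 * Q) * 2" using N0 that by linarith
      then show "t / real N * (2 * Q) \<le> 1/2" using N by (simp add: field_simps)
    qed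
    then show "\<exists>N0. \<forall>N\<ge>N0. ?y t \<le> exp ((LL R + 2 * (2 * Q)) * t) * (t * (A * (t / real N)))" by blast
  qed
  then have "(L2_norm M (\<lambda>x. w x t))\<^sup>2 \<le> 0"
    using W_sq_bounds(2)[OF t _ w[OF t], of 0] ynn[of t] by simp
  then have "L2_norm M (\<lambda>x. w x t) = 0" by simp
  from L2_norm_zero_AE[OF w[OF t] this] show ?thesis .
qed

end

section \<open>Uniqueness\<close>

lemma set_measurable_continuous:
  fixes f :: "real \<times> real \<Rightarrow> real"
  assumes "continuous_on ({0..M} \<times> {0..T}) f"
  shows "set_borel_measurable lborel ({0..M} \<times> {0..T}) f"
  using borel_measurable_continuous_on_indicator[OF borel_closed assms] closed_Times[of "{0..M}" "{0..T}"]
  unfolding set_borel_measurable_def by (simp add: closed_Times)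

lemma in_Linf_Hn_diff:
  assumes M: "M > 0" and u: "in_Linf_Hn M n T u" and v: "in_Linf_Hn M n T v"
  shows "in_Linf_Hn M n T (\<lambda>x t. u x t - v x t)"
proof -
  obtain C where C: "AE t in lborel. t \<in> {0..T} \<longrightarrow> Hn_norm M n (\<lambda>x. u x t) \<le> C" using u by (auto simp: in_Linf_Hn_def)
  obtain C' where C': "AE t in lborel. t \<in> {0..T} \<longrightarrow> Hn_norm M n (\<lambda>x. v x t) \<le> C'" using v by (auto simp: in_Linf_Hn_def)
  have h: "AE t in lborel. t \<in> {0..T} \<longrightarrow> in_Hn M n (\<lambda>x. u x t)" "AE t in lborel. t \<in> {0..T} \<longrightarrow> in_Hn M n (\<lambda>x. v x t)"
    using u v by (auto simp: in_Linf_Hn_def)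
  have *: "AE t in lborel. t \<in> {0..T} \<longrightarrow> in_Hn M n (\<lambda>x. u x t - v x t) \<and> Hn_norm M n (\<lambda>x. u x t - v x t) \<le> sqrt (real n + 1) * (C + C')"
    using C C' h
  proof eventually_elim
    case (elim t)
    show ?case
    proof
      assume t: "t \<in> {0..T}"
      then obtain D E where D: "Hn_derivs M n (\<lambda>x. u x t) D" and E: "Hn_derivs M n (\<lambda>x. v x t) E" using elim unfolding in_Hn_def by blast
      note DE = Hn_derivs_diff[OF D E]
      have "Hn_norm M n (\<lambda>x. u x t - v x t) \<le> sqrt (real n + 1) * (C + C')"
      proof (rule Hn_norm_le[OF M DE])
        fix k assume k: "k \<le> n"
        have "L2_norm M (\<lambda>x. D k x - E k x) \<le> L2_norm M (D k) + L2_norm M (E k)"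
          by (intro L2_norm_triangle_diff Hn_derivs_sq[OF D k] Hn_derivs_sq[OF E k])
        then show "L2_norm M (\<lambda>x. D k x - E k x) \<le> C + C'"
          using L2_norm_le_Hn_norm[OF M D k] L2_norm_le_Hn_norm[OF M E k] elim t by auto
      qed
      then show "in_Hn M n (\<lambda>x. u x t - v x t) \<and> Hn_norm M n (\<lambda>x. u x t - v x t) \<le> sqrt (real n + 1) * (C + C')"
        using DE by (auto simp: in_Hn_def)
    qed
  qed
  have m: "set_borel_measurable lborel ({0..M} \<times> {0..T}) (\<lambda>p. u (fst p) (snd p) - v (fst p) (snd p))"
    using u v unfolding in_Linf_Hn_def by (auto simp: set_borel_measurable_def right_diff_distrib)
  have "AE t in lborel. t \<in> {0..T} \<longrightarrow> in_Hn M n (\<lambda>x. u x t - v x t)" using * by eventually_elim auto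
  moreover have "AE t in lborel. t \<in> {0..T} \<longrightarrow> Hn_norm M n (\<lambda>x. u x t - v x t) \<le> sqrt (real n + 1) * (C + C')"
    using * by eventually_elim auto
  ultimately show ?thesis using m unfolding in_Linf_Hn_def by blast
qed

lemma weak_deriv_diff: "weak_deriv M f f' \<Longrightarrow> weak_deriv M g g' \<Longrightarrow> weak_deriv M (\<lambda>x. f x - g x) (\<lambda>x. f' x - g' x)"
  using weak_deriv_lin[of M f f' g g' "-1"] by simp

lemma solves_diff:
  assumes u: "solves M T a b c d e u" and v: "solves M T a b c d e' v"
  shows "solves M T a b c d (\<lambda>x t. e x t - e' x t) (\<lambda>x t. u x t - v x t)"
proof -
  obtain U1 U2 U3 where U: "\<And>t. t \<in> {0..T} \<Longrightarrow> weak_deriv M (\<lambda>x. u x t) (\<lambda>x. U1 x t) \<and> weak_deriv M (\<lambda>x. U1 x t) (\<lambda>x. U2 x t) \<and> weak_deriv M (\<lambda>x. U2 x t) (\<lambda>x. U3 x t)"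
    "\<And>V. V \<in> {u, U1, U2, U3} \<Longrightarrow> set_borel_measurable lborel ({0..M} \<times> {0..T}) (\<lambda>p. V (fst p) (snd p))"
    "\<And>t. t \<in> {0..T} \<Longrightarrow> AE x in lborel. x \<in> {0..M} \<longrightarrow> set_integrable lborel {0..t} (\<lambda>s. a x s * U3 x s + b x s * U2 x s + c x s * U1 x s + d x s * u x s + e x s) \<and>
       u x t = u x 0 + prim (\<lambda>s. a x s * U3 x s + b x s * U2 x s + c x s * U1 x s + d x s * u x s + e x s) t"
    using u unfolding solves_def Let_def by blast
  obtain V1 V2 V3 where V: "\<And>t. t \<in> {0..T} \<Longrightarrow> weak_deriv M (\<lambda>x. v x t) (\<lambda>x. V1 x t) \<and> weak_deriv M (\<lambda>x. V1 x t) (\<lambda>x. V2 x t) \<and> weak_deriv M (\<lambda>x. V2 x t) (\<lambda>x. V3 x t)"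
    "\<And>V. V \<in> {v, V1, V2, V3} \<Longrightarrow> set_borel_measurable lborel ({0..M} \<times> {0..T}) (\<lambda>p. V (fst p) (snd p))"
    "\<And>t. t \<in> {0..T} \<Longrightarrow> AE x in lborel. x \<in> {0..M} \<longrightarrow> set_integrable lborel {0..t} (\<lambda>s. a x s * V3 x s + b x s * V2 x s + c x s * V1 x s + d x s * v x s + e' x s) \<and>
       v x t = v x 0 + prim (\<lambda>s. a x s * V3 x s + b x s * V2 x s + c x s * V1 x s + d x s * v x s + e' x s) t"
    using v unfolding solves_def Let_def by blast
  have m: "set_borel_measurable lborel ({0..M} \<times> {0..T}) (\<lambda>p. X (fst p) (snd p) - Y (fst p) (snd p))"
    if "X \<in> {u, U1, U2, U3}" "Y \<in> {v, V1, V2, V3}" for X Y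
    using U(2)[OF that(1)] V(2)[OF that(2)] by (auto simp: set_borel_measurable_def right_diff_distrib)
  show ?thesis unfolding solves_def Let_def
  proof (intro exI conjI ballI)
    show "weak_deriv M (\<lambda>x. u x t - v x t) (\<lambda>x. (\<lambda>x t. U1 x t - V1 x t) x t)" 
      "weak_deriv M (\<lambda>x. (\<lambda>x t. U1 x t - V1 x t) x t) (\<lambda>x. (\<lambda>x t. U2 x t - V2 x t) x t)"
      "weak_deriv M (\<lambda>x. (\<lambda>x t. U2 x t - V2 x t) x t) (\<lambda>x. (\<lambda>x t. U3 x t - V3 x t) x t)" if "t \<in> {0..T}" for t
      using U(1)[OF that] V(1)[OF that] by (auto intro: weak_deriv_diff)
    show "set_borel_measurable lborel ({0..M} \<times> {0..T}) (\<lambda>p. Z (fst p) (snd p))"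
      if "Z \<in> {\<lambda>x t. u x t - v x t, \<lambda>x t. U1 x t - V1 x t, \<lambda>x t. U2 x t - V2 x t, \<lambda>x t. U3 x t - V3 x t}" for Z
      using that m by auto
    show "AE x in lborel. x \<in> {0..M} \<longrightarrow> set_integrable lborel {0..t} (\<lambda>s. a x s * (\<lambda>x t. U3 x t - V3 x t) x s + b x s * (\<lambda>x t. U2 x t - V2 x t) x s + c x s * (\<lambda>x t. U1 x t - V1 x t) x s + d x s * (u x s - v x s) + (e x s - e' x s)) \<and>
       u x t - v x t = u x 0 - v x 0 + prim (\<lambda>s. a x s * (\<lambda>x t. U3 x t - V3 x t) x s + b x s * (\<lambda>x t. U2 x t - V2 x t) x s + c x s * (\<lambda>x t. U1 x t - V1 x t) x s + d x s * (u x s - v x s) + (e x s - e' x s)) t"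
      if "t \<in> {0..T}" for t
      using U(3)[OF that] V(3)[OF that]
    proof eventually_elim
      case (elim x)
      show ?case
      proof
        assume x: "x \<in> {0..M}"
        let ?F = "\<lambda>s. a x s * U3 x s + b x s * U2 x s + c x s * U1 x s + d x s * u x s + e x s"
        let ?F' = "\<lambda>s. a x s * V3 x s + b x s * V2 x s + c x s * V1 x s + d x s * v x s + e' x s"
        have eq: "(\<lambda>s. a x s * (U3 x s - V3 x s) + b x s * (U2 x s - V2 x s) + c x s * (U1 x s - V1 x s) + d x s * (u x s - v x s) + (e x s - e' x s)) = (\<lambda>s. ?F s - ?F' s)"
          by (rule ext) (simp add: algebra_simps)
        have f: "set_integrable lborel {0..t} ?F" "set_integrable lborel {0..t} ?F'" 
          "u x t = u x 0 + prim ?F t" "v x t = v x 0 + prim ?F' t" using elim x by blast+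
        show "set_integrable lborel {0..t} (\<lambda>s. a x s * (\<lambda>x t. U3 x t - V3 x t) x s + b x s * (\<lambda>x t. U2 x t - V2 x t) x s + c x s * (\<lambda>x t. U1 x t - V1 x t) x s + d x s * (u x s - v x s) + (e x s - e' x s)) \<and>
          u x t - v x t = u x 0 - v x 0 + prim (\<lambda>s. a x s * (\<lambda>x t. U3 x t - V3 x t) x s + b x s * (\<lambda>x t. U2 x t - V2 x t) x s + c x s * (\<lambda>x t. U1 x t - V1 x t) x s + d x s * (u x s - v x s) + (e x s - e' x s)) t"
          unfolding eq set_integral_diff(2)[OF f(1,2)] using f(3,4) set_integral_diff(1)[OF f(1,2)] by linarith
      qed
    qed
  qed
qed

text \<open>\<open>solves\<close> provides weak derivatives up to order three only. They agree
  almost everywhere with the derivatives of the continuous representative, to which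
  \<open>energy_core\<close> applies with j = 0; the d term is of order zero and costs R.\<close>

lemma (in coef) operator_bounds:
  assumes D: "Hn_derivs M n f D" and K0: "\<And>j. j \<le> n \<Longrightarrow> L2_norm M (D j) \<le> K0"
    and f: "weak_deriv M f f1" "weak_deriv M f1 f2" "weak_deriv M f2 f3"
  shows "sq M (\<lambda>x. a x * f3 x + b x * f2 x + c x * f1 x + d x * f x)" (is "sq M ?g")
    and "L2_norm M (\<lambda>x. a x * f3 x + b x * f2 x + c x * f1 x + d x * f x) \<le> 4 * R * K0"
    and "I M (\<lambda>x. (a x * f3 x + b x * f2 x + c x * f1 x + d x * f x) * (wt M 0 a b x * f x))
       \<le> (Ybound R + R) * I M (\<lambda>x. wt M 0 a b x * (f x)\<^sup>2)"
proof -
  note rep = Hn_representative[OF M(1) D]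
  obtain V where V: "Hn_derivs M n (V 0) V" "\<And>j. j \<le> n \<Longrightarrow> AE x in lborel. x \<in> {0..M} \<longrightarrow> D j x = V j x"
    "\<And>j. j \<le> n \<Longrightarrow> L2_norm M (V j) = L2_norm M (D j)"
    "\<And>K0. (\<And>j. j \<le> n \<Longrightarrow> L2_norm M (D j) \<le> K0) \<Longrightarrow> Hc M n K0 V"
    "\<And>j. j < n \<Longrightarrow> continuous_on {0..M} (V j)"
    "\<And>j. j \<le> n \<Longrightarrow> periodic M (V j)" by (rule rep) blast
  have s: "sq M f" "sq M f1" "sq M f2" "sq M f3" using f by (auto simp: weak_deriv_def L2_iff)
  have cc: "continuous_on {0..M} a" "continuous_on {0..M} b" "continuous_on {0..M} c" "continuous_on {0..M} d"
    using Cd_coefs[THEN Cd_continuous_on, of 0] by auto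
  have wV: "weak_deriv M (V 0) (V 1)" "weak_deriv M (V 1) (V 2)" "weak_deriv M (V 2) (V 3)"
    using V(1) n unfolding Hn_derivs_def by (auto simp: numeral_2_eq_2 numeral_3_eq_3)
  have e0: "AE x in lborel. x \<in> {0..M} \<longrightarrow> f x = V 0 x" using V(2)[of 0] D by (simp add: Hn_derivs_def)
  have e1: "AE x in lborel. x \<in> {0..M} \<longrightarrow> f1 x = V 1 x" by (rule weak_deriv_unique[OF M(1) f(1) wV(1) e0])
  have e2: "AE x in lborel. x \<in> {0..M} \<longrightarrow> f2 x = V 2 x" by (rule weak_deriv_unique[OF M(1) f(2) wV(2) e1])
  have e3: "AE x in lborel. x \<in> {0..M} \<longrightarrow> f3 x = V 3 x" by (rule weak_deriv_unique[OF M(1) f(3) wV(3) e2])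
  have sV: "sq M (V j)" if "j \<le> n" for j by (rule Hn_derivs_sq[OF V(1) that])
  have le: "L2_norm M f \<le> K0" "L2_norm M f1 \<le> K0" "L2_norm M f2 \<le> K0" "L2_norm M f3 \<le> K0"
    using L2_norm_cong_AE[OF s(1) sV e0] L2_norm_cong_AE[OF s(2) sV e1] L2_norm_cong_AE[OF s(3) sV e2] L2_norm_cong_AE[OF s(4) sV e3]
      V(3)[of 0] V(3)[of 1] V(3)[of 2] V(3)[of 3] K0[of 0] K0[of 1] K0[of 2] K0[of 3] n by auto
  have R0: "R \<ge> 0" using R4 by simp
  have sp: "sq M (\<lambda>x. a x * f3 x)" "sq M (\<lambda>x. b x * f2 x)" "sq M (\<lambda>x. c x * f1 x)" "sq M (\<lambda>x. d x * f x)"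
    by (intro sq_cmult_cont cc s)+
  show sg: "sq M ?g" by (intro sq_add sp)
  have "L2_norm M (\<lambda>x. a x * f3 x) \<le> R * L2_norm M f3" "L2_norm M (\<lambda>x. b x * f2 x) \<le> R * L2_norm M f2" 
    "L2_norm M (\<lambda>x. c x * f1 x) \<le> R * L2_norm M f1" "L2_norm M (\<lambda>x. d x * f x) \<le> R * L2_norm M f"
    using L2_norm_mult_le[OF cc(1) s(4) _ R0] L2_norm_mult_le[OF cc(2) s(3) _ R0] L2_norm_mult_le[OF cc(3) s(2) _ R0] L2_norm_mult_le[OF cc(4) s(1) _ R0]
      bd(1)[of 0] bd(2)[of 0] bd(3)[of 0] bd(4)[of 0] by auto
  moreover have "R * L2_norm M f3 \<le> R * K0" "R * L2_norm M f2 \<le> R * K0" "R * L2_norm M f1 \<le> R * K0" "R * L2_norm M f \<le> R * K0"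
    using le R0 by (auto intro: mult_left_mono)
  moreover have "L2_norm M ?g \<le> L2_norm M (\<lambda>x. a x * f3 x + b x * f2 x + c x * f1 x) + L2_norm M (\<lambda>x. d x * f x)"
    "L2_norm M (\<lambda>x. a x * f3 x + b x * f2 x + c x * f1 x) \<le> L2_norm M (\<lambda>x. a x * f3 x + b x * f2 x) + L2_norm M (\<lambda>x. c x * f1 x)"
    "L2_norm M (\<lambda>x. a x * f3 x + b x * f2 x) \<le> L2_norm M (\<lambda>x. a x * f3 x) + L2_norm M (\<lambda>x. b x * f2 x)"
    by (intro L2_norm_triangle sq_add sp)+
  ultimately have "L2_norm M ?g \<le> R * K0 + R * K0 + R * K0 + R * K0" by linarith
  also have "R * K0 + R * K0 + R * K0 + R * K0 = 4 * R * K0" by simp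
  finally show "L2_norm M ?g \<le> 4 * R * K0" .
  let ?W = "wt M 0 a b"
  have cV: "continuous_on {0..M} (V 0)" "continuous_on {0..M} (V 1)" "continuous_on {0..M} (V 2)" "continuous_on {0..M} (V 3)"
    using V(5) n by auto
  have dV: "\<And>x. x \<in> {0..M} \<Longrightarrow> (V 0 has_real_derivative V 1 x) (at x within {0..M})"
      "\<And>x. x \<in> {0..M} \<Longrightarrow> (V 1 has_real_derivative V 2 x) (at x within {0..M})"
      "\<And>x. x \<in> {0..M} \<Longrightarrow> (V 2 has_real_derivative V 3 x) (at x within {0..M})"
    using V(4)[OF K0] n unfolding Hc_def by (auto simp: numeral_2_eq_2 numeral_3_eq_3)
  have pV: "V 0 M = V 0 0" "V 1 M = V 1 0" "V 2 M = V 2 0" using V(6) n per0 by auto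
  have core: "I M (\<lambda>x. ?W x * (V 0 x * (a x * V 3 x + b x * V 2 x + c x * V 1 x))) \<le> Ybound R * I M (\<lambda>x. ?W x * (V 0 x)\<^sup>2)"
    using energy_core[OF _ dV cV(4) pV, of 0] by (simp add: binomial_eq_0)
  have ci: "set_integrable lborel {0..M} (\<lambda>x. ?W x * (V 0 x * (a x * V 3 x + b x * V 2 x + c x * V 1 x)))"
    "set_integrable lborel {0..M} (\<lambda>x. d x * (?W x * (V 0 x)\<^sup>2))" "set_integrable lborel {0..M} (\<lambda>x. R * (?W x * (V 0 x)\<^sup>2))"
    by (intro borel_integrable_atLeastAtMost' continuous_intros cc cV wt_cont)+
  have mq: "set_borel_measurable lborel {0..M} (\<lambda>x. ?W x * (h x)\<^sup>2)" if "sq M h" for h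
    using sq_continuous[OF wt_cont[of 0]] that unfolding sq_def power2_eq_square by (intro set_measurable_mult) auto
  have "I M (\<lambda>x. ?g x * (?W x * f x)) = I M (\<lambda>x. ?W x * (V 0 x * (a x * V 3 x + b x * V 2 x + c x * V 1 x)) + d x * (?W x * (V 0 x)\<^sup>2))"
  proof (rule I_cong_AE)
    show "AE x in lborel. x \<in> {0..M} \<longrightarrow> ?g x * (?W x * f x) = ?W x * (V 0 x * (a x * V 3 x + b x * V 2 x + c x * V 1 x)) + d x * (?W x * (V 0 x)\<^sup>2)"
      using e0 e1 e2 e3 by eventually_elim (auto simp: power2_eq_square algebra_simps)
    show "set_borel_measurable lborel {0..M} (\<lambda>x. ?g x * (?W x * f x))"
      using sg sq_cmult_cont[OF wt_cont s(1), of 0] by (auto simp: sq_def intro!: set_measurable_mult)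
    show "set_borel_measurable lborel {0..M} (\<lambda>x. ?W x * (V 0 x * (a x * V 3 x + b x * V 2 x + c x * V 1 x)) + d x * (?W x * (V 0 x)\<^sup>2))"
      using set_integral_add(1)[OF ci(1,2)] by (auto simp: set_integrable_def set_borel_measurable_def)
  qed
  also have "\<dots> = I M (\<lambda>x. ?W x * (V 0 x * (a x * V 3 x + b x * V 2 x + c x * V 1 x))) + I M (\<lambda>x. d x * (?W x * (V 0 x)\<^sup>2))"
    by (rule set_integral_add(2)[OF ci(1,2)])
  also have "\<dots> \<le> Ybound R * I M (\<lambda>x. ?W x * (V 0 x)\<^sup>2) + I M (\<lambda>x. R * (?W x * (V 0 x)\<^sup>2))"
  proof (rule add_mono[OF core I_mono[OF ci(2,3)]])
    fix x
    have "d x \<le> R" using bd(4)[of 0 x] by simp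
    then show "d x * (?W x * (V 0 x)\<^sup>2) \<le> R * (?W x * (V 0 x)\<^sup>2)" by (rule mult_right_mono) simp
  qed
  also have "\<dots> = (Ybound R + R) * I M (\<lambda>x. ?W x * (V 0 x)\<^sup>2)" by (simp add: distrib_right)
  also have "I M (\<lambda>x. ?W x * (V 0 x)\<^sup>2) = I M (\<lambda>x. ?W x * (f x)\<^sup>2)"
  proof (rule I_cong_AE)
    show "AE x in lborel. x \<in> {0..M} \<longrightarrow> ?W x * (V 0 x)\<^sup>2 = ?W x * (f x)\<^sup>2" using e0 by eventually_elim auto
  qed (intro mq s sV le0)+
  finally show "I M (\<lambda>x. ?g x * (?W x * f x)) \<le> (Ybound R + R) * I M (\<lambda>x. ?W x * (f x)\<^sup>2)" .
qed

context adm begin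

text \<open>By \<open>operator_bounds\<close> the right-hand side of the equation is a
  \<open>time_int\<close> family that satisfies the energy inequality required by
  \<open>zero_solution\<close>.\<close>

lemma homogeneous_solution_zero:
  assumes w: "in_Linf_Hn M n T w" "solves M T a b c d (\<lambda>x t. 0) w" "AE x in lborel. x \<in> {0..M} \<longrightarrow> w x 0 = 0"
    and t: "t \<in> {0..T}"
  shows "AE x in lborel. x \<in> {0..M} \<longrightarrow> w x t = 0"
proof -
  obtain U1 U2 U3 where U: "\<And>t. t \<in> {0..T} \<Longrightarrow> weak_deriv M (\<lambda>x. w x t) (\<lambda>x. U1 x t) \<and> weak_deriv M (\<lambda>x. U1 x t) (\<lambda>x. U2 x t) \<and> weak_deriv M (\<lambda>x. U2 x t) (\<lambda>x. U3 x t)"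
    "\<And>V. V \<in> {w, U1, U2, U3} \<Longrightarrow> set_borel_measurable lborel ({0..M} \<times> {0..T}) (\<lambda>p. V (fst p) (snd p))"
    "\<And>t. t \<in> {0..T} \<Longrightarrow> AE x in lborel. x \<in> {0..M} \<longrightarrow> set_integrable lborel {0..t} (\<lambda>s. a x s * U3 x s + b x s * U2 x s + c x s * U1 x s + d x s * w x s + 0) \<and>
       w x t = w x 0 + prim (\<lambda>s. a x s * U3 x s + b x s * U2 x s + c x s * U1 x s + d x s * w x s + 0) t"
    using w(2) unfolding solves_def Let_def by blast
  obtain C where C: "AE t in lborel. t \<in> {0..T} \<longrightarrow> Hn_norm M n (\<lambda>x. w x t) \<le> C" using w(1) by (auto simp: in_Linf_Hn_def)
  have H: "AE t in lborel. t \<in> {0..T} \<longrightarrow> in_Hn M n (\<lambda>x. w x t)" using w(1) by (auto simp: in_Linf_Hn_def)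
  define G where "G = (\<lambda>x s. a x s * U3 x s + b x s * U2 x s + c x s * U1 x s + d x s * w x s)"
  have bounds: "AE s in lborel. s \<in> {0..T} \<longrightarrow> sq M (\<lambda>x. G x s) \<and> L2_norm M (\<lambda>x. G x s) \<le> 4 * R * C \<and>
      I M (\<lambda>x. G x s * (W s 0 x * w x s)) \<le> (Ybound R + R) * I M (\<lambda>x. W s 0 x * (w x s)\<^sup>2)"
    using C H
  proof eventually_elim
    case (elim s)
    show ?case
    proof
      assume s: "s \<in> {0..T}"
      then obtain D where D: "Hn_derivs M n (\<lambda>x. w x s) D" using elim by (auto simp: in_Hn_def)
      have "L2_norm M (D j) \<le> C" if "j \<le> n" for j using L2_norm_le_Hn_norm[OF M(1) D that] elim s by auto
      note ob = coef.operator_bounds[OF coefs[OF s] D this U(1)[OF s, THEN conjunct1] U(1)[OF s, THEN conjunct2, THEN conjunct1] U(1)[OF s, THEN conjunct2, THEN conjunct2]]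
      show "sq M (\<lambda>x. G x s) \<and> L2_norm M (\<lambda>x. G x s) \<le> 4 * R * C \<and>
          I M (\<lambda>x. G x s * (W s 0 x * w x s)) \<le> (Ybound R + R) * I M (\<lambda>x. W s 0 x * (w x s)\<^sup>2)"
        unfolding G_def by (intro conjI ob)
    qed
  qed
  note jm = joint[THEN set_measurable_continuous]
  have ti: "time_int M T (4 * R * C) G"
  proof
    show "set_borel_measurable lborel ({0..M} \<times> {0..T}) (\<lambda>p. G (fst p) (snd p))"
      unfolding G_def
      by (rule set_measurable_add[OF set_measurable_add[OF set_measurable_add[OF
          set_measurable_mult[OF jm(1) U(2)] set_measurable_mult[OF jm(2) U(2)]] set_measurable_mult[OF jm(3) U(2)]] set_measurable_mult[OF jm(4) U(2)]]) simp_all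
    show "AE s in lborel. s \<in> {0..T} \<longrightarrow> sq M (\<lambda>x. G x s) \<and> L2_norm M (\<lambda>x. G x s) \<le> 4 * R * C"
      using bounds by eventually_elim auto
  qed (use M T in auto)
  show ?thesis
  proof (rule zero_solution[OF ti])
    show "sq M (\<lambda>x. w x t)" if "t \<in> {0..T}" for t using U(1)[OF that] by (auto simp: weak_deriv_def L2_iff)
    show "AE x in lborel. x \<in> {0..M} \<longrightarrow> w x t = prim (G x) t" if "t \<in> {0..T}" for t
      using U(3)[OF that] w(3) by eventually_elim (auto simp: G_def)
    show "AE s in lborel. s \<in> {0..T} \<longrightarrow> I M (\<lambda>x. G x s * (W s 0 x * w x s)) \<le> (Ybound R + R) * I M (\<lambda>x. W s 0 x * (w x s)\<^sup>2)"
      using bounds by eventually_elim auto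
    show "Ybound R + R \<ge> 0" using Ybound_nonneg[of R] R4 by simp
  qed (rule t)
qed

end

section \<open>Essential suprema in time\<close>

lemma AE_Icc_witness:
  fixes p q :: real
  assumes "AE t in lborel. t \<in> {p..q} \<longrightarrow> P t" "p < q" shows "\<exists>t\<in>{p..q}. P t"
proof (rule ccontr)
  assume "\<not> ?thesis"
  then have "AE t in lborel. t \<notin> {p..q}" using assms(1) by (auto elim: AE_mp)
  then have "emeasure lborel {p..q} = 0" by (subst (asm) AE_iff_measurable[of "{p..q}"]) auto
  then show False using assms(2) by simp
qed

lemma LinfT_le:
  assumes T: "T > 0" and C: "AE t in lborel. t \<in> {0..T} \<longrightarrow> N (\<lambda>x. u x t) \<le> C" and N: "\<And>f. N f \<ge> 0"
  shows "LinfT N T u \<le> C"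
  unfolding LinfT_def
proof (rule cInf_lower)
  show "C \<in> {C. AE t in lborel. t \<in> {0..T} \<longrightarrow> N (\<lambda>x. u x t) \<le> C}" using C by simp
  show "bdd_below {C. AE t in lborel. t \<in> {0..T} \<longrightarrow> N (\<lambda>x. u x t) \<le> C}"
  proof (rule bdd_belowI[of _ 0])
    fix C' assume "C' \<in> {C. AE t in lborel. t \<in> {0..T} \<longrightarrow> N (\<lambda>x. u x t) \<le> C}"
    then obtain t where "N (\<lambda>x. u x t) \<le> C'" using AE_Icc_witness[of 0 T "\<lambda>t. N (\<lambda>x. u x t) \<le> C'"] T by auto
    then show "0 \<le> C'" using N[of "\<lambda>x. u x t"] by simp
  qed
qed

text \<open>The infimum is attained, because the exceptional sets for the excesses 1/(m+1) are
  countably many null sets.\<close>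

lemma LinfT_AE:
  assumes C: "AE t in lborel. t \<in> {0..T} \<longrightarrow> N (\<lambda>x. u x t) \<le> C"
  shows "AE t in lborel. t \<in> {0..T} \<longrightarrow> N (\<lambda>x. u x t) \<le> LinfT N T u"
proof -
  let ?S = "{C. AE t in lborel. t \<in> {0..T} \<longrightarrow> N (\<lambda>x. u x t) \<le> C}"
  have "\<forall>m. AE t in lborel. t \<in> {0..T} \<longrightarrow> N (\<lambda>x. u x t) \<le> LinfT N T u + inverse (real (Suc m))"
  proof
    fix m
    have "\<exists>C\<in>?S. C < LinfT N T u + inverse (real (Suc m))"
      by (rule cInf_lessD) (use C in \<open>auto simp: LinfT_def\<close>)
    then obtain C' where C': "C' < LinfT N T u + inverse (real (Suc m))" "AE t in lborel. t \<in> {0..T} \<longrightarrow> N (\<lambda>x. u x t) \<le> C'" by blast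
    from C'(2) show "AE t in lborel. t \<in> {0..T} \<longrightarrow> N (\<lambda>x. u x t) \<le> LinfT N T u + inverse (real (Suc m))"
      by eventually_elim (use C'(1) in auto)
  qed
  then have "AE t in lborel. \<forall>m. t \<in> {0..T} \<longrightarrow> N (\<lambda>x. u x t) \<le> LinfT N T u + inverse (real (Suc m))"
    by (subst AE_all_countable)
  then show ?thesis
  proof eventually_elim
    case (elim t)
    show ?case
    proof
      assume t: "t \<in> {0..T}"
      have "(\<lambda>m. LinfT N T u + inverse (real (Suc m))) \<longlonglongrightarrow> LinfT N T u + 0"
        by (intro tendsto_add tendsto_const LIMSEQ_inverse_real_of_nat)
      then show "N (\<lambda>x. u x t) \<le> LinfT N T u"
        using elim t by (intro LIMSEQ_le_const[of _ "LinfT N T u"]) auto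
    qed
  qed
qed

text \<open>Recovers a bound at every single time from an essential supremum. By \<open>low\<close>,
  the norm is at least q - \<epsilon> at all times near t; these fill an interval of positive
  length, which no null set can contain.\<close>

lemma LinfT_ge:
  assumes T: "T > 0" and C: "\<And>t. t \<in> {0..T} \<Longrightarrow> N (\<lambda>x. u x t) \<le> C" and t: "t \<in> {0..T}"
    and low: "\<And>\<epsilon>. \<epsilon> > 0 \<Longrightarrow> \<exists>\<delta>>0. \<forall>s\<in>{0..T}. \<bar>s - t\<bar> < \<delta> \<longrightarrow> q \<le> N (\<lambda>x. u x s) + \<epsilon>"
  shows "q \<le> LinfT N T u"
  unfolding LinfT_def
proof (rule cInf_greatest)
  show "{C. AE t in lborel. t \<in> {0..T} \<longrightarrow> N (\<lambda>x. u x t) \<le> C} \<noteq> {}" using C by (auto intro!: exI[of _ C])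
  fix C' assume "C' \<in> {C. AE t in lborel. t \<in> {0..T} \<longrightarrow> N (\<lambda>x. u x t) \<le> C}"
  then have C': "AE t in lborel. t \<in> {0..T} \<longrightarrow> N (\<lambda>x. u x t) \<le> C'" by simp
  show "q \<le> C'"
  proof (rule field_le_epsilon)
    fix \<epsilon> :: real assume "\<epsilon> > 0"
    then obtain \<delta> where \<delta>: "\<delta> > 0" "\<And>s. s \<in> {0..T} \<Longrightarrow> \<bar>s - t\<bar> < \<delta> \<Longrightarrow> q \<le> N (\<lambda>x. u x s) + \<epsilon>" using low by blast
    \<comment> \<open>Cut off at 0 and T; the interval stays nondegenerate even if t is an end
      point.\<close>
    define p r where "p = max 0 (t - \<delta> / 2)" and "r = min T (t + \<delta> / 2)"
    have pr: "p < r" using t T \<delta>(1) by (auto simp: p_def r_def)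
    have "AE s in lborel. s \<in> {p..r} \<longrightarrow> N (\<lambda>x. u x s) \<le> C'" 
      using C' by eventually_elim (auto simp: p_def r_def)
    then obtain s where s: "s \<in> {p..r}" "N (\<lambda>x. u x s) \<le> C'" using AE_Icc_witness[where P = "\<lambda>s. N (\<lambda>x. u x s) \<le> C'", OF _ pr] by blast
    then have "s \<in> {0..T}" "\<bar>s - t\<bar> < \<delta>" using \<delta>(1) by (auto simp: p_def r_def abs_less_iff)
    then show "q \<le> C' + \<epsilon>" using \<delta>(2) s(2) by force
  qed
qed

section \<open>Coefficients as continuous families in time\<close>

lemma periodic_reduce:
  assumes M: "M > 0" and p: "periodic M f" shows "\<exists>y\<in>{0..M}. f x = f y"
proof -
  have nat: "f (y + real k * M) = f y" for k y
  proof (induction k)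
    case (Suc k)
    have "y + real (Suc k) * M = (y + real k * M) + M" by (simp add: algebra_simps)
    then show ?case using p Suc by (simp only: periodic_def)
  qed simp
  have int: "f (y + of_int k * M) = f y" for k y
  proof (cases "k \<ge> 0")
    case True then show ?thesis using nat[of y "nat k"] by simp
  next
    case False then show ?thesis using nat[of "y + of_int k * M" "nat (- k)"] by simp
  qed
  define k where "k = \<lfloor>x / M\<rfloor>"
  have "of_int k \<le> x / M" "x / M < of_int k + 1" by (auto simp: k_def)
  then have "x - of_int k * M \<in> {0..M}" using M by (auto simp: field_simps)
  moreover have "f x = f (x - of_int k * M)" using int[of "x - of_int k * M" k] by simp
  ultimately show ?thesis by blast
qed

lemma Ck_norm_ge:
  assumes M: "M > 0" and f: "Ck M k f" and j: "j \<le> k"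
  shows "\<bar>(deriv ^^ j) f x\<bar> \<le> Ck_norm M k f"
proof -
  have f': "periodic M f" "Cd k f" using f by (auto simp: Ck_iff)
  obtain y where y: "y \<in> {0..M}" "(deriv ^^ j) f x = (deriv ^^ j) f y"
    using periodic_reduce[OF M periodic_funpow_deriv[OF f'(1)], of j x] by blast
  have "bdd_above ((\<lambda>x. \<bar>(deriv ^^ j) f x\<bar>) ` {0..M})"
    by (intro bounded_imp_bdd_above compact_imp_bounded compact_continuous_image continuous_intros Cd_continuous_on[OF f'(2) j] compact_Icc)
  then have "\<bar>(deriv ^^ j) f y\<bar> \<le> Sup ((\<lambda>x. \<bar>(deriv ^^ j) f x\<bar>) ` {0..M})" by (intro cSUP_upper y)
  also have "\<dots> \<le> Ck_norm M k f" unfolding Ck_norm_def using j by (intro Max_ge) auto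
  finally show ?thesis using y(2) by simp
qed

lemma Ck_norm_le:
  assumes M: "M > 0" and "\<And>j x. j \<le> k \<Longrightarrow> x \<in> {0..M} \<Longrightarrow> \<bar>(deriv ^^ j) f x\<bar> \<le> C"
  shows "Ck_norm M k f \<le> C"
proof -
  have "Sup ((\<lambda>x. \<bar>(deriv ^^ j) f x\<bar>) ` {0..M}) \<le> C" if "j \<le> k" for j
    using assms that by (intro cSUP_least) auto
  then show ?thesis unfolding Ck_norm_def by (subst Max_le_iff) auto
qed

lemma Ck_diff: "Ck M k f \<Longrightarrow> Ck M k g \<Longrightarrow> Ck M k (\<lambda>x. f x - g x)"
  by (auto simp: Ck_iff Cd_diff periodic_def)

lemma C_Ck_equicontinuous:
  assumes M: "M > 0" and u: "C_Ck M T k u" and j: "j \<le> k" and t: "t \<in> {0..T}" and \<epsilon>: "\<epsilon> > 0"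
  shows "\<exists>\<delta>>0. \<forall>s\<in>{0..T}. \<bar>s - t\<bar> < \<delta> \<longrightarrow> (\<forall>x. \<bar>(deriv ^^ j) (\<lambda>x. u x s) x - (deriv ^^ j) (\<lambda>x. u x t) x\<bar> < \<epsilon>)"
proof -
  obtain \<delta> where \<delta>: "\<delta> > 0" "\<And>s. s \<in> {0..T} \<Longrightarrow> \<bar>s - t\<bar> < \<delta> \<Longrightarrow> Ck_norm M k (\<lambda>x. u x s - u x t) < \<epsilon>"
    using u t \<epsilon> unfolding C_Ck_def cont_into_def by blast
  have C: "Ck M k (\<lambda>x. u x s)" if "s \<in> {0..T}" for s using u that by (simp add: C_Ck_def)
  have "\<bar>(deriv ^^ j) (\<lambda>x. u x s) x - (deriv ^^ j) (\<lambda>x. u x t) x\<bar> < \<epsilon>" if s: "s \<in> {0..T}" "\<bar>s - t\<bar> < \<delta>" for s x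
  proof -
    have "(deriv ^^ j) (\<lambda>x. u x s - u x t) x = (deriv ^^ j) (\<lambda>x. u x s) x - (deriv ^^ j) (\<lambda>x. u x t) x"
      using funpow_deriv_diff[OF _ _ j, of "\<lambda>x. u x s" "\<lambda>x. u x t"] C[OF s(1)] C[OF t] by (simp add: Ck_iff)
    then show ?thesis using Ck_norm_ge[OF M Ck_diff[OF C[OF s(1)] C[OF t]] j, of x] \<delta>(2)[OF s] by simp
  qed
  with \<delta>(1) show ?thesis by blast
qed

lemma C_Ck_mono:
  assumes M: "M > 0" and u: "C_Ck M T k u" and m: "m \<le> k" shows "C_Ck M T m u"
proof -
  have C: "Ck M k (\<lambda>x. u x s)" if "s \<in> {0..T}" for s using u that by (simp add: C_Ck_def)
  have le: "Ck_norm M m (\<lambda>x. u x s - u x t) \<le> Ck_norm M k (\<lambda>x. u x s - u x t)" if "s \<in> {0..T}" "t \<in> {0..T}" for s t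
    using m by (intro Ck_norm_le[OF M] Ck_norm_ge[OF M Ck_diff[OF C[OF that(1)] C[OF that(2)]]]) auto
  have "Ck M m (\<lambda>x. u x s)" if "s \<in> {0..T}" for s using C[OF that] Cd_mono[OF _ m] by (auto simp: Ck_iff)
  moreover have "cont_into (Ck_norm M m) T u"
    unfolding cont_into_def
  proof (intro ballI allI impI)
    fix t \<epsilon> assume t: "t \<in> {0..T}" and "(\<epsilon>::real) > 0"
    then obtain \<delta> where \<delta>: "\<delta> > 0" "\<And>s. s \<in> {0..T} \<Longrightarrow> \<bar>s - t\<bar> < \<delta> \<Longrightarrow> Ck_norm M k (\<lambda>x. u x s - u x t) < \<epsilon>"
      using u unfolding C_Ck_def cont_into_def by blast
    then show "\<exists>\<delta>>0. \<forall>s\<in>{0..T}. \<bar>s - t\<bar> < \<delta> \<longrightarrow> Ck_norm M m (\<lambda>x. u x s - u x t) < \<epsilon>"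
      using le[OF _ t] by (meson le_less_trans)
  qed
  ultimately show ?thesis by (simp add: C_Ck_def)
qed

text \<open>By the triangle inequality, continuity bounds the norm near each time, and compactness
  of [0, T] leaves finitely many of these bounds.\<close>

lemma C_Ck_bounded:
  assumes M: "M > 0" and u: "C_Ck M T k u"
  shows "\<exists>C. \<forall>t\<in>{0..T}. Ck_norm M k (\<lambda>x. u x t) \<le> C"
proof -
  have C: "Ck M k (\<lambda>x. u x s)" if "s \<in> {0..T}" for s using u that by (simp add: C_Ck_def)
  have tri: "Ck_norm M k (\<lambda>x. u x s) \<le> Ck_norm M k (\<lambda>x. u x t) + Ck_norm M k (\<lambda>x. u x s - u x t)" if "s \<in> {0..T}" "t \<in> {0..T}" for s t
  proof (rule Ck_norm_le[OF M])
    fix j x assume j: "j \<le> k"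
    have "(deriv ^^ j) (\<lambda>x. u x s - u x t) x = (deriv ^^ j) (\<lambda>x. u x s) x - (deriv ^^ j) (\<lambda>x. u x t) x"
      using funpow_deriv_diff[OF _ _ j, of "\<lambda>x. u x s" "\<lambda>x. u x t"] C[OF that(1)] C[OF that(2)] by (simp add: Ck_iff)
    then show "\<bar>(deriv ^^ j) (\<lambda>x. u x s) x\<bar> \<le> Ck_norm M k (\<lambda>x. u x t) + Ck_norm M k (\<lambda>x. u x s - u x t)"
      using Ck_norm_ge[OF M Ck_diff[OF C[OF that(1)] C[OF that(2)]] j, of x] Ck_norm_ge[OF M C[OF that(2)] j, of x] by linarith
  qed
  have "\<exists>\<delta>>0. \<forall>s\<in>{0..T}. \<bar>s - t\<bar> < \<delta> \<longrightarrow> Ck_norm M k (\<lambda>x. u x s) \<le> Ck_norm M k (\<lambda>x. u x t) + 1" if t: "t \<in> {0..T}" for t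
  proof -
    have "\<exists>\<delta>>0. \<forall>s\<in>{0..T}. \<bar>s - t\<bar> < \<delta> \<longrightarrow> Ck_norm M k (\<lambda>x. u x s - u x t) < 1"
      using u t unfolding C_Ck_def cont_into_def by (meson zero_less_one)
    then obtain \<delta> where \<delta>: "\<delta> > 0" "\<And>s. s \<in> {0..T} \<Longrightarrow> \<bar>s - t\<bar> < \<delta> \<Longrightarrow> Ck_norm M k (\<lambda>x. u x s - u x t) < 1" by blast
    have "Ck_norm M k (\<lambda>x. u x s) \<le> Ck_norm M k (\<lambda>x. u x t) + 1" if "s \<in> {0..T}" "\<bar>s - t\<bar> < \<delta>" for s
      using tri[OF that(1) t] \<delta>(2)[OF that] by linarith
    with \<delta>(1) show ?thesis by blast
  qed
  then have "\<forall>t\<in>{0..T}. \<exists>\<delta>. \<delta> > 0 \<and> (\<forall>s\<in>{0..T}. \<bar>s - t\<bar> < \<delta> \<longrightarrow> Ck_norm M k (\<lambda>x. u x s) \<le> Ck_norm M k (\<lambda>x. u x t) + 1)" by blast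
  from bchoice[OF this] obtain \<delta> where \<delta>: "\<And>t. t \<in> {0..T} \<Longrightarrow> \<delta> t > 0" 
     "\<And>t s. t \<in> {0..T} \<Longrightarrow> s \<in> {0..T} \<Longrightarrow> \<bar>s - t\<bar> < \<delta> t \<Longrightarrow> Ck_norm M k (\<lambda>x. u x s) \<le> Ck_norm M k (\<lambda>x. u x t) + 1" by blast
  have cov: "{0..T} \<subseteq> (\<Union>t\<in>{0..T}. ball t (\<delta> t))" using \<delta>(1) by force
  obtain F where F: "F \<subseteq> {0..T}" "finite F" "{0..T} \<subseteq> (\<Union>t\<in>F. ball t (\<delta> t))"
    by (rule compactE_image[OF compact_Icc _ cov]) auto
  let ?C = "\<Sum>t\<in>F. \<bar>Ck_norm M k (\<lambda>x. u x t)\<bar> + 1"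
  have "Ck_norm M k (\<lambda>x. u x s) \<le> ?C" if s: "s \<in> {0..T}" for s
  proof -
    obtain t where t: "t \<in> F" "dist t s < \<delta> t" using F(3) s by auto
    then have "Ck_norm M k (\<lambda>x. u x s) \<le> Ck_norm M k (\<lambda>x. u x t) + 1"
      using \<delta>(2)[of t s] F(1) s by (auto simp: dist_real_def abs_minus_commute)
    also have "\<dots> \<le> \<bar>Ck_norm M k (\<lambda>x. u x t)\<bar> + 1" by simp
    also have "\<dots> \<le> ?C" using member_le_sum[of t F "\<lambda>t. \<bar>Ck_norm M k (\<lambda>x. u x t)\<bar> + 1"] F(2) t(1) by simp
    finally show ?thesis .
  qed
  then show ?thesis by blast
qed

text \<open>The essential suprema in \<open>Ktilde\<close> thus control every derivative of the
  coefficients at every time and not just almost always, as the Euler scheme evaluates them at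
  prescribed times.\<close>

lemma C_Ck_LinfT:
  assumes M: "M > 0" and T: "T > 0" and u: "C_Ck M T k u" and j: "j \<le> k" and t: "t \<in> {0..T}"
  shows "\<bar>(deriv ^^ j) (\<lambda>x. u x t) x\<bar> \<le> LinfT (Ck_norm M k) T u"
proof -
  obtain C where C: "\<And>t. t \<in> {0..T} \<Longrightarrow> Ck_norm M k (\<lambda>x. u x t) \<le> C" using C_Ck_bounded[OF M u] by blast
  show ?thesis
  proof (rule LinfT_ge[OF T _ t, where C = C])
    show "Ck_norm M k (\<lambda>x. u x t) \<le> C" if "t \<in> {0..T}" for t by (rule C[OF that])
    fix \<epsilon> :: real assume "\<epsilon> > 0"
    then obtain \<delta> where \<delta>: "\<delta> > 0" "\<And>s. s \<in> {0..T} \<Longrightarrow> \<bar>s - t\<bar> < \<delta> \<Longrightarrow> \<bar>(deriv ^^ j) (\<lambda>x. u x s) x - (deriv ^^ j) (\<lambda>x. u x t) x\<bar> < \<epsilon>"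
      using C_Ck_equicontinuous[OF M u j t] by blast
    have "\<bar>(deriv ^^ j) (\<lambda>x. u x t) x\<bar> \<le> Ck_norm M k (\<lambda>x. u x s) + \<epsilon>" if "s \<in> {0..T}" "\<bar>s - t\<bar> < \<delta>" for s
      using \<delta>(2)[OF that] Ck_norm_ge[OF M _ j, of "\<lambda>x. u x s" x] u that by (simp add: C_Ck_def)
    with \<delta>(1) show "\<exists>\<delta>>0. \<forall>s\<in>{0..T}. \<bar>s - t\<bar> < \<delta> \<longrightarrow> \<bar>(deriv ^^ j) (\<lambda>x. u x t) x\<bar> \<le> Ck_norm M k (\<lambda>x. u x s) + \<epsilon>" by blast
  qed
qed

lemma C_Ck_joint:
  assumes M: "M > 0" and u: "C_Ck M T k u"
  shows "continuous_on ({0..M} \<times> {0..T}) (\<lambda>p. u (fst p) (snd p))"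
  unfolding continuous_on_iff
proof (intro ballI allI impI)
  fix p \<epsilon> assume p: "p \<in> {0..M} \<times> {0..T}" and \<epsilon>: "(\<epsilon>::real) > 0"
  let ?t = "snd p"
  have t: "?t \<in> {0..T}" using p by auto
  obtain \<delta> where \<delta>: "\<delta> > 0" "\<And>s x. s \<in> {0..T} \<Longrightarrow> \<bar>s - ?t\<bar> < \<delta> \<Longrightarrow> \<bar>u x s - u x ?t\<bar> < \<epsilon> / 2"
    using C_Ck_equicontinuous[OF M u _ t, of 0 "\<epsilon> / 2"] \<epsilon> by auto
  have "continuous_on UNIV (\<lambda>x. u x ?t)" using u t Cd_continuous_on[of k "\<lambda>x. u x ?t" 0] by (auto simp: C_Ck_def Ck_iff)
  then have "\<exists>d>0. \<forall>x. dist x (fst p) < d \<longrightarrow> dist (u x ?t) (u (fst p) ?t) < \<epsilon> / 2"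
    unfolding continuous_on_iff using \<epsilon> by (meson UNIV_I half_gt_zero)
  then obtain d where d: "d > 0" "\<And>x. dist x (fst p) < d \<Longrightarrow> dist (u x ?t) (u (fst p) ?t) < \<epsilon> / 2" by blast
  show "\<exists>d>0. \<forall>q\<in>{0..M} \<times> {0..T}. dist q p < d \<longrightarrow> dist (u (fst q) (snd q)) (u (fst p) (snd p)) < \<epsilon>"
  proof (intro exI[of _ "min d \<delta>"] conjI ballI impI)
    fix q assume q: "q \<in> {0..M} \<times> {0..T}" "dist q p < min d \<delta>"
    have "dist (fst q) (fst p) < d" "dist (snd q) ?t < \<delta>" using q(2) dist_fst_le[of q p] dist_snd_le[of q p] by auto
    then have "\<bar>u (fst q) ?t - u (fst p) ?t\<bar> < \<epsilon> / 2" "\<bar>u (fst q) (snd q) - u (fst q) ?t\<bar> < \<epsilon> / 2"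
      using d(2)[of "fst q"] \<delta>(2)[of "snd q" "fst q"] q(1) by (auto simp: dist_real_def)
    then show "dist (u (fst q) (snd q)) (u (fst p) ?t) < \<epsilon>" unfolding dist_real_def by arith
  qed (use d \<delta> in auto)
qed

lemma Lipschitz_in_time:
  fixes f :: "real \<Rightarrow> real"
  assumes "\<And>t. t \<in> {0..T} \<Longrightarrow> (f has_real_derivative f' t) (at t within {0..T})" "\<And>t. t \<in> {0..T} \<Longrightarrow> \<bar>f' t\<bar> \<le> R"
    and "s \<in> {0..T}" "t \<in> {0..T}"
  shows "\<bar>f t - f s\<bar> \<le> R * \<bar>t - s\<bar>"
  using field_differentiable_bound[of "{0..T}" f f' R t s] assms by auto

text \<open>Being continuous without zeros, a has one sign; the mean of b / |a| is therefore
  \<open>mu\<close> up to exactly that sign.\<close>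

lemma weighted_mean_sign:
  assumes M: "M > 0" and a: "continuous_on UNIV a" "\<And>x. a x \<noteq> 0"
    and A3: "(1 / M) * I M (\<lambda>y. b y / \<bar>a y\<bar>) \<ge> 0"
  shows "a x * mu M a b \<ge> 0"
proof -
  have conn: "connected (range a)" by (intro connected_continuous_image a(1) connected_UNIV)
  have "(\<forall>y. a y > 0) \<or> (\<forall>y. a y < 0)"
  proof (rule ccontr)
    assume "\<not> ?thesis"
    then obtain y z where "a y \<le> 0" "a z \<ge> 0" by (auto simp: not_less)
    then have "0 \<in> range a" by (rule connectedD_interval[OF conn rangeI rangeI])
    then show False using a(2) by fastforce
  qed
  then show ?thesis
  proof
    assume p: "\<forall>y. a y > 0"
    then have "(\<lambda>y. b y / \<bar>a y\<bar>) = (\<lambda>y. b y / a y)" by (intro ext) (simp add: abs_of_pos)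
    then have "mu M a b \<ge> 0" using A3 by (simp add: mu_def)
    then show ?thesis using p by (intro mult_nonneg_nonneg) (auto intro: less_imp_le)
  next
    assume p: "\<forall>y. a y < 0"
    then have "(\<lambda>y. b y / \<bar>a y\<bar>) = (\<lambda>y. - (b y / a y))" by (intro ext) (simp add: abs_of_neg)
    then have "- (mu M a b) \<ge> 0" using A3 by (simp add: mu_def set_lebesgue_integral_def)
    then show ?thesis using p by (intro mult_nonpos_nonpos) (auto intro: less_imp_le)
  qed
qed

text \<open>All summands of \<open>Ktilde\<close> are nonnegative, so it dominates each of them and
  can serve as R.\<close>

theorem adm_Ktilde:
  assumes M: "M > 0" and T: "T > 0" and n: "n \<ge> 4"
    and a: "C_Ck M T (n + 3) a" "\<forall>x. \<forall>t\<in>{0..T}. ((\<lambda>s. a x s) has_real_derivative da x t) (at t within {0..T})" "C_Ck M T n da"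
    and b: "C_Ck M T (n + 2) b" "\<forall>x. \<forall>t\<in>{0..T}. ((\<lambda>s. b x s) has_real_derivative db x t) (at t within {0..T})" "C_Ck M T n db"
    and c: "C_Ck M T n c" and d: "C_Ck M T n d" and e: "in_Linf_Hn M n T e"
    and a0: "0 < a0" "\<forall>x. \<forall>t\<in>{0..T}. a0 \<le> \<bar>a x t\<bar>"
    and A3: "\<forall>t\<in>{0..T}. (1 / M) * I M (\<lambda>y. b y t / \<bar>a y t\<bar>) \<ge> 0"
  shows "adm (Ktilde M T n a da b db c d e) M T n a b c d"
    and "AE t in lborel. t \<in> {0..T} \<longrightarrow> Hn_norm M n (\<lambda>x. e x t) \<le> Ktilde M T n a da b db c d e"
proof -
  define R where "R = Ktilde M T n a da b db c d e"
  have z: "0 \<in> {0..T}" using T by simp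
  obtain Ce where Ce: "AE t in lborel. t \<in> {0..T} \<longrightarrow> Hn_norm M n (\<lambda>x. e x t) \<le> Ce" using e by (auto simp: in_Linf_Hn_def)
  note eA = LinfT_AE[where N = "Hn_norm M n" and u = e, OF Ce]
  have e0: "LinfT (Hn_norm M n) T e \<ge> 0"
  proof -
    obtain t where "Hn_norm M n (\<lambda>x. e x t) \<le> LinfT (Hn_norm M n) T e" using AE_Icc_witness[where P = "\<lambda>t. Hn_norm M n (\<lambda>x. e x t) \<le> LinfT (Hn_norm M n) T e", OF eA T] by auto
    then show ?thesis using Hn_norm_nonneg[of M n "\<lambda>x. e x t"] by simp
  qed
  have da: "C_Ck M T 1 da" and db: "C_Ck M T 0 db" and b': "C_Ck M T n b"
    using C_Ck_mono[OF M a(3), of 1] C_Ck_mono[OF M b(3), of 0] C_Ck_mono[OF M b(1), of n] n by auto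
  note L = C_Ck_LinfT[OF M T]
  have nn: "LinfT (Ck_norm M k) T u \<ge> 0" if "C_Ck M T k u" for k u
    using L[OF that le0 z, of 0] by linarith
  have an: "a x t \<noteq> 0" if "t \<in> {0..T}" for x t using a0(1) a0(2)[rule_format, OF that, of x] by auto
  have aC: "Ck M (n + 3) (\<lambda>x. a x t)" if "t \<in> {0..T}" for t using a(1) that by (simp add: C_Ck_def)
  have ac: "continuous_on UNIV (\<lambda>x. a x t)" if "t \<in> {0..T}" for t
    using aC[OF that] Cd_continuous_on[of "n + 3" "\<lambda>x. a x t" 0] by (auto simp: Ck_iff)
  have iC: "Ck M 0 (\<lambda>x. 1 / a x t)" if "t \<in> {0..T}" for t
    using aC[OF that] an[OF that] ac[OF that] by (auto simp: Ck_iff periodic_def Cd_0 intro!: continuous_intros)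
  \<comment> \<open>Continuity in time of 1 / a at each fixed x is enough for
    \<open>LinfT_ge\<close>; the bound 1 / a0 from (A2) only keeps the essential supremum finite and
    does not enter R.\<close>
  have ia: "\<bar>1 / a x t\<bar> \<le> LinfT (\<lambda>f. Ck_norm M 0 (\<lambda>x. 1 / f x)) T a" if t: "t \<in> {0..T}" for x t
  proof (rule LinfT_ge[OF T _ t])
    show "Ck_norm M 0 (\<lambda>x. 1 / a x t) \<le> 1 / a0" if "t \<in> {0..T}" for t
      using a0 that by (intro Ck_norm_le[OF M]) (auto simp: divide_simps intro: mult_left_le)
    fix \<epsilon> :: real assume \<epsilon>: "\<epsilon> > 0"
    have "continuous_on {0..T} (a x)"
      using a(2) by (intro DERIV_continuous_on) blast
    then have "continuous_on {0..T} (\<lambda>s. 1 / a x s)" using an by (intro continuous_intros) auto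
    then obtain \<delta> where \<delta>: "\<delta> > 0" "\<And>s. s \<in> {0..T} \<Longrightarrow> dist s t < \<delta> \<Longrightarrow> dist (1 / a x s) (1 / a x t) < \<epsilon>"
      using t \<epsilon> unfolding continuous_on_iff by blast
    have "\<bar>1 / a x t\<bar> \<le> Ck_norm M 0 (\<lambda>x. 1 / a x s) + \<epsilon>" if s: "s \<in> {0..T}" "\<bar>s - t\<bar> < \<delta>" for s
    proof -
      have "\<bar>1 / a x s - 1 / a x t\<bar> < \<epsilon>" using \<delta>(2)[of s] s by (simp add: dist_real_def)
      moreover have "\<bar>1 / a x s\<bar> \<le> Ck_norm M 0 (\<lambda>x. 1 / a x s)" using Ck_norm_ge[OF M iC[OF s(1)], of 0 x] by simp
      ultimately show ?thesis by linarith
    qed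
    with \<delta>(1) show "\<exists>\<delta>>0. \<forall>s\<in>{0..T}. \<bar>s - t\<bar> < \<delta> \<longrightarrow> \<bar>1 / a x t\<bar> \<le> Ck_norm M 0 (\<lambda>x. 1 / a x s) + \<epsilon>" by blast
  qed
  have i0: "LinfT (\<lambda>f. Ck_norm M 0 (\<lambda>x. 1 / f x)) T a \<ge> 0" using ia[OF z, of 0] by linarith
  note pos = nn[OF a(1)] nn[OF da] nn[OF b'] nn[OF db] nn[OF c] nn[OF d] i0 e0 M T
  have le: "M \<le> R" "T \<le> R" "real n \<le> R" "LinfT (Ck_norm M (n + 3)) T a \<le> R" "LinfT (Ck_norm M 1) T da \<le> R"
    "LinfT (\<lambda>f. Ck_norm M 0 (\<lambda>x. 1 / f x)) T a \<le> R" "LinfT (Ck_norm M n) T b \<le> R" "LinfT (Ck_norm M 0) T db \<le> R"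
    "LinfT (Ck_norm M n) T c \<le> R" "LinfT (Ck_norm M n) T d \<le> R" "LinfT (Hn_norm M n) T e \<le> R"
    using pos by (auto simp: R_def Ktilde_def)
  have "adm R M T n a b c d"
  proof (rule adm.intro)
    show "T > 0" "T \<le> R" using T le by auto
    fix t assume t: "t \<in> {0..T}"
    show "coef R M n (\<lambda>x. a x t) (\<lambda>x. b x t) (\<lambda>x. c x t) (\<lambda>x. d x t)"
    proof
      show "\<bar>1 / a x t\<bar> \<le> R" for x using ia[OF t, of x] le by linarith
      show "\<bar>(deriv ^^ i) (\<lambda>x. a x t) x\<bar> \<le> R" if "i \<le> n + 3" for i x using L[OF a(1) that t, of x] le by linarith
      show "\<bar>(deriv ^^ i) (\<lambda>x. b x t) x\<bar> \<le> R" if "i \<le> n" for i x using L[OF b' that t, of x] le by linarith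
      show "\<bar>(deriv ^^ i) (\<lambda>x. c x t) x\<bar> \<le> R" if "i \<le> n" for i x using L[OF c that t, of x] le by linarith
      show "\<bar>(deriv ^^ i) (\<lambda>x. d x t) x\<bar> \<le> R" if "i \<le> n" for i x using L[OF d that t, of x] le by linarith
      show "a x t * mu M (\<lambda>x. a x t) (\<lambda>x. b x t) \<ge> 0" for x
        using weighted_mean_sign[OF M ac[OF t] an[OF t], of "\<lambda>x. b x t" x] A3 t by auto
    qed (use M n le an[OF t] a(1) b(1) c d t in \<open>auto simp: C_Ck_def\<close>)
  next
    fix x s t assume st: "s \<in> {0..T}" "t \<in> {0..T}"
    have "\<bar>da x t\<bar> \<le> R" "\<bar>db x t\<bar> \<le> R" if "t \<in> {0..T}" for t
      using L[OF da le0 that, of x] L[OF db le0 that, of x] le by auto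
    then show "\<bar>a x t - a x s\<bar> \<le> R * \<bar>t - s\<bar>" "\<bar>b x t - b x s\<bar> \<le> R * \<bar>t - s\<bar>"
      using Lipschitz_in_time[of T "a x" "da x" R s t] Lipschitz_in_time[of T "b x" "db x" R s t] a(2) b(2) st by auto
  qed (rule C_Ck_joint[OF M a(1)] C_Ck_joint[OF M b(1)] C_Ck_joint[OF M c] C_Ck_joint[OF M d])+
  then show "adm (Ktilde M T n a da b db c d e) M T n a b c d" unfolding R_def .
  show "AE t in lborel. t \<in> {0..T} \<longrightarrow> Hn_norm M n (\<lambda>x. e x t) \<le> Ktilde M T n a da b db c d e"
    using eA by eventually_elim (use le(11) in \<open>auto simp: R_def\<close>)
qed

section \<open>The solution map\<close>

lemma Hn_derivs_zero: "in_Hn M n f \<Longrightarrow> Hn_derivs M n (\<lambda>x. 0) (\<lambda>j x. 0)"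
  unfolding in_Hn_def using Hn_derivs_diff by fastforce

lemma in_Hn_diff: "in_Hn M n f \<Longrightarrow> in_Hn M n g \<Longrightarrow> in_Hn M n (\<lambda>x. f x - g x)"
  unfolding in_Hn_def using Hn_derivs_diff by blast

context adm begin

text \<open>Derivatives below n are jointly continuous on a compact set, hence uniformly continuous,
  which gives continuity in time into H^m for m < n; the derivative of order n is only bounded in
  L2.\<close>

theorem solution_exists:
  assumes e: "in_Linf_Hn M n T e" and E: "E > 0" "AE r in lborel. r \<in> {0..T} \<longrightarrow> Hn_norm M n (\<lambda>x. e x r) \<le> E"
    and u0: "in_Hn M n u0" "Hn_norm M n u0 \<le> E"
  shows "\<exists>u. in_Linf_Hn M n T u \<and> (\<forall>m<n. C_Hn M T m u) \<and>
     (\<forall>t\<in>{0..T}. \<forall>m\<le>n. in_Hn M m (\<lambda>x. u x t) \<and> Hn_norm M m (\<lambda>x. u x t) \<le> sqrt (real n + 1) * (KB R * (2 * E))) \<and>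
     (AE x in lborel. x \<in> {0..M} \<longrightarrow> u x 0 = u0 x) \<and> solves M T a b c d e u"
proof -
  obtain D0 where D0: "Hn_derivs M n u0 D0" using u0(1) by (auto simp: in_Hn_def)
  have D0E: "L2_norm M (D0 j) \<le> E" if "j \<le> n" for j using L2_norm_le_Hn_norm[OF M(1) D0 that] u0(2) by linarith
  from existence[OF e E D0 D0E] obtain V where
      V1: "\<forall>t\<in>{0..T}. Hn_derivs M n (\<lambda>x. V 0 x t) (\<lambda>j x. V j x t) \<and> (\<forall>j\<le>n. L2_norm M (\<lambda>x. V j x t) \<le> KB R * (2 * E))"
    and V2: "\<forall>j<n. continuous_on ({0..M} \<times> {0..T}) (\<lambda>p. V j (fst p) (snd p))"
    and V3: "AE x in lborel. x \<in> {0..M} \<longrightarrow> V 0 x 0 = u0 x"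
    and V4: "\<forall>t\<in>{0..T}. AE x in lborel. x \<in> {0..M} \<longrightarrow> V 0 x t = V 0 x 0 +
        prim (\<lambda>s. a x s * V 3 x s + b x s * V 2 x s + c x s * V 1 x s + d x s * V 0 x s) t + prim (e x) t" by blast
  have HV: "Hn_derivs M m (\<lambda>x. V 0 x t) (\<lambda>j x. V j x t)" if "t \<in> {0..T}" "m \<le> n" for t m
    using V1 that by (blast intro: Hn_derivs_mono)
  have nV: "Hn_norm M m (\<lambda>x. V 0 x t) \<le> sqrt (real n + 1) * (KB R * (2 * E))" if "t \<in> {0..T}" "m \<le> n" for t m
  proof -
    have "Hn_norm M m (\<lambda>x. V 0 x t) \<le> Hn_norm M n (\<lambda>x. V 0 x t)"
      using HV[OF that(1) order_refl] that by (intro Hn_norm_mono M) (auto simp: in_Hn_def)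
    also have "\<dots> \<le> sqrt (real n + 1) * (KB R * (2 * E))"
      using V1 that(1) by (intro Hn_norm_le[OF M(1) HV[OF that(1) order_refl]]) auto
    finally show ?thesis .
  qed
  have bound: "\<forall>t\<in>{0..T}. \<forall>m\<le>n. in_Hn M m (\<lambda>x. V 0 x t) \<and> Hn_norm M m (\<lambda>x. V 0 x t) \<le> sqrt (real n + 1) * (KB R * (2 * E))"
    using HV nV unfolding in_Hn_def by blast
  have Vm: "set_borel_measurable lborel ({0..M} \<times> {0..T}) (\<lambda>p. V j (fst p) (snd p))" if "j < n" for j
    using V2 that by (intro set_measurable_continuous) auto
  have Linf: "in_Linf_Hn M n T (V 0)"
    unfolding in_Linf_Hn_def
  proof (intro conjI exI[of _ "sqrt (real n + 1) * (KB R * (2 * E))"])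
    show "set_borel_measurable lborel ({0..M} \<times> {0..T}) (\<lambda>p. V 0 (fst p) (snd p))" using Vm[of 0] n by simp
  qed (use bound in auto)
  have uc: "\<exists>\<delta>>0. \<forall>s\<in>{0..T}. \<forall>t\<in>{0..T}. \<bar>s - t\<bar> < \<delta> \<longrightarrow> (\<forall>x\<in>{0..M}. \<bar>V j x s - V j x t\<bar> < \<omega>)" if j: "j < n" and \<omega>: "\<omega> > 0" for j \<omega>
  proof -
    have "uniformly_continuous_on ({0..M} \<times> {0..T}) (\<lambda>p. V j (fst p) (snd p))"
      using V2 j by (intro compact_uniformly_continuous compact_Times compact_Icc) auto
    then obtain h where h: "h > 0" "\<And>p q. p \<in> {0..M} \<times> {0..T} \<Longrightarrow> q \<in> {0..M} \<times> {0..T} \<Longrightarrow> dist q p < h \<Longrightarrow> dist (V j (fst q) (snd q)) (V j (fst p) (snd p)) < \<omega>"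
      unfolding uniformly_continuous_on_def using \<omega> by meson
    have "\<bar>V j x s - V j x t\<bar> < \<omega>" if "x \<in> {0..M}" "s \<in> {0..T}" "t \<in> {0..T}" "\<bar>s - t\<bar> < h" for x s t
      using h(2)[of "(x, t)" "(x, s)"] that by (auto simp: dist_Pair_Pair dist_real_def)
    with h(1) show ?thesis by blast
  qed
  have CH: "C_Hn M T m (V 0)" if m: "m < n" for m
    unfolding C_Hn_def cont_into_def
  proof (intro conjI ballI allI impI)
    show "in_Hn M m (\<lambda>x. V 0 x t)" if "t \<in> {0..T}" for t using bound that m by auto
    fix t \<epsilon> assume t: "t \<in> {0..T}" and \<epsilon>: "(\<epsilon>::real) > 0"
    define \<omega> where "\<omega> = \<epsilon> / (2 * (sqrt (real m + 1) * sqrt M))"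
    have pos: "sqrt (real m + 1) * sqrt M > 0" using M by simp
    have \<omega>: "\<omega> > 0" unfolding \<omega>_def by (intro divide_pos_pos \<epsilon> mult_pos_pos[OF _ pos]) simp
    have \<omega>': "sqrt (real m + 1) * (sqrt M * \<omega>) < \<epsilon>"
    proof -
      have "P * (\<epsilon> / (2 * P)) < \<epsilon>" if "P > 0" for P :: real using that \<epsilon> by simp
      from this[OF pos] show ?thesis unfolding \<omega>_def by (simp only: mult.assoc)
    qed
    have "\<forall>j. \<exists>\<delta>. j < n \<longrightarrow> \<delta> > 0 \<and> (\<forall>s\<in>{0..T}. \<forall>t\<in>{0..T}. \<bar>s - t\<bar> < \<delta> \<longrightarrow> (\<forall>x\<in>{0..M}. \<bar>V j x s - V j x t\<bar> < \<omega>))"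
      using uc[OF _ \<omega>] by blast
    from choice[OF this] obtain \<delta> where \<delta>: "\<And>j. j < n \<Longrightarrow> \<delta> j > 0"
      "\<And>j s t x. j < n \<Longrightarrow> s \<in> {0..T} \<Longrightarrow> t \<in> {0..T} \<Longrightarrow> \<bar>s - t\<bar> < \<delta> j \<Longrightarrow> x \<in> {0..M} \<Longrightarrow> \<bar>V j x s - V j x t\<bar> < \<omega>" by blast
    show "\<exists>\<delta>>0. \<forall>s\<in>{0..T}. \<bar>s - t\<bar> < \<delta> \<longrightarrow> Hn_norm M m (\<lambda>x. V 0 x s - V 0 x t) < \<epsilon>"
    proof (intro exI[of _ "Min (\<delta> ` {..m})"] conjI ballI impI)
      show "Min (\<delta> ` {..m}) > 0" using \<delta>(1) m by (subst Min_gr_iff) auto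
      fix s assume s: "s \<in> {0..T}" and st: "\<bar>s - t\<bar> < Min (\<delta> ` {..m})"
      have "Hn_norm M m (\<lambda>x. V 0 x s - V 0 x t) \<le> sqrt (real m + 1) * (sqrt M * \<omega>)"
      proof (rule Hn_norm_le[OF M(1) Hn_derivs_diff[OF HV[OF s] HV[OF t]]])
        fix k assume k: "k \<le> m"
        have "\<bar>s - t\<bar> < \<delta> k" using st k by (subst (asm) Min_gr_iff) auto
        then have "\<bar>V k x s - V k x t\<bar> \<le> \<omega>" if "x \<in> {0..M}" for x
          using \<delta>(2)[of k s t x] k m s t that by (simp add: less_imp_le)
        then show "L2_norm M (\<lambda>x. V k x s - V k x t) \<le> sqrt M * \<omega>"
          using M k m s t by (intro L2_norm_sup sq_diff Hn_derivs_sq[OF HV[OF s order_refl], of k] Hn_derivs_sq[OF HV[OF t order_refl], of k]) auto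
      qed (use m in auto)
      then show "Hn_norm M m (\<lambda>x. V 0 x s - V 0 x t) < \<epsilon>" using \<omega>' by linarith
    qed
  qed
  have "solves M T a b c d e (V 0)"
    unfolding solves_def Let_def
  proof (rule exI[of _ "V 1"], rule exI[of _ "V 2"], rule exI[of _ "V 3"], intro conjI ballI)
    fix t assume t: "t \<in> {0..T}"
    have "\<forall>k<n. weak_deriv M (\<lambda>x. V k x t) (\<lambda>x. V (Suc k) x t)" using HV[OF t order_refl] by (simp add: Hn_derivs_def)
    then show "weak_deriv M (\<lambda>x. V 0 x t) (\<lambda>x. V 1 x t)" "weak_deriv M (\<lambda>x. V 1 x t) (\<lambda>x. V 2 x t)" "weak_deriv M (\<lambda>x. V 2 x t) (\<lambda>x. V 3 x t)"
      using n by (auto simp: numeral_2_eq_2 numeral_3_eq_3)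
  next
    fix Z assume "Z \<in> {V 0, V 1, V 2, V 3}"
    then show "set_borel_measurable lborel ({0..M} \<times> {0..T}) (\<lambda>p. Z (fst p) (snd p))"
      using Vm[of 0] Vm[of 1] Vm[of 2] Vm[of 3] n by auto
  next
    fix t assume t: "t \<in> {0..T}"
    let ?F = "\<lambda>x s. a x s * V 3 x s + b x s * V 2 x s + c x s * V 1 x s + d x s * V 0 x s"
    have Fc: "continuous_on ({0..M} \<times> {0..T}) (\<lambda>p. ?F (fst p) (snd p))"
      using V2 n by (intro continuous_intros joint) auto
    note ae = time_int.AE_integrable[OF time_integral_Hn(1)[OF M(1) T(1) e E(2)]]
    show "AE x in lborel. x \<in> {0..M} \<longrightarrow> set_integrable lborel {0..t} (\<lambda>s. a x s * V 3 x s + b x s * V 2 x s + c x s * V 1 x s + d x s * V 0 x s + e x s) \<and>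
       V 0 x t = V 0 x 0 + prim (\<lambda>s. a x s * V 3 x s + b x s * V 2 x s + c x s * V 1 x s + d x s * V 0 x s + e x s) t"
      using ae V4[rule_format, OF t]
    proof eventually_elim
      case (elim x)
      show ?case
      proof
        assume x: "x \<in> {0..M}"
        have "continuous_on {0..t} (\<lambda>s. (x, s))" by (intro continuous_intros)
        moreover have "(\<lambda>s. (x, s)) ` {0..t} \<subseteq> {0..M} \<times> {0..T}" using x t by auto
        ultimately have "continuous_on {0..t} (\<lambda>s. ?F (fst (x, s)) (snd (x, s)))" by (rule continuous_on_compose2[OF Fc])
        then have i1: "set_integrable lborel {0..t} (?F x)" by (intro borel_integrable_atLeastAtMost') simp
        have i2: "set_integrable lborel {0..t} (e x)" 
          by (rule set_integrable_subset[of lborel "{0..T}"]) (use elim x t in auto)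
        show "set_integrable lborel {0..t} (\<lambda>s. a x s * V 3 x s + b x s * V 2 x s + c x s * V 1 x s + d x s * V 0 x s + e x s) \<and>
            V 0 x t = V 0 x 0 + prim (\<lambda>s. a x s * V 3 x s + b x s * V 2 x s + c x s * V 1 x s + d x s * V 0 x s + e x s) t"
        proof
          show "set_integrable lborel {0..t} (\<lambda>s. ?F x s + e x s)" by (rule set_integral_add(1)[OF i1 i2])
          have "V 0 x t = V 0 x 0 + prim (?F x) t + prim (e x) t" using elim x by blast
          then show "V 0 x t = V 0 x 0 + prim (\<lambda>s. ?F x s + e x s) t"
            unfolding set_integral_add(2)[OF i1 i2] by simp
        qed
      qed
    qed
  qed
  with Linf CH bound V3 show ?thesis by blast
qed

lemma solution_unique:
  assumes u: "in_Linf_Hn M n T u" "solves M T a b c d e u" and v: "in_Linf_Hn M n T v" "solves M T a b c d e v"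
    and init: "AE x in lborel. x \<in> {0..M} \<longrightarrow> v x 0 = u x 0" and t: "t \<in> {0..T}"
  shows "AE x in lborel. x \<in> {0..M} \<longrightarrow> v x t = u x t"
proof -
  have "AE x in lborel. x \<in> {0..M} \<longrightarrow> v x t - u x t = 0"
  proof (rule homogeneous_solution_zero[OF in_Linf_Hn_diff[OF M(1) v(1) u(1)] _ _ t])
    show "solves M T a b c d (\<lambda>x t. 0) (\<lambda>x t. v x t - u x t)" using solves_diff[OF v(2) u(2)] by simp
    show "AE x in lborel. x \<in> {0..M} \<longrightarrow> v x 0 - u x 0 = 0" using init by eventually_elim auto
  qed
  then show ?thesis by eventually_elim auto
qed

text \<open>By linearity the difference solves the equation without source for the data g - f. The
  solution constructed for these data with E = \<delta> has a bound linear in \<delta>, and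
  uniqueness transfers it to the difference.\<close>

lemma solution_difference:
  assumes u: "in_Linf_Hn M n T u" "solves M T a b c d e u" "AE x in lborel. x \<in> {0..M} \<longrightarrow> u x 0 = f x" "\<And>t. t \<in> {0..T} \<Longrightarrow> in_Hn M n (\<lambda>x. u x t)"
    and v: "in_Linf_Hn M n T v" "solves M T a b c d e v" "AE x in lborel. x \<in> {0..M} \<longrightarrow> v x 0 = g x" "\<And>t. t \<in> {0..T} \<Longrightarrow> in_Hn M n (\<lambda>x. v x t)"
    and d: "in_Hn M n (\<lambda>x. g x - f x)" "Hn_norm M n (\<lambda>x. g x - f x) \<le> \<delta>" "\<delta> > 0"
  shows "LinfT (Hn_norm M n) T (\<lambda>x t. v x t - u x t) \<le> sqrt (real n + 1) * (KB R * (2 * \<delta>))"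
proof -
  note z = Hn_derivs_zero[OF d(1)]
  have z0: "Hn_norm M n (\<lambda>x. 0) \<le> \<delta>"
    unfolding Hn_norm_eq[OF M(1) z] using d(3) by (simp add: L2_norm_def)
  have Z: "in_Linf_Hn M n T (\<lambda>x t. 0)"
    unfolding in_Linf_Hn_def using z z0 by (auto simp: in_Hn_def set_borel_measurable_def)
  obtain w where w: "in_Linf_Hn M n T w" "\<And>t. t \<in> {0..T} \<Longrightarrow> in_Hn M n (\<lambda>x. w x t) \<and> Hn_norm M n (\<lambda>x. w x t) \<le> sqrt (real n + 1) * (KB R * (2 * \<delta>))"
     "AE x in lborel. x \<in> {0..M} \<longrightarrow> w x 0 = g x - f x" "solves M T a b c d (\<lambda>x t. 0) w"
    using solution_exists[OF Z d(3) _ d(1,2)] z0 by auto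
  have eq: "AE x in lborel. x \<in> {0..M} \<longrightarrow> v x t - u x t = w x t" if t: "t \<in> {0..T}" for t
  proof (rule solution_unique[OF w(1,4) in_Linf_Hn_diff[OF M(1) v(1) u(1)] _ _ t])
    show "solves M T a b c d (\<lambda>x t. 0) (\<lambda>x t. v x t - u x t)" using solves_diff[OF v(2) u(2)] by simp
    show "AE x in lborel. x \<in> {0..M} \<longrightarrow> v x 0 - u x 0 = w x 0" using u(3) v(3) w(3) by eventually_elim auto
  qed
  have "Hn_norm M n (\<lambda>x. v x t - u x t) \<le> sqrt (real n + 1) * (KB R * (2 * \<delta>))" if t: "t \<in> {0..T}" for t
  proof -
    obtain D where D: "Hn_derivs M n (\<lambda>x. w x t) D" using w(2)[OF t] by (auto simp: in_Hn_def)
    have "AE x in lborel. x \<in> {0..M} \<longrightarrow> w x t = v x t - u x t" using eq[OF t] by eventually_elim auto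
    from Hn_norm_eq_AE[OF M(1) D in_Hn_diff[OF v(4)[OF t] u(4)[OF t]] this] Hn_norm_eq[OF M(1) D]
    show ?thesis using w(2)[OF t] by simp
  qed
  then show ?thesis by (intro LinfT_le T Hn_norm_nonneg) auto
qed

end

text \<open>The right-hand side contains the constant used in the theorem; the absolute values keep
  it positive at every real argument, also at those that no equation produces.\<close>

lemma solution_constant_le:
  fixes h R :: real
  assumes "h \<ge> 0" "R \<ge> 0" "real n \<le> R"
  shows "sqrt (real n + 1) * (KB R * (2 * (h + R))) \<le> (1 + sqrt (\<bar>R\<bar> + 1) * (\<bar>KB R\<bar> * (2 * (1 + \<bar>R\<bar>)))) * (h + 1)"
proof -
  have "h + R \<le> (1 + R) * (h + 1)" using assms by (simp add: algebra_simps)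
  then have "KB R * (2 * (h + R)) \<le> \<bar>KB R\<bar> * (2 * ((1 + R) * (h + 1)))"
    using assms by (intro mult_mono) auto
  then have "sqrt (real n + 1) * (KB R * (2 * (h + R))) \<le> sqrt (real n + 1) * (\<bar>KB R\<bar> * (2 * ((1 + R) * (h + 1))))"
    by (rule mult_left_mono) simp
  also have "\<dots> \<le> sqrt (R + 1) * (\<bar>KB R\<bar> * (2 * ((1 + R) * (h + 1))))"
    using assms by (intro mult_right_mono) auto
  also have "\<dots> = (sqrt (\<bar>R\<bar> + 1) * (\<bar>KB R\<bar> * (2 * (1 + \<bar>R\<bar>)))) * (h + 1)" using assms by simp
  also have "\<dots> \<le> (1 + sqrt (\<bar>R\<bar> + 1) * (\<bar>KB R\<bar> * (2 * (1 + \<bar>R\<bar>)))) * (h + 1)" using assms by (intro mult_right_mono) auto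
  finally show ?thesis .
qed

theorem theorem1:
  "\<exists>K :: real \<Rightarrow> real. (\<forall>k. K k > 0) \<and>
   (\<forall>(M::real) (T::real) (n::nat) a da b db c d e (a0::real).
     M > 0 \<longrightarrow> T > 0 \<longrightarrow> n \<ge> 4 \<longrightarrow>
     \<comment> \<open>(A1)\<close>
     C_Ck M T (n + 3) a \<longrightarrow>
     (\<forall>x. \<forall>t\<in>{0..T}. ((\<lambda>s. a x s) has_real_derivative da x t) (at t within {0..T})) \<longrightarrow>
     C_Ck M T n da \<longrightarrow>
     C_Ck M T (n + 2) b \<longrightarrow>
     (\<forall>x. \<forall>t\<in>{0..T}. ((\<lambda>s. b x s) has_real_derivative db x t) (at t within {0..T})) \<longrightarrow>
     C_Ck M T n db \<longrightarrow>
     C_Ck M T n c \<longrightarrow>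
     C_Ck M T n d \<longrightarrow>
     in_Linf_Hn M n T e \<longrightarrow>
     \<comment> \<open>(A2)\<close>
     0 < a0 \<longrightarrow> (\<forall>x. \<forall>t\<in>{0..T}. a0 \<le> \<bar>a x t\<bar>) \<longrightarrow>
     \<comment> \<open>(A3)\<close>
     (\<forall>t\<in>{0..T}. (1 / M) * (LINT y:{0..M}|lborel. b y t / \<bar>a y t\<bar>) \<ge> 0) \<longrightarrow>
     (let Kc = K (Ktilde M T n a da b db c d e) in
      \<exists>\<Psi> :: (real \<Rightarrow> real) \<Rightarrow> real \<Rightarrow> real \<Rightarrow> real.
        \<comment> \<open>\<Psi> : H^n \<rightarrow> L^\<infinity>([0,T];H^n) continuous\<close>
        (\<forall>u0. in_Hn M n u0 \<longrightarrow> in_Linf_Hn M n T (\<Psi> u0)) \<and>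
        (\<forall>u0. in_Hn M n u0 \<longrightarrow> (\<forall>\<epsilon>>0. \<exists>\<delta>>0. \<forall>v0. in_Hn M n v0 \<longrightarrow>
            Hn_norm M n (\<lambda>x. v0 x - u0 x) < \<delta> \<longrightarrow>
            LinfT (Hn_norm M n) T (\<lambda>x t. \<Psi> v0 x t - \<Psi> u0 x t) < \<epsilon>)) \<and>
        (\<forall>u0. in_Hn M n u0 \<longrightarrow>
          (let u = \<Psi> u0 in
            LinfT (Hn_norm M n) T u \<le> Kc * (Hn_norm M n u0 + 1) \<and>
            \<comment> \<open>(1)\<close>
            (\<forall>n'<n. C_Hn M T n' u \<and>
                (\<forall>t\<in>{0..T}. Hn_norm M n' (\<lambda>x. u x t) \<le> Kc * (Hn_norm M n u0 + 1))) \<and>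
            \<comment> \<open>(2)\<close>
            (AE x in lborel. x \<in> {0..M} \<longrightarrow> u x 0 = u0 x) \<and>
            \<comment> \<open>(3)\<close>
            solves M T a b c d e u \<and>
            \<comment> \<open>(4)\<close>
            (\<forall>v. in_Linf_Hn M n T v \<longrightarrow>
                 (AE x in lborel. x \<in> {0..M} \<longrightarrow> v x 0 = u0 x) \<longrightarrow>
                 solves M T a b c d e v \<longrightarrow>
                 (\<forall>t\<in>{0..T}. AE x in lborel. x \<in> {0..M} \<longrightarrow> v x t = u x t))))))"
proof (intro exI[of _ "\<lambda>k. 1 + sqrt (\<bar>k\<bar> + 1) * (\<bar>KB k\<bar> * (2 * (1 + \<bar>k\<bar>)))"] conjI allI impI)
  show "0 < 1 + sqrt (\<bar>k\<bar> + 1) * (\<bar>KB k\<bar> * (2 * (1 + \<bar>k\<bar>)))" for k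
    by (intro add_pos_nonneg mult_nonneg_nonneg) auto
next
  fix M T :: real and n :: nat and a da b db c d e :: "real \<Rightarrow> real \<Rightarrow> real" and a0 :: real
  assume hyps: "M > 0" "T > 0" "n \<ge> 4" "C_Ck M T (n + 3) a"
     "\<forall>x. \<forall>t\<in>{0..T}. ((\<lambda>s. a x s) has_real_derivative da x t) (at t within {0..T})"
     "C_Ck M T n da" "C_Ck M T (n + 2) b"
     "\<forall>x. \<forall>t\<in>{0..T}. ((\<lambda>s. b x s) has_real_derivative db x t) (at t within {0..T})"
     "C_Ck M T n db" "C_Ck M T n c" "C_Ck M T n d" "in_Linf_Hn M n T e" "0 < a0"
     "\<forall>x. \<forall>t\<in>{0..T}. a0 \<le> \<bar>a x t\<bar>"
     "\<forall>t\<in>{0..T}. (1 / M) * (LINT y:{0..M}|lborel. b y t / \<bar>a y t\<bar>) \<ge> 0"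
  define R where "R = Ktilde M T n a da b db c d e"
  define Kc where "Kc = 1 + sqrt (\<bar>R\<bar> + 1) * (\<bar>KB R\<bar> * (2 * (1 + \<bar>R\<bar>)))"
  note aK = adm_Ktilde[OF hyps, folded R_def]
  interpret adm R M T n a b c d by (rule aK(1))
  have R: "R \<ge> 0" "real n \<le> R" using R4 coef.n(2)[OF coef0] by auto
  \<comment> \<open>The bound is recorded at every time and for all m up to n, so that one choice of
    u serves all parts of the claim.\<close>
  define Sol where "Sol = (\<lambda>u0 u. in_Linf_Hn M n T u \<and> (\<forall>m<n. C_Hn M T m u) \<and>
     (\<forall>t\<in>{0..T}. \<forall>m\<le>n. in_Hn M m (\<lambda>x. u x t) \<and> Hn_norm M m (\<lambda>x. u x t) \<le> Kc * (Hn_norm M n u0 + 1)) \<and>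
     (AE x in lborel. x \<in> {0..M} \<longrightarrow> u x 0 = u0 x) \<and> solves M T a b c d e u)"
  define \<Psi> where "\<Psi> = (\<lambda>u0. SOME u. Sol u0 u)"
  have S: "Sol u0 (\<Psi> u0)" if u0: "in_Hn M n u0" for u0
  proof -
    let ?h = "Hn_norm M n u0"
    have h: "?h \<ge> 0" by (rule Hn_norm_nonneg)
    \<comment> \<open>\<open>?h + R\<close> dominates both the data and the source, and R \<ge> 4
      keeps it positive.\<close>
    have E: "?h + R > 0" using h R4 by linarith
    have "AE r in lborel. r \<in> {0..T} \<longrightarrow> Hn_norm M n (\<lambda>x. e x r) \<le> ?h + R"
      using aK(2) by eventually_elim (use h in auto)
    from solution_exists[OF hyps(12) E this u0] obtain u where u: "in_Linf_Hn M n T u" "\<forall>m<n. C_Hn M T m u"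
       "\<forall>t\<in>{0..T}. \<forall>m\<le>n. in_Hn M m (\<lambda>x. u x t) \<and> Hn_norm M m (\<lambda>x. u x t) \<le> sqrt (real n + 1) * (KB R * (2 * (?h + R)))"
       "AE x in lborel. x \<in> {0..M} \<longrightarrow> u x 0 = u0 x" "solves M T a b c d e u" using R(1) by auto
    have "\<forall>t\<in>{0..T}. \<forall>m\<le>n. in_Hn M m (\<lambda>x. u x t) \<and> Hn_norm M m (\<lambda>x. u x t) \<le> Kc * (?h + 1)"
      using u(3) solution_constant_le[OF h R] unfolding Kc_def by (meson order_trans)
    then have "Sol u0 u" using u unfolding Sol_def by blast
    then show ?thesis unfolding \<Psi>_def by (rule someI[where P = "Sol u0"])
  qed
  have cont: "\<exists>\<delta>>0. \<forall>v0. in_Hn M n v0 \<longrightarrow> Hn_norm M n (\<lambda>x. v0 x - u0 x) < \<delta> \<longrightarrow> LinfT (Hn_norm M n) T (\<lambda>x t. \<Psi> v0 x t - \<Psi> u0 x t) < \<epsilon>"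
    if u0: "in_Hn M n u0" and \<epsilon>: "\<epsilon> > 0" for u0 \<epsilon>
  proof -
    \<comment> \<open>The summand 1 makes P positive and the final inequality strict.\<close>
    define P where "P = sqrt (real n + 1) * (\<bar>KB R\<bar> * 2) + 1"
    have P: "P > 0" unfolding P_def by (intro add_nonneg_pos mult_nonneg_nonneg) auto
    define \<delta> where "\<delta> = \<epsilon> / P"
    have \<delta>: "\<delta> > 0" "P * \<delta> = \<epsilon>" using \<epsilon> P by (auto simp: \<delta>_def)
    have "LinfT (Hn_norm M n) T (\<lambda>x t. \<Psi> v0 x t - \<Psi> u0 x t) < \<epsilon>"
      if v0: "in_Hn M n v0" "Hn_norm M n (\<lambda>x. v0 x - u0 x) < \<delta>" for v0
    proof -
      have "LinfT (Hn_norm M n) T (\<lambda>x t. \<Psi> v0 x t - \<Psi> u0 x t) \<le> sqrt (real n + 1) * (KB R * (2 * \<delta>))"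
        by (rule solution_difference[where e = e and f = u0 and g = v0])
          (use S[OF u0] S[OF v0(1)] v0(2) \<delta>(1) in_Hn_diff[OF v0(1) u0] in \<open>auto simp: Sol_def\<close>)
      also have "\<dots> \<le> sqrt (real n + 1) * (\<bar>KB R\<bar> * (2 * \<delta>))" using \<delta>(1) by (intro mult_left_mono mult_right_mono) auto
      also have "\<dots> < P * \<delta>" using \<delta>(1) by (simp add: P_def distrib_right mult.assoc)
      finally show ?thesis using \<delta>(2) by simp
    qed
    with \<delta>(1) show ?thesis by blast
  qed
  have props: "LinfT (Hn_norm M n) T (\<Psi> u0) \<le> Kc * (Hn_norm M n u0 + 1) \<and>
       (\<forall>n'<n. C_Hn M T n' (\<Psi> u0) \<and> (\<forall>t\<in>{0..T}. Hn_norm M n' (\<lambda>x. \<Psi> u0 x t) \<le> Kc * (Hn_norm M n u0 + 1))) \<and>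
       (AE x in lborel. x \<in> {0..M} \<longrightarrow> \<Psi> u0 x 0 = u0 x) \<and> solves M T a b c d e (\<Psi> u0) \<and>
       (\<forall>v. in_Linf_Hn M n T v \<longrightarrow> (AE x in lborel. x \<in> {0..M} \<longrightarrow> v x 0 = u0 x) \<longrightarrow> solves M T a b c d e v \<longrightarrow>
           (\<forall>t\<in>{0..T}. AE x in lborel. x \<in> {0..M} \<longrightarrow> v x t = \<Psi> u0 x t))"
    if u0: "in_Hn M n u0" for u0
  proof -
    note s = S[OF u0, unfolded Sol_def]
    have "LinfT (Hn_norm M n) T (\<Psi> u0) \<le> Kc * (Hn_norm M n u0 + 1)"
      using s by (intro LinfT_le hyps Hn_norm_nonneg) auto
    moreover have "AE x in lborel. x \<in> {0..M} \<longrightarrow> v x t = \<Psi> u0 x t"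
      if v: "in_Linf_Hn M n T v" "AE x in lborel. x \<in> {0..M} \<longrightarrow> v x 0 = u0 x" "solves M T a b c d e v" "t \<in> {0..T}" for v t
    proof (rule solution_unique[where e = e, OF _ _ v(1,3) _ v(4)])
      have i: "AE x in lborel. x \<in> {0..M} \<longrightarrow> \<Psi> u0 x 0 = u0 x" using s by blast
      show "AE x in lborel. x \<in> {0..M} \<longrightarrow> v x 0 = \<Psi> u0 x 0" using v(2) i by eventually_elim auto
    qed (use s in auto)
    ultimately show ?thesis using s by auto
  qed
  have "in_Linf_Hn M n T (\<Psi> u0)" if "in_Hn M n u0" for u0 using S[OF that] unfolding Sol_def by blast
  then show "let Kc = 1 + sqrt (\<bar>Ktilde M T n a da b db c d e\<bar> + 1) * (\<bar>KB (Ktilde M T n a da b db c d e)\<bar> * (2 * (1 + \<bar>Ktilde M T n a da b db c d e\<bar>))) in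
      \<exists>\<Psi> :: (real \<Rightarrow> real) \<Rightarrow> real \<Rightarrow> real \<Rightarrow> real.
        (\<forall>u0. in_Hn M n u0 \<longrightarrow> in_Linf_Hn M n T (\<Psi> u0)) \<and>
        (\<forall>u0. in_Hn M n u0 \<longrightarrow> (\<forall>\<epsilon>>0. \<exists>\<delta>>0. \<forall>v0. in_Hn M n v0 \<longrightarrow>
            Hn_norm M n (\<lambda>x. v0 x - u0 x) < \<delta> \<longrightarrow>
            LinfT (Hn_norm M n) T (\<lambda>x t. \<Psi> v0 x t - \<Psi> u0 x t) < \<epsilon>)) \<and>
        (\<forall>u0. in_Hn M n u0 \<longrightarrow>
          (let u = \<Psi> u0 in
            LinfT (Hn_norm M n) T u \<le> Kc * (Hn_norm M n u0 + 1) \<and>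
            (\<forall>n'<n. C_Hn M T n' u \<and>
                (\<forall>t\<in>{0..T}. Hn_norm M n' (\<lambda>x. u x t) \<le> Kc * (Hn_norm M n u0 + 1))) \<and>
            (AE x in lborel. x \<in> {0..M} \<longrightarrow> u x 0 = u0 x) \<and>
            solves M T a b c d e u \<and>
            (\<forall>v. in_Linf_Hn M n T v \<longrightarrow>
                 (AE x in lborel. x \<in> {0..M} \<longrightarrow> v x 0 = u0 x) \<longrightarrow>
                 solves M T a b c d e v \<longrightarrow>
                 (\<forall>t\<in>{0..T}. AE x in lborel. x \<in> {0..M} \<longrightarrow> v x t = u x t))))"
    unfolding Let_def R_def[symmetric] Kc_def[symmetric] using cont props by (intro exI[of _ \<Psi>] conjI) blast+
qed

end
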